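(* Let $M$ be a Riemannian manifold of dimension $n\ge4$ and suppose $K\ge a_1$ and $Ric\ge a_2$ for some functions $a_1$ and $a_2$ on $M$. Let $E$ be a Riemannian vector bundle on $M$, and let $B_1>0$ and $B_2>0$ be the uniform constants specified in the context. (a) For a Yang-Mills connection $A$ on $E$ with curvature $F$, the function $u=|F|^{\frac{n-3}{n-2}}$ satisfies $$\Delta u\ge -B|F|u+au,$$ where $B=\frac{n-3}{n-2}B_1$ and $a=\frac{n-3}{n-2}a_1$. (b) For a Yang-Mills-Higgs pair $(A,\Phi)$ on $E$, with $F$ the curvature of $A$, the function $u=(|F|^2+|d_A\Phi|^2)^{\frac{n-2}{2(n-1)}}$ satisfies $$\Delta u\ge -B|F|u+au,$$ where $B=\frac{n-2}{n-1}\max\{B_1,3B_2\}$ and $a=\frac{n-2}{n-1}\min\{a_1,a_2\}$.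
   Context: $\Delta=\operatorname{div}\nabla$ on functions. $Rm$ and $Ric$ are the Riemann and Ricci curvatures, with the convention $Ric(X,Y)=\sum_iRm(X,e_i,Y,e_i)$ in a local orthonormal frame $\{e_i\}$ (so round spheres have positive $Ric$). For a two-form $\omega$, $$K(\omega)(X,Y)=\omega(Ric(X),Y)+\omega(X,Ric(Y))-\sum_{i,j}Rm(X,Y,e_i,e_j)\,\omega(e_i,e_j).$$ For a function $a$ on $M$, $K\ge a$ means $\langle K(\omega),\omega\rangle\ge a|\omega|^2$ for all two-forms $\omega$ on $M$, and $Ric\ge a$ means $Ric(X,X)\ge a|X|^2$ for all tangent vectors $X$. The bundle $so(E)$ of skew-symmetric endomorphisms of $E$ carries an $\mathrm{Ad}$-invariant metric. For a metric connection $A$ on $E$, $F$ is its curvature (a two-form with values in $so(E)$), $d_A$ the exterior covariant derivative, $d_A^*$ its formal adjoint, $\nabla_A$ the covariant derivative, and $\Delta_A=-\nabla_A^*\nabla_A$. A Yang-Mills connection is a metric connection $A$ with $d_A^*F=0$. A Yang-Mills-Higgs pair $(A,\Phi)$ is a metric connection $A$ on $E$ and a section $\Phi$ of $so(E)$ satisfying $d_A^*F=[d_A\Phi,\Phi]$ and $\Delta_A\Phi=0$, where $[\omega,\Phi](X)=[\omega(X),\Phi]$ for a one-form $\omega$ with values in $so(E)$. Norms of two-forms use $|\omega|^2=\sum_{i<j}|\omega(e_i,e_j)|^2$. For a two-form $\omega$ with values in $so(E)$, $$\tilde F(\omega)(X,Y)=\sum_i\big([F(X,e_i),\omega(Y,e_i)]-[F(Y,e_i),\omega(X,e_i)]\big),$$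 and for one-forms $\alpha,\beta$ with values in $so(E)$, $[\alpha,\beta](X,Y)=[\alpha(X),\beta(Y)]-[\alpha(Y),\beta(X)]$. The constants $B_1>0$ and $B_2>0$ are fixed uniform constants such that, pointwise on $M$, $$|\langle\tilde F(F),F\rangle|\le B_1|F|^3,\qquad |[d_A\Phi,d_A\Phi]|\le B_2|d_A\Phi|^2 .$$ *)

theory Defs
  imports "HOL-Analysis.Analysis"
begin

section \<open>Smooth functions on open sets\<close>

definition dd :: "('a::real_normed_vector \<Rightarrow> 'b::real_normed_vector) \<Rightarrow> 'a \<Rightarrow> 'a \<Rightarrow> 'b"
  where "dd f y v = frechet_derivative f (at y) v"

text \<open>The set \<open>S\<close> is meant to be open.\<close>

fun Ck_on :: "nat \<Rightarrow> ('a::real_normed_vector \<Rightarrow> 'b::real_normed_vector) \<Rightarrow> 'a set \<Rightarrow> bool"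
  where
    "Ck_on 0 f S \<longleftrightarrow> continuous_on S f"
  | "Ck_on (Suc k) f S \<longleftrightarrow>
       (\<forall>y\<in>S. f differentiable (at y)) \<and> (\<forall>v. Ck_on k (\<lambda>y. dd f y v) S)"

definition smooth_on :: "('a::real_normed_vector \<Rightarrow> 'b::real_normed_vector) \<Rightarrow> 'a set \<Rightarrow> bool"
  where "smooth_on f S \<longleftrightarrow> (\<forall>k. Ck_on k f S)"

definition vanishes_off_compact :: "'a::real_normed_vector set \<Rightarrow> ('a \<Rightarrow> 'b::zero) \<Rightarrow> bool"
  where "vanishes_off_compact D f \<longleftrightarrow> (\<exists>C. compact C \<and> C \<subseteq> D \<and> (\<forall>y. y \<notin> C \<longrightarrow> f y = 0))"

definition test_function :: "'a::real_normed_vector set \<Rightarrow> ('a \<Rightarrow> 'b::real_normed_vector) \<Rightarrow> bool"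
  where "test_function D f \<longleftrightarrow> smooth_on f UNIV \<and> vanishes_off_compact D f"


section \<open>Riemannian manifolds\<close>

text \<open>
  The manifold is the whole type \<open>'m\<close>, and its dimension is \<open>CARD('n)\<close>. A chart is an open set
  together with a coordinate map (whose values outside that set are irrelevant). Tensor fields are
  families, indexed by the charts, of fields on the coordinate domains that satisfy the usual
  transformation laws. A tangent vector at a point \<open>x\<close> is represented in a chart around \<open>x\<close> by
  its component vector in \<open>real^'n\<close>, and a form at \<open>x\<close> by a multilinear function of such vectors.
\<close>

type_synonym ('m, 'n) chart = "'m set \<times> ('m \<Rightarrow> real^'n)"

definition pt :: "('m, 'n) chart \<Rightarrow> real^'n \<Rightarrow> 'm"
  where "pt c = inv_into (fst c) (snd c)"

definition loc :: "('m, 'n) chart \<Rightarrow> 'm set \<Rightarrow> (real^'n) set"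
  where "loc c W = snd c ` (fst c \<inter> W)"

abbreviation cdom :: "('m, 'n) chart \<Rightarrow> (real^'n) set"
  where "cdom c \<equiv> loc c UNIV"

definition transition :: "('m, 'n) chart \<Rightarrow> ('m, 'n) chart \<Rightarrow> real^'n \<Rightarrow> real^'n"
  where "transition c c' = snd c' \<circ> pt c"

definition smooth_atlas :: "('m::{t2_space,second_countable_topology}, 'n::finite) chart set \<Rightarrow> bool"
  where "smooth_atlas \<A> \<longleftrightarrow>
    (\<Union>c\<in>\<A>. fst c) = UNIV \<and>
    (\<forall>c\<in>\<A>. open (fst c) \<and> open (cdom c) \<and> homeomorphism (fst c) (cdom c) (snd c) (pt c)) \<and>
    (\<forall>c\<in>\<A>. \<forall>c'\<in>\<A>. smooth_on (transition c c') (loc c (fst c')))"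

text \<open>The inner product of two component vectors with respect to a Gram matrix.\<close>

definition met :: "real^'n^'n \<Rightarrow> real^'n \<Rightarrow> real^'n \<Rightarrow> real"
  where "met G X Y = X \<bullet> (G *v Y)"

definition riemannian_metric ::
  "('m, 'n::finite) chart set \<Rightarrow> (('m, 'n) chart \<Rightarrow> real^'n \<Rightarrow> real^'n^'n) \<Rightarrow> bool"
  where "riemannian_metric \<A> g \<longleftrightarrow>
    (\<forall>c\<in>\<A>. smooth_on (g c) (cdom c)) \<and>
    (\<forall>c\<in>\<A>. \<forall>y\<in>cdom c. transpose (g c y) = g c y \<and> (\<forall>X. X \<noteq> 0 \<longrightarrow> met (g c y) X X > 0)) \<and>
    (\<forall>c\<in>\<A>. \<forall>c'\<in>\<A>. \<forall>y\<in>loc c (fst c'). \<forall>X Y.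
       met (g c y) X Y =
       met (g c' (transition c c' y)) (dd (transition c c') y X) (dd (transition c c') y Y))"

definition riemannian_manifold ::
  "('m::{t2_space,second_countable_topology}, 'n::finite) chart set \<Rightarrow>
   (('m, 'n) chart \<Rightarrow> real^'n \<Rightarrow> real^'n^'n) \<Rightarrow> bool"
  where "riemannian_manifold \<A> g \<longleftrightarrow> smooth_atlas \<A> \<and> riemannian_metric \<A> g"

text \<open>
  The sum \<open>\<Sum>a. b (e a) (e a)\<close> over a \<open>G\<close>-orthonormal frame \<open>e\<close>, written as a contraction with the
  inverse Gram matrix; see \<open>mtrace_orthonormal_frame\<close> below.
\<close>

definition mtrace :: "real^'n^'n \<Rightarrow> (real^'n \<Rightarrow> real^'n \<Rightarrow> 'b::real_vector) \<Rightarrow> 'b"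
  where "mtrace G b =
    (\<Sum>i\<in>UNIV. \<Sum>j\<in>UNIV. (matrix_inv G $ i $ j) *\<^sub>R b (axis i 1) (axis j 1))"

lemma mtrace_orthonormal_frame:
  fixes b :: "real^'n \<Rightarrow> real^'n \<Rightarrow> 'b::real_vector" and e :: "'n::finite \<Rightarrow> real^'n"
  assumes b: "bilinear b"
    and e: "\<And>i j. met G (e i) (e j) = (if i = j then 1 else 0)"
  shows "mtrace G b = (\<Sum>i\<in>UNIV. b (e i) (e i))"
proof -
  define P :: "real^'n^'n" where "P = (\<chi> i a. e a $ i)"
  have PG: "transpose P ** (G ** P) = mat 1"
    using e
    by (simp add: vec_eq_iff matrix_matrix_mult_def transpose_def mat_def P_def met_def
        inner_vec_def matrix_vector_mult_def)
  then have PG': "(G ** P) ** transpose P = mat 1"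
    using matrix_left_right_inverse by blast
  then have r: "G ** (P ** transpose P) = mat 1"
    by (simp add: matrix_mul_assoc)
  then have l: "(P ** transpose P) ** G = mat 1"
    using matrix_left_right_inverse by blast
  have inv: "matrix_inv G = P ** transpose P"
  proof -
    have "G ** matrix_inv G = mat 1 \<and> matrix_inv G ** G = mat 1"
      unfolding matrix_inv_def
      by (rule someI[where P = "\<lambda>A. G ** A = mat 1 \<and> A ** G = mat 1", OF conjI[OF r l]])
    then have "(P ** transpose P) ** (G ** matrix_inv G) = P ** transpose P"
      by (simp only: matrix_mul_rid)
    then show ?thesis
      by (simp only: matrix_mul_assoc l matrix_mul_lid)
  qed
  have exp: "e a = (\<Sum>i\<in>UNIV. (e a $ i) *\<^sub>R axis i 1)" for a
    using basis_expansion[of "e a"] by (simp add: scalar_mult_eq_scaleR)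
  have be: "b (e a) (e a) =
      (\<Sum>i\<in>UNIV. \<Sum>j\<in>UNIV. (e a $ i * e a $ j) *\<^sub>R b (axis i 1) (axis j 1))" for a
  proof -
    have "b (e a) (e a) = b (\<Sum>i\<in>UNIV. (e a $ i) *\<^sub>R axis i 1) (\<Sum>j\<in>UNIV. (e a $ j) *\<^sub>R axis j 1)"
      by (rule arg_cong2[where f = b, OF exp exp])
    also have "\<dots> = (\<Sum>(i,j)\<in>UNIV \<times> UNIV. b ((e a $ i) *\<^sub>R axis i 1) ((e a $ j) *\<^sub>R axis j 1))"
      by (rule bilinear_sum[OF b])
    also have "\<dots> = (\<Sum>i\<in>UNIV. \<Sum>j\<in>UNIV. (e a $ i * e a $ j) *\<^sub>R b (axis i 1) (axis j 1))"
      by (simp add: sum.cartesian_product bilinear_lmul[OF b] bilinear_rmul[OF b] mult.commute)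
    finally show ?thesis .
  qed
  have "(\<Sum>a\<in>UNIV. b (e a) (e a)) =
      (\<Sum>i\<in>UNIV. \<Sum>j\<in>UNIV. \<Sum>a\<in>UNIV. (e a $ i * e a $ j) *\<^sub>R b (axis i 1) (axis j 1))"
    unfolding be
    by (rule trans[OF sum.swap]) (rule sum.cong[OF refl], rule sum.swap)
  also have "\<dots> = mtrace G b"
    by (simp add: mtrace_def inv matrix_matrix_mult_def transpose_def P_def scaleR_sum_left)
  finally show ?thesis by simp
qed


subsection \<open>Levi-Civita connection, curvature and Laplacian\<close>

text \<open>
  In this subsection \<open>g\<close> is a field of Gram matrices on a coordinate domain; vectors are extended
  to vector fields with constant components. Below, \<open>chris g y X Y\<close> is \<open>\<nabla>\<^sub>X Y\<close> for constant fields,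
  given by the Koszul formula.
\<close>

definition chris :: "(real^'n \<Rightarrow> real^'n^'n) \<Rightarrow> real^'n \<Rightarrow> real^'n \<Rightarrow> real^'n \<Rightarrow> real^'n"
  where "chris g y X Y = matrix_inv (g y) *v
    (\<chi> l. (dd (\<lambda>z. met (g z) Y (axis l 1)) y X + dd (\<lambda>z. met (g z) X (axis l 1)) y Y
           - dd (\<lambda>z. met (g z) X Y) y (axis l 1)) / 2)"

text \<open>The curvature operator \<open>R(X,Y)W = \<nabla>\<^sub>X \<nabla>\<^sub>Y W - \<nabla>\<^sub>Y \<nabla>\<^sub>X W\<close>, for constant fields.\<close>

definition curv_op ::
  "(real^'n \<Rightarrow> real^'n^'n) \<Rightarrow> real^'n \<Rightarrow> real^'n \<Rightarrow> real^'n \<Rightarrow> real^'n \<Rightarrow> real^'n"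
  where "curv_op g y X Y W =
    dd (\<lambda>z. chris g z Y W) y X - dd (\<lambda>z. chris g z X W) y Y
    + chris g y X (chris g y Y W) - chris g y Y (chris g y X W)"

text \<open>Sign convention: \<open>Rm X Y X Y\<close> is positive on round spheres.\<close>

definition Rm ::
  "(real^'n \<Rightarrow> real^'n^'n) \<Rightarrow> real^'n \<Rightarrow> real^'n \<Rightarrow> real^'n \<Rightarrow> real^'n \<Rightarrow> real^'n \<Rightarrow> real"
  where "Rm g y X Y Z W = met (g y) (curv_op g y X Y W) Z"

definition Ric :: "(real^'n \<Rightarrow> real^'n^'n) \<Rightarrow> real^'n \<Rightarrow> real^'n \<Rightarrow> real^'n \<Rightarrow> real"
  where "Ric g y X Y = mtrace (g y) (\<lambda>v w. Rm g y X v Y w)"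

text \<open>The Ricci endomorphism: \<open>met (g y) (Ric_end g y X) Y = Ric g y X Y\<close>.\<close>

definition Ric_end :: "(real^'n \<Rightarrow> real^'n^'n) \<Rightarrow> real^'n \<Rightarrow> real^'n \<Rightarrow> real^'n"
  where "Ric_end g y X = matrix_inv (g y) *v (\<chi> l. Ric g y X (axis l 1))"

definition grad :: "(real^'n \<Rightarrow> real^'n^'n) \<Rightarrow> (real^'n \<Rightarrow> real) \<Rightarrow> real^'n \<Rightarrow> real^'n"
  where "grad g u y = matrix_inv (g y) *v (\<chi> l. dd u y (axis l 1))"

text \<open>The divergence of a vector field is the trace of its covariant derivative.\<close>

definition divg :: "(real^'n \<Rightarrow> real^'n^'n) \<Rightarrow> (real^'n \<Rightarrow> real^'n) \<Rightarrow> real^'n \<Rightarrow> real"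
  where "divg g X y = (\<Sum>i\<in>UNIV. (dd X y (axis i 1) + chris g y (axis i 1) (X y)) $ i)"

definition lap :: "(real^'n \<Rightarrow> real^'n^'n) \<Rightarrow> (real^'n \<Rightarrow> real) \<Rightarrow> real^'n \<Rightarrow> real"
  where "lap g u = divg g (grad g u)"

text \<open>Integration over a coordinate domain against the Riemannian volume.\<close>

definition vol :: "(real^'n \<Rightarrow> real^'n^'n) \<Rightarrow> real^'n \<Rightarrow> real"
  where "vol g y = sqrt (det (g y))"

definition vint :: "(real^'n \<Rightarrow> real^'n^'n) \<Rightarrow> (real^'n) set \<Rightarrow> (real^'n \<Rightarrow> real) \<Rightarrow> real"
  where "vint g D f = integral D (\<lambda>y. f y * vol g y)"


subsection \<open>Inner products of forms, and the bounds on the curvature\<close>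

text \<open>
  Here \<open>\<kappa>\<close> is the inner product on the values. The factor \<open>1/2\<close> turns the sum over all pairs
  \<open>(i,j)\<close> into the sum over \<open>i < j\<close>.
\<close>

definition ip1 :: "real^'n^'n \<Rightarrow> ('b \<Rightarrow> 'b \<Rightarrow> real) \<Rightarrow>
    (real^'n \<Rightarrow> 'b) \<Rightarrow> (real^'n \<Rightarrow> 'b) \<Rightarrow> real"
  where "ip1 G \<kappa> \<alpha> \<beta> = mtrace G (\<lambda>v v'. \<kappa> (\<alpha> v) (\<beta> v'))"

definition ip2 :: "real^'n^'n \<Rightarrow> ('b \<Rightarrow> 'b \<Rightarrow> real) \<Rightarrow>
    (real^'n \<Rightarrow> real^'n \<Rightarrow> 'b) \<Rightarrow> (real^'n \<Rightarrow> real^'n \<Rightarrow> 'b) \<Rightarrow> real"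
  where "ip2 G \<kappa> \<omega> \<eta> =
    1/2 * mtrace G (\<lambda>v v'. mtrace G (\<lambda>w w'. \<kappa> (\<omega> v w) (\<eta> v' w')))"

definition two_form :: "(real^'n \<Rightarrow> real^'n \<Rightarrow> 'b::real_vector) \<Rightarrow> bool"
  where "two_form \<omega> \<longleftrightarrow> bilinear \<omega> \<and> (\<forall>X. \<omega> X X = 0)"

definition Kop :: "(real^'n \<Rightarrow> real^'n^'n) \<Rightarrow> real^'n \<Rightarrow>
    (real^'n \<Rightarrow> real^'n \<Rightarrow> real) \<Rightarrow> real^'n \<Rightarrow> real^'n \<Rightarrow> real"
  where "Kop g y \<omega> X Y = \<omega> (Ric_end g y X) Y + \<omega> X (Ric_end g y Y)
    - mtrace (g y) (\<lambda>v v'. mtrace (g y) (\<lambda>w w'. Rm g y X Y v w * \<omega> v' w'))"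

definition K_ge :: "('m, 'n::finite) chart set \<Rightarrow> (('m, 'n) chart \<Rightarrow> real^'n \<Rightarrow> real^'n^'n) \<Rightarrow>
    ('m \<Rightarrow> real) \<Rightarrow> bool"
  where "K_ge \<A> g a \<longleftrightarrow> (\<forall>c\<in>\<A>. \<forall>y\<in>cdom c. \<forall>\<omega>. two_form \<omega> \<longrightarrow>
    ip2 (g c y) (*) (Kop (g c) y \<omega>) \<omega> \<ge> a (pt c y) * ip2 (g c y) (*) \<omega> \<omega>)"

definition Ric_ge :: "('m, 'n::finite) chart set \<Rightarrow> (('m, 'n) chart \<Rightarrow> real^'n \<Rightarrow> real^'n^'n) \<Rightarrow>
    ('m \<Rightarrow> real) \<Rightarrow> bool"
  where "Ric_ge \<A> g a \<longleftrightarrow> (\<forall>c\<in>\<A>. \<forall>y\<in>cdom c. \<forall>X.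
    Ric (g c) y X X \<ge> a (pt c y) * met (g c y) X X)"


subsection \<open>The differential inequality \<open>\<Delta>u \<ge> h\<close>\<close>

text \<open>
  A power of the norm of a form need not be differentiable at the zeros of the form. The inequality
  is therefore required pointwise, at all points near which \<open>u\<close> is of class \<open>C\<^sup>2\<close> (among them all
  points where \<open>u\<close> does not vanish), and on all of the manifold in the sense of distributions. The
  distributional inequality is tested on functions supported in one chart; the integrability
  condition is needed because \<open>h\<close> may involve an arbitrary function.
\<close>

definition C2_near :: "('m::topological_space, 'n::finite) chart set \<Rightarrow> ('m \<Rightarrow> real) \<Rightarrow> 'm \<Rightarrow> bool"
  where "C2_near \<A> u x \<longleftrightarrow>
    (\<exists>W. open W \<and> x \<in> W \<and> (\<forall>c\<in>\<A>. Ck_on 2 (u \<circ> pt c) (loc c W)))"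

definition lap_ge_pointwise :: "('m::topological_space, 'n::finite) chart set \<Rightarrow>
    (('m, 'n) chart \<Rightarrow> real^'n \<Rightarrow> real^'n^'n) \<Rightarrow> ('m \<Rightarrow> real) \<Rightarrow> ('m \<Rightarrow> real) \<Rightarrow> bool"
  where "lap_ge_pointwise \<A> g u h \<longleftrightarrow>
    (\<forall>x. u x \<noteq> 0 \<longrightarrow> C2_near \<A> u x) \<and>
    (\<forall>x. C2_near \<A> u x \<longrightarrow> (\<forall>c\<in>\<A>. x \<in> fst c \<longrightarrow> lap (g c) (u \<circ> pt c) (snd c x) \<ge> h x))"

definition lap_ge_distr :: "('m::topological_space, 'n::finite) chart set \<Rightarrow>
    (('m, 'n) chart \<Rightarrow> real^'n \<Rightarrow> real^'n^'n) \<Rightarrow> ('m \<Rightarrow> real) \<Rightarrow> ('m \<Rightarrow> real) \<Rightarrow> bool"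
  where "lap_ge_distr \<A> g u h \<longleftrightarrow>
    (\<forall>c\<in>\<A>. continuous_on (cdom c) (u \<circ> pt c)) \<and>
    (\<forall>c\<in>\<A>. \<forall>\<phi>. test_function (cdom c) \<phi> \<and> (\<forall>y. \<phi> y \<ge> 0) \<and>
       (\<lambda>y. h (pt c y) * \<phi> y * vol (g c) y) absolutely_integrable_on cdom c \<longrightarrow>
       vint (g c) (cdom c) (\<lambda>y. u (pt c y) * lap (g c) \<phi> y) \<ge>
       vint (g c) (cdom c) (\<lambda>y. h (pt c y) * \<phi> y))"

definition lap_ge :: "('m::topological_space, 'n::finite) chart set \<Rightarrow>
    (('m, 'n) chart \<Rightarrow> real^'n \<Rightarrow> real^'n^'n) \<Rightarrow> ('m \<Rightarrow> real) \<Rightarrow> ('m \<Rightarrow> real) \<Rightarrow> bool"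
  where "lap_ge \<A> g u h \<longleftrightarrow> lap_ge_pointwise \<A> g u h \<and> lap_ge_distr \<A> g u h"


section \<open>Riemannian vector bundles\<close>

text \<open>
  A Riemannian vector bundle of rank \<open>CARD('r)\<close> is given by an open cover \<open>V i\<close> (\<open>i \<in> J\<close>), with an
  orthonormal frame over each \<open>V i\<close>, and the cocycle \<open>t\<close> of orthogonal transition matrices: the
  components of a section satisfy \<open>s\<^sub>i = t i j s\<^sub>j\<close>. Accordingly, skew-symmetric endomorphisms are
  represented by skew-symmetric matrices that transform by conjugation.
\<close>

definition riemannian_bundle :: "('m::topological_space, 'n::finite) chart set \<Rightarrow> 'i set \<Rightarrow>
    ('i \<Rightarrow> 'm set) \<Rightarrow> ('i \<Rightarrow> 'i \<Rightarrow> 'm \<Rightarrow> real^'r^'r) \<Rightarrow> bool"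
  where "riemannian_bundle \<A> J V t \<longleftrightarrow>
    (\<forall>i\<in>J. open (V i)) \<and> (\<Union>i\<in>J. V i) = UNIV \<and>
    (\<forall>i\<in>J. \<forall>j\<in>J. \<forall>x\<in>V i \<inter> V j. orthogonal_matrix (t i j x)) \<and>
    (\<forall>i\<in>J. \<forall>x\<in>V i. t i i x = mat 1) \<and>
    (\<forall>i\<in>J. \<forall>j\<in>J. \<forall>k\<in>J. \<forall>x\<in>V i \<inter> V j \<inter> V k. t i j x ** t j k x = t i k x) \<and>
    (\<forall>i\<in>J. \<forall>j\<in>J. \<forall>c\<in>\<A>. smooth_on (t i j \<circ> pt c) (loc c (V i \<inter> V j)))"

definition so :: "(real^'r^'r) set"
  where "so = {a. transpose a = - a}"

definition comm :: "real^'r^'r \<Rightarrow> real^'r^'r \<Rightarrow> real^'r^'r"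
  where "comm a b = a ** b - b ** a"

text \<open>
  An inner product on \<open>so\<close> that is invariant under the adjoint action of the orthogonal group; it
  induces a metric on the bundle of skew-symmetric endomorphisms. Only the values on \<open>so\<close> matter.
\<close>

definition Ad_invariant_metric :: "(real^'r^'r \<Rightarrow> real^'r^'r \<Rightarrow> real) \<Rightarrow> bool"
  where "Ad_invariant_metric \<kappa> \<longleftrightarrow>
    bilinear \<kappa> \<and>
    (\<forall>a\<in>so. \<forall>b\<in>so. \<kappa> a b = \<kappa> b a) \<and>
    (\<forall>a\<in>so. a \<noteq> 0 \<longrightarrow> \<kappa> a a > 0) \<and>
    (\<forall>q. orthogonal_matrix q \<longrightarrow>
       (\<forall>a\<in>so. \<forall>b\<in>so. \<kappa> (q ** a ** transpose q) (q ** b ** transpose q) = \<kappa> a b))"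

text \<open>
  A metric connection is represented by its connection forms \<open>A c i\<close>: in the frame over \<open>V i\<close> and
  the chart \<open>c\<close>, the covariant derivative of a section \<open>s\<close> is \<open>ds + (A c i) s\<close>. The second clause
  is the change of charts and the third one the change of frames.
\<close>

definition metric_connection :: "('m::topological_space, 'n::finite) chart set \<Rightarrow> 'i set \<Rightarrow>
    ('i \<Rightarrow> 'm set) \<Rightarrow> ('i \<Rightarrow> 'i \<Rightarrow> 'm \<Rightarrow> real^'r^'r) \<Rightarrow>
    (('m, 'n) chart \<Rightarrow> 'i \<Rightarrow> real^'n \<Rightarrow> real^'n \<Rightarrow> real^'r^'r) \<Rightarrow> bool"
  where "metric_connection \<A> J V t A \<longleftrightarrow>
    (\<forall>c\<in>\<A>. \<forall>i\<in>J.
       (\<forall>y\<in>loc c (V i). linear (A c i y) \<and> (\<forall>X. A c i y X \<in> so)) \<and>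
       (\<forall>X. smooth_on (\<lambda>y. A c i y X) (loc c (V i)))) \<and>
    (\<forall>c\<in>\<A>. \<forall>c'\<in>\<A>. \<forall>i\<in>J. \<forall>y\<in>loc c (fst c' \<inter> V i). \<forall>X.
       A c i y X = A c' i (transition c c' y) (dd (transition c c') y X)) \<and>
    (\<forall>c\<in>\<A>. \<forall>i\<in>J. \<forall>j\<in>J. \<forall>y\<in>loc c (V i \<inter> V j). \<forall>X.
       A c i y X = t i j (pt c y) ** A c j y X ** transpose (t i j (pt c y))
         - dd (t i j \<circ> pt c) y X ** transpose (t i j (pt c y)))"

definition so_section :: "('m::topological_space, 'n::finite) chart set \<Rightarrow> 'i set \<Rightarrow>
    ('i \<Rightarrow> 'm set) \<Rightarrow> ('i \<Rightarrow> 'i \<Rightarrow> 'm \<Rightarrow> real^'r^'r) \<Rightarrow> ('i \<Rightarrow> 'm \<Rightarrow> real^'r^'r) \<Rightarrow> bool"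
  where "so_section \<A> J V t \<Phi> \<longleftrightarrow>
    (\<forall>i\<in>J. \<forall>x\<in>V i. \<Phi> i x \<in> so) \<and>
    (\<forall>c\<in>\<A>. \<forall>i\<in>J. smooth_on (\<Phi> i \<circ> pt c) (loc c (V i))) \<and>
    (\<forall>i\<in>J. \<forall>j\<in>J. \<forall>x\<in>V i \<inter> V j. \<Phi> i x = t i j x ** \<Phi> j x ** transpose (t i j x))"


subsection \<open>Covariant derivatives and brackets in a chart and a frame\<close>

text \<open>Here \<open>A\<close> is a single connection form on a coordinate domain.\<close>

definition bracket11 :: "(real^'n \<Rightarrow> real^'r^'r) \<Rightarrow> (real^'n \<Rightarrow> real^'r^'r) \<Rightarrow>
    real^'n \<Rightarrow> real^'n \<Rightarrow> real^'r^'r"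
  where "bracket11 \<alpha> \<beta> X Y = comm (\<alpha> X) (\<beta> Y) - comm (\<alpha> Y) (\<beta> X)"

definition curvature :: "(real^'n \<Rightarrow> real^'n \<Rightarrow> real^'r^'r) \<Rightarrow> real^'n \<Rightarrow>
    real^'n \<Rightarrow> real^'n \<Rightarrow> real^'r^'r"
  where "curvature A y X Y =
    dd (\<lambda>z. A z Y) y X - dd (\<lambda>z. A z X) y Y + comm (A y X) (A y Y)"

text \<open>The covariant derivative \<open>\<nabla>\<^sub>A\<close> of a section of \<open>so(E)\<close>, which is also \<open>d\<^sub>A\<close> on sections.\<close>

definition dA0 :: "(real^'n \<Rightarrow> real^'n \<Rightarrow> real^'r^'r) \<Rightarrow> (real^'n \<Rightarrow> real^'r^'r) \<Rightarrow>
    real^'n \<Rightarrow> real^'n \<Rightarrow> real^'r^'r"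
  where "dA0 A \<phi> y X = dd \<phi> y X + comm (A y X) (\<phi> y)"

definition dA1 :: "(real^'n \<Rightarrow> real^'n \<Rightarrow> real^'r^'r) \<Rightarrow> (real^'n \<Rightarrow> real^'n \<Rightarrow> real^'r^'r) \<Rightarrow>
    real^'n \<Rightarrow> real^'n \<Rightarrow> real^'n \<Rightarrow> real^'r^'r"
  where "dA1 A \<beta> y X Y =
    dd (\<lambda>z. \<beta> z Y) y X - dd (\<lambda>z. \<beta> z X) y Y + bracket11 (A y) (\<beta> y) X Y"

definition Ftilde :: "real^'n^'n \<Rightarrow> (real^'n \<Rightarrow> real^'n \<Rightarrow> real^'r^'r) \<Rightarrow>
    (real^'n \<Rightarrow> real^'n \<Rightarrow> real^'r^'r) \<Rightarrow> real^'n \<Rightarrow> real^'n \<Rightarrow> real^'r^'r"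
  where "Ftilde G F \<omega> X Y =
    mtrace G (\<lambda>v w. comm (F X v) (\<omega> Y w) - comm (F Y v) (\<omega> X w))"

abbreviation curv :: "(('m, 'n) chart \<Rightarrow> 'i \<Rightarrow> real^'n \<Rightarrow> real^'n \<Rightarrow> real^'r^'r) \<Rightarrow>
    ('m, 'n) chart \<Rightarrow> 'i \<Rightarrow> real^'n \<Rightarrow> real^'n \<Rightarrow> real^'n \<Rightarrow> real^'r^'r"
  where "curv A c i \<equiv> curvature (A c i)"

abbreviation dAPhi :: "(('m, 'n) chart \<Rightarrow> 'i \<Rightarrow> real^'n \<Rightarrow> real^'n \<Rightarrow> real^'r^'r) \<Rightarrow>
    ('i \<Rightarrow> 'm \<Rightarrow> real^'r^'r) \<Rightarrow>
    ('m, 'n) chart \<Rightarrow> 'i \<Rightarrow> real^'n \<Rightarrow> real^'n \<Rightarrow> real^'r^'r"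
  where "dAPhi A \<Phi> c i \<equiv> dA0 (A c i) (\<Phi> i \<circ> pt c)"


subsection \<open>Formal adjoints and the Yang--Mills equations\<close>

definition so_test_form :: "(real^'n) set \<Rightarrow> (real^'n \<Rightarrow> real^'n \<Rightarrow> real^'r^'r) \<Rightarrow> bool"
  where "so_test_form D \<beta> \<longleftrightarrow>
    (\<forall>y. linear (\<beta> y)) \<and> (\<forall>y X. \<beta> y X \<in> so) \<and> (\<forall>X. test_function D (\<lambda>y. \<beta> y X))"

text \<open>
  The formal adjoints are the adjoints with respect to the \<open>L\<^sup>2\<close> inner products. As differential
  operators they are determined by test sections supported in one chart and one frame. The
  predicate \<open>dA_adjoint_eq\<close> says \<open>d\<^sub>A\<^sup>* \<omega> = \<eta>\<close> for a two-form \<open>\<omega>\<close>, and \<open>nablaA_adjoint_eq\<close> says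
  \<open>\<nabla>\<^sub>A\<^sup>* \<alpha> = \<psi>\<close> for a one-form \<open>\<alpha>\<close>, where all forms take values in \<open>so(E)\<close>.
\<close>

definition dA_adjoint_eq :: "('m::topological_space, 'n::finite) chart set \<Rightarrow>
    (('m, 'n) chart \<Rightarrow> real^'n \<Rightarrow> real^'n^'n) \<Rightarrow> 'i set \<Rightarrow> ('i \<Rightarrow> 'm set) \<Rightarrow>
    (real^'r^'r \<Rightarrow> real^'r^'r \<Rightarrow> real) \<Rightarrow>
    (('m, 'n) chart \<Rightarrow> 'i \<Rightarrow> real^'n \<Rightarrow> real^'n \<Rightarrow> real^'r^'r) \<Rightarrow>
    (('m, 'n) chart \<Rightarrow> 'i \<Rightarrow> real^'n \<Rightarrow> real^'n \<Rightarrow> real^'n \<Rightarrow> real^'r^'r) \<Rightarrow>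
    (('m, 'n) chart \<Rightarrow> 'i \<Rightarrow> real^'n \<Rightarrow> real^'n \<Rightarrow> real^'r^'r) \<Rightarrow> bool"
  where "dA_adjoint_eq \<A> g J V \<kappa> A \<omega> \<eta> \<longleftrightarrow>
    (\<forall>c\<in>\<A>. \<forall>i\<in>J. \<forall>\<beta>. so_test_form (loc c (V i)) \<beta> \<longrightarrow>
       vint (g c) (loc c (V i)) (\<lambda>y. ip2 (g c y) \<kappa> (\<omega> c i y) (dA1 (A c i) \<beta> y)) =
       vint (g c) (loc c (V i)) (\<lambda>y. ip1 (g c y) \<kappa> (\<eta> c i y) (\<beta> y)))"

definition nablaA_adjoint_eq :: "('m::topological_space, 'n::finite) chart set \<Rightarrow>
    (('m, 'n) chart \<Rightarrow> real^'n \<Rightarrow> real^'n^'n) \<Rightarrow> 'i set \<Rightarrow> ('i \<Rightarrow> 'm set) \<Rightarrow>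
    (real^'r^'r \<Rightarrow> real^'r^'r \<Rightarrow> real) \<Rightarrow>
    (('m, 'n) chart \<Rightarrow> 'i \<Rightarrow> real^'n \<Rightarrow> real^'n \<Rightarrow> real^'r^'r) \<Rightarrow>
    (('m, 'n) chart \<Rightarrow> 'i \<Rightarrow> real^'n \<Rightarrow> real^'n \<Rightarrow> real^'r^'r) \<Rightarrow>
    ('i \<Rightarrow> 'm \<Rightarrow> real^'r^'r) \<Rightarrow> bool"
  where "nablaA_adjoint_eq \<A> g J V \<kappa> A \<alpha> \<psi> \<longleftrightarrow>
    (\<forall>c\<in>\<A>. \<forall>i\<in>J. \<forall>\<xi>. test_function (loc c (V i)) \<xi> \<and> (\<forall>y. \<xi> y \<in> so) \<longrightarrow>
       vint (g c) (loc c (V i)) (\<lambda>y. ip1 (g c y) \<kappa> (\<alpha> c i y) (dA0 (A c i) \<xi> y)) =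
       vint (g c) (loc c (V i)) (\<lambda>y. \<kappa> (\<psi> i (pt c y)) (\<xi> y)))"

definition yang_mills :: "('m::topological_space, 'n::finite) chart set \<Rightarrow>
    (('m, 'n) chart \<Rightarrow> real^'n \<Rightarrow> real^'n^'n) \<Rightarrow> 'i set \<Rightarrow> ('i \<Rightarrow> 'm set) \<Rightarrow>
    ('i \<Rightarrow> 'i \<Rightarrow> 'm \<Rightarrow> real^'r^'r) \<Rightarrow> (real^'r^'r \<Rightarrow> real^'r^'r \<Rightarrow> real) \<Rightarrow>
    (('m, 'n) chart \<Rightarrow> 'i \<Rightarrow> real^'n \<Rightarrow> real^'n \<Rightarrow> real^'r^'r) \<Rightarrow> bool"
  where "yang_mills \<A> g J V t \<kappa> A \<longleftrightarrow>
    metric_connection \<A> J V t A \<and>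
    dA_adjoint_eq \<A> g J V \<kappa> A (curv A) (\<lambda>c i y X. 0)"

text \<open>
  The equation \<open>\<Delta>\<^sub>A \<Phi> = 0\<close> is \<open>\<nabla>\<^sub>A\<^sup>* (\<nabla>\<^sub>A \<Phi>) = 0\<close>, since \<open>\<Delta>\<^sub>A = - \<nabla>\<^sub>A\<^sup>* \<nabla>\<^sub>A\<close>.
\<close>

definition yang_mills_higgs :: "('m::topological_space, 'n::finite) chart set \<Rightarrow>
    (('m, 'n) chart \<Rightarrow> real^'n \<Rightarrow> real^'n^'n) \<Rightarrow> 'i set \<Rightarrow> ('i \<Rightarrow> 'm set) \<Rightarrow>
    ('i \<Rightarrow> 'i \<Rightarrow> 'm \<Rightarrow> real^'r^'r) \<Rightarrow> (real^'r^'r \<Rightarrow> real^'r^'r \<Rightarrow> real) \<Rightarrow>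
    (('m, 'n) chart \<Rightarrow> 'i \<Rightarrow> real^'n \<Rightarrow> real^'n \<Rightarrow> real^'r^'r) \<Rightarrow>
    ('i \<Rightarrow> 'm \<Rightarrow> real^'r^'r) \<Rightarrow> bool"
  where "yang_mills_higgs \<A> g J V t \<kappa> A \<Phi> \<longleftrightarrow>
    metric_connection \<A> J V t A \<and> so_section \<A> J V t \<Phi> \<and>
    dA_adjoint_eq \<A> g J V \<kappa> A (curv A)
      (\<lambda>c i y X. comm (dAPhi A \<Phi> c i y X) (\<Phi> i (pt c y))) \<and>
    nablaA_adjoint_eq \<A> g J V \<kappa> A (dAPhi A \<Phi>) (\<lambda>i x. 0)"


subsection \<open>Pointwise norms and the constants\<close>

text \<open>
  The value at a point \<open>x\<close> of a quantity that does not depend on the chart and the frame around \<open>x\<close>.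
\<close>

definition at_point :: "('m, 'n) chart set \<Rightarrow> 'i set \<Rightarrow> ('i \<Rightarrow> 'm set) \<Rightarrow>
    (('m, 'n) chart \<Rightarrow> 'i \<Rightarrow> real^'n \<Rightarrow> real) \<Rightarrow> 'm \<Rightarrow> real"
  where "at_point \<A> J V q x =
    (case (SOME (c, i). c \<in> \<A> \<and> i \<in> J \<and> x \<in> fst c \<inter> V i) of (c, i) \<Rightarrow> q c i (snd c x))"

definition normF :: "('m, 'n::finite) chart set \<Rightarrow> (('m, 'n) chart \<Rightarrow> real^'n \<Rightarrow> real^'n^'n) \<Rightarrow>
    'i set \<Rightarrow> ('i \<Rightarrow> 'm set) \<Rightarrow> (real^'r^'r \<Rightarrow> real^'r^'r \<Rightarrow> real) \<Rightarrow>
    (('m, 'n) chart \<Rightarrow> 'i \<Rightarrow> real^'n \<Rightarrow> real^'n \<Rightarrow> real^'r^'r) \<Rightarrow> 'm \<Rightarrow> real"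
  where "normF \<A> g J V \<kappa> A = at_point \<A> J V
    (\<lambda>c i y. sqrt (ip2 (g c y) \<kappa> (curv A c i y) (curv A c i y)))"

definition normdPhi :: "('m, 'n::finite) chart set \<Rightarrow> (('m, 'n) chart \<Rightarrow> real^'n \<Rightarrow> real^'n^'n) \<Rightarrow>
    'i set \<Rightarrow> ('i \<Rightarrow> 'm set) \<Rightarrow> (real^'r^'r \<Rightarrow> real^'r^'r \<Rightarrow> real) \<Rightarrow>
    (('m, 'n) chart \<Rightarrow> 'i \<Rightarrow> real^'n \<Rightarrow> real^'n \<Rightarrow> real^'r^'r) \<Rightarrow>
    ('i \<Rightarrow> 'm \<Rightarrow> real^'r^'r) \<Rightarrow> 'm \<Rightarrow> real"
  where "normdPhi \<A> g J V \<kappa> A \<Phi> = at_point \<A> J V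
    (\<lambda>c i y. sqrt (ip1 (g c y) \<kappa> (dAPhi A \<Phi> c i y) (dAPhi A \<Phi> c i y)))"

definition Ftilde_bound :: "('m, 'n::finite) chart set \<Rightarrow>
    (('m, 'n) chart \<Rightarrow> real^'n \<Rightarrow> real^'n^'n) \<Rightarrow> 'i set \<Rightarrow> ('i \<Rightarrow> 'm set) \<Rightarrow>
    (real^'r^'r \<Rightarrow> real^'r^'r \<Rightarrow> real) \<Rightarrow>
    (('m, 'n) chart \<Rightarrow> 'i \<Rightarrow> real^'n \<Rightarrow> real^'n \<Rightarrow> real^'r^'r) \<Rightarrow> real \<Rightarrow> bool"
  where "Ftilde_bound \<A> g J V \<kappa> A B \<longleftrightarrow> (\<forall>c\<in>\<A>. \<forall>i\<in>J. \<forall>y\<in>loc c (V i).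
    let F = curv A c i y in
    \<bar>ip2 (g c y) \<kappa> (Ftilde (g c y) F F) F\<bar> \<le> B * sqrt (ip2 (g c y) \<kappa> F F) ^ 3)"

definition bracket_bound :: "('m, 'n::finite) chart set \<Rightarrow>
    (('m, 'n) chart \<Rightarrow> real^'n \<Rightarrow> real^'n^'n) \<Rightarrow> 'i set \<Rightarrow> ('i \<Rightarrow> 'm set) \<Rightarrow>
    (real^'r^'r \<Rightarrow> real^'r^'r \<Rightarrow> real) \<Rightarrow>
    (('m, 'n) chart \<Rightarrow> 'i \<Rightarrow> real^'n \<Rightarrow> real^'n \<Rightarrow> real^'r^'r) \<Rightarrow>
    ('i \<Rightarrow> 'm \<Rightarrow> real^'r^'r) \<Rightarrow> real \<Rightarrow> bool"
  where "bracket_bound \<A> g J V \<kappa> A \<Phi> B \<longleftrightarrow> (\<forall>c\<in>\<A>. \<forall>i\<in>J. \<forall>y\<in>loc c (V i).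
    let \<alpha> = dAPhi A \<Phi> c i y in
    sqrt (ip2 (g c y) \<kappa> (bracket11 \<alpha> \<alpha>) (bracket11 \<alpha> \<alpha>)) \<le> B * ip1 (g c y) \<kappa> \<alpha> \<alpha>)"

end

theory Submission
  imports Defs "HOL-Computational_Algebra.Polynomial"
begin

text \<open>
  The Weitzenboeck formula for \<open>F\<close>, the Bianchi identity \<open>d\<^sub>A F = 0\<close> and \<open>d\<^sub>A\<^sup>* F = 0\<close> give
  \<open>\<Delta>|F|\<^sup>2 / 2 \<ge> |\<nabla>F|\<^sup>2 + a\<^sub>1 |F|\<^sup>2 - B\<^sub>1 |F|\<^sup>3\<close>. Since \<open>F\<close> is both closed and coclosed, Kato's inequality
  improves to \<open>|\<nabla>F|\<^sup>2 \<ge> (n - 1) / (n - 2) |d|F||\<^sup>2\<close>, and the gradient terms cancel in \<open>\<Delta>(f\<^sup>q)\<close> for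
  \<open>f = |F|\<^sup>2\<close> and \<open>2 q = (n - 3) / (n - 2)\<close>. At the zeros of \<open>f\<close> the inequality holds in the weak
  sense, as the limit for \<open>\<epsilon> \<rightarrow> 0\<close> of inequalities for \<open>(f + \<epsilon>)\<^sup>q\<close>, and trivially where \<open>u = 0\<close> is an
  interior minimum of a twice differentiable function.

  A Yang--Mills--Higgs pair \<open>(A, \<Phi>)\<close> is a Yang--Mills connection \<open>A + \<Phi> dt\<close> on the product of the
  manifold with a line, with curvature \<open>F + d\<^sub>A\<Phi> \<and> dt\<close> of squared norm \<open>|F|\<^sup>2 + |d\<^sub>A\<Phi>|\<^sup>2\<close>. The same
  argument in dimension \<open>n + 1\<close> gives the exponent \<open>(n - 2) / (2 (n - 1))\<close>.
\<close>

section \<open>Calculus with directional derivatives\<close>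

text \<open>The exponent is forced by \<open>\<Delta>(f powr q) = q * f powr (q - 2) * (f \<Delta>f
  - (1 - q) |\<nabla>f|\<^sup>2)\<close>. For f = |F|^2 one has |\<nabla>f|^2 = 4 f |\<nabla>|F||^2,
  so the Kato constant permits exactly 4 (1 - q) (n - 2) / (n - 1) = 2. The 3 in
  \<open>3 * B2\<close> arises because the pairing of F with the bracket of the derivatives of
  \<Phi> occurs once in the horizontal and twice in the vertical part of the Weitzenboeck term on
  the product. Three obstacles shape the proof. The field equations are known only against test
  forms in one chart and one frame, so they must first be turned into pointwise equations that can
  be differentiated. The form \<open>\<kappa>\<close> is an inner product on \<open>so\<close> only,
  and is extended by a projection. Orthonormal frames are chosen at single points only: derivatives
  are taken along constant coordinate vectors, and the parallel inverse metric replaces moving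
  frames. Since the abstract computation uses nothing but the inverse metric and the connection, the
  product with a line is a second instance of it.\<close>

lemma has_derivative_dd: "f differentiable (at y) \<Longrightarrow> (f has_derivative dd f y) (at y)"
  unfolding dd_def by (simp add: frechet_derivative_works)

lemma dd_eqI: "(f has_derivative f') (at y) \<Longrightarrow> dd f y v = f' v"
  unfolding dd_def using frechet_derivative_at by metis

lemma linear_dd: "f differentiable (at y) \<Longrightarrow> linear (dd f y)"
  using has_derivative_dd has_derivative_linear by blast

lemma differentiable_bilinear:
  assumes "bounded_bilinear p" "f differentiable (at y)" "h differentiable (at y)"
  shows "(\<lambda>z. p (f z) (h z)) differentiable (at y)"
  using bounded_bilinear.FDERIV[OF assms(1) has_derivative_dd[OF assms(2)] has_derivative_dd[OF assms(3)]]
  by (auto simp: differentiable_def)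

lemma dd_bilinear:
  assumes "bounded_bilinear p" "f differentiable (at y)" "h differentiable (at y)"
  shows "dd (\<lambda>z. p (f z) (h z)) y v = p (dd f y v) (h y) + p (f y) (dd h y v)"
  using dd_eqI[OF bounded_bilinear.FDERIV[OF assms(1) has_derivative_dd[OF assms(2)] has_derivative_dd[OF assms(3)]], of v]
  by simp

lemma differentiable_bounded_linear:
  assumes "bounded_linear L" "f differentiable (at y)"
  shows "(\<lambda>z. L (f z)) differentiable (at y)"
  using bounded_linear.has_derivative[OF assms(1) has_derivative_dd[OF assms(2)]] by (auto simp: differentiable_def)

lemma dd_bounded_linear:
  assumes "bounded_linear L" "f differentiable (at y)"
  shows "dd (\<lambda>z. L (f z)) y v = L (dd f y v)"
  using dd_eqI[OF bounded_linear.has_derivative[OF assms(1) has_derivative_dd[OF assms(2)]], of v] .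

lemma dd_const [simp]: "dd (\<lambda>z. c) y v = 0"
  by (rule dd_eqI) (rule has_derivative_const)

lemma dd_add:
  assumes "f differentiable (at y)" "h differentiable (at y)"
  shows "dd (\<lambda>z. f z + h z) y v = dd f y v + dd h y v"
  by (rule dd_eqI) (intro has_derivative_add has_derivative_dd assms)

lemma dd_diff:
  assumes "f differentiable (at y)" "h differentiable (at y)"
  shows "dd (\<lambda>z. f z - h z) y v = dd f y v - dd h y v"
  by (rule dd_eqI) (intro has_derivative_diff has_derivative_dd assms)

lemma dd_minus:
  assumes "f differentiable (at y)"
  shows "dd (\<lambda>z. - f z) y v = - dd f y v"
  by (rule dd_eqI) (intro has_derivative_minus has_derivative_dd assms)

lemma dd_sum:
  assumes "\<And>i. i \<in> I \<Longrightarrow> f i differentiable (at y)"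
  shows "dd (\<lambda>z. \<Sum>i\<in>I. f i z) y v = (\<Sum>i\<in>I. dd (f i) y v)"
  by (rule dd_eqI) (intro has_derivative_sum has_derivative_dd assms)

lemma dd_mult:
  fixes f h :: "'a::real_normed_vector \<Rightarrow> real"
  assumes "f differentiable (at y)" "h differentiable (at y)"
  shows "dd (\<lambda>z. f z * h z) y v = dd f y v * h y + f y * dd h y v"
  by (rule dd_bilinear[OF bounded_bilinear_mult assms])

lemma dd_scaleR:
  assumes "f differentiable (at y)" "h differentiable (at y)"
  shows "dd (\<lambda>z. f z *\<^sub>R h z) y v = dd f y v *\<^sub>R h y + f y *\<^sub>R dd h y v"
  by (rule dd_bilinear[OF bounded_bilinear_scaleR assms])

lemma dd_compose:
  assumes "f differentiable (at y)" "h differentiable (at (f y))"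
  shows "dd (\<lambda>z. h (f z)) y v = dd h (f y) (dd f y v)"
  by (rule dd_eqI) (rule has_derivative_compose[OF has_derivative_dd[OF assms(1)] has_derivative_dd[OF assms(2)]])

lemma dd_real_compose:
  fixes f :: "'a::real_normed_vector \<Rightarrow> real"
  assumes "f differentiable (at y)" "(h has_real_derivative h') (at (f y))"
  shows "dd (\<lambda>z. h (f z)) y v = h' * dd f y v"
  by (rule dd_eqI) (rule has_derivative_compose[OF has_derivative_dd[OF assms(1)]
        assms(2)[unfolded has_field_derivative_def], simplified])

lemma dd_cong_open:
  assumes "open S" "y \<in> S" "\<And>z. z \<in> S \<Longrightarrow> f z = h z"
  shows "dd f y v = dd h y v"
proof -
  have "(f has_derivative f') (at y) \<longleftrightarrow> (h has_derivative f') (at y)" for f'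
    using has_derivative_transform_within_open[OF _ assms(1,2)] assms(3) by metis
  then show ?thesis unfolding dd_def frechet_derivative_def by simp
qed

lemma differentiable_cong_open:
  assumes "open S" "y \<in> S" "\<And>z. z \<in> S \<Longrightarrow> f z = h z" "f differentiable (at y)"
  shows "h differentiable (at y)"
proof -
  obtain f' where "(f has_derivative f') (at y)" using assms(4) unfolding differentiable_def by blast
  then have "(h has_derivative f') (at y)"
    by (rule has_derivative_transform_within_open[OF _ assms(1,2)]) (rule assms(3))
  then show ?thesis unfolding differentiable_def by blast
qed


section \<open>Differentiability classes and their closure properties\<close>

lemma Ck_on_subset: "Ck_on k f S \<Longrightarrow> T \<subseteq> S \<Longrightarrow> Ck_on k f T"
  by (induction k arbitrary: f) (auto intro: continuous_on_subset)

text \<open>The recursion records derivatives only, so passing to a lower order needs an induction;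
  it starts from the continuity of differentiable functions.\<close>

lemma Ck_on_SucD: "Ck_on (Suc k) f S \<Longrightarrow> Ck_on k f S"
proof (induction k arbitrary: f)
  case 0
  then show ?case
    by (auto intro!: differentiable_imp_continuous_on simp: differentiable_on_def differentiable_at_withinI)
next
  case (Suc k)
  from Suc.prems show ?case using Suc.IH by (subst Ck_on.simps) (auto simp del: Ck_on.simps simp: Ck_on.simps(2)[of "Suc k"])
qed

lemma Ck_on_mono: "Ck_on k f S \<Longrightarrow> j \<le> k \<Longrightarrow> Ck_on j f S"
  by (induction k) (auto simp: le_Suc_eq simp del: Ck_on.simps dest: Ck_on_SucD)

lemma Ck_on_cong:
  assumes "open S" "Ck_on k f S" "\<And>y. y \<in> S \<Longrightarrow> f y = h y"
  shows "Ck_on k h S"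
  using assms(2,3)
proof (induction k arbitrary: f h)
  case 0
  then show ?case using continuous_on_cong by (metis Ck_on.simps(1))
next
  case (Suc k)
  have "h differentiable (at y)" if "y \<in> S" for y
    using Suc.prems differentiable_cong_open[OF assms(1) that] that by auto
  moreover have "Ck_on k (\<lambda>y. dd h y v) S" for v
    by (rule Suc.IH[of "\<lambda>y. dd f y v"])
      (use Suc.prems(1) dd_cong_open[OF assms(1) _ Suc.prems(2)] in auto)
  ultimately show ?case by simp
qed

lemma Ck_on_const: "Ck_on k (\<lambda>y. c) S"
  by (induction k arbitrary: c) auto

lemma Ck_on_bounded_linear:
  assumes "open S" "bounded_linear L" "Ck_on k f S"
  shows "Ck_on k (\<lambda>y. L (f y)) S"
  using assms(3)
proof (induction k arbitrary: f)
  case 0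
  then show ?case using bounded_linear.continuous_on[OF assms(2)] by auto
next
  case (Suc k)
  have "Ck_on k (\<lambda>y. dd (\<lambda>z. L (f z)) y v) S" for v
    by (rule Ck_on_cong[OF assms(1), of _ "\<lambda>y. L (dd f y v)"])
      (use Suc in \<open>auto simp: dd_bounded_linear[OF assms(2)]\<close>)
  then show ?case using Suc.prems differentiable_bounded_linear[OF assms(2)] by auto
qed

lemma Ck_on_id: "Ck_on k (\<lambda>y. y) S"
proof (cases k)
  case (Suc j)
  have "dd (\<lambda>y. y) y v = v" for y v :: 'a by (rule dd_eqI) (rule has_derivative_ident)
  then show ?thesis using Suc by (simp add: Ck_on_const)
qed simp

lemma Ck_on_add:
  assumes "open S" "Ck_on k f S" "Ck_on k h S"
  shows "Ck_on k (\<lambda>y. f y + h y) S"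
  using assms(2,3)
proof (induction k arbitrary: f h)
  case (Suc k)
  have "Ck_on k (\<lambda>y. dd (\<lambda>z. f z + h z) y v) S" for v
    by (rule Ck_on_cong[OF assms(1), of _ "\<lambda>y. dd f y v + dd h y v"])
      (use Suc in \<open>auto simp: dd_add\<close>)
  then show ?case using Suc.prems by auto
qed (auto intro: continuous_on_add)

text \<open>A general bounded bilinear map lets one induction serve products, scalar multiples,
  inner products, brackets and \<open>\<kappa>\<close>.\<close>

lemma Ck_on_bilinear:
  assumes "open S" "bounded_bilinear p" "Ck_on k f S" "Ck_on k h S"
  shows "Ck_on k (\<lambda>y. p (f y) (h y)) S"
  using assms(3,4)
proof (induction k arbitrary: f h)
  case 0
  then show ?case using bounded_bilinear.continuous_on[OF assms(2)] by auto
next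
  case (Suc k)
  have k: "Ck_on k f S" "Ck_on k h S" using Suc.prems Ck_on_SucD by blast+
  have "Ck_on k (\<lambda>y. dd (\<lambda>z. p (f z) (h z)) y v) S" for v
    by (rule Ck_on_cong[OF assms(1), of _ "\<lambda>y. p (dd f y v) (h y) + p (f y) (dd h y v)"],
        rule Ck_on_add[OF assms(1)]) (use Suc k in \<open>auto simp: dd_bilinear[OF assms(2)]\<close>)
  moreover have "(\<lambda>y. p (f y) (h y)) differentiable (at y)" if "y \<in> S" for y
    using Suc.prems that by (intro differentiable_bilinear[OF assms(2)]) auto
  ultimately show ?case by simp
qed

lemma Ck_on_sum:
  assumes "open S" "\<And>i. i \<in> I \<Longrightarrow> Ck_on k (f i) S"
  shows "Ck_on k (\<lambda>y. \<Sum>i\<in>I. f i y) S"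
  using assms(2) by (induction I rule: infinite_finite_induct) (auto simp: Ck_on_const Ck_on_add[OF assms(1)])

text \<open>Membership of \<open>h\<close> in a class closed under differentiation replaces Faa di Bruno's formula.\<close>

lemma Ck_on_compose_class:
  fixes f :: "'a::real_normed_vector \<Rightarrow> real"
  assumes cl: "\<And>h. h \<in> H \<Longrightarrow> \<exists>h'\<in>H. \<forall>x\<in>I. (h has_real_derivative h' x) (at x)"
    and S: "open S" "\<And>y. y \<in> S \<Longrightarrow> f y \<in> I" and "h \<in> H" "Ck_on k f S"
  shows "Ck_on k (\<lambda>y. h (f y)) S"
  using assms(4,5)
proof (induction k arbitrary: h)
  case 0
  then obtain h' where "\<And>x. x \<in> I \<Longrightarrow> (h has_real_derivative h' x) (at x)" using cl by blast
  then have "continuous_on I h"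
    by (meson DERIV_isCont continuous_at_imp_continuous_on)
  then show ?case using 0 S continuous_on_compose2[of I h S f] by auto
next
  case (Suc k)
  obtain h' where h': "h' \<in> H" "\<And>x. x \<in> I \<Longrightarrow> (h has_real_derivative h' x) (at x)"
    using cl Suc.prems by blast
  have k: "Ck_on k f S" using Suc.prems Ck_on_SucD by blast
  have d: "f differentiable (at y)" if "y \<in> S" for y using Suc.prems that by auto
  have e: "dd (\<lambda>z. h (f z)) y v = h' (f y) * dd f y v" if "y \<in> S" for y v
    by (rule dd_real_compose) (use that d h' S in auto)
  have "Ck_on k (\<lambda>y. dd (\<lambda>z. h (f z)) y v) S" for v
    by (rule Ck_on_cong[OF S(1), of _ "\<lambda>y. h' (f y) * dd f y v"],
        rule Ck_on_bilinear[OF S(1) bounded_bilinear_mult])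
      (use Suc h' k e in auto)
  moreover have "(\<lambda>y. h (f y)) differentiable (at y)" if "y \<in> S" for y
    using has_derivative_compose[OF has_derivative_dd[OF d[OF that]]
      h'(2)[OF S(2)[OF that], unfolded has_field_derivative_def]] differentiable_def by blast
  ultimately show ?case by simp
qed

text \<open>The functions \<open>c * x powr q\<close> with varying \<open>c\<close> and
  \<open>q\<close> form a class that is closed under differentiation on the positive
  half-line.\<close>

lemma Ck_on_powr:
  fixes f :: "'a::real_normed_vector \<Rightarrow> real"
  assumes "open S" "Ck_on k f S" "\<And>y. y \<in> S \<Longrightarrow> f y > 0"
  shows "Ck_on k (\<lambda>y. f y powr q) S"
proof (rule Ck_on_compose_class[where h = "\<lambda>x. x powr q" and H = "{\<lambda>x. c * x powr q | c q. True}" and I = "{0<..}"])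
  fix h assume "h \<in> {\<lambda>x::real. c * x powr q | c q. True}"
  then obtain c q where h: "h = (\<lambda>x. c * x powr q)" by auto
  show "\<exists>h'\<in>{\<lambda>x. c * x powr q |c q. True}. \<forall>x\<in>{0<..}. (h has_real_derivative h' x) (at x)"
    unfolding h by (rule bexI[of _ "\<lambda>x. (c * q) * x powr (q - 1)"])
      (auto intro!: derivative_eq_intros)
next
  show "(\<lambda>x. x powr q) \<in> {\<lambda>x. c * x powr q |c q. True}"
    by (rule CollectI, rule exI[of _ 1], rule exI[of _ q]) simp
qed (use assms in auto)

lemma smooth_onD: "smooth_on f S \<Longrightarrow> Ck_on k f S" by (simp add: smooth_on_def)

lemma smooth_on_subset: "smooth_on f S \<Longrightarrow> T \<subseteq> S \<Longrightarrow> smooth_on f T"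
  unfolding smooth_on_def using Ck_on_subset by blast

lemma smooth_on_dd: "smooth_on f S \<Longrightarrow> smooth_on (\<lambda>y. dd f y v) S"
  using Ck_on.simps(2) unfolding smooth_on_def by blast

lemma smooth_on_differentiable: "smooth_on f S \<Longrightarrow> y \<in> S \<Longrightarrow> f differentiable (at y)"
  using Ck_on.simps(2) unfolding smooth_on_def by blast

lemma smooth_on_continuous: "smooth_on f S \<Longrightarrow> continuous_on S f"
  using Ck_on.simps(1) unfolding smooth_on_def by blast

lemma smooth_on_cong:
  assumes "open S" "smooth_on f S" "\<And>y. y \<in> S \<Longrightarrow> f y = h y"
  shows "smooth_on h S"
  using assms Ck_on_cong unfolding smooth_on_def by blast

lemma smooth_on_const: "smooth_on (\<lambda>y. c) S"
  by (simp add: smooth_on_def Ck_on_const)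

lemma smooth_on_id: "smooth_on (\<lambda>y. y) S"
  by (simp add: smooth_on_def Ck_on_id)

lemma smooth_on_bounded_linear:
  "open S \<Longrightarrow> bounded_linear L \<Longrightarrow> smooth_on f S \<Longrightarrow> smooth_on (\<lambda>y. L (f y)) S"
  by (simp add: smooth_on_def Ck_on_bounded_linear)

lemma smooth_on_add: "open S \<Longrightarrow> smooth_on f S \<Longrightarrow> smooth_on h S \<Longrightarrow> smooth_on (\<lambda>y. f y + h y) S"
  by (simp add: smooth_on_def Ck_on_add)

lemma smooth_on_minus: "open S \<Longrightarrow> smooth_on f S \<Longrightarrow> smooth_on (\<lambda>y. - f y) S"
  by (rule smooth_on_bounded_linear[OF _ bounded_linear_minus[OF bounded_linear_ident]])

lemma smooth_on_diff: "open S \<Longrightarrow> smooth_on f S \<Longrightarrow> smooth_on h S \<Longrightarrow> smooth_on (\<lambda>y. f y - h y) S"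
  using smooth_on_add[of S f "\<lambda>y. - h y"] smooth_on_minus by auto

lemma smooth_on_bilinear:
  "open S \<Longrightarrow> bounded_bilinear p \<Longrightarrow> smooth_on f S \<Longrightarrow> smooth_on h S \<Longrightarrow> smooth_on (\<lambda>y. p (f y) (h y)) S"
  by (simp add: smooth_on_def Ck_on_bilinear)

lemmas smooth_on_mult = smooth_on_bilinear[OF _ bounded_bilinear_mult]
lemmas smooth_on_scaleR = smooth_on_bilinear[OF _ bounded_bilinear_scaleR]

lemma smooth_on_sum:
  "open S \<Longrightarrow> (\<And>i. i \<in> I \<Longrightarrow> smooth_on (f i) S) \<Longrightarrow> smooth_on (\<lambda>y. \<Sum>i\<in>I. f i y) S"
  by (simp add: smooth_on_def Ck_on_sum)

lemma smooth_on_prod: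
  fixes f :: "'i \<Rightarrow> 'a::real_normed_vector \<Rightarrow> real"
  assumes "open S" "\<And>i. i \<in> I \<Longrightarrow> smooth_on (f i) S"
  shows "smooth_on (\<lambda>y. \<Prod>i\<in>I. f i y) S"
  using assms(2)
  by (induction I rule: infinite_finite_induct) (auto simp: smooth_on_const smooth_on_mult[OF assms(1)])

lemma smooth_on_powr:
  fixes f :: "'a::real_normed_vector \<Rightarrow> real"
  shows "open S \<Longrightarrow> smooth_on f S \<Longrightarrow> (\<And>y. y \<in> S \<Longrightarrow> f y > 0) \<Longrightarrow> smooth_on (\<lambda>y. f y powr q) S"
  by (simp add: smooth_on_def Ck_on_powr)

lemma smooth_on_componentwise:
  fixes f :: "'a::real_normed_vector \<Rightarrow> 'b::euclidean_space"
  assumes "open S" "\<And>b. b \<in> Basis \<Longrightarrow> smooth_on (\<lambda>y. f y \<bullet> b) S"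
  shows "smooth_on f S"
proof -
  have "smooth_on (\<lambda>y. \<Sum>b\<in>Basis. (f y \<bullet> b) *\<^sub>R b) S"
    by (intro smooth_on_sum smooth_on_scaleR smooth_on_const assms) (use assms in auto)
  then show ?thesis by (simp add: euclidean_representation)
qed

lemma smooth_on_inner_const:
  fixes f :: "'a::real_normed_vector \<Rightarrow> 'b::euclidean_space"
  shows "open S \<Longrightarrow> smooth_on f S \<Longrightarrow> smooth_on (\<lambda>y. f y \<bullet> b) S"
  by (rule smooth_on_bounded_linear[OF _ bounded_linear_inner_left])

lemma smooth_on_nth:
  fixes f :: "'a::real_normed_vector \<Rightarrow> 'b::real_normed_vector ^ 'n"
  shows "open S \<Longrightarrow> smooth_on f S \<Longrightarrow> smooth_on (\<lambda>y. f y $ i) S"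
  by (rule smooth_on_bounded_linear[OF _ bounded_linear_vec_nth])

lemma smooth_on_vec:
  fixes f :: "'a::real_normed_vector \<Rightarrow> 'b::euclidean_space ^ 'n"
  assumes "open S" "\<And>i. smooth_on (\<lambda>y. f y $ i) S"
  shows "smooth_on f S"
proof (rule smooth_on_componentwise[OF assms(1)])
  fix b :: "'b ^ 'n" assume "b \<in> Basis"
  then obtain i u where "b = axis i u" by (auto simp: Basis_vec_def)
  then show "smooth_on (\<lambda>y. f y \<bullet> b) S"
    using smooth_on_inner_const[OF assms(1) assms(2)[of i], of u] by (simp add: inner_axis)
qed

section \<open>Symmetry of second derivatives\<close>

lemma second_difference:
  fixes f :: "'a::real_normed_vector \<Rightarrow> real"
  assumes f: "Ck_on 2 f S" and h: "h > 0"
    and S: "\<And>s t. 0 \<le> s \<Longrightarrow> s \<le> h \<Longrightarrow> 0 \<le> t \<Longrightarrow> t \<le> h \<Longrightarrow> y + s *\<^sub>R X + t *\<^sub>R Y \<in> S"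
  shows "\<exists>s t. 0 \<le> s \<and> s \<le> h \<and> 0 \<le> t \<and> t \<le> h \<and>
    f (y + h *\<^sub>R X + h *\<^sub>R Y) - f (y + h *\<^sub>R X) - f (y + h *\<^sub>R Y) + f y
      = h * h * dd (\<lambda>z. dd f z X) (y + s *\<^sub>R X + t *\<^sub>R Y) Y"
proof -
  have d1: "f differentiable (at z)" if "z \<in> S" for z using f that by (simp add: numeral_2_eq_2)
  have d2: "(\<lambda>z. dd f z X) differentiable (at z)" if "z \<in> S" for z using f that by (simp add: numeral_2_eq_2)
  have aff: "((\<lambda>s. z + s *\<^sub>R Z) has_derivative (\<lambda>s. s *\<^sub>R Z)) (at s)" for z Z :: 'a and s :: real
    by (auto intro!: derivative_eq_intros)
  have D: "((\<lambda>s. k (z + s *\<^sub>R Z)) has_derivative (\<lambda>r. r * dd k (z + s *\<^sub>R Z) Z)) (at s)"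
    if "k differentiable (at (z + s *\<^sub>R Z))" for k :: "'a \<Rightarrow> real" and z Z s
    using has_derivative_compose[OF aff has_derivative_dd[OF that]] linear_scale[OF linear_dd[OF that]]
    by simp
  \<comment> \<open>Mean value theorem in direction \<open>X\<close> for the increment of
    \<open>f\<close> across \<open>h *\<^sub>R Y\<close>; a second application below treats
    direction \<open>Y\<close>.\<close>
  have "\<exists>s\<in>{0<..<h}. (\<lambda>s. f ((y + h *\<^sub>R Y) + s *\<^sub>R X) - f (y + s *\<^sub>R X)) h - (\<lambda>s. f ((y + h *\<^sub>R Y) + s *\<^sub>R X) - f (y + s *\<^sub>R X)) 0
     = (\<lambda>s r. r * dd f ((y + h *\<^sub>R Y) + s *\<^sub>R X) X - r * dd f (y + s *\<^sub>R X) X) s (h - 0)"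
  proof (rule mvt_simple[OF h])
    fix s assume s: "0 \<le> s" "s \<le> h"
    have "y + h *\<^sub>R Y + s *\<^sub>R X \<in> S" "y + s *\<^sub>R X \<in> S" using S[OF s, of h] S[OF s, of 0] h by (auto simp: ac_simps)
    then show "((\<lambda>s. f (y + h *\<^sub>R Y + s *\<^sub>R X) - f (y + s *\<^sub>R X)) has_derivative
       (\<lambda>r. r * dd f (y + h *\<^sub>R Y + s *\<^sub>R X) X - r * dd f (y + s *\<^sub>R X) X)) (at s within {0..h})"
      by (intro has_derivative_diff has_derivative_at_withinI[OF D] d1)
  qed
  then obtain s where s: "0 < s" "s < h" and e1: "f (y + h *\<^sub>R X + h *\<^sub>R Y) - f (y + h *\<^sub>R X) - f (y + h *\<^sub>R Y) + f y
     = h * (dd f ((y + s *\<^sub>R X) + h *\<^sub>R Y) X - dd f (y + s *\<^sub>R X) X)"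
    by (auto simp: ac_simps algebra_simps)
  have "\<exists>t\<in>{0<..<h}. (\<lambda>t. dd f ((y + s *\<^sub>R X) + t *\<^sub>R Y) X) h - (\<lambda>t. dd f ((y + s *\<^sub>R X) + t *\<^sub>R Y) X) 0
     = (\<lambda>t r. r * dd (\<lambda>z. dd f z X) ((y + s *\<^sub>R X) + t *\<^sub>R Y) Y) t (h - 0)"
  proof (rule mvt_simple[OF h])
    fix t assume t: "0 \<le> t" "t \<le> h"
    show "((\<lambda>t. dd f (y + s *\<^sub>R X + t *\<^sub>R Y) X) has_derivative
       (\<lambda>r. r * dd (\<lambda>z. dd f z X) (y + s *\<^sub>R X + t *\<^sub>R Y) Y)) (at t within {0..h})"
      by (rule has_derivative_at_withinI[OF D[of "\<lambda>z. dd f z X"]], rule d2, rule S) (use s t in auto)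
  qed
  then obtain t where "0 < t" "t < h" "dd f ((y + s *\<^sub>R X) + h *\<^sub>R Y) X - dd f (y + s *\<^sub>R X) X
      = h * dd (\<lambda>z. dd f z X) ((y + s *\<^sub>R X) + t *\<^sub>R Y) Y" by auto
  then show ?thesis using e1 s by (intro exI[of _ s] exI[of _ t]) auto
qed

text \<open>The second difference over a small parallelogram does not depend on the order of
  \<open>X\<close> and \<open>Y\<close>. Divided by \<open>h * h\<close> it is a value of either
  mixed derivative near \<open>y\<close>, so continuity forces the two to agree at
  \<open>y\<close>.\<close>

lemma dd_commute_real:
  fixes f :: "'a::real_normed_vector \<Rightarrow> real"
  assumes "open S" "y \<in> S" "Ck_on 2 f S"
  shows "dd (\<lambda>z. dd f z X) y Y = dd (\<lambda>z. dd f z Y) y X"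
proof (rule ccontr)
  define P where "P = (\<lambda>z. dd (\<lambda>z. dd f z X) z Y)"
  define Q where "Q = (\<lambda>z. dd (\<lambda>z. dd f z Y) z X)"
  assume "\<not> ?thesis"
  then have ne: "P y \<noteq> Q y" by (simp add: P_def Q_def)
  \<comment> \<open>Half the gap: values of \<open>P\<close> and \<open>Q\<close> that are closer
    than \<open>e\<close> to their values at \<open>y\<close> cannot coincide.\<close>
  define e where "e = \<bar>P y - Q y\<bar> / 2"
  have e: "e > 0" using ne by (simp add: e_def)
  have "continuous_on S P" "continuous_on S Q" using assms(3) unfolding P_def Q_def numeral_2_eq_2 by simp_all
  then have c: "continuous (at y) P" "continuous (at y) Q" using assms(1,2) continuous_on_eq_continuous_at by blast+
  obtain d1 where d1: "d1 > 0" "\<And>z. dist z y < d1 \<Longrightarrow> dist (P z) (P y) < e"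
    using c(1) e unfolding continuous_at_eps_delta by metis
  obtain d2 where d2: "d2 > 0" "\<And>z. dist z y < d2 \<Longrightarrow> dist (Q z) (Q y) < e"
    using c(2) e unfolding continuous_at_eps_delta by metis
  obtain d3 where d3: "d3 > 0" "ball y d3 \<subseteq> S" using assms open_contains_ball by blast
  define d where "d = min d1 (min d2 d3)"
  have d: "d > 0" using d1 d2 d3 by (simp add: d_def)
  \<comment> \<open>The factor 2 leaves a margin below \<open>d\<close>, and the summand 1 keeps the
    denominator positive when \<open>X\<close> and \<open>Y\<close> vanish.\<close>
  define h where "h = d / (2 * (norm X + norm Y + 1))"
  have h: "h > 0" using d by (simp add: h_def add_nonneg_pos)
  have nb: "dist (y + s *\<^sub>R X + t *\<^sub>R Y) y < d" if "0 \<le> s" "s \<le> h" "0 \<le> t" "t \<le> h" for s t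
  proof -
    have "dist (y + s *\<^sub>R X + t *\<^sub>R Y) y = norm (s *\<^sub>R X + t *\<^sub>R Y)" by (simp add: dist_norm algebra_simps)
    also have "\<dots> \<le> s * norm X + t * norm Y" using norm_triangle_ineq[of "s *\<^sub>R X" "t *\<^sub>R Y"] that by simp
    also have "\<dots> \<le> h * norm X + h * norm Y" using that by (intro add_mono mult_right_mono) auto
    also have "\<dots> \<le> h * (norm X + norm Y + 1)" using h by (simp add: algebra_simps)
    also have "\<dots> = d / 2" 
    proof -
      have "norm X + norm Y + 1 > 0" by (smt (verit) norm_ge_zero)
      then show ?thesis unfolding h_def by (auto simp: field_simps simp del: distrib_left)
    qed
    also have "\<dots> < d" using d by simp
    finally show ?thesis .
  qed
  have in_S: "y + s *\<^sub>R X + t *\<^sub>R Y \<in> S" if "0 \<le> s" "s \<le> h" "0 \<le> t" "t \<le> h" for s t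
    using nb[OF that] d3 by (auto simp: d_def dist_commute subset_iff)
  obtain s t where st: "0 \<le> s" "s \<le> h" "0 \<le> t" "t \<le> h" "f (y + h *\<^sub>R X + h *\<^sub>R Y) - f (y + h *\<^sub>R X) - f (y + h *\<^sub>R Y) + f y
      = h * h * P (y + s *\<^sub>R X + t *\<^sub>R Y)"
    using second_difference[OF assms(3) h in_S] unfolding P_def by blast
  have in_S': "y + s *\<^sub>R Y + t *\<^sub>R X \<in> S" if "0 \<le> s" "s \<le> h" "0 \<le> t" "t \<le> h" for s t
    using in_S[OF that(3,4,1,2)] by (simp add: ac_simps)
  obtain s' t' where st': "0 \<le> s'" "s' \<le> h" "0 \<le> t'" "t' \<le> h" "f (y + h *\<^sub>R Y + h *\<^sub>R X) - f (y + h *\<^sub>R Y) - f (y + h *\<^sub>R X) + f y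
      = h * h * Q (y + s' *\<^sub>R Y + t' *\<^sub>R X)"
    using second_difference[OF assms(3) h in_S'] unfolding Q_def by blast
  have "h * h * P (y + s *\<^sub>R X + t *\<^sub>R Y) = h * h * Q (y + s' *\<^sub>R Y + t' *\<^sub>R X)"
  proof -
    have "y + h *\<^sub>R Y + h *\<^sub>R X = y + h *\<^sub>R X + h *\<^sub>R Y" by simp
    then show ?thesis using st(5) st'(5)[unfolded \<open>y + h *\<^sub>R Y + h *\<^sub>R X = y + h *\<^sub>R X + h *\<^sub>R Y\<close>] by linarith
  qed
  then have eq: "P (y + s *\<^sub>R X + t *\<^sub>R Y) = Q (y + t' *\<^sub>R X + s' *\<^sub>R Y)" using h by (simp add: ac_simps)
  have "dist (P (y + s *\<^sub>R X + t *\<^sub>R Y)) (P y) < e" using d1(2) nb[OF st(1-4)] by (simp add: d_def)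
  moreover have "dist (Q (y + t' *\<^sub>R X + s' *\<^sub>R Y)) (Q y) < e" using d2(2) nb[OF st'(3,4,1,2)] by (simp add: d_def)
  ultimately show False using eq by (simp add: dist_real_def e_def abs_if split: if_splits)
qed

lemma dd_commute:
  fixes f :: "'a::real_normed_vector \<Rightarrow> 'b::euclidean_space"
  assumes "open S" "y \<in> S" "Ck_on 2 f S"
  shows "dd (\<lambda>z. dd f z X) y Y = dd (\<lambda>z. dd f z Y) y X"
proof (rule euclidean_eqI)
  fix b :: 'b assume "b \<in> Basis"
  have d1: "f differentiable (at z)" "(\<lambda>z. dd f z V) differentiable (at z)" if "z \<in> S" for z V
    using assms(3) that by (simp_all add: numeral_2_eq_2)
  have *: "dd (\<lambda>z. dd f z X) y Y \<bullet> b = dd (\<lambda>z. dd (\<lambda>w. f w \<bullet> b) z X) y Y" for X Y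
  proof -
    have "dd (\<lambda>z. dd (\<lambda>w. f w \<bullet> b) z X) y Y = dd (\<lambda>z. dd f z X \<bullet> b) y Y"
      by (rule dd_cong_open[OF assms(1,2)]) (rule dd_bounded_linear[OF bounded_linear_inner_left d1(1)])
    also have "\<dots> = dd (\<lambda>z. dd f z X) y Y \<bullet> b"
      by (rule dd_bounded_linear[OF bounded_linear_inner_left d1(2)[OF assms(2)]])
    finally show ?thesis by simp
  qed
  show "dd (\<lambda>z. dd f z X) y Y \<bullet> b = dd (\<lambda>z. dd f z Y) y X \<bullet> b"
    unfolding * by (rule dd_commute_real[OF assms(1,2)])
      (rule Ck_on_bounded_linear[OF assms(1) bounded_linear_inner_left assms(3)])
qed

section \<open>Test functions and integration by parts\<close>

definition flat_exp :: "real poly \<Rightarrow> real \<Rightarrow> real"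
  where "flat_exp p x = (if x > 0 then poly p (inverse x) * exp (- inverse x) else 0)"

lemma poly_exp_tendsto_0: "((\<lambda>x. poly p x * exp (- x)) \<longlongrightarrow> (0::real)) at_top"
proof -
  have "((\<lambda>x. \<Sum>i\<le>degree p. coeff p i * (x ^ i / exp x)) \<longlongrightarrow> (\<Sum>i\<le>degree p. coeff p i * 0)) at_top"
    by (intro tendsto_sum tendsto_mult tendsto_const tendsto_power_div_exp_0)
  moreover have "(\<Sum>i\<le>degree p. coeff p i * (x ^ i / exp x)) = poly p x * exp (- x)" for x :: real
    by (simp add: poly_altdef sum_distrib_right exp_minus divide_inverse mult.assoc)
  ultimately show ?thesis by simp
qed

text \<open>With \<open>s = 1/x\<close>, the derivative of \<open>p(s) exp(-s)\<close> in
  \<open>x\<close> is \<open>s\<^sup>2 (p - p')(s) exp(-s)\<close>, which explains the polynomial.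
  Hence the family \<open>range flat_exp\<close> is closed under differentiation, as
  \<open>Ck_on_compose_class\<close> requires.\<close>

lemma flat_exp_has_derivative:
  "(flat_exp p has_real_derivative flat_exp ([:0, 0, 1:] * (p - pderiv p)) x) (at x)"
proof -
  consider "x > 0" | "x < 0" | "x = 0" by linarith
  then show ?thesis
  proof cases
    case 1
    have "((\<lambda>x. poly p (inverse x) * exp (- inverse x)) has_real_derivative
        flat_exp ([:0, 0, 1:] * (p - pderiv p)) x) (at x)"
      using 1 by (auto intro!: derivative_eq_intros DERIV_chain'[OF _ poly_DERIV]
          simp: flat_exp_def field_simps power2_eq_square)
    then show ?thesis
      by (rule has_field_derivative_transform_within_open[where S = "{0<..}"]) (use 1 in \<open>auto simp: flat_exp_def\<close>)
  next
    case 2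
    have "((\<lambda>x. 0) has_real_derivative flat_exp ([:0, 0, 1:] * (p - pderiv p)) x) (at x)"
      using 2 by (simp add: flat_exp_def)
    then show ?thesis
      by (rule has_field_derivative_transform_within_open[where S = "{..<0}"]) (use 2 in \<open>auto simp: flat_exp_def\<close>)
  next
    case 3
    \<comment> \<open>At 0 the right difference quotient is \<open>s p(s) exp(-s)\<close> with
      \<open>s = 1/h\<close> tending to infinity; the left one is identically 0.\<close>
    have "((\<lambda>h. poly ([:0, 1:] * p) (inverse h) * exp (- inverse h)) \<longlongrightarrow> 0) (at_right (0::real))"
      using filterlim_compose[OF poly_exp_tendsto_0 filterlim_inverse_at_top_right] .
    then have "((\<lambda>h. (flat_exp p (0 + h) - flat_exp p 0) / h) \<longlongrightarrow> 0) (at_right 0)"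
    proof (rule Lim_transform_eventually)
      have e: "poly ([:0, 1:] * p) (inverse h) * exp (- inverse h) = (flat_exp p (0 + h) - flat_exp p 0) / h" if "0 < h" for h
        using that by (simp add: flat_exp_def field_simps)
      show "\<forall>\<^sub>F h in at_right 0. poly ([:0, 1:] * p) (inverse h) * exp (- inverse h) = (flat_exp p (0 + h) - flat_exp p 0) / h"
        by (rule eventually_mono[OF eventually_at_right_less[of 0]]) (rule e)
    qed
    moreover have "((\<lambda>h. (flat_exp p (0 + h) - flat_exp p 0) / h) \<longlongrightarrow> 0) (at_left 0)"
      by (rule Lim_transform_eventually[OF tendsto_const])
        (auto simp: flat_exp_def eventually_at_filter)
    ultimately have "((\<lambda>h. (flat_exp p (0 + h) - flat_exp p 0) / h) \<longlongrightarrow> 0) (at 0)"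
      using filterlim_split_at by blast
    then show ?thesis using 3 by (simp add: DERIV_def flat_exp_def)
  qed
qed

text \<open>A flat function of \<open>r\<^sup>2 - |y - y0|\<^sup>2\<close>: unlike the distance from
  \<open>y0\<close> this argument is smooth everywhere, and for positive \<open>r\<close> it is
  positive exactly inside the ball.\<close>

definition bump :: "'a::euclidean_space \<Rightarrow> real \<Rightarrow> 'a \<Rightarrow> real"
  where "bump y0 r y = flat_exp 1 (r\<^sup>2 - (y - y0) \<bullet> (y - y0))"

lemma smooth_on_bump: "smooth_on (bump y0 r) UNIV"
proof -
  have q: "smooth_on (\<lambda>y. r\<^sup>2 - (y - y0) \<bullet> (y - y0)) UNIV"
    by (intro smooth_on_diff[OF open_UNIV] smooth_on_const smooth_on_bilinear[OF open_UNIV bounded_bilinear_inner] smooth_on_id)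
  have "Ck_on k (\<lambda>y. flat_exp 1 (r\<^sup>2 - (y - y0) \<bullet> (y - y0))) UNIV" for k
  proof (rule Ck_on_compose_class[where H = "range flat_exp" and h = "flat_exp 1" and I = UNIV])
    fix h assume "h \<in> range flat_exp"
    then obtain p where "h = flat_exp p" by auto
    then show "\<exists>h'\<in>range flat_exp. \<forall>x\<in>UNIV. (h has_real_derivative h' x) (at x)"
      using flat_exp_has_derivative[of p] by blast
  next
    show "Ck_on k (\<lambda>y. r\<^sup>2 - (y - y0) \<bullet> (y - y0)) UNIV" by (rule smooth_onD[OF q])
  qed auto
  then show ?thesis unfolding smooth_on_def bump_def[abs_def] by blast
qed

lemma bump_nonneg: "bump y0 r y \<ge> 0"
  by (simp add: bump_def flat_exp_def)

lemma bump_pos: "r > 0 \<Longrightarrow> bump y0 r y0 > 0"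
  by (simp add: bump_def flat_exp_def)

lemma bump_outside: "r > 0 \<Longrightarrow> y \<notin> cball y0 r \<Longrightarrow> bump y0 r y = 0"
proof -
  assume "r > 0" "y \<notin> cball y0 r"
  then have "r\<^sup>2 < (norm (y - y0))\<^sup>2" by (intro power_strict_mono) (auto simp: dist_norm norm_minus_commute)
  then show ?thesis by (simp add: bump_def flat_exp_def dot_square_norm)
qed

lemma test_function_bump: "r > 0 \<Longrightarrow> cball y0 r \<subseteq> D \<Longrightarrow> test_function D (bump y0 r)"
  unfolding test_function_def vanishes_off_compact_def
  using smooth_on_bump bump_outside compact_cball by metis

section \<open>Integrals of compactly supported functions\<close>

lemma continuous_on_extend_0:
  fixes f :: "'a::t2_space \<Rightarrow> 'b::real_normed_vector"
  assumes "open D" "compact C" "C \<subseteq> D" "continuous_on D f" "\<And>y. y \<in> D - C \<Longrightarrow> f y = 0"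
  shows "continuous_on UNIV (\<lambda>y. if y \<in> D then f y else 0)" (is "continuous_on _ ?g")
proof -
  have "continuous_on D ?g" using assms(4) by (rule continuous_on_eq) simp
  moreover have "continuous_on (- C) ?g" by (rule continuous_on_eq[OF continuous_on_const[of _ 0]]) (use assms in auto)
  moreover have "open (- C)" using assms(2) compact_imp_closed by blast
  ultimately have "continuous_on (D \<union> - C) ?g" using continuous_on_open_Un assms(1) by blast
  moreover have "D \<union> - C = UNIV" using assms by auto
  ultimately show ?thesis by simp
qed

text \<open>The extension by zero is continuous on a box containing \<open>C\<close>, hence
  absolutely integrable there, and it vanishes outside the box.\<close>

lemma absolutely_integrable_compact_support:
  fixes f :: "'a::euclidean_space \<Rightarrow> real"
  assumes "open D" "compact C" "C \<subseteq> D" "continuous_on D f" "\<And>y. y \<in> D - C \<Longrightarrow> f y = 0"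
  shows "f absolutely_integrable_on D"
proof -
  let ?g = "\<lambda>y. if y \<in> D then f y else 0"
  obtain a where a: "C \<subseteq> cbox (-a) a" using bounded_subset_cbox_symmetric compact_imp_bounded assms(2) by blast
  have "?g absolutely_integrable_on cbox (-a) a"
    using absolutely_integrable_continuous continuous_on_subset[OF continuous_on_extend_0[OF assms]] by blast
  then have "(\<lambda>y. if y \<in> cbox (-a) a then ?g y else 0) absolutely_integrable_on UNIV"
    by (simp only: absolutely_integrable_restrict_UNIV)
  also have "(\<lambda>y. if y \<in> cbox (-a) a then ?g y else 0) = ?g"
  proof
    fix y show "(if y \<in> cbox (-a) a then ?g y else 0) = ?g y" using a assms(5)[of y] by auto
  qed
  finally show ?thesis by (simp only: absolutely_integrable_restrict_UNIV)
qed

lemma fundamental_lemma_of_variations: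
  fixes w :: "'a::euclidean_space \<Rightarrow> real"
  assumes D: "open D" and w: "continuous_on D w"
    and z: "\<And>\<phi>. test_function D \<phi> \<Longrightarrow> integral D (\<lambda>y. \<phi> y * w y) = 0"
    and y0: "y0 \<in> D"
  shows "w y0 = 0"
proof -
  \<comment> \<open>It suffices to exclude a positive value, since the hypotheses carry over to
    \<open>- w\<close>. A narrow bump times a function that is positive at \<open>y0\<close> would
    be continuous and nonnegative with integral zero, yet positive at \<open>y0\<close>.\<close>
  have pos: "\<not> w' y0 > 0" if w': "continuous_on D w'" "\<And>\<phi>. test_function D \<phi> \<Longrightarrow> integral D (\<lambda>y. \<phi> y * w' y) = 0"
    for w' :: "'a \<Rightarrow> real"
  proof
    assume p: "w' y0 > 0"
    have "continuous (at y0) w'" using w'(1) D y0 continuous_on_eq_continuous_at by blast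
    then obtain d where d: "d > 0" "\<And>y. dist y y0 < d \<Longrightarrow> dist (w' y) (w' y0) < w' y0"
      using p unfolding continuous_at_eps_delta by metis
    obtain r' where r': "r' > 0" "cball y0 r' \<subseteq> D" using D y0 open_contains_cball by blast
    define r where "r = min r' (d / 2)"
    have r: "r > 0" "cball y0 r \<subseteq> D" using r' d by (auto simp: r_def)
    have wp: "w' y \<ge> 0" if "y \<in> cball y0 r" for y
    proof -
      have "dist y y0 < d" using that d by (auto simp: r_def dist_commute)
      from d(2)[OF this] show ?thesis by (auto simp: dist_real_def abs_if split: if_splits)
    qed
    let ?f = "\<lambda>y. bump y0 r y * w' y"
    let ?g = "\<lambda>y. if y \<in> D then ?f y else 0"
    have sup: "?f y = 0" if "y \<notin> cball y0 r" for y using bump_outside[OF r(1) that] by simp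
    have cf: "continuous_on D ?f"
      by (intro continuous_on_mult w' continuous_on_subset[OF smooth_on_continuous[OF smooth_on_bump]]) auto
    have cg: "continuous_on UNIV ?g" by (rule continuous_on_extend_0[OF D compact_cball r(2) cf]) (use sup in auto)
    have ig: "?g integrable_on UNIV"
      using absolutely_integrable_compact_support[OF D compact_cball r(2) cf] sup
      by (subst integrable_restrict_UNIV) (auto intro: set_lebesgue_integral_eq_integral(1))
    have "integral UNIV ?g = 0" using w'(2)[OF test_function_bump[OF r]] by (simp only: integral_restrict_UNIV)
    then have h: "(?g has_integral 0) UNIV" using ig integrable_integral by metis
    obtain a where a: "cball y0 r \<subseteq> cbox (-a) a" using bounded_subset_cbox_symmetric bounded_cball by blast
    have "((\<lambda>y. if y \<in> cbox (-a) a then ?g y else 0) has_integral 0) UNIV"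
    proof (rule has_integral_eq[OF _ h])
      fix y show "?g y = (if y \<in> cbox (-a) a then ?g y else 0)" using a sup[of y] by (cases "y \<in> cball y0 r") auto
    qed
    then have "(?g has_integral 0) (cbox (-a) a)" by (simp only: has_integral_restrict_UNIV)
    then have "?g y0 = 0"
    proof (rule has_integral_0_cbox_imp_0[rotated 2])
      have "ball y0 r \<subseteq> interior (cbox (-a) a)" using a by (meson ball_subset_cball interior_maximal open_ball order_trans)
      then show "box (-a) a \<noteq> {}" using r(1) by (auto simp: interior_cbox)
      show "y0 \<in> cbox (-a) a" using a r(1) by auto
      show "0 \<le> ?g x" for x using wp[of x] sup[of x] bump_nonneg[of y0 r x] by (cases "x \<in> cball y0 r") auto
    qed (use cg continuous_on_subset in blast)
    then show False using p y0 bump_pos[OF r(1), of y0] by auto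
  qed
  have "\<not> w y0 > 0" by (rule pos[OF w z])
  moreover have "\<not> - w y0 > 0"
    by (rule pos[of "\<lambda>y. - w y"]) (use w z in \<open>auto intro: continuous_on_minus\<close>)
  ultimately show ?thesis by linarith
qed

text \<open>The integrals of the difference quotients vanish by translation invariance.\<close>

lemma integral_dd_eq_0_UNIV:
  fixes f :: "'a::euclidean_space \<Rightarrow> real"
  assumes f: "\<And>y. f differentiable (at y)" and c: "continuous_on UNIV (\<lambda>y. dd f y v)"
    and C: "compact C" "\<And>y. y \<notin> C \<Longrightarrow> f y = 0"
  shows "integral UNIV (\<lambda>y. dd f y v) = 0"
proof -
  obtain B where B: "\<And>x. x \<in> C \<Longrightarrow> norm x \<le> B" "B > 0" using compact_imp_bounded[OF C(1)] bounded_pos by metis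
  \<comment> \<open>If \<open>y + t *\<^sub>R v\<close> lies in \<open>C\<close> for some
    \<open>t\<close> between 0 and 1, then \<open>norm y \<le> R\<close>; so outside the box all
    these translates miss \<open>C\<close>.\<close>
  define R where "R = B + norm v"
  obtain a where a: "cball 0 R \<subseteq> cbox (-a) (a::'a)" using bounded_subset_cbox_symmetric bounded_cball by blast
  have fz: "f (y + t *\<^sub>R v) = 0" if "y \<notin> cbox (-a) a" "0 \<le> t" "t \<le> 1" for y t
  proof (rule C(2), rule notI)
    assume "y + t *\<^sub>R v \<in> C"
    then have "norm (y + t *\<^sub>R v) \<le> B" using B by blast
    moreover have "norm y \<le> norm (y + t *\<^sub>R v) + norm (t *\<^sub>R v)" by (metis add_diff_cancel_right' norm_triangle_ineq4)
    moreover have "norm (t *\<^sub>R v) \<le> norm v" using that by (simp add: mult_left_le_one_le)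
    ultimately have "y \<in> cball 0 R" by (simp add: R_def)
    then show False using a that by auto
  qed
  have cf: "continuous_on UNIV f" using f by (simp add: differentiable_imp_continuous_on differentiable_on_def)
  have "compact ((\<lambda>(y, t). y + t *\<^sub>R v) ` (cbox (-a) a \<times> {0..1::real}))"
    by (intro compact_continuous_image compact_Times compact_cbox compact_Icc)
      (auto simp: case_prod_beta intro!: continuous_intros)
  then have "bounded ((\<lambda>y. dd f y v) ` ((\<lambda>(y, t). y + t *\<^sub>R v) ` (cbox (-a) a \<times> {0..1::real})))"
    by (intro compact_imp_bounded compact_continuous_image[OF continuous_on_subset[OF c]]) auto
  then obtain M where M0: "\<And>x. x \<in> (\<lambda>y. dd f y v) ` ((\<lambda>(y, t). y + t *\<^sub>R v) ` (cbox (-a) a \<times> {0..1::real})) \<Longrightarrow> norm x \<le> M"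
    unfolding bounded_iff by blast
  have M: "\<bar>dd f (y + t *\<^sub>R v) v\<bar> \<le> M" if "y \<in> cbox (-a) a" "t \<in> {0..1::real}" for y t
    using M0[OF imageI[OF imageI[of "(y, t)"]]] that by simp
  define t where "t k = 1 / real (Suc k)" for k
  have t: "0 < t k" "t k \<le> 1" for k by (auto simp: t_def)
  define q where "q k y = (f (y + t k *\<^sub>R v) - f y) / t k" for k y
  have D: "((\<lambda>s. f (y + s *\<^sub>R v)) has_derivative (\<lambda>r. r * dd f (y + s *\<^sub>R v) v)) (at s)" for y s
  proof -
    have "((\<lambda>s. y + s *\<^sub>R v) has_derivative (\<lambda>s. s *\<^sub>R v)) (at s)" by (auto intro!: derivative_eq_intros)
    from has_derivative_compose[OF this has_derivative_dd[OF f]] show ?thesis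
      using linear_scale[OF linear_dd[OF f]] by simp
  qed
  have lim: "(\<lambda>k. q k y) \<longlonglongrightarrow> dd f y v" for y
  proof -
    have "((\<lambda>s. f (y + s *\<^sub>R v)) has_real_derivative dd f y v) (at 0)"
      using D[of y 0] by (simp add: has_field_derivative_def mult.commute[of _ "dd f y v"])
    then have "((\<lambda>h. (f (y + h *\<^sub>R v) - f y) / h) \<longlongrightarrow> dd f y v) (at 0)" by (simp add: DERIV_def)
    moreover have "filterlim t (at 0) sequentially"
    proof -
      have "t \<longlonglongrightarrow> 0" unfolding t_def[abs_def] by (rule LIMSEQ_Suc[OF lim_1_over_n])
      moreover have "\<forall>\<^sub>F k in sequentially. t k \<in> UNIV \<and> t k \<noteq> 0"
        using t(1) by (intro always_eventually) (auto simp: less_imp_neq[symmetric])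
      ultimately show ?thesis unfolding filterlim_at by blast
    qed
    ultimately show ?thesis unfolding q_def by (rule filterlim_compose)
  qed
  \<comment> \<open>By the mean value theorem each difference quotient is a value of the directional
    derivative on the translates of the box, which form a compact set. This gives one integrable
    majorant for all \<open>k\<close>.\<close>
  have bd: "norm (q k y) \<le> (if y \<in> cbox (-a) a then M else 0)" for k y
  proof (cases "y \<in> cbox (-a) a")
    case True
    have "\<exists>s\<in>{0<..<t k}. (\<lambda>s. f (y + s *\<^sub>R v)) (t k) - (\<lambda>s. f (y + s *\<^sub>R v)) 0 = (\<lambda>s r. r * dd f (y + s *\<^sub>R v) v) s (t k - 0)"
      by (rule mvt_simple[OF t(1)]) (rule has_derivative_at_withinI[OF D])
    then obtain s where s: "0 < s" "s < t k" "q k y = dd f (y + s *\<^sub>R v) v"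
      using t(1)[of k] by (auto simp: q_def)
    then show ?thesis using M[OF True, of s] True t(2)[of k] by auto
  next
    case False
    then show ?thesis using fz[OF False, of "t k"] fz[OF False, of 0] t[of k] by (simp add: q_def)
  qed
  have int: "f integrable_on UNIV"
    using absolutely_integrable_compact_support[of UNIV C f] cf C set_lebesgue_integral_eq_integral(1) by auto
  have shift: "((\<lambda>y. f (y + w)) has_integral integral UNIV f) UNIV" for w
  proof -
    obtain b where b: "C \<subseteq> cbox (-b) b" using bounded_subset_cbox_symmetric compact_imp_bounded C(1) by blast
    have "((\<lambda>y. if y \<in> cbox (-b) b then f y else 0) has_integral integral UNIV f) UNIV"
      by (rule has_integral_eq[OF _ integrable_integral[OF int]]) (use b C in auto)
    then have "(f has_integral integral UNIV f) (cbox (-b) b)" by (simp only: has_integral_restrict_UNIV)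
    from has_integral_shift_cbox[OF this, of w] show ?thesis
    proof (rule has_integral_on_superset)
      fix x assume "x \<notin> cbox (- b - w) (b - w)"
      then have "x + w \<notin> cbox (-b) b" by (auto simp: mem_box algebra_simps)
      then show "f (x + w) = 0" using b C by blast
    qed auto
  qed
  have q0: "(q k has_integral 0) UNIV" for k
    using has_integral_divide[OF has_integral_diff[OF shift[of "t k *\<^sub>R v"] shift[of 0]], of "t k"]
    by (simp add: q_def[abs_def])
  have "(\<lambda>y. if y \<in> cbox (-a) a then M else 0) integrable_on UNIV"
    using integrable_restrict_UNIV[of "cbox (-a) a" "\<lambda>_. M"] integrable_const[of M "-a" a] by blast
  then have "(\<lambda>k. integral UNIV (q k)) \<longlonglongrightarrow> integral UNIV (\<lambda>y. dd f y v)"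
    using q0 by (intro dominated_convergence(2)[where h = "\<lambda>y. if y \<in> cbox (-a) a then M else 0"] bd lim) auto
  moreover have "integral UNIV (q k) = 0" for k using q0 by (rule integral_unique)
  ultimately show ?thesis by (simp add: LIMSEQ_const_iff)
qed

lemma dd_eq_0_open: "open S \<Longrightarrow> y \<in> S \<Longrightarrow> (\<And>z. z \<in> S \<Longrightarrow> f z = 0) \<Longrightarrow> dd f y v = 0"
  using dd_cong_open[of S y f "\<lambda>z. 0"] by simp

lemma integral_dd_eq_0:
  fixes f :: "'a::euclidean_space \<Rightarrow> real"
  assumes "open D" "compact C" "C \<subseteq> D" "Ck_on 1 f D" "\<And>y. y \<in> D - C \<Longrightarrow> f y = 0"
  shows "integral D (\<lambda>y. dd f y v) = 0"
proof -
  let ?g = "\<lambda>y. if y \<in> D then f y else 0"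
  have f: "f differentiable (at y)" "continuous_on D (\<lambda>y. dd f y v)" if "y \<in> D" for y using assms(4) that by auto
  have oC: "open (- C)" using assms(2) compact_imp_closed by blast
  have z: "?g y = 0" if "y \<in> - C" for y using that assms(5) by auto
  have ddD: "dd ?g y v = dd f y v" if "y \<in> D" for y by (rule dd_cong_open[OF assms(1) that]) simp
  have ddC: "dd ?g y v = 0" if "y \<in> - C" for y using dd_eq_0_open[OF oC that z] .
  have diff: "?g differentiable (at y)" for y
  proof (cases "y \<in> D")
    case True
    then show ?thesis using differentiable_cong_open[OF assms(1) True _ f(1)[OF True], of ?g] by simp
  next
    case False
    then have "y \<in> - C" using assms(3) by auto
    then show ?thesis using differentiable_cong_open[OF oC _ _ differentiable_const[of 0], of y ?g] z by simp
  qed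
  have e: "dd ?g y v = (if y \<in> D then dd f y v else 0)" for y using ddD ddC[of y] assms(3) by auto
  have cdd: "continuous_on D (\<lambda>y. dd f y v)" using assms(4) by simp
  have dd0: "dd f y v = 0" if "y \<in> D - C" for y using that e[of y] ddC[of y] by auto
  have "continuous_on UNIV (\<lambda>y. dd ?g y v)"
    unfolding e by (rule continuous_on_extend_0[OF assms(1-3) cdd dd0])
  then have "integral UNIV (\<lambda>y. dd ?g y v) = 0"
    by (rule integral_dd_eq_0_UNIV[OF diff _ assms(2)]) (use z in auto)
  then show ?thesis unfolding e by (simp only: integral_restrict_UNIV)
qed

section \<open>Orthonormal frames\<close>

text \<open>Frames are sets, and completeness is expressed by the expansion of the vectors of
  \<open>U\<close>. The subspace \<open>U\<close> allows the same notion for tangent vectors and for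
  \<open>so\<close>, on which alone \<open>\<kappa>\<close> is an inner product.\<close>

definition orthonormal_frame :: "('a::real_vector \<Rightarrow> 'a \<Rightarrow> real) \<Rightarrow> 'a set \<Rightarrow> 'a set \<Rightarrow> bool"
  where "orthonormal_frame p U S \<longleftrightarrow> finite S \<and> S \<subseteq> U \<and>
    (\<forall>a\<in>S. \<forall>b\<in>S. p a b = (if a = b then 1 else 0)) \<and> (\<forall>x\<in>U. (\<Sum>e\<in>S. p x e *\<^sub>R e) = x)"

lemma orthonormal_independent:
  fixes p :: "'a::real_vector \<Rightarrow> 'a \<Rightarrow> real"
  assumes "bilinear p" "finite S" and on: "\<And>a b. a \<in> S \<Longrightarrow> b \<in> S \<Longrightarrow> p a b = (if a = b then 1 else 0)"
  shows "independent S"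
proof
  assume "dependent S"
  then obtain u v where v: "v \<in> S" "u v \<noteq> 0" and z: "(\<Sum>v\<in>S. u v *\<^sub>R v) = 0"
    using dependent_finite[OF assms(2)] by blast
  have l: "linear (\<lambda>x. p x v)" using assms(1) by (simp add: bilinear_def)
  have "0 = p (\<Sum>v\<in>S. u v *\<^sub>R v) v" using linear_0[OF l] z by simp
  also have "\<dots> = (\<Sum>w\<in>S. u w * p w v)" by (simp add: linear_sum[OF l] linear_scale[OF l])
  also have "\<dots> = (\<Sum>w\<in>S. if w = v then u v else 0)" by (rule sum.cong) (auto simp: on v)
  also have "\<dots> = u v" using v assms(2) by simp
  finally show False using v by simp
qed

text \<open>An orthonormal set of maximal cardinality containing \<open>S0\<close> is complete: a
  vector that is not reproduced would leave a nonzero residual orthogonal to the set, and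
  normalising it would enlarge the set. The prescribed part \<open>S0\<close> later carries the
  direction of a gradient.\<close>

lemma orthonormal_frame_extend:
  fixes p :: "'a::euclidean_space \<Rightarrow> 'a \<Rightarrow> real"
  assumes p: "bilinear p" and U: "subspace U"
    and sym: "\<And>x y. x \<in> U \<Longrightarrow> y \<in> U \<Longrightarrow> p x y = p y x"
    and pos: "\<And>x. x \<in> U \<Longrightarrow> x \<noteq> 0 \<Longrightarrow> p x x > 0"
    and S0: "finite S0" "S0 \<subseteq> U" "\<And>a b. a \<in> S0 \<Longrightarrow> b \<in> S0 \<Longrightarrow> p a b = (if a = b then 1 else 0)"
  shows "\<exists>S. S0 \<subseteq> S \<and> orthonormal_frame p U S"
proof -
  define ok where "ok S \<longleftrightarrow> finite S \<and> S0 \<subseteq> S \<and> S \<subseteq> U \<and> (\<forall>a\<in>S. \<forall>b\<in>S. p a b = (if a = b then 1 else 0))" for S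
  \<comment> \<open>Orthonormal sets are independent, so the dimension bounds their size and a
    maximal one exists.\<close>
  have "card S < Suc (DIM('a))" if "ok S" for S
    using independent_card_le[OF orthonormal_independent[OF p, of S]] that unfolding ok_def by auto
  moreover have "ok S0" using S0 by (auto simp: ok_def)
  ultimately obtain S where S: "ok S" and mx: "\<And>T. ok T \<Longrightarrow> card T \<le> card S"
    using ex_has_greatest_nat[of ok S0 card "Suc (DIM('a))"] by (metis less_imp_le)
  have fin: "finite S" and on: "\<And>a b. a \<in> S \<Longrightarrow> b \<in> S \<Longrightarrow> p a b = (if a = b then 1 else 0)" and SU: "S \<subseteq> U"
    using S by (auto simp: ok_def)
  have l: "linear (\<lambda>x. p x v)" for v using p by (simp add: bilinear_def)
  have "(\<Sum>e\<in>S. p x e *\<^sub>R e) = x" if x: "x \<in> U" for x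
  proof (rule ccontr)
    define r where "r = x - (\<Sum>e\<in>S. p x e *\<^sub>R e)"
    assume "(\<Sum>e\<in>S. p x e *\<^sub>R e) \<noteq> x"
    then have r0: "r \<noteq> 0" by (simp add: r_def)
    have rU: "r \<in> U" unfolding r_def using SU x U by (intro subspace_diff subspace_sum subspace_scale) auto
    have rv: "p r v = 0" if "v \<in> S" for v
    proof -
      have "p r v = p x v - (\<Sum>e\<in>S. p x e * p e v)"
        by (simp add: r_def linear_diff[OF l] linear_sum[OF l] linear_scale[OF l])
      also have "(\<Sum>e\<in>S. p x e * p e v) = (\<Sum>e\<in>S. if e = v then p x v else 0)"
        by (rule sum.cong) (auto simp: on that)
      finally show ?thesis using that fin by simp
    qed
    define e where "e = (1 / sqrt (p r r)) *\<^sub>R r"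
    have pr: "p r r > 0" by (rule pos[OF rU r0])
    have eU: "e \<in> U" unfolding e_def using rU U by (rule subspace_scale[rotated])
    have ee: "p e e = 1" using pr by (simp add: e_def bilinear_lmul[OF p] bilinear_rmul[OF p] real_sqrt_mult_self field_simps)
    have ev: "p e v = 0" if "v \<in> S" for v using rv[OF that] by (simp add: e_def bilinear_lmul[OF p])
    have ve: "p v e = 0" if "v \<in> S" for v using ev[OF that] sym[of v e] that SU eU by auto
    have "e \<notin> S" using ee ev[of e] by auto
    then have "card (insert e S) = Suc (card S)" using fin by simp
    moreover have "ok (insert e S)" using S ee ev ve eU \<open>e \<notin> S\<close> by (auto simp: ok_def)
    ultimately show False using mx[of "insert e S"] by simp
  qed
  then have "orthonormal_frame p U S" using S by (auto simp: ok_def orthonormal_frame_def)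
  then show ?thesis using S by (auto simp: ok_def)
qed

lemma orthonormal_frame_linear:
  assumes "orthonormal_frame p U S" "linear L" "x \<in> U"
  shows "(\<Sum>e\<in>S. p x e *\<^sub>R L e) = L x"
proof -
  have "L (\<Sum>e\<in>S. p x e *\<^sub>R e) = (\<Sum>e\<in>S. p x e *\<^sub>R L e)"
    by (simp add: linear_sum[OF assms(2)] linear_scale[OF assms(2)])
  then show ?thesis using assms(1,3) by (simp add: orthonormal_frame_def)
qed

subsection \<open>Gram matrices\<close>

definition gram :: "real^'n^'n \<Rightarrow> bool"
  where "gram G \<longleftrightarrow> transpose G = G \<and> (\<forall>X. X \<noteq> 0 \<longrightarrow> met G X X > 0)"

abbreviation gframe :: "real^'n^'n \<Rightarrow> (real^'n) set \<Rightarrow> bool"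
  where "gframe G S \<equiv> orthonormal_frame (met G) UNIV S"

lemma met_sum: "met G X Y = (\<Sum>i\<in>UNIV. \<Sum>j\<in>UNIV. X $ i * G $ i $ j * Y $ j)"
  by (simp add: met_def inner_vec_def matrix_vector_mult_def sum_distrib_left mult.assoc)

lemma bilinear_met: "bilinear (met G)"
  unfolding bilinear_def met_def
  by (auto intro!: linearI simp: inner_add_left matrix_vector_right_distrib inner_add_right
      matrix_vector_mult_scaleR)

lemma met_axis: "met G (axis i 1) (axis j 1) = G $ i $ j"
  by (simp add: met_def inner_axis' matrix_vector_mult_basis column_def)

lemma met_sym: "transpose G = G \<Longrightarrow> met G X Y = met G Y X"
  by (metis met_def dot_lmul_matrix inner_commute transpose_matrix_vector)

lemma gram_met_sym: "gram G \<Longrightarrow> met G X Y = met G Y X"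
  by (rule met_sym) (simp add: gram_def)

lemma linear_met1: "linear (\<lambda>v. met G v X)"
  using bilinear_met[of G] by (simp add: bilinear_def)

lemma gram_frame_extend:
  fixes S0 :: "(real^'n::finite) set"
  assumes "gram G" "finite S0" "\<And>a b. a \<in> S0 \<Longrightarrow> b \<in> S0 \<Longrightarrow> met G a b = (if a = b then 1 else 0)"
  shows "\<exists>S. S0 \<subseteq> S \<and> gframe G S"
  by (rule orthonormal_frame_extend[OF bilinear_met subspace_UNIV])
    (use assms met_sym in \<open>auto simp: gram_def\<close>)

lemma gram_frame: "gram (G :: real^'n::finite^'n) \<Longrightarrow> \<exists>S. gframe G S"
  using gram_frame_extend[of G "{}"] by auto

lemma gframe_card:
  fixes S :: "(real^'n::finite) set"
  assumes "gframe G S" shows "card S = CARD('n)"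
proof -
  have "independent S"
    by (rule orthonormal_independent[OF bilinear_met[of G]]) (use assms in \<open>auto simp: orthonormal_frame_def\<close>)
  moreover have "UNIV \<subseteq> span S"
  proof
    fix x :: "real^'n"
    have "x = (\<Sum>e\<in>S. met G x e *\<^sub>R e)" using assms by (simp add: orthonormal_frame_def)
    then show "x \<in> span S" using span_sum span_scale span_base by (metis (no_types, lifting))
  qed
  ultimately have "card S = dim (UNIV :: (real^'n) set)" by (intro basis_card_eq_dim) auto
  then show ?thesis by simp
qed

lemma mtrace_gframe:
  fixes b :: "real^'n::finite \<Rightarrow> real^'n \<Rightarrow> 'b::real_vector"
  assumes "gframe G S" "bilinear b"
  shows "mtrace G b = (\<Sum>e\<in>S. b e e)"
proof -
  have f: "finite S" using assms(1) by (simp add: orthonormal_frame_def)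
  obtain h :: "'n \<Rightarrow> _" where h: "bij_betw h UNIV S"
    using finite_same_card_bij[of "UNIV :: 'n set" S] f gframe_card[OF assms(1)] by auto
  have "met G (h i) (h j) = (if i = j then 1 else 0)" for i j
  proof -
    have "h i \<in> S" "h j \<in> S" "h i = h j \<longleftrightarrow> i = j" using h by (auto simp: bij_betw_def inj_def)
    then show ?thesis using assms(1) by (auto simp: orthonormal_frame_def)
  qed
  from mtrace_orthonormal_frame[OF assms(2) this] show ?thesis
    using sum.reindex_bij_betw[OF h, of "\<lambda>e. b e e"] by simp
qed

lemma mtrace_nth: "mtrace G (\<lambda>v w. v $ i * w $ j) = matrix_inv G $ i $ j"
proof -
  have "mtrace G (\<lambda>v w. v $ i * w $ j) =
    (\<Sum>k\<in>UNIV. \<Sum>l\<in>UNIV. if l = j then (if k = i then matrix_inv G $ i $ j else 0) else 0)"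
    unfolding mtrace_def by (intro sum.cong refl) (auto simp: axis_def)
  then show ?thesis by simp
qed

text \<open>The trace of the coordinate product \<open>v $ i * w $ j\<close> is an entry of the
  inverse Gram matrix by definition, and evaluates to this sum in the frame.\<close>

lemma matrix_inv_gframe:
  assumes "gframe G S" shows "matrix_inv G $ i $ j = (\<Sum>e\<in>S. e $ i * e $ j)"
  unfolding mtrace_nth[symmetric]
  by (rule mtrace_gframe[OF assms]) (auto simp: bilinear_def algebra_simps intro!: linearI)

lemma axis_expand: "(\<Sum>i\<in>UNIV. (x $ i) *\<^sub>R axis i 1) = (x :: real^'n)"
  using basis_expansion[of x] by (simp add: scalar_mult_eq_scaleR)

lemma linear_axis_expand:
  fixes L :: "real^'n \<Rightarrow> 'b::real_vector"
  assumes "linear L" shows "(\<Sum>i\<in>UNIV. (x $ i) *\<^sub>R L (axis i 1)) = L x"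
  using arg_cong[OF axis_expand[of x], of L] by (simp add: linear_sum[OF assms] linear_scale[OF assms])

lemma sharp_gframe:
  fixes f :: "real^'n::finite \<Rightarrow> real"
  assumes S: "gframe G S" and f: "linear f"
  shows "matrix_inv G *v (\<chi> l. f (axis l 1)) = (\<Sum>e\<in>S. f e *\<^sub>R e)"
proof (rule vec_eq_iff[THEN iffD2], rule allI)
  fix i
  have "(matrix_inv G *v (\<chi> l. f (axis l 1))) $ i = (\<Sum>j\<in>UNIV. \<Sum>e\<in>S. e $ i * e $ j * f (axis j 1))"
    by (simp add: matrix_vector_mult_def matrix_inv_gframe[OF S] sum_distrib_right)
  also have "\<dots> = (\<Sum>e\<in>S. e $ i * (\<Sum>j\<in>UNIV. e $ j *\<^sub>R f (axis j 1)))"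
    by (subst sum.swap) (simp add: sum_distrib_left mult.assoc)
  also have "\<dots> = (\<Sum>e\<in>S. f e *\<^sub>R e) $ i" unfolding linear_axis_expand[OF f] by (simp add: mult.commute)
  finally show "(matrix_inv G *v (\<chi> l. f (axis l 1))) $ i = (\<Sum>e\<in>S. f e *\<^sub>R e) $ i" .
qed

lemma gframe_expand_right:
  assumes "gram G" "gframe G S" shows "(\<Sum>e\<in>S. met G e x *\<^sub>R e) = x"
  using assms(2) by (simp add: orthonormal_frame_def gram_met_sym[OF assms(1), of _ x])

text \<open>Riesz representation of a linear form: in a frame the vector is
  \<open>\<Sum>e\<in>S. f e *\<^sub>R e\<close>, and pairing it with \<open>X\<close> is the
  expansion of \<open>X\<close> inside \<open>f\<close>.\<close>

lemma met_sharp: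
  fixes f :: "real^'n::finite \<Rightarrow> real"
  assumes "gram G" "linear f"
  shows "met G (matrix_inv G *v (\<chi> l. f (axis l 1))) X = f X"
proof -
  obtain S where S: "gframe G S" using gram_frame assms by blast
  note l = linear_met1[of G X]
  have "met G (\<Sum>e\<in>S. f e *\<^sub>R e) X = (\<Sum>e\<in>S. met G e X *\<^sub>R f e)"
    by (simp add: linear_sum[OF l] linear_scale[OF l] mult.commute)
  also have "\<dots> = (\<Sum>e\<in>S. met G X e *\<^sub>R f e)"
    by (rule sum.cong[OF refl]) (use met_sym[of G] assms(1) in \<open>simp add: gram_def\<close>)
  also have "\<dots> = f X" by (rule orthonormal_frame_linear[OF S assms(2)]) simp
  finally show ?thesis by (simp add: sharp_gframe[OF S assms(2)])
qed

lemma gram_nondegenerate: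
  assumes "gram G" "\<And>X. met G u X = met G v X" shows "u = v"
proof (rule ccontr)
  assume "u \<noteq> v"
  then have "met G (u - v) (u - v) > 0" using assms(1) by (simp add: gram_def)
  then show False using assms(2)[of "u - v"] bilinear_lsub[OF bilinear_met, of G u v "u - v"] by simp
qed

lemma trace_gframe:
  fixes L :: "real^'n::finite \<Rightarrow> real^'n"
  assumes "gram G" "gframe G S" "linear L"
  shows "(\<Sum>i\<in>UNIV. L (axis i 1) $ i) = (\<Sum>e\<in>S. met G (L e) e)"
proof -
  have "(\<Sum>i\<in>UNIV. L (axis i 1) $ i) = (\<Sum>i\<in>UNIV. \<Sum>e\<in>S. met G (axis i 1) e * L e $ i)"
  proof (rule sum.cong[OF refl])
    fix i :: 'n
    have "L (axis i 1) = (\<Sum>e\<in>S. met G (axis i 1) e *\<^sub>R L e)" using orthonormal_frame_linear[OF assms(2,3), of "axis i 1"] by simp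
    then show "L (axis i 1) $ i = (\<Sum>e\<in>S. met G (axis i 1) e * L e $ i)" by simp
  qed
  also have "\<dots> = (\<Sum>e\<in>S. \<Sum>i\<in>UNIV. (L e $ i) *\<^sub>R met G (axis i 1) e)"
    by (subst sum.swap) (simp add: mult.commute)
  also have "\<dots> = (\<Sum>e\<in>S. met G (L e) e)"
    by (intro sum.cong refl linear_axis_expand linear_met1)
  finally show ?thesis .
qed

lemma matrix_inv_mult_gram:
  assumes "gram (G :: real^'n::finite^'n)"
  shows "(\<Sum>j\<in>UNIV. matrix_inv G $ i $ j * G $ j $ k) = (if i = k then 1 else 0)"
proof -
  obtain S where S: "gframe G S" using gram_frame assms by blast
  note l = linear_met1[of G "axis k 1"]
  have "(\<Sum>j\<in>UNIV. matrix_inv G $ i $ j * G $ j $ k) = (\<Sum>j\<in>UNIV. \<Sum>e\<in>S. e $ i * (e $ j *\<^sub>R met G (axis j 1) (axis k 1)))"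
    by (simp add: matrix_inv_gframe[OF S] sum_distrib_right met_axis mult.assoc)
  also have "\<dots> = (\<Sum>e\<in>S. e $ i * (\<Sum>j\<in>UNIV. e $ j *\<^sub>R met G (axis j 1) (axis k 1)))"
    by (subst sum.swap) (simp add: sum_distrib_left)
  also have "\<dots> = (\<Sum>e\<in>S. met G e (axis k 1) *\<^sub>R e) $ i" unfolding linear_axis_expand[OF l] by (simp add: mult.commute)
  also have "\<dots> = (if i = k then 1 else 0)" using gframe_expand_right[OF assms S] by (simp add: axis_def)
  finally show ?thesis .
qed

lemma matrix_inv_sym:
  assumes "gram (G :: real^'n::finite^'n)"
  shows "matrix_inv G $ i $ j = matrix_inv G $ j $ i"
proof -
  obtain S where S: "gframe G S" using gram_frame assms by blast
  show ?thesis by (simp add: matrix_inv_gframe[OF S] mult.commute)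
qed

lemma gram_nth_sym: "gram G \<Longrightarrow> G $ i $ j = G $ j $ i"
  using met_sym[of G "axis i 1" "axis j 1"] by (simp add: gram_def met_axis)

text \<open>If the columns of \<open>P\<close> form an orthonormal frame, then
  \<open>transpose P ** G ** P\<close> is the identity, so
  \<open>det G * (det P)\<^sup>2 = 1\<close>.\<close>

lemma gram_det_pos:
  assumes "gram (G :: real^'n::finite^'n)" shows "det G > 0"
proof -
  obtain S where S: "gframe G S" using gram_frame assms by blast
  have f: "finite S" using S by (simp add: orthonormal_frame_def)
  obtain e :: "'n \<Rightarrow> _" where e: "bij_betw e UNIV S"
    using finite_same_card_bij[of "UNIV :: 'n set" S] f gframe_card[OF S] by auto
  have on: "met G (e i) (e j) = (if i = j then 1 else 0)" for i j
  proof -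
    have "e i \<in> S" "e j \<in> S" "e i = e j \<longleftrightarrow> i = j" using e by (auto simp: bij_betw_def inj_def)
    then show ?thesis using S by (auto simp: orthonormal_frame_def)
  qed
  define P :: "real^'n^'n" where "P = (\<chi> i a. e a $ i)"
  have PG: "transpose P ** (G ** P) = mat 1"
    using on
    by (simp add: vec_eq_iff matrix_matrix_mult_def transpose_def mat_def P_def met_def
        inner_vec_def matrix_vector_mult_def)
  have "det P * (det G * det P) = 1" using arg_cong[OF PG, of det] by (simp add: det_mul)
  then have "det G * (det P)\<^sup>2 = 1" by (simp add: power2_eq_square ac_simps)
  then show ?thesis by (metis zero_less_mult_pos2 zero_less_one zero_le_power2 less_le mult_zero_right zero_neq_one mult.commute)
qed

lemma sum_swap_pairs:
  "(\<Sum>l\<in>A. \<Sum>k\<in>B. \<Sum>e\<in>C. \<Sum>e'\<in>E. f l k e e') = (\<Sum>e\<in>C. \<Sum>e'\<in>E. \<Sum>l\<in>A. \<Sum>k\<in>B. (f l k e e' :: 'a::comm_monoid_add))"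
proof -
  have "(\<Sum>l\<in>A. \<Sum>k\<in>B. \<Sum>e\<in>C. \<Sum>e'\<in>E. f l k e e') = (\<Sum>l\<in>A. \<Sum>e\<in>C. \<Sum>k\<in>B. \<Sum>e'\<in>E. f l k e e')"
    by (intro sum.cong refl sum.swap)
  also have "\<dots> = (\<Sum>e\<in>C. \<Sum>l\<in>A. \<Sum>e'\<in>E. \<Sum>k\<in>B. f l k e e')"
    by (subst sum.swap) (intro sum.cong refl sum.swap)
  also have "\<dots> = (\<Sum>e\<in>C. \<Sum>e'\<in>E. \<Sum>l\<in>A. \<Sum>k\<in>B. f l k e e')"
    by (intro sum.cong refl sum.swap)
  finally show ?thesis .
qed

section \<open>Fields of Gram matrices\<close>

lemma smooth_on_det:
  fixes M :: "'a::real_normed_vector \<Rightarrow> real^'n::finite^'n"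
  assumes "open S" "\<And>i j. smooth_on (\<lambda>y. M y $ i $ j) S"
  shows "smooth_on (\<lambda>y. det (M y)) S"
  unfolding det_def
  by (intro smooth_on_sum smooth_on_mult smooth_on_const smooth_on_prod assms)

text \<open>At the identity only the identity permutation contributes to first order.\<close>

lemma dd_det_identity:
  fixes M :: "'a::real_normed_vector \<Rightarrow> real^'n::finite^'n"
  assumes M: "\<And>i j. (\<lambda>z. M z $ i $ j) differentiable (at y)" and 1: "M y = mat 1"
  shows "dd (\<lambda>z. det (M z)) y Z = (\<Sum>i\<in>UNIV. dd (\<lambda>z. M z $ i $ i) y Z)"
proof -
  let ?P = "{p. p permutes (UNIV::'n set)}"
  let ?D = "\<lambda>p Z. \<Sum>i\<in>UNIV. dd (\<lambda>z. M z $ i $ p i) y Z * (\<Prod>k\<in>UNIV - {i}. M y $ k $ p k)"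
  have "((\<lambda>z. det (M z)) has_derivative (\<lambda>Z. \<Sum>p\<in>?P. of_int (sign p) * ?D p Z)) (at y)"
    unfolding det_def
    by (intro has_derivative_sum has_derivative_mult_right has_derivative_prod has_derivative_dd M)
  then have e: "dd (\<lambda>z. det (M z)) y Z = (\<Sum>p\<in>?P. of_int (sign p) * ?D p Z)" by (rule dd_eqI)
  have z: "(\<Prod>k\<in>UNIV - {i}. M y $ k $ p k) = 0" if p: "p permutes UNIV" "p \<noteq> id" for p :: "'n \<Rightarrow> 'n" and i
  proof -
    obtain k where k: "p k \<noteq> k" using p(2) by (auto simp: fun_eq_iff)
    have "\<exists>k'. k' \<noteq> i \<and> p k' \<noteq> k'"
    proof (cases "k = i")
      case True
      have "p (p k) \<noteq> p k" using k p(1) by (metis permutes_inj injD)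
      then show ?thesis using True k by (intro exI[of _ "p k"]) auto
    qed (use k in auto)
    then obtain k' where "k' \<in> UNIV - {i}" "p k' \<noteq> k'" by auto
    then have "M y $ k' $ p k' = 0" by (simp add: 1 mat_def)
    then show ?thesis using \<open>k' \<in> UNIV - {i}\<close> by (intro prod_zero) auto
  qed
  have "(\<Sum>p\<in>?P. of_int (sign p) * ?D p Z) = (\<Sum>p\<in>?P. if p = id then ?D id Z else 0)"
  proof (rule sum.cong[OF refl])
    fix p :: "'n \<Rightarrow> 'n" assume "p \<in> ?P"
    then show "of_int (sign p) * ?D p Z = (if p = id then ?D id Z else 0)"
      by (cases "p = id") (simp_all add: sign_id z del: prod_zero_iff)
  qed
  also have "\<dots> = ?D id Z" using permutes_id by (simp add: finite_permutations)
  also have "\<dots> = (\<Sum>i\<in>UNIV. dd (\<lambda>z. M z $ i $ i) y Z)" by (simp add: 1 mat_def)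
  finally show ?thesis using e by simp
qed

text \<open>A Riemannian metric in coordinates, detached from any atlas, so that its theory
  restricts to smaller open sets such as the set where a function is positive.\<close>

locale gram_field =
  fixes D :: "(real^'n::finite) set" and g :: "real^'n \<Rightarrow> real^'n^'n"
  assumes open_D: "open D" and smooth_g: "smooth_on g D" and gram: "\<And>y. y \<in> D \<Longrightarrow> gram (g y)"
begin

lemma smooth_g_nth: "smooth_on (\<lambda>y. g y $ i $ j) D"
  by (intro smooth_on_nth open_D smooth_g)

lemma smooth_met: "smooth_on (\<lambda>y. met (g y) X Y) D"
  unfolding met_sum by (intro smooth_on_sum smooth_on_mult smooth_on_const open_D smooth_g_nth)

lemma diff_met: "y \<in> D \<Longrightarrow> (\<lambda>y. met (g y) X Y) differentiable (at y)"
  using smooth_on_differentiable[OF smooth_met] .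

lemma det_pos: "y \<in> D \<Longrightarrow> det (g y) > 0"
  by (rule gram_det_pos[OF gram])

lemma smooth_det: "smooth_on (\<lambda>y. det (g y)) D"
  by (rule smooth_on_det[OF open_D smooth_g_nth])

lemma smooth_vol: "smooth_on (\<lambda>y. vol (g) y) D"
proof -
  have "smooth_on (\<lambda>y. det (g y) powr (1/2)) D" by (rule smooth_on_powr[OF open_D smooth_det det_pos])
  then show ?thesis
    by (rule smooth_on_cong[OF open_D]) (use det_pos in \<open>simp add: vol_def powr_half_sqrt less_imp_le\<close>)
qed

lemma vol_pos: "y \<in> D \<Longrightarrow> vol g y > 0" using det_pos by (simp add: vol_def)

text \<open>Cramer's rule writes each entry of the inverse as a quotient of determinants; the power
  -1 stands for the reciprocal so that smoothness of real powers applies.\<close>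

lemma smooth_inv: "smooth_on (\<lambda>y. matrix_inv (g y) $ i $ j) D"
proof -
  \<comment> \<open>The metric with column \<open>i\<close> replaced by the unit vector number
    \<open>j\<close>.\<close>
  let ?M = "\<lambda>y. \<chi> a b. if b = i then axis j 1 $ a else g y $ a $ b"
  have "smooth_on (\<lambda>y. ?M y $ a $ b) D" for a b
    by (cases "b = i") (simp_all add: smooth_on_const smooth_g_nth)
  then have "smooth_on (\<lambda>y. det (?M y) * det (g y) powr (-1)) D"
    by (intro smooth_on_mult open_D smooth_on_det smooth_on_powr smooth_det det_pos)
  then show ?thesis
  proof (rule smooth_on_cong[OF open_D])
    fix y assume y: "y \<in> D"
    have "(g y *v (\<chi> k. matrix_inv (g y) $ k $ j)) $ l = axis j 1 $ l" for l
    proof -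
      have "(g y *v (\<chi> k. matrix_inv (g y) $ k $ j)) $ l = (\<Sum>k\<in>UNIV. matrix_inv (g y) $ j $ k * g y $ k $ l)"
        unfolding matrix_vector_mult_def
        by (simp add: matrix_inv_sym[OF gram[OF y], of _ j] gram_nth_sym[OF gram[OF y], of l] mult.commute)
      then show ?thesis using matrix_inv_mult_gram[OF gram[OF y], of j l] by (simp add: axis_def)
    qed
    then have "g y *v (\<chi> k. matrix_inv (g y) $ k $ j) = axis j 1" by (simp add: vec_eq_iff)
    then have "(\<chi> k. matrix_inv (g y) $ k $ j) = (\<chi> k. det (\<chi> a b. if b = k then axis j 1 $ a else g y $ a $ b) / det (g y))"
      using cramer[of "g y"] det_pos[OF y] by auto
    then have "matrix_inv (g y) $ i $ j = det (?M y) / det (g y)" by (simp add: vec_eq_iff)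
    then show "det (?M y) * det (g y) powr (-1) = matrix_inv (g y) $ i $ j"
      using det_pos[OF y] by (simp add: powr_minus_divide)
  qed
qed

lemma linear_dd_met:
  assumes y: "y \<in> D"
  shows "linear (\<lambda>W. dd (\<lambda>z. met (g z) X W) y Z)" "linear (\<lambda>W. dd (\<lambda>z. met (g z) W X) y Z)"
    "linear (\<lambda>Z. dd (\<lambda>z. met (g z) X W) y Z)"
proof -
  note d = diff_met[OF y]
  show "linear (\<lambda>W. dd (\<lambda>z. met (g z) X W) y Z)"
    by (rule linearI) (simp_all add: bilinear_radd[OF bilinear_met] bilinear_rmul[OF bilinear_met] dd_add d dd_bounded_linear[OF bounded_linear_mult_right])
  show "linear (\<lambda>W. dd (\<lambda>z. met (g z) W X) y Z)"
    by (rule linearI) (simp_all add: bilinear_ladd[OF bilinear_met] bilinear_lmul[OF bilinear_met] dd_add d dd_bounded_linear[OF bounded_linear_mult_right])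
  show "linear (\<lambda>Z. dd (\<lambda>z. met (g z) X W) y Z)"
    using linear_dd[OF d] by simp
qed

lemma dd_met_sym: "y \<in> D \<Longrightarrow> dd (\<lambda>z. met (g z) X Y) y Z = dd (\<lambda>z. met (g z) Y X) y Z"
  by (rule dd_cong_open[OF open_D]) (auto intro: gram_met_sym gram)

text \<open>The Koszul formula with its index lowered, free of the inverse matrix. Algebraic
  properties of \<open>chris\<close> follow from it by testing against arbitrary
  \<open>W\<close>.\<close>

lemma met_chris:
  assumes y: "y \<in> D"
  shows "met (g y) (chris g y X Y) W = (dd (\<lambda>z. met (g z) Y W) y X + dd (\<lambda>z. met (g z) X W) y Y
           - dd (\<lambda>z. met (g z) X Y) y W) / 2"
proof -
  note l = linear_dd_met[OF y]
  have "linear (\<lambda>W. (dd (\<lambda>z. met (g z) Y W) y X + dd (\<lambda>z. met (g z) X W) y Y - dd (\<lambda>z. met (g z) X Y) y W) / 2)"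
    by (rule linearI) (simp_all add: linear_add[OF l(1)] linear_add[OF l(3)] linear_scale[OF l(1)] linear_scale[OF l(3)] field_simps)
  from met_sharp[OF gram[OF y] this, of W] show ?thesis unfolding chris_def .
qed

lemma chris_sym: "y \<in> D \<Longrightarrow> chris g y X Y = chris g y Y X"
  by (rule gram_nondegenerate[OF gram]) (auto simp: met_chris dd_met_sym[of y X Y])

lemma bilinear_chris:
  assumes y: "y \<in> D" shows "bilinear (chris g y)"
proof -
  note l = linear_dd_met[OF y]
  have lin: "linear (\<lambda>X. met (g y) (chris g y X Y) W)" for Y W
    unfolding met_chris[OF y] divide_real_def
    by (intro linear_compose[OF linear_compose_sub[OF linear_compose_add[OF l(3) l(2)] l(2)], unfolded o_def])
      (auto intro!: linearI simp: field_simps)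
  have "linear (\<lambda>X. chris g y X Y)" for Y
  proof (rule linearI; rule gram_nondegenerate[OF gram[OF y]])
    show "met (g y) (chris g y (X + X') Y) W = met (g y) (chris g y X Y + chris g y X' Y) W" for X X' W
      using linear_add[OF lin] by (simp only: bilinear_ladd[OF bilinear_met])
    show "met (g y) (chris g y (c *\<^sub>R X) Y) W = met (g y) (c *\<^sub>R chris g y X Y) W" for c X W
      using linear_scale[OF lin] by (simp add: bilinear_lmul[OF bilinear_met])
  qed
  moreover have "chris g y X = (\<lambda>Y. chris g y Y X)" for X using chris_sym[OF y] by blast
  ultimately show ?thesis unfolding bilinear_def by metis
qed

text \<open>Compatibility of the connection with the metric: in the sum of two instances of the
  Koszul formula everything but the derivative along \<open>Z\<close> cancels by symmetry of the
  metric.\<close>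

lemma dd_met:
  assumes y: "y \<in> D"
  shows "dd (\<lambda>z. met (g z) X Y) y Z = met (g y) (chris g y Z X) Y + met (g y) X (chris g y Z Y)"
proof -
  have "met (g y) X (chris g y Z Y) = met (g y) (chris g y Z Y) X" by (rule gram_met_sym[OF gram[OF y]])
  then show ?thesis
    using dd_met_sym[OF y, of Y X Z] dd_met_sym[OF y, of Z Y X] dd_met_sym[OF y, of Z X Y]
    by (simp only: met_chris[OF y]) argo
qed

lemma smooth_chris: "smooth_on (\<lambda>y. chris g y X Y) D"
proof (rule smooth_on_vec[OF open_D])
  fix i
  have "chris g y X Y $ i = (\<Sum>l\<in>UNIV. matrix_inv (g y) $ i $ l * ((1/2) * (dd (\<lambda>z. met (g z) Y (axis l 1)) y X + dd (\<lambda>z. met (g z) X (axis l 1)) y Y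
           - dd (\<lambda>z. met (g z) X Y) y (axis l 1))))" for y
    by (simp add: chris_def matrix_vector_mult_def)
  moreover have "smooth_on (\<lambda>y. (\<Sum>l\<in>UNIV. matrix_inv (g y) $ i $ l * ((1/2) * (dd (\<lambda>z. met (g z) Y (axis l 1)) y X + dd (\<lambda>z. met (g z) X (axis l 1)) y Y
           - dd (\<lambda>z. met (g z) X Y) y (axis l 1))))) D"
    by (intro smooth_on_sum smooth_on_mult smooth_on_diff smooth_on_add smooth_on_const open_D smooth_inv smooth_on_dd smooth_met)
  ultimately show "smooth_on (\<lambda>y. chris g y X Y $ i) D" by simp
qed

text \<open>The inverse metric is parallel as well. Differentiating the product of inverse and
  metric gives minus the derivative of the metric between two inverses. Each inverse is a sum over
  the frame frozen at \<open>y\<close>, and metric compatibility turns the result into connection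
  terms.\<close>

lemma dd_inv:
  assumes y: "y \<in> D" and S: "gframe (g y) S"
  shows "dd (\<lambda>z. matrix_inv (g z) $ i $ j) y Z =
     - (\<Sum>e\<in>S. chris g y Z e $ i * e $ j + e $ i * chris g y Z e $ j)"
proof -
  let ?I = "\<lambda>i j. matrix_inv (g y) $ i $ j"
  let ?G = "\<lambda>j k. dd (\<lambda>z. g z $ j $ k) y Z"
  note dI = smooth_on_differentiable[OF smooth_inv y] and dG = smooth_on_differentiable[OF smooth_g_nth y]
  have 1: "(\<Sum>k\<in>UNIV. dd (\<lambda>z. matrix_inv (g z) $ i $ k) y Z * g y $ k $ l) = - (\<Sum>k\<in>UNIV. ?I i k * ?G k l)" for l
  proof -
    have "0 = dd (\<lambda>z. if i = l then 1 else 0 :: real) y Z" by simp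
    also have "\<dots> = dd (\<lambda>z. \<Sum>k\<in>UNIV. matrix_inv (g z) $ i $ k * g z $ k $ l) y Z"
      by (rule dd_cong_open[OF open_D y]) (simp add: matrix_inv_mult_gram[OF gram])
    also have "\<dots> = (\<Sum>k\<in>UNIV. dd (\<lambda>z. matrix_inv (g z) $ i $ k) y Z * g y $ k $ l + ?I i k * ?G k l)"
      by (subst dd_sum) (auto intro!: sum.cong dd_mult differentiable_bilinear[OF bounded_bilinear_mult] dI dG)
    finally show ?thesis by (simp add: sum.distrib eq_neg_iff_add_eq_0)
  qed
  have inv2: "(\<Sum>l\<in>UNIV. g y $ k $ l * ?I l j) = (if k = j then 1 else 0)" for k
    using matrix_inv_mult_gram[OF gram[OF y], of j k] by (simp add: matrix_inv_sym[OF gram[OF y], of j] gram_nth_sym[OF gram[OF y], of k] mult.commute eq_commute)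
  have "dd (\<lambda>z. matrix_inv (g z) $ i $ j) y Z = (\<Sum>k\<in>UNIV. dd (\<lambda>z. matrix_inv (g z) $ i $ k) y Z * (if k = j then 1 else 0))"
    by (simp add: if_distrib[of "\<lambda>x. _ * x"] cong: if_cong)
  also have "\<dots> = (\<Sum>k\<in>UNIV. \<Sum>l\<in>UNIV. dd (\<lambda>z. matrix_inv (g z) $ i $ k) y Z * g y $ k $ l * ?I l j)"
    unfolding inv2[symmetric] by (simp add: sum_distrib_left mult.assoc)
  also have "\<dots> = (\<Sum>l\<in>UNIV. (\<Sum>k\<in>UNIV. dd (\<lambda>z. matrix_inv (g z) $ i $ k) y Z * g y $ k $ l) * ?I l j)"
    by (subst sum.swap) (simp add: sum_distrib_right)
  also have "\<dots> = - (\<Sum>l\<in>UNIV. \<Sum>k\<in>UNIV. ?I i k * ?G k l * ?I l j)"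
    unfolding 1 by (simp add: sum_distrib_right sum_negf)
  also have "(\<Sum>l\<in>UNIV. \<Sum>k\<in>UNIV. ?I i k * ?G k l * ?I l j) =
      (\<Sum>l\<in>UNIV. \<Sum>k\<in>UNIV. \<Sum>e\<in>S. \<Sum>e'\<in>S. e $ i * e' $ j * (e $ k * (e' $ l * ?G k l)))"
    by (intro sum.cong refl) (simp add: matrix_inv_gframe[OF S] sum_distrib_left sum_distrib_right ac_simps)
  also have "\<dots> = (\<Sum>e\<in>S. \<Sum>e'\<in>S. \<Sum>l\<in>UNIV. \<Sum>k\<in>UNIV. e $ i * e' $ j * (e $ k * (e' $ l * ?G k l)))"
    by (rule sum_swap_pairs)
  also have "\<dots> = (\<Sum>e\<in>S. \<Sum>e'\<in>S. e $ i * e' $ j * dd (\<lambda>z. met (g z) e e') y Z)"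
  proof (intro sum.cong refl)
    fix e e'
    have "dd (\<lambda>z. met (g z) e e') y Z = (\<Sum>k\<in>UNIV. e $ k * (\<Sum>l\<in>UNIV. e' $ l * dd (\<lambda>z. met (g z) (axis k 1) (axis l 1)) y Z))"
      using linear_axis_expand[OF linear_dd_met(2)[OF y, of e' Z], of e]
        linear_axis_expand[OF linear_dd_met(1)[OF y, of "axis k 1" Z for k], of e'] by simp
    then show "(\<Sum>l\<in>UNIV. \<Sum>k\<in>UNIV. e $ i * e' $ j * (e $ k * (e' $ l * ?G k l))) = e $ i * e' $ j * dd (\<lambda>z. met (g z) e e') y Z"
      by (subst sum.swap) (simp add: met_axis sum_distrib_left)
  qed
  also have "\<dots> = (\<Sum>e\<in>S. \<Sum>e'\<in>S. e $ i * e' $ j * met (g y) (chris g y Z e) e') + (\<Sum>e\<in>S. \<Sum>e'\<in>S. e $ i * e' $ j * met (g y) e (chris g y Z e'))"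
    by (simp add: dd_met[OF y] distrib_left sum.distrib)
  also have "(\<Sum>e\<in>S. \<Sum>e'\<in>S. e $ i * e' $ j * met (g y) (chris g y Z e) e') = (\<Sum>e\<in>S. e $ i * chris g y Z e $ j)"
  proof (rule sum.cong[OF refl])
    fix e
    have "chris g y Z e $ j = (\<Sum>e'\<in>S. met (g y) (chris g y Z e) e' *\<^sub>R e') $ j" using S by (simp add: orthonormal_frame_def)
    then show "(\<Sum>e'\<in>S. e $ i * e' $ j * met (g y) (chris g y Z e) e') = e $ i * chris g y Z e $ j" by (simp add: sum_distrib_left ac_simps)
  qed
  also have "(\<Sum>e\<in>S. \<Sum>e'\<in>S. e $ i * e' $ j * met (g y) e (chris g y Z e')) = (\<Sum>e'\<in>S. chris g y Z e' $ i * e' $ j)"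
  proof (subst sum.swap, rule sum.cong[OF refl])
    fix e'
    have "chris g y Z e' $ i = (\<Sum>e\<in>S. met (g y) e (chris g y Z e') *\<^sub>R e) $ i" using gframe_expand_right[OF gram[OF y] S] by simp
    then show "(\<Sum>e\<in>S. e $ i * e' $ j * met (g y) e (chris g y Z e')) = chris g y Z e' $ i * e' $ j" by (simp add: sum_distrib_left sum_distrib_right ac_simps)
  qed
  finally show ?thesis by (simp add: sum.distrib)
qed

text \<open>The contracted Christoffel symbol, which is the logarithmic derivative of the volume
  density.\<close>

definition trG :: "real^'n \<Rightarrow> real^'n \<Rightarrow> real"
  where "trG y Z = (\<Sum>i\<in>UNIV. chris g y Z (axis i 1) $ i)"

lemma linear_trG: "y \<in> D \<Longrightarrow> linear (trG y)"
  unfolding trG_def by (rule linearI)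
    (simp_all add: bilinear_ladd[OF bilinear_chris] bilinear_lmul[OF bilinear_chris] sum.distrib sum_distrib_left)

text \<open>Jacobi's formula. Factoring out the constant matrix \<open>g y\<close> leaves the
  determinant of a matrix that is the identity at \<open>y\<close>.\<close>

lemma dd_det:
  assumes y: "y \<in> D"
  shows "dd (\<lambda>z. det (g z)) y Z = det (g y) * (2 * trG y Z)"
proof -
  obtain S where S: "gframe (g y) S" using gram_frame gram[OF y] by blast
  let ?M = "\<lambda>z. matrix_inv (g y) ** g z"
  note dG = smooth_on_differentiable[OF smooth_g_nth y]
  have M: "?M z $ i $ j = (\<Sum>k\<in>UNIV. matrix_inv (g y) $ i $ k * g z $ k $ j)" for z i j
    by (simp add: matrix_matrix_mult_def)
  have 1: "?M y = mat 1" unfolding vec_eq_iff M by (simp add: matrix_inv_mult_gram[OF gram[OF y]] mat_def)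
  have dM: "(\<lambda>z. ?M z $ i $ j) differentiable (at y)" for i j
    unfolding M by (rule differentiable_sum) (use differentiable_bounded_linear[OF bounded_linear_mult_right dG] in auto)
  have i: "det (g z) = det (g y) * det (?M z)" for z
    using arg_cong[OF 1, of det] by (simp add: det_mul mult.assoc[symmetric] mult.commute[of "det (g y)"])
  have ddiff: "(\<lambda>z. det (?M z)) differentiable (at y)"
    using differentiable_bounded_linear[OF bounded_linear_mult_right smooth_on_differentiable[OF smooth_det y], of "det (matrix_inv (g y))"]
    by (simp add: det_mul)
  have "dd (\<lambda>z. det (g z)) y Z = dd (\<lambda>z. det (g y) * det (?M z)) y Z" unfolding i[symmetric] ..
  also have "\<dots> = det (g y) * dd (\<lambda>z. det (?M z)) y Z" by (rule dd_bounded_linear[OF bounded_linear_mult_right ddiff])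
  also have "dd (\<lambda>z. det (?M z)) y Z = (\<Sum>i\<in>UNIV. dd (\<lambda>z. ?M z $ i $ i) y Z)" by (rule dd_det_identity[OF dM 1])
  also have "\<dots> = (\<Sum>i\<in>UNIV. \<Sum>k\<in>UNIV. matrix_inv (g y) $ i $ k * dd (\<lambda>z. g z $ k $ i) y Z)"
    unfolding M by (subst dd_sum) (auto intro!: sum.cong dd_bounded_linear[OF bounded_linear_mult_right] differentiable_bounded_linear[OF bounded_linear_mult_right] dG)
  also have "\<dots> = mtrace (g y) (\<lambda>v w. dd (\<lambda>z. met (g z) w v) y Z)"
    by (simp add: mtrace_def met_axis)
  also have "\<dots> = (\<Sum>e\<in>S. dd (\<lambda>z. met (g z) e e) y Z)"
    by (rule mtrace_gframe[OF S]) (simp add: bilinear_def linear_dd_met[OF y])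
  also have "\<dots> = (\<Sum>e\<in>S. 2 * met (g y) (chris g y Z e) e)"
    by (rule sum.cong) (simp_all add: dd_met[OF y] gram_met_sym[OF gram[OF y], of _ "chris g y Z _"])
  also have "\<dots> = 2 * trG y Z"
    unfolding trG_def using trace_gframe[OF gram[OF y] S, of "chris g y Z"] bilinear_chris[OF y]
    by (simp add: sum_distrib_left bilinear_def)
  finally show ?thesis .
qed

lemma dd_vol:
  assumes y: "y \<in> D"
  shows "dd (vol g) y Z = vol g y * trG y Z"
proof -
  have "dd (vol g) y Z = (inverse (sqrt (det (g y))) / 2) * dd (\<lambda>z. det (g z)) y Z"
    unfolding vol_def[abs_def]
    by (rule dd_real_compose[OF smooth_on_differentiable[OF smooth_det y] DERIV_real_sqrt[OF det_pos[OF y]]])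
  also have "\<dots> = vol g y * trG y Z"
    using det_pos[OF y] by (simp add: dd_det[OF y] vol_def field_simps)
  finally show ?thesis .
qed

end

lemma Ck_on_vec:
  fixes f :: "'a::real_normed_vector \<Rightarrow> real ^ 'n"
  assumes "open S" "\<And>i. Ck_on k (\<lambda>y. f y $ i) S"
  shows "Ck_on k f S"
proof -
  have "bounded_linear (\<lambda>x::real. x *\<^sub>R (axis i 1 :: real^'n))" for i by (rule bounded_linear_scaleR_left)
  then have "Ck_on k (\<lambda>y. \<Sum>i\<in>UNIV. (f y $ i) *\<^sub>R (axis i 1 :: real^'n)) S"
    by (intro Ck_on_sum[OF assms(1)] Ck_on_bounded_linear[OF assms(1) _ assms(2)])
  then show ?thesis by (simp only: axis_expand)
qed

lemma Ck_on_2D: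
  assumes "Ck_on 2 f D" "y \<in> D"
  shows "f differentiable (at y)" "(\<lambda>z. dd f z v) differentiable (at y)"
  using assms by (simp_all add: numeral_2_eq_2)

lemma Ck_on_2_dd: "Ck_on 2 f D \<Longrightarrow> Ck_on 1 (\<lambda>z. dd f z v) D"
  by (simp add: numeral_2_eq_2)

lemma linear_dd_param:
  fixes \<omega> :: "'a::real_normed_vector \<Rightarrow> 'b::real_vector \<Rightarrow> 'w::real_normed_vector"
  assumes D: "open D" "y \<in> D" and l: "\<And>z. z \<in> D \<Longrightarrow> linear (\<omega> z)"
    and d: "\<And>X. (\<lambda>z. \<omega> z X) differentiable (at y)"
  shows "linear (\<lambda>X. dd (\<lambda>z. \<omega> z X) y Z)"
proof (rule linearI)
  fix a b
  have "dd (\<lambda>z. \<omega> z (a + b)) y Z = dd (\<lambda>z. \<omega> z a + \<omega> z b) y Z"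
    by (rule dd_cong_open[OF D]) (rule linear_add[OF l])
  then show "dd (\<lambda>z. \<omega> z (a + b)) y Z = dd (\<lambda>z. \<omega> z a) y Z + dd (\<lambda>z. \<omega> z b) y Z" by (simp add: dd_add d)
next
  fix c a
  have "dd (\<lambda>z. \<omega> z (c *\<^sub>R a)) y Z = dd (\<lambda>z. c *\<^sub>R \<omega> z a) y Z"
    by (rule dd_cong_open[OF D]) (rule linear_scale[OF l])
  then show "dd (\<lambda>z. \<omega> z (c *\<^sub>R a)) y Z = c *\<^sub>R dd (\<lambda>z. \<omega> z a) y Z"
    by (simp add: dd_bounded_linear[OF bounded_linear_scaleR_right d])
qed

lemma bilinear_dd_form:
  assumes D: "open D" "y \<in> D" and l: "\<And>z. z \<in> D \<Longrightarrow> linear (\<theta> z)"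
    and d: "\<And>X. (\<lambda>z. \<theta> z X) differentiable (at y)"
  shows "bilinear (\<lambda>v w. dd (\<lambda>z. \<theta> z w) y v)"
  unfolding bilinear_def using linear_dd_param[OF D l d] linear_dd[OF d] by simp

section \<open>Divergence, Laplacian and Green's formula on a coordinate domain\<close>

context gram_field
begin

lemma trG_eq: "y \<in> D \<Longrightarrow> (\<Sum>i\<in>UNIV. chris g y (axis i 1) Z $ i) = trG y Z"
  by (simp add: trG_def chris_sym[of y Z])

text \<open>The derivative of the density supplies precisely the contracted connection term of the
  divergence. In this form the divergence theorem reduces to the vanishing of integrals of partial
  derivatives.\<close>

lemma divergence_eq:
  assumes y: "y \<in> D" and X: "X differentiable (at y)"
  shows "(\<Sum>i\<in>UNIV. dd (\<lambda>z. vol g z * X z $ i) y (axis i 1)) = vol g y * divg g X y"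
proof -
  have dX: "(\<lambda>z. X z $ i) differentiable (at y)" "dd (\<lambda>z. X z $ i) y v = dd X y v $ i" for i v
    by (rule differentiable_bounded_linear[OF bounded_linear_vec_nth X], rule dd_bounded_linear[OF bounded_linear_vec_nth X])
  have dv: "vol g differentiable (at y)" using smooth_on_differentiable[OF smooth_vol y] .
  have "(\<Sum>i\<in>UNIV. dd (\<lambda>z. vol g z * X z $ i) y (axis i 1)) =
      (\<Sum>i\<in>UNIV. vol g y * ((X y $ i) *\<^sub>R trG y (axis i 1)) + vol g y * (dd X y (axis i 1) $ i))"
    by (rule sum.cong) (simp_all add: dd_mult[OF dv dX(1)] dX(2) dd_vol[OF y])
  also have "\<dots> = vol g y * (trG y (X y) + (\<Sum>i\<in>UNIV. dd X y (axis i 1) $ i))"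
    by (simp only: sum.distrib sum_distrib_left[symmetric] linear_axis_expand[OF linear_trG[OF y]] distrib_left)
  also have "\<dots> = vol g y * divg g X y"
    by (simp add: divg_def sum.distrib trG_eq[OF y])
  finally show ?thesis .
qed

lemma grad_nth: "grad g u y $ i = (\<Sum>j\<in>UNIV. matrix_inv (g y) $ i $ j * dd u y (axis j 1))"
  by (simp add: grad_def matrix_vector_mult_def)

lemma Ck_on_grad: "Ck_on 2 u D \<Longrightarrow> Ck_on 1 (grad g u) D"
  by (rule Ck_on_vec[OF open_D], unfold grad_nth)
    (intro Ck_on_sum open_D Ck_on_bilinear[OF open_D bounded_bilinear_mult] smooth_onD[OF smooth_inv] Ck_on_2_dd)

lemma grad_gframe:
  assumes "y \<in> D" "gframe (g y) S" "u differentiable (at y)"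
  shows "grad g u y = (\<Sum>e\<in>S. dd u y e *\<^sub>R e)"
  unfolding grad_def by (rule sharp_gframe[OF assms(2) linear_dd[OF assms(3)]])

definition sharp :: "(real^'n \<Rightarrow> real^'n \<Rightarrow> real) \<Rightarrow> real^'n \<Rightarrow> real^'n"
  where "sharp \<theta> y = matrix_inv (g y) *v (\<chi> l. \<theta> y (axis l 1))"

lemma sharp_nth: "sharp \<theta> y $ i = (\<Sum>j\<in>UNIV. matrix_inv (g y) $ i $ j * \<theta> y (axis j 1))"
  by (simp add: sharp_def matrix_vector_mult_def)

lemma Ck_on_sharp: "(\<And>X. Ck_on k (\<lambda>z. \<theta> z X) D) \<Longrightarrow> Ck_on k (sharp \<theta>) D"
  by (rule Ck_on_vec[OF open_D], unfold sharp_nth)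
    (intro Ck_on_sum open_D Ck_on_bilinear[OF open_D bounded_bilinear_mult] smooth_onD[OF smooth_inv], blast)

text \<open>The divergence is the trace of the covariant derivative of \<open>\<theta>\<close>. The
  frame vectors are extended with constant components, and \<open>chris g y e e\<close> accounts for
  their not being parallel.\<close>

lemma divg_sharp_gframe:
  assumes y: "y \<in> D" and S: "gframe (g y) S" and l: "\<And>z. z \<in> D \<Longrightarrow> linear (\<theta> z)"
    and C: "\<And>X. Ck_on 1 (\<lambda>z. \<theta> z X) D"
  shows "divg g (sharp \<theta>) y = (\<Sum>e\<in>S. dd (\<lambda>z. \<theta> z e) y e - \<theta> y (chris g y e e))"
proof -
  have du: "(\<lambda>z. \<theta> z X) differentiable (at y)" for X using C[of X] y by simp
  note lu = l[OF y]
  note dI = smooth_on_differentiable[OF smooth_inv y]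
  have dgr: "sharp \<theta> differentiable (at y)" using Ck_on_sharp[OF C] y by simp
  have 1: "dd (sharp \<theta>) y (axis i 1) $ i =
     (\<Sum>j\<in>UNIV. dd (\<lambda>z. matrix_inv (g z) $ i $ j) y (axis i 1) * \<theta> y (axis j 1) + matrix_inv (g y) $ i $ j * dd (\<lambda>z. \<theta> z (axis j 1)) y (axis i 1))" for i
  proof -
    have "dd (sharp \<theta>) y (axis i 1) $ i = dd (\<lambda>z. sharp \<theta> z $ i) y (axis i 1)"
      by (rule dd_bounded_linear[OF bounded_linear_vec_nth dgr, symmetric])
    also have "\<dots> = (\<Sum>j\<in>UNIV. dd (\<lambda>z. matrix_inv (g z) $ i $ j * \<theta> z (axis j 1)) y (axis i 1))"
      unfolding sharp_nth by (rule dd_sum) (rule differentiable_bilinear[OF bounded_bilinear_mult dI du])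
    finally show ?thesis by (simp add: dd_mult[OF dI du])
  qed
  \<comment> \<open>The derivative of the inverse metric contributes the correction by
    \<open>chris g y e e\<close> and a term with \<open>trG\<close> that cancels the connection term
    of the divergence.\<close>
  have 2: "(\<Sum>i\<in>UNIV. \<Sum>j\<in>UNIV. dd (\<lambda>z. matrix_inv (g z) $ i $ j) y (axis i 1) * \<theta> y (axis j 1))
      = - (\<Sum>e\<in>S. \<theta> y e * trG y e + \<theta> y (chris g y e e))"
  proof -
    have "(\<Sum>i\<in>UNIV. \<Sum>j\<in>UNIV. dd (\<lambda>z. matrix_inv (g z) $ i $ j) y (axis i 1) * \<theta> y (axis j 1)) =
      - (\<Sum>i\<in>UNIV. \<Sum>j\<in>UNIV. \<Sum>e\<in>S. chris g y (axis i 1) e $ i * (e $ j *\<^sub>R \<theta> y (axis j 1))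
         + e $ i * (chris g y (axis i 1) e $ j *\<^sub>R \<theta> y (axis j 1)))"
      unfolding dd_inv[OF y S] by (simp add: sum_negf sum_distrib_right distrib_right mult.assoc)
    also have "(\<Sum>i\<in>UNIV. \<Sum>j\<in>UNIV. \<Sum>e\<in>S. chris g y (axis i 1) e $ i * (e $ j *\<^sub>R \<theta> y (axis j 1))
         + e $ i * (chris g y (axis i 1) e $ j *\<^sub>R \<theta> y (axis j 1)))
       = (\<Sum>i\<in>UNIV. \<Sum>e\<in>S. \<Sum>j\<in>UNIV. chris g y (axis i 1) e $ i * (e $ j *\<^sub>R \<theta> y (axis j 1))
         + e $ i * (chris g y (axis i 1) e $ j *\<^sub>R \<theta> y (axis j 1)))"
      by (intro sum.cong refl sum.swap)
    also have "\<dots> = (\<Sum>i\<in>UNIV. \<Sum>e\<in>S. chris g y (axis i 1) e $ i * \<theta> y e + e $ i * \<theta> y (chris g y (axis i 1) e))"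
      by (simp only: sum.distrib sum_distrib_left[symmetric] linear_axis_expand[OF lu])
    also have "\<dots> = (\<Sum>e\<in>S. \<Sum>i\<in>UNIV. chris g y (axis i 1) e $ i * \<theta> y e + e $ i *\<^sub>R \<theta> y (chris g y (axis i 1) e))"
      by (subst sum.swap) simp
    also have "\<dots> = (\<Sum>e\<in>S. \<theta> y e * trG y e + \<theta> y (chris g y e e))"
    proof (rule sum.cong[OF refl])
      fix e
      have "linear (\<lambda>v. \<theta> y (chris g y v e))"
        using linear_compose[OF _ lu, of "\<lambda>v. chris g y v e"] bilinear_chris[OF y] by (simp add: bilinear_def o_def)
      from linear_axis_expand[OF this, of e]
      show "(\<Sum>i\<in>UNIV. chris g y (axis i 1) e $ i * \<theta> y e + e $ i *\<^sub>R \<theta> y (chris g y (axis i 1) e)) = \<theta> y e * trG y e + \<theta> y (chris g y e e)"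
        by (simp add: sum.distrib sum_distrib_right[symmetric] trG_eq[OF y] mult.commute[of "\<theta> y e"])
    qed
    finally show ?thesis .
  qed
  have 3: "(\<Sum>i\<in>UNIV. \<Sum>j\<in>UNIV. matrix_inv (g y) $ i $ j * dd (\<lambda>z. \<theta> z (axis j 1)) y (axis i 1)) = (\<Sum>e\<in>S. dd (\<lambda>z. \<theta> z e) y e)"
    using mtrace_gframe[OF S bilinear_dd_form[OF open_D y l du]] by (simp add: mtrace_def)
  have 4: "trG y (sharp \<theta> y) = (\<Sum>e\<in>S. \<theta> y e * trG y e)"
    unfolding sharp_def sharp_gframe[OF S lu] by (simp add: linear_sum[OF linear_trG[OF y]] linear_scale[OF linear_trG[OF y]])
  have "divg g (sharp \<theta>) y = (\<Sum>i\<in>UNIV. dd (sharp \<theta>) y (axis i 1) $ i) + trG y (sharp \<theta> y)"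
    by (simp add: divg_def sum.distrib trG_eq[OF y])
  also have "\<dots> = (\<Sum>e\<in>S. dd (\<lambda>z. \<theta> z e) y e - \<theta> y (chris g y e e))"
    unfolding 1 sum.distrib 2 3 4 by (simp add: sum_subtractf sum.distrib sum_negf)
  finally show ?thesis .
qed

lemma lap_gframe:
  assumes y: "y \<in> D" and S: "gframe (g y) S" and u: "Ck_on 2 u D"
  shows "lap g u y = (\<Sum>e\<in>S. dd (\<lambda>z. dd u z e) y e - dd u y (chris g y e e))"
proof -
  have "grad g u = sharp (dd u)" by (simp add: fun_eq_iff grad_def sharp_def)
  then show ?thesis unfolding lap_def
    using divg_sharp_gframe[OF y S linear_dd[OF Ck_on_2D(1)[OF u]] Ck_on_2_dd[OF u]] by simp
qed

lemma continuous_on_lap: "Ck_on 2 u D \<Longrightarrow> continuous_on D (lap g u)"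
proof -
  assume u: "Ck_on 2 u D"
  have g1: "continuous_on D (\<lambda>y. dd (grad g u) y v)" "continuous_on D (grad g u)" for v
    using Ck_on_grad[OF u] Ck_on_SucD[of 0 "grad g u" D] by simp_all
  have c: "continuous_on D (\<lambda>y. chris g y v w)" for v w using smooth_on_continuous[OF smooth_chris] .
  \<comment> \<open>The gradient inside \<open>chris\<close> varies with the point; its expansion
    along the axes leaves only continuous coefficients.\<close>
  have "continuous_on D (\<lambda>y. \<Sum>i\<in>UNIV. (dd (grad g u) y (axis i 1) + (\<Sum>j\<in>UNIV. (grad g u y $ j) *\<^sub>R chris g y (axis i 1) (axis j 1))) $ i)"
    by (intro continuous_on_sum bounded_linear.continuous_on[OF bounded_linear_vec_nth] continuous_on_add continuous_on_scaleR g1 c)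
  moreover have e: "(\<Sum>j\<in>UNIV. (grad g u y $ j) *\<^sub>R chris g y v (axis j 1)) = chris g y v (grad g u y)" if "y \<in> D" for y v
    by (rule linear_axis_expand) (use bilinear_chris[OF that] in \<open>simp add: bilinear_def\<close>)
  ultimately show ?thesis
    unfolding lap_def[abs_def] divg_def by (elim continuous_on_eq) (simp add: e)
qed

lemma lap_eq_0_off:
  assumes "open W" "y \<in> W" "\<And>z. z \<in> W \<Longrightarrow> u z = 0" "y \<in> D"
  shows "lap g u y = 0"
proof -
  have "dd u z v = 0" if "z \<in> W" for z v using dd_eq_0_open[OF assms(1) that assms(3)] .
  then have z: "grad g u z = 0" if "z \<in> W" for z using that by (simp add: vec_eq_iff grad_nth)
  have "dd (grad g u) y v = 0" for v by (rule dd_eq_0_open[OF assms(1,2) z])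
  then show ?thesis using z[OF assms(2)] bilinear_rzero[OF bilinear_chris[OF assms(4)]] by (simp add: lap_def divg_def)
qed

lemma divg_scaleR:
  assumes "y \<in> D" "f differentiable (at y)" "U differentiable (at y)"
  shows "divg g (\<lambda>z. f z *\<^sub>R U z) y = f y * divg g U y + dd f y (U y)"
proof -
  have l: "linear (chris g y v)" for v using bilinear_chris[OF assms(1)] by (simp add: bilinear_def)
  have "divg g (\<lambda>z. f z *\<^sub>R U z) y =
    (\<Sum>i\<in>UNIV. f y * (dd U y (axis i 1) + chris g y (axis i 1) (U y)) $ i + U y $ i *\<^sub>R dd f y (axis i 1))"
    unfolding divg_def by (rule sum.cong) (simp_all add: dd_scaleR[OF assms(2,3)] linear_scale[OF l] algebra_simps)
  then show ?thesis
    by (simp only: sum.distrib linear_axis_expand[OF linear_dd[OF assms(2)]] divg_def sum_distrib_left)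
qed

lemma integral_divg_eq_0:
  assumes U: "Ck_on 1 U D" and C: "compact C" "C \<subseteq> D" and Uz: "\<And>y. y \<in> D - C \<Longrightarrow> U y = 0"
  shows "integral D (\<lambda>y. divg g U y * vol g y) = 0"
proof -
  have oDC: "open (D - C)" using open_D C(1) compact_imp_closed by blast
  have Cps: "Ck_on 1 (\<lambda>z. vol g z * U z $ i) D" for i
    by (intro Ck_on_bilinear[OF open_D bounded_bilinear_mult] smooth_onD[OF smooth_vol] Ck_on_bounded_linear[OF open_D bounded_linear_vec_nth] U)
  have ps0: "vol g z * U z $ i = 0" if "z \<in> D - C" for z i using Uz[OF that] by simp
  have int0: "integral D (\<lambda>y. dd (\<lambda>z. vol g z * U z $ i) y (axis i 1)) = 0" for i
    by (rule integral_dd_eq_0[OF open_D C Cps ps0])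
  have inte: "(\<lambda>y. dd (\<lambda>z. vol g z * U z $ i) y (axis i 1)) integrable_on D" for i
  proof (rule set_lebesgue_integral_eq_integral(1), rule absolutely_integrable_compact_support[OF open_D C])
    show "continuous_on D (\<lambda>y. dd (\<lambda>z. vol g z * U z $ i) y (axis i 1))" using Cps[of i] by simp
    show "dd (\<lambda>z. vol g z * U z $ i) y (axis i 1) = 0" if "y \<in> D - C" for y by (rule dd_eq_0_open[OF oDC that ps0])
  qed
  have "0 = (\<Sum>i\<in>UNIV. integral D (\<lambda>y. dd (\<lambda>z. vol g z * U z $ i) y (axis i 1)))" using int0 by simp
  also have "\<dots> = integral D (\<lambda>y. \<Sum>i\<in>UNIV. dd (\<lambda>z. vol g z * U z $ i) y (axis i 1))"
    by (rule integral_sum[symmetric]) (use inte in auto)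
  also have "\<dots> = integral D (\<lambda>y. divg g U y * vol g y)"
    by (rule integral_cong) (use divergence_eq U in \<open>simp add: mult.commute\<close>)
  finally show ?thesis by simp
qed

text \<open>\<open>f \<Delta>\<phi> - \<phi> \<Delta>f\<close> is the divergence of \<open>f \<nabla>\<phi> - \<phi> \<nabla>f\<close>.\<close>

lemma green:
  assumes f: "Ck_on 2 f D" and p: "Ck_on 2 p D" and C: "compact C" "C \<subseteq> D" and pz: "\<And>y. y \<in> D - C \<Longrightarrow> p y = 0"
  shows "integral D (\<lambda>y. f y * lap g p y * vol g y) = integral D (\<lambda>y. p y * lap g f y * vol g y)"
    "(\<lambda>y. p y * lap g f y * vol g y) absolutely_integrable_on D"
proof -
  have oDC: "open (D - C)" using open_D C(1) compact_imp_closed by blast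
  define X where "X z = f z *\<^sub>R grad g p z - p z *\<^sub>R grad g f z" for z
  have dp0: "dd p y v = 0" if "y \<in> D - C" for y v by (rule dd_eq_0_open[OF oDC that pz])
  have gp0: "grad g p y = 0" if "y \<in> D - C" for y using dp0[OF that] by (simp add: vec_eq_iff grad_nth)
  have lp0: "lap g p y = 0" if "y \<in> D - C" for y by (rule lap_eq_0_off[OF oDC that pz]) (use that in auto)
  have c1: "Ck_on 1 f D" "Ck_on 1 p D" using Ck_on_mono[OF f, of 1] Ck_on_mono[OF p, of 1] by auto
  have CX: "Ck_on 1 X D"
  proof -
    have "Ck_on 1 (\<lambda>z. f z *\<^sub>R grad g p z + - (p z *\<^sub>R grad g f z)) D"
      by (intro Ck_on_add Ck_on_bounded_linear[OF open_D bounded_linear_minus[OF bounded_linear_ident]]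
          Ck_on_bilinear[OF open_D bounded_bilinear_scaleR] open_D c1 Ck_on_grad f p)
    then show ?thesis by (simp add: X_def[abs_def])
  qed
  have X0: "X z = 0" if "z \<in> D - C" for z using pz[OF that] gp0[OF that] by (simp add: X_def)
  have dg: "divg g X y * vol g y = f y * lap g p y * vol g y - p y * lap g f y * vol g y" if y: "y \<in> D" for y
  proof -
    have d: "f differentiable (at y)" "p differentiable (at y)" using Ck_on_2D f p y by auto
    have dgr: "grad g f differentiable (at y)" "grad g p differentiable (at y)" using Ck_on_grad f p y by auto
    obtain S where S: "gframe (g y) S" using gram_frame gram[OF y] by blast
    have l: "linear (chris g y v)" for v using bilinear_chris[OF y] by (simp add: bilinear_def)
    have sx: "(\<lambda>z. f z *\<^sub>R grad g p z) differentiable (at y)" "(\<lambda>z. p z *\<^sub>R grad g f z) differentiable (at y)"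
      by (intro differentiable_bilinear[OF bounded_bilinear_scaleR] d dgr)+
    have "divg g X y = divg g (\<lambda>z. f z *\<^sub>R grad g p z) y - divg g (\<lambda>z. p z *\<^sub>R grad g f z) y"
      by (simp add: divg_def X_def[abs_def] dd_diff[OF sx] linear_diff[OF l] sum_subtractf[symmetric] algebra_simps)
    also have "\<dots> = f y * lap g p y - p y * lap g f y + (dd f y (grad g p y) - dd p y (grad g f y))"
      by (simp add: divg_scaleR[OF y d(1) dgr(2)] divg_scaleR[OF y d(2) dgr(1)] lap_def)
    \<comment> \<open>Both sides are the inner product of the two gradients, so the first-order
      terms cancel.\<close>
    also have "dd f y (grad g p y) = dd p y (grad g f y)"
      unfolding grad_gframe[OF y S d(1)] grad_gframe[OF y S d(2)]
      by (simp add: linear_sum[OF linear_dd] linear_scale[OF linear_dd] d mult.commute)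
    finally have q: "divg g X y = f y * lap g p y - p y * lap g f y" by simp
    show ?thesis unfolding q by (simp add: algebra_simps)
  qed
  have cv: "continuous_on D (vol g)" "continuous_on D f" "continuous_on D p"
    using smooth_on_continuous[OF smooth_vol] Ck_on_mono[OF f, of 0] Ck_on_mono[OF p, of 0] by auto
  have i1: "(\<lambda>y. f y * lap g p y * vol g y) absolutely_integrable_on D"
    by (rule absolutely_integrable_compact_support[OF open_D C])
      (use lp0 in \<open>auto intro!: continuous_on_mult cv continuous_on_lap p\<close>)
  show i2: "(\<lambda>y. p y * lap g f y * vol g y) absolutely_integrable_on D"
    by (rule absolutely_integrable_compact_support[OF open_D C])
      (use pz in \<open>auto intro!: continuous_on_mult cv continuous_on_lap f\<close>)
  have "0 = integral D (\<lambda>y. divg g X y * vol g y)" using integral_divg_eq_0[OF CX C X0] by simp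
  also have "\<dots> = integral D (\<lambda>y. f y * lap g p y * vol g y - p y * lap g f y * vol g y)"
    by (rule integral_cong) (rule dg)
  also have "\<dots> = integral D (\<lambda>y. f y * lap g p y * vol g y) - integral D (\<lambda>y. p y * lap g f y * vol g y)"
    by (rule integral_diff) (use i1 i2 set_lebesgue_integral_eq_integral(1) in auto)
  finally show "integral D (\<lambda>y. f y * lap g p y * vol g y) = integral D (\<lambda>y. p y * lap g f y * vol g y)" by simp
qed

end

section \<open>The Weitzenboeck formula and the refined Kato inequality\<close>

text \<open>The product rule for a form applied to a vector that varies with the point.
  Differentiability of the form is given for constant vectors only, so the moving vector is expanded
  in \<open>Basis\<close>.\<close>

lemma dd_linear_moving:
  fixes \<omega> :: "'a::real_normed_vector \<Rightarrow> 'b::euclidean_space \<Rightarrow> 'w::real_normed_vector"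
  assumes D: "open D" "y \<in> D" and l: "\<And>z. z \<in> D \<Longrightarrow> linear (\<omega> z)"
    and d: "\<And>X. (\<lambda>z. \<omega> z X) differentiable (at y)" and v: "v differentiable (at y)"
  shows "(\<lambda>z. \<omega> z (v z)) differentiable (at y)"
    "dd (\<lambda>z. \<omega> z (v z)) y Z = dd (\<lambda>z. \<omega> z (v y)) y Z + \<omega> y (dd v y Z)"
proof -
  let ?f = "\<lambda>u z. \<Sum>b\<in>Basis. (u z \<bullet> b) *\<^sub>R \<omega> z b"
  have e: "?f u z = \<omega> z (u z)" if "z \<in> D" for z and u :: "'a \<Rightarrow> 'b"
    using arg_cong[OF euclidean_representation[of "u z"], of "\<omega> z"]
    by (simp add: linear_sum[OF l[OF that]] linear_scale[OF l[OF that]])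
  have dv: "(\<lambda>z. v z \<bullet> b) differentiable (at y)" "dd (\<lambda>z. v z \<bullet> b) y Z = dd v y Z \<bullet> b" for b
    by (rule differentiable_bounded_linear[OF bounded_linear_inner_left v],
        rule dd_bounded_linear[OF bounded_linear_inner_left v])
  have df: "?f v differentiable (at y)"
    by (rule differentiable_sum) (auto intro: differentiable_bilinear[OF bounded_bilinear_scaleR] dv d)
  show "(\<lambda>z. \<omega> z (v z)) differentiable (at y)"
    by (rule differentiable_cong_open[OF D, of "?f v"]) (use e df in auto)
  have "dd (\<lambda>z. \<omega> z (v z)) y Z = dd (?f v) y Z"
    by (rule dd_cong_open[OF D]) (simp add: e)
  also have "\<dots> = (\<Sum>b\<in>Basis. (dd v y Z \<bullet> b) *\<^sub>R \<omega> y b + (v y \<bullet> b) *\<^sub>R dd (\<lambda>z. \<omega> z b) y Z)"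
    by (subst dd_sum) (auto intro!: sum.cong differentiable_bilinear[OF bounded_bilinear_scaleR] dv d simp: dd_scaleR[OF dv(1) d] dv(2))
  also have "\<dots> = \<omega> y (dd v y Z) + (\<Sum>b\<in>Basis. (v y \<bullet> b) *\<^sub>R dd (\<lambda>z. \<omega> z b) y Z)"
    using e[OF D(2), of "\<lambda>_. dd v y Z"] by (simp add: sum.distrib)
  also have "(\<Sum>b\<in>Basis. (v y \<bullet> b) *\<^sub>R dd (\<lambda>z. \<omega> z b) y Z) = dd (?f (\<lambda>_. v y)) y Z"
    by (subst dd_sum) (auto intro!: sum.cong differentiable_bilinear[OF bounded_bilinear_scaleR] d simp: dd_scaleR[OF _ d])
  also have "\<dots> = dd (\<lambda>z. \<omega> z (v y)) y Z"
    by (rule dd_cong_open[OF D]) (rule e[of _ "\<lambda>_. v y"])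
  finally show "dd (\<lambda>z. \<omega> z (v z)) y Z = dd (\<lambda>z. \<omega> z (v y)) y Z + \<omega> y (dd v y Z)" by simp
qed

lemma smooth_on_linear_moving:
  fixes \<omega> :: "'a::real_normed_vector \<Rightarrow> 'b::euclidean_space \<Rightarrow> 'w::real_normed_vector"
  assumes D: "open D" and l: "\<And>z. z \<in> D \<Longrightarrow> linear (\<omega> z)"
    and d: "\<And>X. smooth_on (\<lambda>z. \<omega> z X) D" and v: "smooth_on v D"
  shows "smooth_on (\<lambda>z. \<omega> z (v z)) D"
proof -
  have "smooth_on (\<lambda>z. \<Sum>b\<in>Basis. (v z \<bullet> b) *\<^sub>R \<omega> z b) D"
    by (intro smooth_on_sum smooth_on_scaleR smooth_on_inner_const D d v)
  moreover have "(\<Sum>b\<in>Basis. (v z \<bullet> b) *\<^sub>R \<omega> z b) = \<omega> z (v z)" if "z \<in> D" for z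
    using arg_cong[OF euclidean_representation[of "v z"], of "\<omega> z"]
    by (simp add: linear_sum[OF l[OF that]] linear_scale[OF l[OF that]])
  ultimately show ?thesis by (rule smooth_on_cong[OF D])
qed

lemma bilinearD: "bilinear b \<Longrightarrow> linear (b x)" "bilinear b \<Longrightarrow> linear (\<lambda>x. b x y)"
  by (simp_all add: bilinear_def)

lemma bilinearI': "(\<And>y. linear (\<lambda>x. b x y)) \<Longrightarrow> (\<And>x. linear (b x)) \<Longrightarrow> bilinear b"
  by (simp add: bilinear_def)

text \<open>
  The components \<open>\<gamma> y i j\<close> of the inverse metric with respect to \<open>Basis\<close> and the connection \<open>\<Gamma>\<close> are
  all that is needed of a metric on \<open>D\<close>. The product of a manifold with a line is obtained
  by taking the type of the coordinates to be a product.
\<close>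

locale bundle_field =
  fixes D :: "'a::euclidean_space set" and \<gamma> :: "'a \<Rightarrow> 'a \<Rightarrow> 'a \<Rightarrow> real" and \<Gamma> :: "'a \<Rightarrow> 'a \<Rightarrow> 'a \<Rightarrow> 'a"
    and br :: "'w::euclidean_space \<Rightarrow> 'w \<Rightarrow> 'w" and \<kappa> :: "'w \<Rightarrow> 'w \<Rightarrow> real" and A :: "'a \<Rightarrow> 'a \<Rightarrow> 'w"
  assumes open_D: "open D"
    and smooth_\<gamma>: "\<And>i j. i \<in> Basis \<Longrightarrow> j \<in> Basis \<Longrightarrow> smooth_on (\<lambda>y. \<gamma> y i j) D"
    and bilinear_\<Gamma>: "\<And>y. y \<in> D \<Longrightarrow> bilinear (\<Gamma> y)"
    and \<Gamma>_sym: "\<And>y X Y. y \<in> D \<Longrightarrow> \<Gamma> y X Y = \<Gamma> y Y X"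
    and smooth_\<Gamma>: "\<And>X Y. smooth_on (\<lambda>y. \<Gamma> y X Y) D"
    and \<gamma>_parallel: "\<And>y i j Z. y \<in> D \<Longrightarrow> i \<in> Basis \<Longrightarrow> j \<in> Basis \<Longrightarrow>
      dd (\<lambda>z. \<gamma> z i j) y Z = - (\<Sum>k\<in>Basis. \<gamma> y k j * (\<Gamma> y Z k \<bullet> i) + \<gamma> y i k * (\<Gamma> y Z k \<bullet> j))"
    and br: "bounded_bilinear br" and br_anti: "\<And>a b. br a b = - br b a"
    and jacobi: "\<And>a b c. br a (br b c) = br (br a b) c + br b (br a c)"
    and \<kappa>: "bounded_bilinear \<kappa>" and \<kappa>_sym: "\<And>a b. \<kappa> a b = \<kappa> b a" and \<kappa>_nonneg: "\<And>a. \<kappa> a a \<ge> 0"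
    and linear_A: "\<And>y. y \<in> D \<Longrightarrow> linear (A y)"
    and smooth_A: "\<And>X. smooth_on (\<lambda>y. A y X) D"
    and \<kappa>_inv: "\<And>y X b c. y \<in> D \<Longrightarrow> \<kappa> (br (A y X) b) c + \<kappa> b (br (A y X) c) = 0"
begin

lemmas br_lin = bounded_bilinear.add_left[OF br] bounded_bilinear.add_right[OF br]
  bounded_bilinear.diff_left[OF br] bounded_bilinear.diff_right[OF br]
  bounded_bilinear.minus_left[OF br] bounded_bilinear.minus_right[OF br]
  bounded_bilinear.scaleR_left[OF br] bounded_bilinear.scaleR_right[OF br]
  bounded_bilinear.zero_left[OF br] bounded_bilinear.zero_right[OF br]

lemmas \<kappa>_lin = bounded_bilinear.add_left[OF \<kappa>] bounded_bilinear.add_right[OF \<kappa>]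
  bounded_bilinear.diff_left[OF \<kappa>] bounded_bilinear.diff_right[OF \<kappa>]
  bounded_bilinear.minus_left[OF \<kappa>] bounded_bilinear.minus_right[OF \<kappa>]
  bounded_bilinear.scaleR_left[OF \<kappa>] bounded_bilinear.scaleR_right[OF \<kappa>]
  bounded_bilinear.zero_left[OF \<kappa>] bounded_bilinear.zero_right[OF \<kappa>]

lemma linear_br: "linear (br a)" "linear (\<lambda>x. br x a)"
  by (auto intro!: linearI simp: br_lin)

lemma diff_\<Gamma>: "y \<in> D \<Longrightarrow> (\<lambda>z. \<Gamma> z X Y) differentiable (at y)"
  using smooth_on_differentiable[OF smooth_\<Gamma>] .

lemma diff_A: "y \<in> D \<Longrightarrow> (\<lambda>z. A z X) differentiable (at y)"
  using smooth_on_differentiable[OF smooth_A] .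

text \<open>The vectors are constant coordinate fields, and the \<open>\<Gamma>\<close> terms
  correct the two form slots. Iterating with \<open>Z\<close> fixed therefore leaves the slot
  \<open>Z\<close> uncorrected, which \<open>cov2F\<close> repairs.\<close>

definition cov :: "('a \<Rightarrow> 'a \<Rightarrow> 'a \<Rightarrow> 'w) \<Rightarrow> 'a \<Rightarrow> 'a \<Rightarrow> 'a \<Rightarrow> 'a \<Rightarrow> 'w"
  where "cov \<omega> y Z X Y = dd (\<lambda>z. \<omega> z X Y) y Z + br (A y Z) (\<omega> y X Y) - \<omega> y (\<Gamma> y Z X) Y - \<omega> y X (\<Gamma> y Z Y)"

definition F :: "'a \<Rightarrow> 'a \<Rightarrow> 'a \<Rightarrow> 'w"
  where "F y X Y = dd (\<lambda>z. A z Y) y X - dd (\<lambda>z. A z X) y Y + br (A y X) (A y Y)"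

definition R :: "'a \<Rightarrow> 'a \<Rightarrow> 'a \<Rightarrow> 'a \<Rightarrow> 'a"
  where "R y X Y W = dd (\<lambda>z. \<Gamma> z Y W) y X - dd (\<lambda>z. \<Gamma> z X W) y Y + \<Gamma> y X (\<Gamma> y Y W) - \<Gamma> y Y (\<Gamma> y X W)"

definition tr :: "'a \<Rightarrow> ('a \<Rightarrow> 'a \<Rightarrow> 'v::real_normed_vector) \<Rightarrow> 'v"
  where "tr y b = (\<Sum>i\<in>Basis. \<Sum>j\<in>Basis. \<gamma> y i j *\<^sub>R b i j)"

definition tensor2 :: "('a \<Rightarrow> 'a \<Rightarrow> 'a \<Rightarrow> 'v::real_normed_vector) \<Rightarrow> bool"
  where "tensor2 \<omega> \<longleftrightarrow> (\<forall>y\<in>D. bilinear (\<omega> y)) \<and> (\<forall>X Y. smooth_on (\<lambda>y. \<omega> y X Y) D)"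

lemma tensor2D:
  assumes "tensor2 \<omega>"
  shows "y \<in> D \<Longrightarrow> bilinear (\<omega> y)" "smooth_on (\<lambda>y. \<omega> y X Y) D" "y \<in> D \<Longrightarrow> (\<lambda>z. \<omega> z X Y) differentiable (at y)"
  using assms smooth_on_differentiable[of "\<lambda>z. \<omega> z X Y" D y] by (auto simp: tensor2_def)

lemma tensor2_moving:
  assumes t: "tensor2 \<omega>" and y: "y \<in> D" and v: "v differentiable (at y)"
  shows "(\<lambda>z. \<omega> z (v z) Y) differentiable (at y)"
    "dd (\<lambda>z. \<omega> z (v z) Y) y Z = dd (\<lambda>z. \<omega> z (v y) Y) y Z + \<omega> y (dd v y Z) Y"
    "(\<lambda>z. \<omega> z X (v z)) differentiable (at y)"
    "dd (\<lambda>z. \<omega> z X (v z)) y Z = dd (\<lambda>z. \<omega> z X (v y)) y Z + \<omega> y X (dd v y Z)"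
  using dd_linear_moving[OF open_D y _ _ v, of "\<lambda>z X. \<omega> z X Y"] dd_linear_moving[OF open_D y _ _ v, of "\<lambda>z. \<omega> z X"]
    bilinearD[OF tensor2D(1)[OF t]] tensor2D(3)[OF t y] by blast+

lemma bilinear_cov:
  assumes t: "tensor2 \<omega>" and y: "y \<in> D"
  shows "bilinear (cov \<omega> y Z)"
proof -
  note l = bilinearD[OF tensor2D(1)[OF t]] and lg = bilinearD[OF bilinear_\<Gamma>[OF y]]
  have d: "linear (\<lambda>X. dd (\<lambda>z. \<omega> z X Y) y Z)" "linear (\<lambda>X. dd (\<lambda>z. \<omega> z Y X) y Z)" for Y
    by (rule linear_dd_param[OF open_D y], fact l, fact tensor2D(3)[OF t y])+
  note s = linear_add[OF l(1)[OF y]] linear_add[OF l(2)[OF y]] linear_scale[OF l(1)[OF y]] linear_scale[OF l(2)[OF y]]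
    linear_add[OF lg(1)] linear_scale[OF lg(1)] linear_add[OF d(1)] linear_add[OF d(2)] linear_scale[OF d(1)] linear_scale[OF d(2)]
  show ?thesis
    by (rule bilinearI'; rule linearI) (simp_all add: cov_def s br_lin algebra_simps)
qed

lemma linear_cov:
  assumes t: "tensor2 \<omega>" and y: "y \<in> D"
  shows "linear (\<lambda>Z. cov \<omega> y Z X Y)"
proof -
  note l = bilinearD[OF tensor2D(1)[OF t]] and lg = bilinearD[OF bilinear_\<Gamma>[OF y]] and lA = linear_A[OF y]
  have d: "linear (\<lambda>Z. dd (\<lambda>z. \<omega> z X Y) y Z)" using linear_dd[OF tensor2D(3)[OF t y]] by simp
  note s = linear_add[OF l(1)[OF y]] linear_add[OF l(2)[OF y]] linear_scale[OF l(1)[OF y]] linear_scale[OF l(2)[OF y]]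
    linear_add[OF lg(2)] linear_scale[OF lg(2)] linear_add[OF d] linear_scale[OF d] linear_add[OF lA] linear_scale[OF lA]
  show ?thesis by (rule linearI) (simp_all add: cov_def s br_lin algebra_simps)
qed

lemma smooth_cov:
  assumes t: "tensor2 \<omega>"
  shows "smooth_on (\<lambda>y. cov \<omega> y Z X Y) D"
proof -
  note l = bilinearD[OF tensor2D(1)[OF t]]
  have "smooth_on (\<lambda>y. \<omega> y (\<Gamma> y Z X) Y) D"
    by (rule smooth_on_linear_moving[OF open_D, of "\<lambda>y X. \<omega> y X Y"]) (use l tensor2D(2)[OF t] smooth_\<Gamma> in auto)
  moreover have "smooth_on (\<lambda>y. \<omega> y X (\<Gamma> y Z Y)) D"
    by (rule smooth_on_linear_moving[OF open_D, of "\<lambda>y. \<omega> y X"]) (use l tensor2D(2)[OF t] smooth_\<Gamma> in auto)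
  ultimately show ?thesis unfolding cov_def
    by (intro smooth_on_diff[OF open_D] smooth_on_add[OF open_D] smooth_on_bilinear[OF open_D br] smooth_on_dd
        tensor2D(2)[OF t] smooth_A)
qed

lemma tensor2_cov: "tensor2 \<omega> \<Longrightarrow> tensor2 (\<lambda>y. cov \<omega> y Z)"
  using bilinear_cov smooth_cov by (auto simp: tensor2_def)

section \<open>Commutation of covariant derivatives and the Bianchi identities\<close>

lemma cov_cov:
  assumes t: "tensor2 \<omega>" and y: "y \<in> D"
  shows "cov (\<lambda>y. cov \<omega> y Z) y W U V =
     dd (\<lambda>z. dd (\<lambda>w. \<omega> w U V) z Z) y W + (br (dd (\<lambda>z. A z Z) y W) (\<omega> y U V) + br (A y Z) (dd (\<lambda>z. \<omega> z U V) y W))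
      - (dd (\<lambda>z. \<omega> z (\<Gamma> y Z U) V) y W + \<omega> y (dd (\<lambda>z. \<Gamma> z Z U) y W) V)
      - (dd (\<lambda>z. \<omega> z U (\<Gamma> y Z V)) y W + \<omega> y U (dd (\<lambda>z. \<Gamma> z Z V) y W))
      + br (A y W) (cov \<omega> y Z U V) - cov \<omega> y Z (\<Gamma> y W U) V - cov \<omega> y Z U (\<Gamma> y W V)"
proof -
  have d: "(\<lambda>z. dd (\<lambda>w. \<omega> w U V) z Z) differentiable (at y)" by (rule smooth_on_differentiable[OF smooth_on_dd[OF tensor2D(2)[OF t]] y])
  have b: "(\<lambda>z. br (A z Z) (\<omega> z U V)) differentiable (at y)" by (rule differentiable_bilinear[OF br diff_A[OF y] tensor2D(3)[OF t y]])
  note m = tensor2_moving[OF t y diff_\<Gamma>[OF y]]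
  have "dd (\<lambda>z. cov \<omega> z Z U V) y W =
    dd (\<lambda>z. dd (\<lambda>w. \<omega> w U V) z Z) y W + (br (dd (\<lambda>z. A z Z) y W) (\<omega> y U V) + br (A y Z) (dd (\<lambda>z. \<omega> z U V) y W))
      - (dd (\<lambda>z. \<omega> z (\<Gamma> y Z U) V) y W + \<omega> y (dd (\<lambda>z. \<Gamma> z Z U) y W) V)
      - (dd (\<lambda>z. \<omega> z U (\<Gamma> y Z V)) y W + \<omega> y U (dd (\<lambda>z. \<Gamma> z Z V) y W))"
    unfolding cov_def
    by (simp only: dd_diff[OF differentiable_diff[OF differentiable_add[OF d b] m(1)] m(3)]
        dd_diff[OF differentiable_add[OF d b] m(1)] dd_add[OF d b] m(2,4) dd_bilinear[OF br diff_A[OF y] tensor2D(3)[OF t y]])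
  then show ?thesis by (simp only: cov_def[of "\<lambda>y. cov \<omega> y Z"])
qed

lemma dd_commute_smooth: "smooth_on f D \<Longrightarrow> y \<in> D \<Longrightarrow> dd (\<lambda>z. dd f z X) y Y = dd (\<lambda>z. dd f z Y) y (X::'a)"
  for f :: "'a \<Rightarrow> 'w" using dd_commute[OF open_D _ smooth_onD] by blast

text \<open>Second partial derivatives commute and constant fields have vanishing Lie bracket, so
  only curvature survives: the Jacobi identity assembles the bracket terms into \<open>F\<close>,
  and the derivatives and products of \<open>\<Gamma>\<close> assemble into
  \<open>R\<close>.\<close>

lemma ricci_identity:
  assumes t: "tensor2 \<omega>" and y: "y \<in> D"
  shows "cov (\<lambda>y. cov \<omega> y Z) y W U V - cov (\<lambda>y. cov \<omega> y W) y Z U V =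
    br (F y W Z) (\<omega> y U V) - \<omega> y (R y W Z U) V - \<omega> y U (R y W Z V)"
proof -
  note l = bilinearD[OF tensor2D(1)[OF t y]]
  note lin = linear_add[OF l(1)] linear_add[OF l(2)] linear_diff[OF l(1)] linear_diff[OF l(2)]
  have c: "dd (\<lambda>z. dd (\<lambda>w. \<omega> w U V) z Z) y W = dd (\<lambda>z. dd (\<lambda>w. \<omega> w U V) z W) y Z"
    by (rule dd_commute_smooth[OF tensor2D(2)[OF t] y])
  have j: "br (A y W) (br (A y Z) (\<omega> y U V)) = br (br (A y W) (A y Z)) (\<omega> y U V) + br (A y Z) (br (A y W) (\<omega> y U V))"
    by (rule jacobi)
  show ?thesis
    unfolding cov_cov[OF t y] F_def R_def by (simp add: cov_def[of \<omega>] c j lin br_lin algebra_simps)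
qed

lemma F_anti: "F y X Y = - F y Y X"
  using br_anti[of "A y X"] by (simp add: F_def)

lemma bilinear_F: assumes y: "y \<in> D" shows "bilinear (F y)"
proof -
  have d1: "linear (\<lambda>X. dd (\<lambda>z. A z X) y Y)" for Y by (rule linear_dd_param[OF open_D y linear_A diff_A[OF y]])
  have d2: "linear (dd (\<lambda>z. A z Y) y)" for Y by (rule linear_dd[OF diff_A[OF y]])
  note s = linear_add[OF d1] linear_add[OF d2] linear_scale[OF d1] linear_scale[OF d2] linear_add[OF linear_A[OF y]] linear_scale[OF linear_A[OF y]]
  show ?thesis by (rule bilinearI'; rule linearI) (simp_all add: F_def s br_lin algebra_simps)
qed

lemma tensor2_F: "tensor2 F"
  unfolding tensor2_def using bilinear_F
  by (auto simp: F_def intro!: smooth_on_diff[OF open_D] smooth_on_add[OF open_D] smooth_on_bilinear[OF open_D br] smooth_on_dd smooth_A)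

lemma cov_F_anti: assumes "y \<in> D" shows "cov F y Z X Y = - cov F y Z Y X"
proof -
  have "dd (\<lambda>z. F z X Y) y Z = dd (\<lambda>z. - F z Y X) y Z" by (subst F_anti) simp
  also have "\<dots> = - dd (\<lambda>z. F z Y X) y Z" by (rule dd_minus[OF tensor2D(3)[OF tensor2_F assms]])
  finally show ?thesis
    using F_anti[of y X Y] F_anti[of y "\<Gamma> y Z X" Y] F_anti[of y X "\<Gamma> y Z Y"] by (simp add: cov_def br_lin)
qed

text \<open>Second derivatives of \<open>A\<close> cancel by symmetry, the \<open>\<Gamma>\<close>
  terms by torsion-freeness and antisymmetry of \<open>F\<close>, the brackets of \<open>A\<close>
  with its derivatives in pairs, and the triple brackets by the Jacobi identity.\<close>

lemma bianchi:
  assumes y: "y \<in> D"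
  shows "cov F y X Y Z + cov F y Y Z X + cov F y Z X Y = 0"
proof -
  have dF: "dd (\<lambda>z. F z Y Z) y X = dd (\<lambda>z. dd (\<lambda>w. A w Z) z Y) y X - dd (\<lambda>z. dd (\<lambda>w. A w Y) z Z) y X
      + (br (dd (\<lambda>z. A z Y) y X) (A y Z) + br (A y Y) (dd (\<lambda>z. A z Z) y X))" for X Y Z
  proof -
    have d: "(\<lambda>z. dd (\<lambda>w. A w Z) z Y) differentiable (at y)" for Z Y by (rule smooth_on_differentiable[OF smooth_on_dd[OF smooth_A] y])
    show ?thesis unfolding F_def
      by (simp only: dd_add[OF differentiable_diff[OF d d] differentiable_bilinear[OF br diff_A[OF y] diff_A[OF y]]] dd_diff[OF d d]
          dd_bilinear[OF br diff_A[OF y] diff_A[OF y]])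
  qed
  note c = dd_commute_smooth[OF smooth_A y]
  have g: "\<Gamma> y Y X = \<Gamma> y X Y" "\<Gamma> y Z X = \<Gamma> y X Z" "\<Gamma> y Z Y = \<Gamma> y Y Z" using \<Gamma>_sym[OF y] by blast+
  have f: "F y Y (\<Gamma> y X Z) = - F y (\<Gamma> y X Z) Y" "F y Z (\<Gamma> y X Y) = - F y (\<Gamma> y X Y) Z"  "F y X (\<Gamma> y Y Z) = - F y (\<Gamma> y Y Z) X"
    using F_anti by blast+
  have a: "br (A y Y) (dd (\<lambda>z. A z Z) y X) = - br (dd (\<lambda>z. A z Z) y X) (A y Y)" for X Y Z by (rule br_anti)
  have j: "br (A y X) (br (A y Y) (A y Z)) + br (A y Y) (br (A y Z) (A y X)) + br (A y Z) (br (A y X) (A y Y)) = 0"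
    using jacobi[of "A y X" "A y Y" "A y Z"] br_anti[of "br (A y X) (A y Y)" "A y Z"] br_anti[of "A y X" "A y Z"] by (simp add: br_lin)
  have b: "br (A y X) (F y Y Z) = br (A y X) (dd (\<lambda>z. A z Z) y Y) - br (A y X) (dd (\<lambda>z. A z Y) y Z) + br (A y X) (br (A y Y) (A y Z))" for X Y Z
    by (simp add: F_def br_lin)
  have "cov F y X Y Z + cov F y Y Z X + cov F y Z X Y =
     br (A y X) (br (A y Y) (A y Z)) + br (A y Y) (br (A y Z) (A y X)) + br (A y Z) (br (A y X) (A y Y))"
    unfolding cov_def dF b g f a by (simp add: c algebra_simps)
  then show ?thesis using j by simp
qed

text \<open>Subtracting the derivative along \<open>\<Gamma> y W X\<close> gives the second
  covariant derivative, which is tensorial in both directions and can therefore be traced over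
  them.\<close>

definition cov2F :: "'a \<Rightarrow> 'a \<Rightarrow> 'a \<Rightarrow> 'a \<Rightarrow> 'a \<Rightarrow> 'w"
  where "cov2F y W X Y Z = cov (\<lambda>y. cov F y X) y W Y Z - cov F y (\<Gamma> y W X) Y Z"

lemma diff_covF: "y \<in> D \<Longrightarrow> (\<lambda>z. cov F z X Y Z) differentiable (at y)"
  by (rule smooth_on_differentiable[OF smooth_cov[OF tensor2_F]])

lemma cov2F_eq: "cov2F y W X Y Z = dd (\<lambda>z. cov F z X Y Z) y W + br (A y W) (cov F y X Y Z)
    - cov F y (\<Gamma> y W X) Y Z - cov F y X (\<Gamma> y W Y) Z - cov F y X Y (\<Gamma> y W Z)"
  unfolding cov2F_def cov_def[of "\<lambda>y. cov F y X"] by simp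

text \<open>The derivative of the Bianchi identity: the connection terms group into three further
  instances of it, each with one argument replaced by its image under
  \<open>\<Gamma> y W\<close>.\<close>

lemma bianchi2:
  assumes y: "y \<in> D"
  shows "cov2F y W X Y Z + cov2F y W Y Z X + cov2F y W Z X Y = 0"
proof -
  note d = diff_covF[OF y]
  have "dd (\<lambda>z. cov F z X Y Z) y W + dd (\<lambda>z. cov F z Y Z X) y W + dd (\<lambda>z. cov F z Z X Y) y W
     = dd (\<lambda>z. cov F z X Y Z + cov F z Y Z X + cov F z Z X Y) y W"
    by (simp only: dd_add[OF d d] dd_add[OF differentiable_add[OF d d] d])
  also have "\<dots> = 0" by (rule dd_eq_0_open[OF open_D y]) (rule bianchi)
  finally have 1: "dd (\<lambda>z. cov F z X Y Z) y W + dd (\<lambda>z. cov F z Y Z X) y W + dd (\<lambda>z. cov F z Z X Y) y W = 0" .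
  have 2: "br (A y W) (cov F y X Y Z) + br (A y W) (cov F y Y Z X) + br (A y W) (cov F y Z X Y) = 0"
    unfolding br_lin(2)[symmetric] bianchi[OF y] by (rule br_lin)
  have "cov2F y W X Y Z + cov2F y W Y Z X + cov2F y W Z X Y =
     (dd (\<lambda>z. cov F z X Y Z) y W + dd (\<lambda>z. cov F z Y Z X) y W + dd (\<lambda>z. cov F z Z X Y) y W)
    + (br (A y W) (cov F y X Y Z) + br (A y W) (cov F y Y Z X) + br (A y W) (cov F y Z X Y))
    - (cov F y (\<Gamma> y W X) Y Z + cov F y Y Z (\<Gamma> y W X) + cov F y Z (\<Gamma> y W X) Y)
    - (cov F y X (\<Gamma> y W Y) Z + cov F y (\<Gamma> y W Y) Z X + cov F y Z X (\<Gamma> y W Y))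
    - (cov F y X Y (\<Gamma> y W Z) + cov F y Y (\<Gamma> y W Z) X + cov F y (\<Gamma> y W Z) X Y)"
    unfolding cov2F_eq by (simp add: algebra_simps)
  then show ?thesis unfolding 1 2 bianchi[OF y] by simp
qed

lemma cov2F_anti: assumes y: "y \<in> D" shows "cov2F y W X Y Z = - cov2F y W X Z Y"
proof -
  have "dd (\<lambda>z. cov F z X Y Z) y W = dd (\<lambda>z. - cov F z X Z Y) y W"
    by (rule dd_cong_open[OF open_D y]) (rule cov_F_anti)
  also have "\<dots> = - dd (\<lambda>z. cov F z X Z Y) y W" by (rule dd_minus[OF diff_covF[OF y]])
  finally show ?thesis
    unfolding cov2F_eq using cov_F_anti[OF y, of X Y Z] cov_F_anti[OF y, of "\<Gamma> y W X" Y Z]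
      cov_F_anti[OF y, of X "\<Gamma> y W Y" Z] cov_F_anti[OF y, of X Y "\<Gamma> y W Z"] by (simp add: br_lin)
qed

text \<open>The correction that distinguishes \<open>cov2F\<close> from the iterated derivative is
  symmetric in the two directions and drops out of the commutator.\<close>

lemma cov2F_commute:
  assumes y: "y \<in> D"
  shows "cov2F y W Z U V - cov2F y Z W U V = br (F y W Z) (F y U V) - F y (R y W Z U) V - F y U (R y W Z V)"
  using ricci_identity[OF tensor2_F y, of Z W U V] \<Gamma>_sym[OF y, of W Z] by (simp add: cov2F_def)

subsection \<open>Traces\<close>

lemma tr_add: "tr y (\<lambda>X Y. b X Y + c X Y) = tr y b + tr y c"
  by (simp add: tr_def scaleR_add_right sum.distrib)

lemma tr_diff: "tr y (\<lambda>X Y. b X Y - c X Y) = tr y b - tr y c"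
  by (simp add: tr_def scaleR_diff_right sum_subtractf)

lemma tr_linear: "linear L \<Longrightarrow> L (tr y b) = tr y (\<lambda>X Y. L (b X Y))"
  by (simp add: tr_def linear_sum linear_scale)

text \<open>Since \<open>\<gamma>\<close> is parallel, its derivative is exactly the sum that moves
  onto the two arguments of \<open>b\<close>; contraction thus commutes with covariant
  differentiation.\<close>

lemma dd_tr:
  fixes b :: "'a \<Rightarrow> 'a \<Rightarrow> 'a \<Rightarrow> 'v::real_normed_vector"
  assumes y: "y \<in> D" and bl: "bilinear (b y)" and d: "\<And>X Y. (\<lambda>z. b z X Y) differentiable (at y)"
  shows "(\<lambda>z. tr z (b z)) differentiable (at y)"
    "dd (\<lambda>z. tr z (b z)) y W = tr y (\<lambda>X Y. dd (\<lambda>z. b z X Y) y W - b y (\<Gamma> y W X) Y - b y X (\<Gamma> y W Y))"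
proof -
  note dg = smooth_on_differentiable[OF smooth_\<gamma> y]
  note l = bilinearD[OF bl]
  have dgb: "(\<lambda>z. \<gamma> z i j *\<^sub>R b z i j) differentiable (at y)" if "i \<in> Basis" "j \<in> Basis" for i j
    by (rule differentiable_bilinear[OF bounded_bilinear_scaleR dg d]) (use that in auto)
  have dsum: "(\<lambda>z. \<Sum>j\<in>Basis. \<gamma> z i j *\<^sub>R b z i j) differentiable (at y)" if "i \<in> Basis" for i
    by (rule differentiable_sum) (use dgb that in auto)
  show "(\<lambda>z. tr z (b z)) differentiable (at y)"
    unfolding tr_def by (rule differentiable_sum) (use dsum in auto)
  have rep1: "(\<Sum>i\<in>Basis. (v \<bullet> i) *\<^sub>R b y i Y) = b y v Y" for v Y
    using arg_cong[OF euclidean_representation[of v], of "\<lambda>v. b y v Y"] by (simp add: linear_sum[OF l(2)] linear_scale[OF l(2)])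
  have rep2: "(\<Sum>i\<in>Basis. (v \<bullet> i) *\<^sub>R b y Y i) = b y Y v" for v Y
    using arg_cong[OF euclidean_representation[of v], of "b y Y"] by (simp add: linear_sum[OF l(1)] linear_scale[OF l(1)])
  have "dd (\<lambda>z. tr z (b z)) y W = (\<Sum>i\<in>Basis. \<Sum>j\<in>Basis. dd (\<lambda>z. \<gamma> z i j *\<^sub>R b z i j) y W)"
    unfolding tr_def by (subst dd_sum[OF dsum], assumption, rule sum.cong[OF refl], rule dd_sum) (rule dgb)
  also have "\<dots> = (\<Sum>i\<in>Basis. \<Sum>j\<in>Basis. dd (\<lambda>z. \<gamma> z i j) y W *\<^sub>R b y i j + \<gamma> y i j *\<^sub>R dd (\<lambda>z. b z i j) y W)"
    by (intro sum.cong refl dd_scaleR dg d)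
  also have "\<dots> = (\<Sum>i\<in>Basis. \<Sum>j\<in>Basis. dd (\<lambda>z. \<gamma> z i j) y W *\<^sub>R b y i j) + tr y (\<lambda>X Y. dd (\<lambda>z. b z X Y) y W)"
    by (simp add: sum.distrib tr_def)
  also have "(\<Sum>i\<in>Basis. \<Sum>j\<in>Basis. dd (\<lambda>z. \<gamma> z i j) y W *\<^sub>R b y i j) =
     (\<Sum>i\<in>Basis. \<Sum>j\<in>Basis. - ((\<Sum>k\<in>Basis. \<gamma> y k j *\<^sub>R (\<Gamma> y W k \<bullet> i) *\<^sub>R b y i j) + (\<Sum>k\<in>Basis. \<gamma> y i k *\<^sub>R (\<Gamma> y W k \<bullet> j) *\<^sub>R b y i j)))"
    by (intro sum.cong refl) (simp add: \<gamma>_parallel[OF y] scaleR_sum_left scaleR_diff_left sum.distrib)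
  also have "\<dots> = - (\<Sum>i\<in>Basis. \<Sum>j\<in>Basis. \<Sum>k\<in>Basis. \<gamma> y k j *\<^sub>R (\<Gamma> y W k \<bullet> i) *\<^sub>R b y i j) - (\<Sum>i\<in>Basis. \<Sum>j\<in>Basis. \<Sum>k\<in>Basis. \<gamma> y i k *\<^sub>R (\<Gamma> y W k \<bullet> j) *\<^sub>R b y i j)"
    by (simp add: sum.distrib sum_negf sum_subtractf)
  also have "(\<Sum>i\<in>Basis. \<Sum>j\<in>Basis. \<Sum>k\<in>Basis. \<gamma> y k j *\<^sub>R (\<Gamma> y W k \<bullet> i) *\<^sub>R b y i j) = tr y (\<lambda>X Y. b y (\<Gamma> y W X) Y)"
  proof -
    have "(\<Sum>i\<in>Basis. \<Sum>j\<in>Basis. \<Sum>k\<in>Basis. \<gamma> y k j *\<^sub>R (\<Gamma> y W k \<bullet> i) *\<^sub>R b y i j)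
       = (\<Sum>i\<in>Basis. \<Sum>k\<in>Basis. \<Sum>j\<in>Basis. \<gamma> y k j *\<^sub>R (\<Gamma> y W k \<bullet> i) *\<^sub>R b y i j)" by (intro sum.cong refl sum.swap)
    also have "\<dots> = (\<Sum>k\<in>Basis. \<Sum>j\<in>Basis. \<Sum>i\<in>Basis. \<gamma> y k j *\<^sub>R (\<Gamma> y W k \<bullet> i) *\<^sub>R b y i j)"
      by (subst sum.swap) (intro sum.cong refl sum.swap)
    also have "\<dots> = tr y (\<lambda>X Y. b y (\<Gamma> y W X) Y)" by (simp only: tr_def scaleR_sum_right[symmetric] rep1)
    finally show ?thesis .
  qed
  also have "(\<Sum>i\<in>Basis. \<Sum>j\<in>Basis. \<Sum>k\<in>Basis. \<gamma> y i k *\<^sub>R (\<Gamma> y W k \<bullet> j) *\<^sub>R b y i j) = tr y (\<lambda>X Y. b y X (\<Gamma> y W Y))"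
  proof -
    have "(\<Sum>i\<in>Basis. \<Sum>j\<in>Basis. \<Sum>k\<in>Basis. \<gamma> y i k *\<^sub>R (\<Gamma> y W k \<bullet> j) *\<^sub>R b y i j)
       = (\<Sum>i\<in>Basis. \<Sum>k\<in>Basis. \<Sum>j\<in>Basis. \<gamma> y i k *\<^sub>R (\<Gamma> y W k \<bullet> j) *\<^sub>R b y i j)" by (intro sum.cong refl sum.swap)
    also have "\<dots> = tr y (\<lambda>X Y. b y X (\<Gamma> y W Y))" by (simp only: tr_def scaleR_sum_right[symmetric] rep2)
    finally show ?thesis .
  qed
  finally show "dd (\<lambda>z. tr z (b z)) y W = tr y (\<lambda>X Y. dd (\<lambda>z. b z X Y) y W - b y (\<Gamma> y W X) Y - b y X (\<Gamma> y W Y))"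
    by (simp add: tr_diff)
qed

text \<open>Orthonormality expressed through the inverse metric: \<open>\<gamma>\<close> is the sum
  of the tensors \<open>e \<otimes> e\<close>. The cardinality enters the constant of the Kato
  inequality.\<close>

definition coframe :: "'a \<Rightarrow> 'a set \<Rightarrow> bool"
  where "coframe y S \<longleftrightarrow> finite S \<and> card S = DIM('a) \<and> (\<forall>i\<in>Basis. \<forall>j\<in>Basis. \<gamma> y i j = (\<Sum>e\<in>S. (e \<bullet> i) * (e \<bullet> j)))"

lemma tr_coframe:
  fixes b :: "'a \<Rightarrow> 'a \<Rightarrow> 'v::real_normed_vector"
  assumes S: "coframe y S" and b: "bilinear b"
  shows "tr y b = (\<Sum>e\<in>S. b e e)"
proof -
  note l = bilinearD[OF b]
  have e: "b e e = (\<Sum>i\<in>Basis. \<Sum>j\<in>Basis. ((e \<bullet> i) * (e \<bullet> j)) *\<^sub>R b i j)" for e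
  proof -
    have "b e e = b (\<Sum>i\<in>Basis. (e \<bullet> i) *\<^sub>R i) (\<Sum>j\<in>Basis. (e \<bullet> j) *\<^sub>R j)" by (simp add: euclidean_representation)
    also have "\<dots> = (\<Sum>i\<in>Basis. (e \<bullet> i) *\<^sub>R (\<Sum>j\<in>Basis. (e \<bullet> j) *\<^sub>R b i j))"
      by (subst linear_sum[OF l(2)], intro sum.cong refl, subst linear_scale[OF l(2)], subst linear_sum[OF l(1)])
        (simp only: linear_scale[OF l(1)])
    finally show ?thesis by (simp add: scaleR_sum_right)
  qed
  have "tr y b = (\<Sum>i\<in>Basis. \<Sum>j\<in>Basis. \<Sum>e\<in>S. ((e \<bullet> i) * (e \<bullet> j)) *\<^sub>R b i j)"
    unfolding tr_def by (intro sum.cong refl) (use S in \<open>simp add: coframe_def scaleR_sum_left\<close>)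
  also have "\<dots> = (\<Sum>i\<in>Basis. \<Sum>e\<in>S. \<Sum>j\<in>Basis. ((e \<bullet> i) * (e \<bullet> j)) *\<^sub>R b i j)" by (intro sum.cong refl sum.swap)
  also have "\<dots> = (\<Sum>e\<in>S. b e e)" unfolding e by (rule sum.swap)
  finally show ?thesis .
qed

definition ip :: "'a \<Rightarrow> ('a \<Rightarrow> 'a \<Rightarrow> 'w) \<Rightarrow> ('a \<Rightarrow> 'a \<Rightarrow> 'w) \<Rightarrow> real"
  where "ip y \<omega> \<eta> = 1/2 * tr y (\<lambda>X X'. tr y (\<lambda>Y Y'. \<kappa> (\<omega> X Y) (\<eta> X' Y')))"

lemma linear_\<kappa>: "linear (\<kappa> a)" "linear (\<lambda>x. \<kappa> x a)"
  by (auto intro!: linearI simp: \<kappa>_lin)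

lemma bilinear_tr:
  fixes b :: "'a \<Rightarrow> 'a \<Rightarrow> 'a \<Rightarrow> 'a \<Rightarrow> 'v::real_normed_vector"
  assumes "\<And>X' Y Y'. linear (\<lambda>X. b X X' Y Y')" "\<And>X Y Y'. linear (\<lambda>X'. b X X' Y Y')"
  shows "bilinear (\<lambda>X X'. tr y (b X X'))"
proof (rule bilinearI'; rule linearI)
  fix X X' a c
  have "b (X + X') a = (\<lambda>Y Y'. b X a Y Y' + b X' a Y Y')" "b a (X + X') = (\<lambda>Y Y'. b a X Y Y' + b a X' Y Y')"
    by (auto simp: fun_eq_iff linear_add[OF assms(1)] linear_add[OF assms(2)])
  then show "tr y (b (X + X') a) = tr y (b X a) + tr y (b X' a)" "tr y (b a (X + X')) = tr y (b a X) + tr y (b a X')" by (simp_all add: tr_add)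
next
  fix X a :: 'a and c :: real
  have "b (c *\<^sub>R X) a = (\<lambda>Y Y'. c *\<^sub>R b X a Y Y')" "b a (c *\<^sub>R X) = (\<lambda>Y Y'. c *\<^sub>R b a X Y Y')"
    by (auto simp: fun_eq_iff linear_scale[OF assms(1)] linear_scale[OF assms(2)])
  moreover have "linear (\<lambda>v. c *\<^sub>R v :: 'v)" by (rule bounded_linear.linear[OF bounded_linear_scaleR_right])
  ultimately show "tr y (b (c *\<^sub>R X) a) = c *\<^sub>R tr y (b X a)" "tr y (b a (c *\<^sub>R X)) = c *\<^sub>R tr y (b a X)"
    by (simp_all add: tr_linear[symmetric])
qed

lemma linear_\<kappa>_comp:
  "linear f \<Longrightarrow> linear (\<lambda>x. \<kappa> (f x) a)" "linear f \<Longrightarrow> linear (\<lambda>x. \<kappa> a (f x))"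
  by (auto intro!: linearI simp: \<kappa>_lin linear_add linear_scale)

lemma ip_coframe:
  assumes S: "coframe y S" and w: "bilinear \<omega>" "bilinear \<eta>"
  shows "ip y \<omega> \<eta> = 1/2 * (\<Sum>a\<in>S. \<Sum>b\<in>S. \<kappa> (\<omega> a b) (\<eta> a b))"
proof -
  have "bilinear (\<lambda>Y Y'. \<kappa> (\<omega> X Y) (\<eta> X' Y'))" for X X'
    by (rule bilinearI') (intro linear_\<kappa>_comp bilinearD w)+
  then have 1: "tr y (\<lambda>Y Y'. \<kappa> (\<omega> X Y) (\<eta> X' Y')) = (\<Sum>b\<in>S. \<kappa> (\<omega> X b) (\<eta> X' b))" for X X'
    using tr_coframe[OF S] by blast
  have "bilinear (\<lambda>X X'. tr y (\<lambda>Y Y'. \<kappa> (\<omega> X Y) (\<eta> X' Y')))"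
    by (rule bilinear_tr) (intro linear_\<kappa>_comp bilinearD w)+
  from tr_coframe[OF S this] show ?thesis by (simp add: ip_def 1)
qed

text \<open>The inner product is parallel: \<open>dd_tr\<close> absorbs the connection terms of the
  form slots, and \<open>\<kappa>_inv\<close> the brackets with \<open>A\<close>.\<close>

lemma dd_ip:
  assumes t: "tensor2 \<omega>" "tensor2 \<eta>" and y: "y \<in> D"
  shows "(\<lambda>z. ip z (\<omega> z) (\<eta> z)) differentiable (at y)"
    "dd (\<lambda>z. ip z (\<omega> z) (\<eta> z)) y W = ip y (cov \<omega> y W) (\<eta> y) + ip y (\<omega> y) (cov \<eta> y W)"
proof -
  note w = tensor2D[OF t(1)] and e = tensor2D[OF t(2)]
  have dk: "(\<lambda>z. \<kappa> (\<omega> z X Y) (\<eta> z X' Y')) differentiable (at y)" for X X' Y Y'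
    by (rule differentiable_bilinear[OF \<kappa> w(3)[OF y] e(3)[OF y]])
  have bk: "bilinear (\<lambda>Y Y'. \<kappa> (\<omega> y X Y) (\<eta> y X' Y'))" for X X'
    by (rule bilinearI') (intro linear_\<kappa>_comp bilinearD w(1)[OF y] e(1)[OF y])+
  note 1 = dd_tr[OF y bk dk]
  have bt: "bilinear (\<lambda>X X'. tr y (\<lambda>Y Y'. \<kappa> (\<omega> y X Y) (\<eta> y X' Y')))"
    by (rule bilinear_tr) (intro linear_\<kappa>_comp bilinearD w(1)[OF y] e(1)[OF y])+
  note 2 = dd_tr[OF y bt 1(1)]
  show "(\<lambda>z. ip z (\<omega> z) (\<eta> z)) differentiable (at y)" unfolding ip_def
    by (rule differentiable_bounded_linear[OF bounded_linear_mult_right 2(1)])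
  have k: "dd (\<lambda>z. \<kappa> (\<omega> z X Y) (\<eta> z X' Y')) y W - \<kappa> (\<omega> y X (\<Gamma> y W Y)) (\<eta> y X' Y') - \<kappa> (\<omega> y X Y) (\<eta> y X' (\<Gamma> y W Y'))
     = \<kappa> (cov \<omega> y W X Y) (\<eta> y X' Y') + \<kappa> (\<omega> y X Y) (cov \<eta> y W X' Y') + \<kappa> (\<omega> y (\<Gamma> y W X) Y) (\<eta> y X' Y') + \<kappa> (\<omega> y X Y) (\<eta> y (\<Gamma> y W X') Y')" for X X' Y Y'
    using \<kappa>_inv[OF y, of W "\<omega> y X Y" "\<eta> y X' Y'"]
    by (simp add: dd_bilinear[OF \<kappa> w(3)[OF y] e(3)[OF y]] cov_def \<kappa>_lin)
  have "dd (\<lambda>z. ip z (\<omega> z) (\<eta> z)) y W = 1/2 * dd (\<lambda>z. tr z (\<lambda>X X'. tr z (\<lambda>Y Y'. \<kappa> (\<omega> z X Y) (\<eta> z X' Y')))) y W"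
    unfolding ip_def by (rule dd_bounded_linear[OF bounded_linear_mult_right 2(1)])
  then show "dd (\<lambda>z. ip z (\<omega> z) (\<eta> z)) y W = ip y (cov \<omega> y W) (\<eta> y) + ip y (\<omega> y) (cov \<eta> y W)"
    unfolding 2(2) 1(2) k by (simp add: tr_add ip_def distrib_left)
qed

lemma tr_sym_ip: "coframe y S \<Longrightarrow> bilinear \<omega> \<Longrightarrow> bilinear \<eta> \<Longrightarrow> ip y \<omega> \<eta> = ip y \<eta> \<omega>"
  by (simp add: ip_coframe \<kappa>_sym)

end

text \<open>Nonnegativity at \<open>a - b\<close> bounds every cross term by the mean of two
  squares. The form may degenerate because it will be \<open>\<kappa>\<close> composed with a
  projection.\<close>

lemma psd_sum_le:
  fixes k :: "'w::real_vector \<Rightarrow> 'w \<Rightarrow> real"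
  assumes "bilinear k" "\<And>a b. k a b = k b a" "\<And>a. k a a \<ge> 0" "finite K"
  shows "k (\<Sum>i\<in>K. w i) (\<Sum>i\<in>K. w i) \<le> real (card K) * (\<Sum>i\<in>K. k (w i) (w i))"
proof -
  note l = bilinearD[OF assms(1)]
  have h: "k a b \<le> (k a a + k b b) / 2" for a b
    using assms(3)[of "a - b"] assms(2)[of a b] by (simp add: linear_diff[OF l(1)] linear_diff[OF l(2)])
  have "k (\<Sum>i\<in>K. w i) (\<Sum>i\<in>K. w i) = (\<Sum>i\<in>K. \<Sum>j\<in>K. k (w i) (w j))"
    by (subst linear_sum[OF l(2)], subst linear_sum[OF l(1)]) simp
  also have "\<dots> \<le> (\<Sum>i\<in>K. \<Sum>j\<in>K. (k (w i) (w i) + k (w j) (w j)) / 2)" by (intro sum_mono h)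
  also have "\<dots> = real (card K) * (\<Sum>i\<in>K. k (w i) (w i))"
    by (simp add: add_divide_distrib sum.distrib sum_distrib_left[symmetric] sum_divide_distrib[symmetric])
  finally show ?thesis .
qed

text \<open>
  Write \<open>T k i j\<close> for the derivative in direction \<open>k\<close> of a closed and coclosed two-form. Coclosedness
  expresses \<open>T o o j\<close> through the \<open>card S - 2\<close> terms \<open>T k k j\<close> with \<open>k \<noteq> o, j\<close>, and closedness
  expresses \<open>T o i j\<close> through two terms \<open>T i o j\<close>.
\<close>

lemma refined_kato:
  fixes k :: "'w::real_vector \<Rightarrow> 'w \<Rightarrow> real" and T :: "'a \<Rightarrow> 'a \<Rightarrow> 'a \<Rightarrow> 'w"
  assumes k: "bilinear k" "\<And>a b. k a b = k b a" "\<And>a. k a a \<ge> 0" and S: "finite S" "o1 \<in> S" "card S \<ge> 4"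
    and anti: "\<And>a b c. T a b c = - T a c b"
    and closed: "\<And>a b c. T a b c + T b c a + T c a b = 0"
    and coclosed: "\<And>c. (\<Sum>a\<in>S. T a a c) = 0"
  shows "(real (card S) - 1) * (\<Sum>i\<in>S. \<Sum>j\<in>S. k (T o1 i j) (T o1 i j))
      \<le> (real (card S) - 2) * (\<Sum>a\<in>S. \<Sum>i\<in>S. \<Sum>j\<in>S. k (T a i j) (T a i j))"
proof -
  define n where "n w = k w w" for w
  define S' where "S' = S - {o1}"
  define N where "N = real (card S) - 2"
  note l = bilinearD[OF k(1)]
  have N: "N \<ge> 2" using S(3) by (simp add: N_def)
  have fS': "finite S'" using S by (simp add: S'_def)
  have nn: "n w \<ge> 0" for w using k(3) by (simp add: n_def)
  have nm: "n (- w) = n w" for w by (simp add: n_def linear_neg[OF l(1)] linear_neg[OF l(2)])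
  have n0: "n 0 = 0" by (simp add: n_def linear_0[OF l(1)])
  have Taa: "T a b b = 0" for a b using anti[of a b b] by (metis add_eq_0_iff2 scaleR_2 scale_eq_0_iff zero_neq_numeral eq_neg_iff_add_eq_0)
  have sp: "(\<Sum>i\<in>S. f i) = f o1 + (\<Sum>i\<in>S'. f i)" for f :: "'a \<Rightarrow> real" unfolding S'_def by (rule sum.remove[OF S(1,2)])
  have nsym: "n (T a i j) = n (T a j i)" for a i j using nm[of "T a j i"] anti[of a i j] by simp
  \<comment> \<open>\<open>P\<close> collects the components that involve \<open>o1\<close> and
    \<open>W\<close> those that do not; by antisymmetry the full square \<open>Q\<close> counts the
    former twice.\<close>
  define Q where "Q a = (\<Sum>i\<in>S. \<Sum>j\<in>S. n (T a i j))" for a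
  define P where "P a = (\<Sum>j\<in>S'. n (T a o1 j))" for a
  define W where "W a = (\<Sum>i\<in>S'. \<Sum>j\<in>S'. n (T a i j))" for a
  have Q: "Q a = 2 * P a + W a" for a
    unfolding Q_def sp by (simp add: sum.distrib P_def W_def Taa n0 nsym[of a _ o1])
  \<comment> \<open>In the coclosedness relation the summand \<open>a = o1\<close> is isolated and
    \<open>a = j\<close> vanishes by antisymmetry, which leaves \<open>card S - 2\<close>
    terms.\<close>
  have Tk: "n (T o1 o1 j) \<le> N * (\<Sum>a\<in>S'. n (T a a j))" if j: "j \<in> S'" for j
  proof -
    have "T o1 o1 j + (\<Sum>a\<in>S'. T a a j) = 0" using coclosed[of j] unfolding S'_def by (subst (asm) sum.remove[OF S(1,2)])
    moreover have "(\<Sum>a\<in>S'. T a a j) = (\<Sum>a\<in>S' - {j}. T a a j)" using sum.remove[OF fS' j, of "\<lambda>a. T a a j"] by (simp add: Taa)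
    ultimately have "n (T o1 o1 j) = n (\<Sum>a\<in>S' - {j}. T a a j)" using nm by (metis add_eq_0_iff2)
    also have "\<dots> \<le> real (card (S' - {j})) * (\<Sum>a\<in>S' - {j}. n (T a a j))"
      unfolding n_def by (rule psd_sum_le[OF k]) (use fS' in auto)
    also have "real (card (S' - {j})) = N" using S j fS' by (simp add: S'_def N_def)
    also have "(\<Sum>a\<in>S' - {j}. n (T a a j)) = (\<Sum>a\<in>S'. n (T a a j))" using sum.remove[OF fS' j, of "\<lambda>a. n (T a a j)"] by (simp add: Taa n0)
    finally show ?thesis .
  qed
  have A1: "P o1 \<le> N * (\<Sum>a\<in>S'. \<Sum>j\<in>S'. n (T a a j))"
  proof -
    have "P o1 \<le> (\<Sum>j\<in>S'. N * (\<Sum>a\<in>S'. n (T a a j)))" unfolding P_def by (intro sum_mono Tk)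
    also have "\<dots> = N * (\<Sum>j\<in>S'. \<Sum>a\<in>S'. n (T a a j))" by (rule sum_distrib_left[symmetric])
    also have "(\<Sum>j\<in>S'. \<Sum>a\<in>S'. n (T a a j)) = (\<Sum>a\<in>S'. \<Sum>j\<in>S'. n (T a a j))" by (rule sum.swap)
    finally show ?thesis .
  qed
  have A2: "W o1 \<le> 4 * (\<Sum>a\<in>S'. P a)"
  proof -
    have h: "n (T o1 i j) \<le> 2 * (n (T i o1 j) + n (T j o1 i))" for i j
    proof -
      have e: "T o1 i j = T i o1 j - T j o1 i" using closed[of o1 i j] anti[of i j o1] by (simp add: algebra_simps add_eq_0_iff)
      have "n (a - b) \<le> 2 * (n a + n b)" for a b
        using nn[of "a + b"] k(2)[of a b] by (simp add: n_def linear_diff[OF l(1)] linear_diff[OF l(2)] linear_add[OF l(1)] linear_add[OF l(2)])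
      then show ?thesis unfolding e .
    qed
    have "W o1 \<le> (\<Sum>i\<in>S'. \<Sum>j\<in>S'. 2 * (n (T i o1 j) + n (T j o1 i)))" unfolding W_def by (intro sum_mono h)
    also have "\<dots> = 2 * ((\<Sum>i\<in>S'. \<Sum>j\<in>S'. n (T i o1 j)) + (\<Sum>i\<in>S'. \<Sum>j\<in>S'. n (T j o1 i)))"
      by (simp add: sum.distrib sum_distrib_left[symmetric])
    also have "(\<Sum>i\<in>S'. \<Sum>j\<in>S'. n (T j o1 i)) = (\<Sum>i\<in>S'. \<Sum>j\<in>S'. n (T i o1 j))" by (rule sum.swap)
    finally show ?thesis by (simp add: P_def)
  qed
  \<comment> \<open>By antisymmetry \<open>T a a j\<close> reappears with its last two indices
    exchanged, so \<open>W a\<close> counts it twice.\<close>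
  have A3: "2 * (\<Sum>j\<in>S'. n (T a a j)) \<le> W a" if a: "a \<in> S'" for a
  proof -
    have 1: "(\<Sum>j\<in>S'. n (T a i j)) \<ge> n (T a i a)" for i by (rule member_le_sum[OF a]) (use nn fS' in auto)
    have "W a = (\<Sum>j\<in>S'. n (T a a j)) + (\<Sum>i\<in>S' - {a}. \<Sum>j\<in>S'. n (T a i j))"
      unfolding W_def by (rule sum.remove[OF fS' a])
    also have "\<dots> \<ge> (\<Sum>j\<in>S'. n (T a a j)) + (\<Sum>i\<in>S' - {a}. n (T a i a))" using 1 by (intro add_left_mono sum_mono)
    finally have "W a \<ge> (\<Sum>j\<in>S'. n (T a a j)) + (\<Sum>i\<in>S' - {a}. n (T a i a))" .
    moreover have "(\<Sum>i\<in>S' - {a}. n (T a i a)) = (\<Sum>j\<in>S'. n (T a a j))"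
      using sum.remove[OF fS' a, of "\<lambda>j. n (T a a j)"] by (simp add: Taa n0 nsym[of a _ a])
    ultimately show ?thesis by simp
  qed
  have "Q o1 \<le> N * (2 * (\<Sum>a\<in>S'. \<Sum>j\<in>S'. n (T a a j))) + 4 * (\<Sum>a\<in>S'. P a)" unfolding Q using A1 A2 by simp
  also have "2 * (\<Sum>a\<in>S'. \<Sum>j\<in>S'. n (T a a j)) \<le> (\<Sum>a\<in>S'. W a)"
    unfolding sum_distrib_left[of 2 "\<lambda>a. \<Sum>j\<in>S'. n (T a a j)" S'] by (rule sum_mono) (rule A3)
  \<comment> \<open>Dimension at least four enters here: the constant 4 produced by closedness must
    not exceed \<open>2 * N\<close>.\<close>
  also have "4 * (\<Sum>a\<in>S'. P a) \<le> N * (2 * (\<Sum>a\<in>S'. P a))"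
    using mult_right_mono[OF N, of "2 * (\<Sum>a\<in>S'. P a)"] by (simp add: P_def sum_nonneg nn)
  finally have "Q o1 \<le> N * (\<Sum>a\<in>S'. W a) + N * (2 * (\<Sum>a\<in>S'. P a))" using N by simp
  also have "\<dots> = N * (\<Sum>a\<in>S'. Q a)" by (simp add: Q sum.distrib sum_distrib_left distrib_left)
  finally have "Q o1 \<le> N * (\<Sum>a\<in>S'. Q a)" .
  \<comment> \<open>Adding \<open>N * Q o1\<close> to both sides completes the sum over
    \<open>S'\<close> to the sum over \<open>S\<close>.\<close>
  then have "(N + 1) * Q o1 \<le> N * (\<Sum>a\<in>S. Q a)" unfolding sp by (simp add: algebra_simps)
  then show ?thesis by (simp add: Q_def N_def n_def)
qed

section \<open>The Weitzenboeck formula and the combined Bochner-Kato inequality\<close>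

context bundle_field
begin

text \<open>The right-hand side of the Weitzenboeck formula, written in a frame; it splits into
  \<open>Ftilde\<close> and the operator \<open>K\<close> once the Ricci endomorphism is recognised
  in it.\<close>

definition weitz :: "'a \<Rightarrow> 'a set \<Rightarrow> 'a \<Rightarrow> 'a \<Rightarrow> 'w"
  where "weitz y S X Y = (\<Sum>e\<in>S. 2 *\<^sub>R br (F y X e) (F y Y e) + F y (R y X e e) Y + F y X (R y Y e e) - F y (R y X Y e) e)"

lemma R_bianchi: "y \<in> D \<Longrightarrow> R y X Y Z + R y Y Z X + R y Z X Y = 0"
proof -
  assume y: "y \<in> D"
  have d: "dd (\<lambda>z. \<Gamma> z X Y) y Z = dd (\<lambda>z. \<Gamma> z Y X) y Z" for X Y Z
    by (rule dd_cong_open[OF open_D y]) (rule \<Gamma>_sym)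
  show ?thesis unfolding R_def
    by (simp add: d[of Y X] d[of Z X] d[of Z Y] \<Gamma>_sym[OF y, of Y X] \<Gamma>_sym[OF y, of Z X] \<Gamma>_sym[OF y, of Z Y])
qed

lemma R_anti: "R y X Y Z = - R y Y X Z" by (simp add: R_def)

lemma bilinear_covF_trace: "y \<in> D \<Longrightarrow> bilinear (\<lambda>X Y. cov F y X Y Z)"
  by (rule bilinearI'[OF linear_cov[OF tensor2_F]]) (use bilinearD(2)[OF bilinear_cov[OF tensor2_F]] in auto)

lemma ip_nonneg: "coframe y S \<Longrightarrow> bilinear \<omega> \<Longrightarrow> ip y \<omega> \<omega> \<ge> 0"
  by (auto simp: ip_coframe intro!: sum_nonneg \<kappa>_nonneg)

text \<open>The square norm of \<open>a + t b\<close> is a nonnegative polynomial in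
  \<open>t\<close>. As the form may degenerate, a vanishing leading coefficient is a case of its
  own.\<close>

lemma ip_Cauchy_Schwarz:
  assumes S: "coframe y S" and ab: "bilinear a" "bilinear b"
  shows "(ip y a b)\<^sup>2 \<le> ip y a a * ip y b b"
proof -
  note pos = ip_nonneg[OF S] and ipS = ip_coframe[OF S]
  have q: "0 \<le> ip y a a + 2 * t * ip y a b + t\<^sup>2 * ip y b b" for t :: real
  proof -
    have bt: "bilinear (\<lambda>X Y. a X Y + t *\<^sub>R b X Y)"
      by (rule bilinearI'; intro linear_compose_add linear_compose_scale_right bilinearD ab)
    have "ip y (\<lambda>X Y. a X Y + t *\<^sub>R b X Y) (\<lambda>X Y. a X Y + t *\<^sub>R b X Y) = ip y a a + 2 * t * ip y a b + t\<^sup>2 * ip y b b"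
      unfolding ipS[OF bt bt] ipS[OF ab(1) ab(1)] ipS[OF ab] ipS[OF ab(2) ab(2)]
      by (simp add: \<kappa>_lin \<kappa>_sym[of "b _ _" "a _ _"] sum.distrib sum_distrib_left[symmetric] algebra_simps power2_eq_square)
    then show ?thesis using pos[OF bt] by simp
  qed
  show ?thesis
  proof (cases "ip y b b = 0")
    case True
    have "ip y a b = 0"
    proof (rule ccontr)
      assume n: "ip y a b \<noteq> 0"
      \<comment> \<open>For vanishing \<open>ip y b b\<close> the polynomial is affine, and this
        \<open>t\<close> gives it the value -1.\<close>
      from q[of "- (ip y a a + 1) / (2 * ip y a b)"] show False using n True by (simp add: field_simps)
    qed
    then show ?thesis using True by simp
  next
    case False
    then have p: "ip y b b > 0" using pos[OF ab(2)] by simp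
    \<comment> \<open>The minimum of the quadratic polynomial.\<close>
    from q[of "- ip y a b / ip y b b"] p show ?thesis by (simp add: field_simps power2_eq_square)
  qed
qed

lemma smooth_tr:
  fixes b :: "'a \<Rightarrow> 'a \<Rightarrow> 'a \<Rightarrow> real"
  assumes "\<And>i j. smooth_on (\<lambda>y. b y i j) D" shows "smooth_on (\<lambda>y. tr y (b y)) D"
  unfolding tr_def by (intro smooth_on_sum smooth_on_scaleR open_D smooth_\<gamma> assms)

lemma smooth_ip: "tensor2 \<omega> \<Longrightarrow> tensor2 \<eta> \<Longrightarrow> smooth_on (\<lambda>y. ip y (\<omega> y) (\<eta> y)) D"
  unfolding ip_def
  by (intro smooth_on_mult[OF open_D] smooth_on_const smooth_tr smooth_on_bilinear[OF open_D \<kappa>] tensor2D(2); assumption)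

lemma linear_R:
  assumes y: "y \<in> D"
  shows "linear (\<lambda>Y. R y X Y W)" "linear (\<lambda>W. R y X Y W)"
proof -
  note g = bilinearD[OF bilinear_\<Gamma>] and d = diff_\<Gamma>[OF y]
  have l1: "linear (\<lambda>Y. dd (\<lambda>z. \<Gamma> z Y W) y X)" "linear (\<lambda>W. dd (\<lambda>z. \<Gamma> z Y W) y X)" for X Y W
    by (rule linear_dd_param[OF open_D y g(2) d], assumption) (rule linear_dd_param[OF open_D y g(1) d])
  have l2: "linear (dd (\<lambda>z. \<Gamma> z X W) y)" for X W by (rule linear_dd[OF d])
  note s = linear_add[OF l1(1)] linear_scale[OF l1(1)] linear_add[OF l1(2)] linear_scale[OF l1(2)] linear_add[OF l2] linear_scale[OF l2]
    linear_add[OF g(1)[OF y]] linear_add[OF g(2)[OF y]] linear_scale[OF g(1)[OF y]] linear_scale[OF g(2)[OF y]]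
  show "linear (\<lambda>Y. R y X Y W)" by (rule linearI) (simp_all add: R_def s algebra_simps)
  show "linear (\<lambda>W. R y X Y W)" by (rule linearI) (simp_all add: R_def s algebra_simps)
qed

context
  assumes coclosed: "\<And>y Z. y \<in> D \<Longrightarrow> tr y (\<lambda>X Y. cov F y X Y Z) = 0"
begin

lemma bilinear_cov2F_trace: assumes y: "y \<in> D" shows "bilinear (\<lambda>X Y. cov2F y W X Y Z)"
proof (rule bilinearI')
  note g = bilinearD(1)[OF bilinear_\<Gamma>[OF y], of W]
  show "linear (\<lambda>X. cov2F y W X Y Z)" for Y
  proof -
    have d: "linear (\<lambda>X. dd (\<lambda>z. cov F z X Y Z) y W)"
      by (rule linear_dd_param[OF open_D y linear_cov[OF tensor2_F] diff_covF[OF y]])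
    note L = linear_cov[OF tensor2_F y]
    note s = linear_add[OF d] linear_scale[OF d] linear_add[OF L] linear_scale[OF L] linear_add[OF g] linear_scale[OF g]
    show ?thesis by (rule linearI) (simp_all add: cov2F_eq s br_lin algebra_simps)
  qed
  show "linear (\<lambda>Y. cov2F y W X Y Z)" for X
  proof -
    note L = bilinearD(2)[OF bilinear_cov[OF tensor2_cov[OF tensor2_F] y]] bilinearD(2)[OF bilinear_cov[OF tensor2_F y]]
    note s = linear_add[OF L(1)] linear_scale[OF L(1)] linear_add[OF L(2)] linear_scale[OF L(2)]
    show ?thesis by (rule linearI) (simp_all add: cov2F_def s algebra_simps)
  qed
qed

text \<open>Differentiation of the coclosedness equation: \<open>dd_tr\<close> corrects the two
  traced slots, and the corrections by the bracket and in the slot \<open>Z\<close> are traces that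
  vanish by coclosedness again.\<close>

lemma tr_cov2F: assumes y: "y \<in> D" shows "tr y (\<lambda>X Y. cov2F y W X Y Z) = 0"
proof -
  have "dd (\<lambda>z. tr z (\<lambda>X Y. cov F z X Y Z)) y W = 0" by (rule dd_eq_0_open[OF open_D y]) (rule coclosed)
  then have 1: "tr y (\<lambda>X Y. dd (\<lambda>z. cov F z X Y Z) y W - cov F y (\<Gamma> y W X) Y Z - cov F y X (\<Gamma> y W Y) Z) = 0"
    using dd_tr(2)[OF y bilinear_covF_trace[OF y] diff_covF[OF y]] by simp
  have 2: "tr y (\<lambda>X Y. br (A y W) (cov F y X Y Z)) = 0"
    unfolding tr_linear[OF linear_br(1), symmetric] coclosed[OF y] by (rule br_lin)
  have 3: "cov2F y W X Y Z = (dd (\<lambda>z. cov F z X Y Z) y W - cov F y (\<Gamma> y W X) Y Z - cov F y X (\<Gamma> y W Y) Z)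
      + br (A y W) (cov F y X Y Z) - cov F y X Y (\<Gamma> y W Z)" for X Y
    by (simp add: cov2F_eq)
  show ?thesis unfolding 3 tr_diff[of y "\<lambda>X Y. _ X Y + _ X Y"] tr_add
    using 1 2 coclosed[OF y, of "\<Gamma> y W Z"] by simp
qed

text \<open>The differentiated Bianchi identity replaces \<open>cov2F y e e X Y\<close> by terms in
  which \<open>X\<close> or \<open>Y\<close> is a direction of differentiation. After interchanging
  the two derivatives these become traces of the differentiated coclosedness equation, so only the
  commutators remain.\<close>

lemma weitzenboeck:
  assumes y: "y \<in> D" and S: "coframe y S"
  shows "(\<Sum>e\<in>S. cov2F y e e X Y) = weitz y S X Y"
proof -
  have z: "(\<Sum>e\<in>S. cov2F y W e e Z) = 0" for W Z
    using tr_coframe[OF S bilinear_cov2F_trace[OF y]] tr_cov2F[OF y] by metis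
  have z': "(\<Sum>e\<in>S. cov2F y W e Z e) = 0" for W Z
    using z[of W Z] cov2F_anti[OF y, of W _ Z] by (simp add: sum_negf)
  note l = bilinearD[OF bilinear_F[OF y]]
  have t: "cov2F y e e X Y = - cov2F y X e Y e - cov2F y Y e e X +
     (2 *\<^sub>R br (F y X e) (F y Y e) + F y (R y X e e) Y + F y X (R y Y e e) - F y (R y X Y e) e)" for e
  proof -
    have b: "cov2F y e e X Y = - cov2F y e X Y e - cov2F y e Y e X" using bianchi2[OF y, of e e X Y] by (simp add: algebra_simps add_eq_0_iff)
    have c1: "cov2F y e X Y e = cov2F y X e Y e + br (F y e X) (F y Y e) - F y (R y e X Y) e - F y Y (R y e X e)"
      using cov2F_commute[OF y, of e X Y e] by (simp add: algebra_simps)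
    have c2: "cov2F y e Y e X = cov2F y Y e e X + br (F y e Y) (F y e X) - F y (R y e Y e) X - F y e (R y e Y X)"
      using cov2F_commute[OF y, of e Y e X] by (simp add: algebra_simps)
    have e1: "br (F y e X) (F y Y e) = - br (F y X e) (F y Y e)" using F_anti[of y e X] by (simp add: br_lin)
    have e2: "br (F y e Y) (F y e X) = - br (F y X e) (F y Y e)"
      using F_anti[of y e X] F_anti[of y e Y] br_anti[of "F y Y e" "F y X e"] by (simp add: br_lin)
    have e3: "F y Y (R y e X e) = F y (R y X e e) Y"
      using F_anti[of y Y "R y e X e"] R_anti[of y e X e] by (simp add: linear_neg[OF l(2)])
    have e4: "F y (R y e Y e) X = F y X (R y Y e e)"
      using F_anti[of y "R y e Y e" X] R_anti[of y e Y e] by (simp add: linear_neg[OF l(1)])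
    \<comment> \<open>The algebraic Bianchi identity merges the terms with \<open>R y e X Y\<close>
      and \<open>R y e Y X\<close> into the single term with \<open>R y X Y e\<close>.\<close>
    have rb: "R y e X Y = R y e Y X - R y X Y e" using R_bianchi[OF y, of e X Y] R_anti[of y Y e X] by (simp add: algebra_simps add_eq_0_iff)
    have e5: "F y (R y e X Y) e = - F y (R y X Y e) e - F y e (R y e Y X)"
      using F_anti[of y e "R y e Y X"] by (simp add: rb linear_diff[OF l(2)])
    show ?thesis unfolding b c1 c2 e1 e2 e3 e4 e5 by (simp add: algebra_simps scaleR_2)
  qed
  show ?thesis unfolding weitz_def
    by (subst t) (simp add: sum.distrib sum_subtractf sum_negf z z')
qed

text \<open>All of the differential of \<open>f\<close> sits in direction \<open>e1\<close>, where
  it is twice the pairing of the derivative of \<open>F\<close> with \<open>F\<close>.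
  Cauchy-Schwarz and the refined Kato inequality for that one direction bound the squared gradient
  by a multiple of \<open>f\<close> times the full squared derivative. The factor \<open>f\<close>
  keeps the inequality meaningful at zeros.\<close>

lemma bochner_kato:
  assumes y: "y \<in> D" and S: "coframe y S" and e1: "e1 \<in> S" and dim: "DIM('a) \<ge> 4"
    and f: "\<And>z. z \<in> D \<Longrightarrow> f z = ip z (F z) (F z)"
    and df: "\<And>e. e \<in> S \<Longrightarrow> e \<noteq> e1 \<Longrightarrow> dd f y e = 0"
  shows "f y * (\<Sum>e\<in>S. dd (\<lambda>z. dd f z e) y e - dd f y (\<Gamma> y e e))
      - (real DIM('a) - 1) / (2 * (real DIM('a) - 2)) * (\<Sum>e\<in>S. (dd f y e)\<^sup>2)
      \<ge> 2 * f y * ip y (weitz y S) (F y)"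
proof -
  note tF = tensor2_F and tc = tensor2_cov[OF tensor2_F]
  note bF = bilinear_F[OF y] and bc = bilinear_cov[OF tensor2_F y] and bcc = bilinear_cov[OF tensor2_cov[OF tensor2_F] y]
  have fS: "finite S" and cS: "card S = DIM('a)" using S by (auto simp: coframe_def)

  have f1': "dd f z Z = ip z (cov F z Z) (F z) + ip z (F z) (cov F z Z)" if z: "z \<in> D" for z Z
    using dd_cong_open[OF open_D z f, of "\<lambda>z. z" Z] dd_ip(2)[OF tF tF z, where W = Z] by simp
  note ipS = ip_coframe[OF S]
  have ips: "ip y a b = ip y b a" if "bilinear a" "bilinear b" for a b using tr_sym_ip[OF S that] .
  have f1y: "dd f y Z = 2 * ip y (cov F y Z) (F y)" for Z
    unfolding f1'[OF y] using ips[OF bF bc] by simp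
  have f2: "dd (\<lambda>z. dd f z e) y e = 2 * ip y (cov (\<lambda>y. cov F y e) y e) (F y) + 2 * ip y (cov F y e) (cov F y e)" for e
  proof -
    have "dd (\<lambda>z. dd f z e) y e = dd (\<lambda>z. ip z (cov F z e) (F z) + ip z (F z) (cov F z e)) y e"
      by (rule dd_cong_open[OF open_D y]) (rule f1')
    also have "\<dots> = ip y (cov (\<lambda>y. cov F y e) y e) (F y) + ip y (cov F y e) (cov F y e)
        + (ip y (cov F y e) (cov F y e) + ip y (F y) (cov (\<lambda>y. cov F y e) y e))"
      by (simp only: dd_add[OF dd_ip(1)[OF tc tF y] dd_ip(1)[OF tF tc y]] dd_ip(2)[OF tc tF y] dd_ip(2)[OF tF tc y])
    finally show ?thesis using ips[OF bF bcc] by simp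
  qed
  define L where "L = (\<Sum>e\<in>S. dd (\<lambda>z. dd f z e) y e - dd f y (\<Gamma> y e e))"
  define N2 where "N2 = (\<Sum>e\<in>S. ip y (cov F y e) (cov F y e))"
  \<comment> \<open>Bochner's formula: the correction by \<open>\<Gamma> y e e\<close> turns
    iterated derivatives into \<open>cov2F\<close>, whose trace is the Weitzenboeck term.\<close>
  have L: "L = 2 * ip y (weitz y S) (F y) + 2 * N2"
  proof -
    have "L = (\<Sum>e\<in>S. 2 * (ip y (cov (\<lambda>y. cov F y e) y e) (F y) - ip y (cov F y (\<Gamma> y e e)) (F y)) + 2 * ip y (cov F y e) (cov F y e))"
      unfolding L_def f2 f1y by (simp add: algebra_simps)
    also have "\<dots> = 2 * (\<Sum>e\<in>S. ip y (cov (\<lambda>y. cov F y e) y e) (F y) - ip y (cov F y (\<Gamma> y e e)) (F y)) + 2 * N2"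
      by (simp only: sum.distrib sum_distrib_left[symmetric] N2_def)
    also have "(\<Sum>e\<in>S. ip y (cov (\<lambda>y. cov F y e) y e) (F y) - ip y (cov F y (\<Gamma> y e e)) (F y)) = ip y (weitz y S) (F y)"
    proof -
      have "ip y (weitz y S) (F y) = 1/2 * (\<Sum>a\<in>S. \<Sum>b\<in>S. \<Sum>e\<in>S. \<kappa> (cov2F y e e a b) (F y a b))"
      proof -
        have bw: "bilinear (weitz y S)"
        proof -
          have "bilinear (\<lambda>X Y. \<Sum>e\<in>S. cov2F y e e X Y)"
            unfolding cov2F_def
            by (rule bilinearI'[OF linear_compose_sum[OF ballI[OF linear_compose_sub[OF bilinearD(2)[OF bcc] bilinearD(2)[OF bc]]]]
                  linear_compose_sum[OF ballI[OF linear_compose_sub[OF bilinearD(1)[OF bcc] bilinearD(1)[OF bc]]]]])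
          moreover have "(\<lambda>X Y. \<Sum>e\<in>S. cov2F y e e X Y) = weitz y S" by (intro ext weitzenboeck[OF y S])
          ultimately show ?thesis by (rule back_subst)
        qed
        show ?thesis unfolding ipS[OF bw bF] weitzenboeck[OF y S, symmetric] by (simp add: linear_sum[OF linear_\<kappa>(2)])
      qed
      also have "(\<Sum>a\<in>S. \<Sum>b\<in>S. \<Sum>e\<in>S. \<kappa> (cov2F y e e a b) (F y a b)) = (\<Sum>a\<in>S. \<Sum>e\<in>S. \<Sum>b\<in>S. \<kappa> (cov2F y e e a b) (F y a b))"
        by (intro sum.cong refl sum.swap)
      also have "\<dots> = (\<Sum>e\<in>S. \<Sum>a\<in>S. \<Sum>b\<in>S. \<kappa> (cov2F y e e a b) (F y a b))" by (rule sum.swap)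
      finally show ?thesis
        unfolding ipS[OF bcc bF] ipS[OF bc bF] cov2F_def
        by (simp add: \<kappa>_lin sum_subtractf sum_distrib_left right_diff_distrib)
    qed
    finally show ?thesis by simp
  qed
  have kb: "bilinear \<kappa>" by (rule bilinearI'[OF linear_\<kappa>(2) linear_\<kappa>(1)])
  define TT where "TT a = ip y (cov F y a) (cov F y a)" for a
  have kato: "(real DIM('a) - 1) * TT e1 \<le> (real DIM('a) - 2) * N2"
  proof -
    have "(real (card S) - 1) * (\<Sum>i\<in>S. \<Sum>j\<in>S. \<kappa> (cov F y e1 i j) (cov F y e1 i j))
      \<le> (real (card S) - 2) * (\<Sum>a\<in>S. \<Sum>i\<in>S. \<Sum>j\<in>S. \<kappa> (cov F y a i j) (cov F y a i j))"
    proof (rule refined_kato[OF kb \<kappa>_sym \<kappa>_nonneg fS e1])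
      show "(\<Sum>a\<in>S. cov F y a a c) = 0" for c
        using tr_coframe[OF S bilinear_covF_trace[OF y]] coclosed[OF y] by metis
      show "4 \<le> card S" using cS dim by simp
      show "cov F y a b c = - cov F y a c b" for a b c by (rule cov_F_anti[OF y])
      show "cov F y a b c + cov F y b c a + cov F y c a b = 0" for a b c by (rule bianchi[OF y])
    qed
    then show ?thesis unfolding TT_def N2_def ipS[OF bc bc] cS by (simp add: sum_divide_distrib[symmetric])
  qed
  note cs = ip_Cauchy_Schwarz[OF S]
  have fy: "f y = ip y (F y) (F y)" by (rule f[OF y])
  have fpos: "f y \<ge> 0" unfolding fy ipS[OF bF bF] by (intro mult_nonneg_nonneg sum_nonneg \<kappa>_nonneg) auto
  have "(\<Sum>e\<in>S. (dd f y e)\<^sup>2) = (dd f y e1)\<^sup>2"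
    using sum.remove[OF fS e1, of "\<lambda>e. (dd f y e)\<^sup>2"] df by simp
  also have "\<dots> = 4 * (ip y (cov F y e1) (F y))\<^sup>2" unfolding f1y by (simp add: power2_eq_square)
  also have "\<dots> \<le> 4 * (TT e1 * f y)" unfolding TT_def fy by (intro mult_left_mono cs bc bF) auto
  finally have g: "(\<Sum>e\<in>S. (dd f y e)\<^sup>2) \<le> 4 * (TT e1 * f y)" .
  \<comment> \<open>The largest coefficient for which, by the Kato inequality, the term
    \<open>2 * N2\<close> of Bochner's formula absorbs the gradient term.\<close>
  define c where "c = (real DIM('a) - 1) / (2 * (real DIM('a) - 2))"
  have c: "c \<ge> 0" using dim by (simp add: c_def)
  have c2: "c * (4 * TT e1) \<le> 2 * N2" using kato dim by (simp add: c_def field_simps)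
  have "c * (\<Sum>e\<in>S. (dd f y e)\<^sup>2) \<le> c * (4 * (TT e1 * f y))" using g c by (rule mult_left_mono)
  also have "\<dots> = f y * (c * (4 * TT e1))" by simp
  also have "\<dots> \<le> f y * (2 * N2)" using c2 fpos by (rule mult_left_mono)
  finally show ?thesis unfolding L_def[symmetric] c_def[symmetric] L by (simp add: algebra_simps)
qed

end

end

section \<open>Powers of nonnegative functions\<close>

lemma line_has_real_derivative:
  fixes f :: "'a::real_normed_vector \<Rightarrow> real"
  assumes "f differentiable (at (y + s *\<^sub>R v))"
  shows "((\<lambda>s. f (y + s *\<^sub>R v)) has_real_derivative dd f (y + s *\<^sub>R v) v) (at s)"
proof -
  have "((\<lambda>s. y + s *\<^sub>R v) has_derivative (\<lambda>s. s *\<^sub>R v)) (at s)" by (auto intro!: derivative_eq_intros)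
  from has_derivative_compose[OF this has_derivative_dd[OF assms]] show ?thesis
    using linear_scale[OF linear_dd[OF assms]] by (simp add: has_field_derivative_def mult.commute[of _ "dd f _ _"])
qed

text \<open>Restriction to the line in direction \<open>v\<close> reduces this to one variable. A
  negative second derivative would make the first derivative negative just to the right of the
  minimum, and \<open>f\<close> would fall below it.\<close>

lemma minimum_derivatives:
  fixes f :: "'a::real_normed_vector \<Rightarrow> real"
  assumes D: "open D" "y \<in> D" and f: "Ck_on 2 f D" and mn: "\<And>z. z \<in> D \<Longrightarrow> f y \<le> f z"
  shows "dd f y v = 0" "dd (\<lambda>z. dd f z v) y v \<ge> 0"
proof -
  note d = Ck_on_2D[OF f]
  have "((\<lambda>s. y + s *\<^sub>R v) \<longlongrightarrow> y + 0 *\<^sub>R v) (at (0::real))" by (intro tendsto_intros)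
  then have "eventually (\<lambda>s. y + s *\<^sub>R v \<in> D) (at (0::real))" using topological_tendstoD[OF _ D(1), of _ "y + 0 *\<^sub>R v"] D(2) by simp
  then obtain d where dp: "d > 0" and dD: "\<And>s. \<bar>s\<bar> < d \<Longrightarrow> y + s *\<^sub>R v \<in> D"
    using D(2) unfolding eventually_at by (auto simp: dist_real_def) (metis abs_zero add.right_neutral scaleR_zero_left)
  have der: "((\<lambda>s. f (y + s *\<^sub>R v)) has_real_derivative dd f (y + s *\<^sub>R v) v) (at s)" if "\<bar>s\<bar> < d" for s
    by (rule line_has_real_derivative[OF d(1)[OF dD[OF that]]])
  show z: "dd f y v = 0"
  proof (rule DERIV_local_min[OF _ dp])
    show "((\<lambda>s. f (y + s *\<^sub>R v)) has_real_derivative dd f y v) (at 0)" using der[of 0] dp by simp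
    show "\<forall>s. \<bar>0 - s\<bar> < d \<longrightarrow> f (y + 0 *\<^sub>R v) \<le> f (y + s *\<^sub>R v)" using mn dD by simp
  qed
  show "dd (\<lambda>z. dd f z v) y v \<ge> 0"
  proof (rule ccontr)
    assume n: "\<not> dd (\<lambda>z. dd f z v) y v \<ge> 0"
    have "((\<lambda>s. dd f (y + s *\<^sub>R v) v) has_real_derivative dd (\<lambda>z. dd f z v) y v) (at 0)"
      using line_has_real_derivative[of "\<lambda>z. dd f z v" y 0 v] d(2)[OF D(2)] by simp
    from DERIV_neg_dec_right[OF this] n obtain e where e: "e > 0" "\<And>h. 0 < h \<Longrightarrow> h < e \<Longrightarrow> dd f (y + h *\<^sub>R v) v < 0"
      using z by auto
    define s where "s = min d e / 2"
    have s: "0 < s" "s < d" "s < e" using dp e(1) by (auto simp: s_def)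
    have "\<exists>r. 0 < r \<and> r < s \<and> f (y + s *\<^sub>R v) - f (y + 0 *\<^sub>R v) = (s - 0) * dd f (y + r *\<^sub>R v) v"
      by (rule MVT2[OF s(1)]) (use der s in auto)
    then obtain r where r: "0 < r" "r < s" "f (y + s *\<^sub>R v) - f y = s * dd f (y + r *\<^sub>R v) v" by auto
    have "s * dd f (y + r *\<^sub>R v) v < 0" using s r e(2)[of r] by (simp add: mult_pos_neg)
    moreover have "f y \<le> f (y + s *\<^sub>R v)" using mn dD s by simp
    ultimately show False using r by simp
  qed
qed

section \<open>Powers of a function and the passage to the weak inequality\<close>

context gram_field
begin

lemma gram_field_subset: "open W \<Longrightarrow> W \<subseteq> D \<Longrightarrow> gram_field W g"
  by unfold_locales (use smooth_on_subset[OF smooth_g] gram in auto)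

lemma dd_grad_gframe:
  assumes "y \<in> D" "gframe (g y) S" "f differentiable (at y)"
  shows "dd f y (grad g f y) = (\<Sum>e\<in>S. (dd f y e)\<^sup>2)"
  unfolding grad_gframe[OF assms]
  by (simp add: linear_sum[OF linear_dd[OF assms(3)]] linear_scale[OF linear_dd[OF assms(3)]] power2_eq_square)

lemma dd_grad_nonneg: "y \<in> D \<Longrightarrow> f differentiable (at y) \<Longrightarrow> dd f y (grad g f y) \<ge> 0"
  using dd_grad_gframe gram_frame gram by (metis sum_nonneg zero_le_power2)

lemma lap_nonneg_at_min:
  assumes "y \<in> D" "Ck_on 2 u D" "\<And>z. z \<in> D \<Longrightarrow> u y \<le> u z"
  shows "lap g u y \<ge> 0"
proof -
  obtain S where S: "gframe (g y) S" using gram_frame gram assms(1) by blast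
  show ?thesis unfolding lap_gframe[OF assms(1) S assms(2)]
    using minimum_derivatives[OF open_D assms] by (auto intro!: sum_nonneg)
qed

lemma dd_powr:
  fixes f :: "'a::real_normed_vector \<Rightarrow> real"
  assumes "f differentiable (at z)" "f z > 0"
  shows "dd (\<lambda>z. f z powr q) z v = q * f z powr (q - 1) * dd f z v"
  by (rule dd_real_compose[OF assms(1) has_real_derivative_powr[OF assms(2)]])

lemma lap_powr:
  assumes y: "y \<in> D" and f: "Ck_on 2 f D" and pos: "\<And>z. z \<in> D \<Longrightarrow> f z > 0"
  shows "lap g (\<lambda>z. f z powr q) y = q * f y powr (q - 1) * lap g f y + q * (q - 1) * f y powr (q - 2) * dd f y (grad g f y)"
proof -
  obtain S where S: "gframe (g y) S" using gram_frame gram y by blast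
  note d = Ck_on_2D[OF f]
  have C: "Ck_on 2 (\<lambda>z. f z powr q) D" by (rule Ck_on_powr[OF open_D f pos])
  have dp: "(\<lambda>z. f z powr r) differentiable (at y)" for r
    using Ck_on_2D(1)[OF Ck_on_powr[OF open_D f pos] y] .
  have 2: "dd (\<lambda>z. dd (\<lambda>z. f z powr q) z e) y e = q * (q - 1) * f y powr (q - 2) * (dd f y e)\<^sup>2 + q * f y powr (q - 1) * dd (\<lambda>z. dd f z e) y e" for e
  proof -
    have "dd (\<lambda>z. dd (\<lambda>z. f z powr q) z e) y e = dd (\<lambda>z. q * (f z powr (q - 1) * dd f z e)) y e"
      by (rule dd_cong_open[OF open_D y]) (simp add: dd_powr[OF d(1) pos])
    also have "\<dots> = q * (dd (\<lambda>z. f z powr (q - 1)) y e * dd f y e + f y powr (q - 1) * dd (\<lambda>z. dd f z e) y e)"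
      by (simp only: dd_bounded_linear[OF bounded_linear_mult_right differentiable_bilinear[OF bounded_bilinear_mult dp d(2)[OF y]]]
          dd_mult[OF dp d(2)[OF y]])
    finally show ?thesis by (simp add: dd_powr[OF d(1) pos] y algebra_simps power2_eq_square)
  qed
  have "lap g (\<lambda>z. f z powr q) y = (\<Sum>e\<in>S. q * f y powr (q - 1) * (dd (\<lambda>z. dd f z e) y e - dd f y (chris g y e e)) + q * (q - 1) * f y powr (q - 2) * (dd f y e)\<^sup>2)"
    unfolding lap_gframe[OF y S C] 2
    by (rule sum.cong) (simp_all add: dd_powr[OF d(1) pos] y algebra_simps)
  then show ?thesis
    by (simp only: sum.distrib sum_distrib_left[symmetric] lap_gframe[OF y S f] dd_grad_gframe[OF y S d(1)[OF y]])
qed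

lemma lap_add_const:
  assumes y: "y \<in> D" and f: "Ck_on 2 f D"
  shows "lap g (\<lambda>z. f z + c) y = lap g f y" "dd (\<lambda>z. f z + c) y v = dd f y v" "grad g (\<lambda>z. f z + c) y = grad g f y"
proof -
  have d: "dd (\<lambda>z. f z + c) z v = dd f z v" if "z \<in> D" for z v
    using dd_add[OF Ck_on_2D(1)[OF f that] differentiable_const[of c]] by simp
  have gr: "grad g (\<lambda>z. f z + c) z = grad g f z" if "z \<in> D" for z by (simp add: grad_def d[OF that])
  show "dd (\<lambda>z. f z + c) y v = dd f y v" "grad g (\<lambda>z. f z + c) y = grad g f y" using d gr y by auto
  show "lap g (\<lambda>z. f z + c) y = lap g f y"
    unfolding lap_def divg_def using dd_cong_open[OF open_D y gr] gr[OF y] by simp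
qed

context
  fixes f H :: "real^'n \<Rightarrow> real" and q :: real
  assumes f: "Ck_on 2 f D" and f_nonneg: "\<And>y. y \<in> D \<Longrightarrow> f y \<ge> 0" and q: "0 < q" "q < 1"
    and ineq: "\<And>y. y \<in> D \<Longrightarrow> f y > 0 \<Longrightarrow> f y * lap g f y - (1 - q) * dd f y (grad g f y) \<ge> H y * (f y)\<^sup>2 / q"
begin

text \<open>The Laplacian of the power is \<open>q * f powr (q - 2)\<close> times the expression
  bounded by the hypothesis. The chain rule is applied on the open set where \<open>f\<close> is
  positive.\<close>

lemma lap_powr_ge:
  assumes y: "y \<in> D" and p: "f y > 0"
  shows "lap g (\<lambda>z. f z powr q) y \<ge> H y * f y powr q"
proof -
  define W where "W = {z \<in> D. f z > 0}"
  have "continuous_on D f" using Ck_on_mono[OF f, of 0] by simp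
  then have "open (f -` {0<..} \<inter> D)" using continuous_on_open_vimage[OF open_D] open_greaterThan by blast
  moreover have "f -` {0<..} \<inter> D = W" by (auto simp: W_def)
  ultimately have oW: "open W" by simp
  interpret W: gram_field W g by (rule gram_field_subset[OF oW]) (auto simp: W_def)
  have "lap g (\<lambda>z. f z powr q) y = q * f y powr (q - 1) * lap g f y + q * (q - 1) * f y powr (q - 2) * dd f y (grad g f y)"
    by (rule W.lap_powr[OF _ Ck_on_subset[OF f]]) (use y p in \<open>auto simp: W_def\<close>)
  also have "\<dots> = q * f y powr (q - 2) * (f y * lap g f y - (1 - q) * dd f y (grad g f y))"
  proof -
    have "f y powr (q - 1) = f y powr (q - 2) * f y" using p powr_add[of "f y" "q - 2" 1] by simp
    then show ?thesis by (simp add: algebra_simps)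
  qed
  also have "\<dots> \<ge> q * f y powr (q - 2) * (H y * (f y)\<^sup>2 / q)"
    by (rule mult_left_mono[OF ineq[OF y p]]) (use q in auto)
  also have "q * f y powr (q - 2) * (H y * (f y)\<^sup>2 / q) = H y * f y powr q"
  proof -
    have "f y powr q = f y powr (q - 2) * (f y)\<^sup>2" using p powr_add[of "f y" "q - 2" 2] by (simp add: powr_numeral)
    then show ?thesis using q by simp
  qed
  finally show ?thesis by simp
qed

text \<open>Where \<open>f\<close> is positive, the hypothesis is multiplied by
  \<open>(f y + e) / f y \<ge> 1\<close>, and this factor may be dropped from the nonnegative
  gradient term. A zero of \<open>f\<close> is a minimum, where the gradient vanishes and the
  Laplacian is nonnegative. Keeping a factor \<open>f y\<close> on the right makes that side vanish
  there, whatever the sign of \<open>H\<close>.\<close>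

lemma lap_regularized_ge:
  assumes y: "y \<in> D" and e: "e > 0"
  shows "lap g (\<lambda>z. (f z + e) powr q) y \<ge> H y * (f y * (f y + e) powr (q - 1))"
proof -
  let ?L = "lap g f y" and ?G = "dd f y (grad g f y)"
  have fe: "Ck_on 2 (\<lambda>z. f z + e) D" by (rule Ck_on_add[OF open_D f Ck_on_const])
  have p: "f z + e > 0" if "z \<in> D" for z using f_nonneg[OF that] e by simp
  note fy = f_nonneg[OF y] and py = p[OF y]
  have L: "lap g (\<lambda>z. (f z + e) powr q) y = q * (f y + e) powr (q - 2) * ((f y + e) * ?L - (1 - q) * ?G)"
  proof -
    have "(f y + e) powr (q - 1) = (f y + e) powr (q - 2) * (f y + e)" using py powr_add[of "f y + e" "q - 2" 1] by simp
    moreover have "lap g (\<lambda>z. (f z + e) powr q) y = q * (f y + e) powr (q - 1) * ?L + q * (q - 1) * (f y + e) powr (q - 2) * ?G"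
      using lap_powr[OF y fe p] unfolding lap_add_const[OF y f] .
    ultimately show ?thesis by (simp add: algebra_simps)
  qed
  have "(f y + e) * ?L - (1 - q) * ?G \<ge> H y * f y * (f y + e) / q"
  proof (cases "f y = 0")
    case True
    then have mn: "f y \<le> f z" if "z \<in> D" for z using f_nonneg[OF that] by simp
    have "?L \<ge> 0" "?G = 0" using lap_nonneg_at_min[OF y f mn] minimum_derivatives(1)[OF open_D y f mn] by auto
    then show ?thesis using True e by simp
  next
    case False
    then have f0: "f y > 0" using fy by simp
    have G: "?G \<ge> 0" by (rule dd_grad_nonneg[OF y Ck_on_2D(1)[OF f y]])
    have "((1 - q) * ?G + H y * (f y)\<^sup>2 / q) * ((f y + e) / f y) \<le> f y * ?L * ((f y + e) / f y)"
      by (rule mult_right_mono) (use ineq[OF y f0] f0 e in auto)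
    also have "\<dots> = (f y + e) * ?L" using f0 by simp
    moreover have "((1 - q) * ?G + H y * (f y)\<^sup>2 / q) * ((f y + e) / f y) = (1 - q) * ?G * ((f y + e) / f y) + H y * f y * (f y + e) / q"
    proof -
      define k where "k = (f y + e) / f y"
      have "k * f y = f y + e" using f0 by (simp add: k_def)
      then have r: "H y * f y * (f y + e) / q = H y * (f y)\<^sup>2 / q * k" by (metis mult.assoc mult.commute power2_eq_square times_divide_eq_left)
      show ?thesis unfolding r k_def[symmetric] by (rule distrib_right)
    qed
    ultimately have "(1 - q) * ?G * ((f y + e) / f y) + H y * f y * (f y + e) / q \<le> (f y + e) * ?L"
      by linarith
    moreover have "(1 - q) * ?G * 1 \<le> (1 - q) * ?G * ((f y + e) / f y)"
      by (rule mult_left_mono) (use G q f0 e in auto)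
    ultimately show ?thesis by simp
  qed
  then have "q * (f y + e) powr (q - 2) * (H y * f y * (f y + e) / q) \<le> lap g (\<lambda>z. (f z + e) powr q) y"
    unfolding L by (rule mult_left_mono) (use q in auto)
  moreover have "q * (f y + e) powr (q - 2) * (H y * f y * (f y + e) / q) = H y * (f y * (f y + e) powr (q - 1))"
    using q py powr_add[of "f y + e" "q - 2" 1] by simp
  ultimately show ?thesis by simp
qed

text \<open>Green's formula for the regularised powers, then dominated convergence on both sides.
  The assumed integrability supplies the majorant on the side of \<open>H\<close>, where the
  regularised integrand is the limit times a factor between 0 and 1.\<close>

lemma powr_lap_ge_distr:
  assumes p: "test_function D p" "\<And>y. p y \<ge> 0"
    and int: "(\<lambda>y. H y * f y powr q * p y * vol g y) absolutely_integrable_on D"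
  shows "integral D (\<lambda>y. H y * f y powr q * p y * vol g y) \<le> integral D (\<lambda>y. f y powr q * lap g p y * vol g y)"
proof -
  obtain C where C: "compact C" "C \<subseteq> D" "\<And>y. y \<notin> C \<Longrightarrow> p y = 0"
    using p(1) unfolding test_function_def vanishes_off_compact_def by blast
  have oDC: "open (D - C)" using open_D C(1) compact_imp_closed by blast
  have Cp: "Ck_on 2 p D" using p(1) smooth_onD Ck_on_subset unfolding test_function_def by blast
  have lp0: "lap g p y = 0" if "y \<in> D - C" for y by (rule lap_eq_0_off[OF oDC that]) (use that C in auto)
  have cf: "continuous_on D f" using Ck_on_mono[OF f, of 0] by simp
  have cv: "continuous_on D (vol g)" using smooth_on_continuous[OF smooth_vol] .
  define e where "e k = 1 / real (Suc k)" for k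
  have e: "e k > 0" "e k \<le> 1" for k by (auto simp: e_def)
  have e0: "e \<longlonglongrightarrow> 0" unfolding e_def[abs_def] by (rule LIMSEQ_Suc[OF lim_1_over_n])
  have fe: "Ck_on 2 (\<lambda>z. (f z + e k) powr q) D" for k
    by (rule Ck_on_powr[OF open_D Ck_on_add[OF open_D f Ck_on_const]]) (use f_nonneg e(1)[of k] add_nonneg_pos in blast)
  note gr = green[OF fe Cp C(1,2) C(3)]
  define l where "l k y = (f y + e k) powr q * lap g p y * vol g y" for k y
  \<comment> \<open>The ratio of \<open>f y * (f y + e k) powr (q - 1)\<close> to
    \<open>f y powr q\<close>, in a form that remains continuous at zeros of
    \<open>f\<close>.\<close>
  define rho where "rho k y = (f y / (f y + e k)) powr (1 - q)" for k y
  define w where "w y = H y * f y powr q * p y * vol g y" for y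
  define r where "r k y = rho k y * w y" for k y
  have pw: "f y * (f y + e k) powr (q - 1) = f y powr q * rho k y" if "y \<in> D" for k y
  proof (cases "f y = 0")
    case False
    then have f0: "f y > 0" using f_nonneg[OF that] by simp
    have "f y powr q * f y powr (1 - q) = f y" using powr_add[of "f y" q "1 - q"] f0 by simp
    moreover have "(f y + e k) powr (q - 1) = 1 / (f y + e k) powr (1 - q)" by (metis minus_diff_eq powr_minus_divide)
    ultimately show ?thesis using f0 e(1)[of k] by (simp add: rho_def powr_divide mult.assoc[symmetric])
  qed simp
  have rho1: "0 \<le> rho k y" "rho k y \<le> 1" if "y \<in> D" for k y
  proof -
    have "f y / (f y + e k) \<le> 1" "0 \<le> f y / (f y + e k)" using f_nonneg[OF that] e(1)[of k] by auto
    then show "0 \<le> rho k y" "rho k y \<le> 1" unfolding rho_def using q powr_mono2[of "1 - q" _ 1] by auto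
  qed
  have crho: "continuous_on D (rho k)" for k
    unfolding rho_def[abs_def]
  proof (intro continuous_on_powr' continuous_on_divide continuous_on_add continuous_on_const cf ballI conjI impI)
    fix y assume "y \<in> D"
    then show "f y + e k \<noteq> 0" "0 \<le> f y / (f y + e k)" using f_nonneg[of y] e(1)[of k] by auto
    show "f y / (f y + e k) = 0 \<Longrightarrow> 0 < 1 - q" using q by simp
  qed
  have Dl: "D \<in> sets lebesgue" using open_D by (simp add: borel_open lborelD)
  have wint: "w absolutely_integrable_on D" using int by (simp add: w_def[abs_def])
  \<comment> \<open>\<open>H\<close> is accessible only through the integrable product
    \<open>w\<close>, so integrability comes from multiplying \<open>w\<close> by the bounded
    continuous factor \<open>rho k\<close>.\<close>
  have rint: "r k absolutely_integrable_on D" for k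
    unfolding r_def[abs_def]
  proof (rule absolutely_integrable_bounded_measurable_product[where h = "(*)" and f = "rho k", OF _ _ Dl _ wint])
    show "bilinear ((*) :: real \<Rightarrow> real \<Rightarrow> real)" by (simp add: bilinear_conv_bounded_bilinear bounded_bilinear_mult)
    show "rho k \<in> borel_measurable (lebesgue_on D)" by (rule continuous_imp_measurable_on_sets_lebesgue[OF crho Dl])
    show "bounded (rho k ` D)" using rho1 by (intro boundedI[of _ 1]) auto
  qed
  have lint: "l k integrable_on D" for k
    unfolding l_def[abs_def]
    by (rule set_lebesgue_integral_eq_integral(1)[OF absolutely_integrable_compact_support[OF open_D C(1,2)]])
      (use lp0 Ck_on_mono[OF fe[of k], of 0] in \<open>auto intro!: continuous_on_mult cv continuous_on_lap Cp\<close>)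
  have le: "integral D (r k) \<le> integral D (l k)" for k
  proof -
    have "integral D (r k) \<le> integral D (\<lambda>y. p y * lap g (\<lambda>z. (f z + e k) powr q) y * vol g y)"
    proof (rule integral_le)
      show "r k integrable_on D" using rint set_lebesgue_integral_eq_integral(1) by blast
      show "(\<lambda>y. p y * lap g (\<lambda>z. (f z + e k) powr q) y * vol g y) integrable_on D"
        using gr(2)[of k] set_lebesgue_integral_eq_integral(1) by auto
      fix y assume y: "y \<in> D"
      have "r k y = p y * (H y * (f y * (f y + e k) powr (q - 1))) * vol g y" unfolding pw[OF y] r_def w_def by simp
      also have "\<dots> \<le> p y * lap g (\<lambda>z. (f z + e k) powr q) y * vol g y"
        using p(2)[of y] vol_pos[OF y] lap_regularized_ge[OF y e(1)[of k]] by (intro mult_right_mono mult_left_mono) auto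
      finally show "r k y \<le> p y * lap g (\<lambda>z. (f z + e k) powr q) y * vol g y" .
    qed
    also have "\<dots> = integral D (l k)" using gr(1)[of k] by (simp add: l_def[abs_def])
    finally show ?thesis .
  qed
  have "(\<lambda>k. integral D (l k)) \<longlonglongrightarrow> integral D (\<lambda>y. f y powr q * lap g p y * vol g y)"
  proof (rule dominated_convergence(2)[OF lint, where h = "\<lambda>y. (f y + 1) powr q * \<bar>lap g p y\<bar> * vol g y"])
    let ?h = "\<lambda>y. (f y + 1) powr q * \<bar>lap g p y\<bar> * vol g y"
    show "?h integrable_on D"
    proof (rule set_lebesgue_integral_eq_integral(1)[OF absolutely_integrable_compact_support[OF open_D C(1,2)]])
      have "Ck_on 2 (\<lambda>z. (f z + 1) powr q) D"
        by (rule Ck_on_powr[OF open_D Ck_on_add[OF open_D f Ck_on_const]]) (use f_nonneg in \<open>auto intro: add_nonneg_pos\<close>)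
      then show "continuous_on D ?h"
        using Ck_on_mono[of 2 "\<lambda>z. (f z + 1) powr q" D 0] by (auto intro!: continuous_on_mult cv continuous_on_rabs continuous_on_lap Cp)
    qed (use lp0 in auto)
    fix k y assume y: "y \<in> D"
    have "(f y + e k) powr q \<le> (f y + 1) powr q" using f_nonneg[OF y] e[of k] q by (intro powr_mono2) auto
    then show "norm (l k y) \<le> ?h y"
      using vol_pos[OF y] by (auto simp: l_def abs_mult intro!: mult_right_mono)
  next
    fix y assume y: "y \<in> D"
    have "(\<lambda>k. (f y + e k) powr q) \<longlonglongrightarrow> (f y + 0) powr q"
      by (intro tendsto_powr' tendsto_add tendsto_const e0) (use q f_nonneg[OF y] e(1) in \<open>auto intro!: always_eventually add_nonneg_nonneg less_imp_le[OF e(1)]\<close>)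
    then have "(\<lambda>k. (f y + e k) powr q) \<longlonglongrightarrow> f y powr q" by simp
    then show "(\<lambda>k. l k y) \<longlonglongrightarrow> f y powr q * lap g p y * vol g y"
      unfolding l_def by (intro tendsto_mult tendsto_const)
  qed
  note lim_l = this
  have lim_r: "(\<lambda>k. integral D (r k)) \<longlonglongrightarrow> integral D w"
  proof (rule dominated_convergence(2))
    show "r k integrable_on D" for k using rint set_lebesgue_integral_eq_integral(1) by blast
    show "(\<lambda>y. norm (w y)) integrable_on D" using wint by (simp add: absolutely_integrable_on_def)
    show "norm (r k y) \<le> norm (w y)" if "y \<in> D" for k y
      using rho1[OF that, of k] by (simp add: r_def abs_mult mult_left_le_one_le)
    show "(\<lambda>k. r k y) \<longlonglongrightarrow> w y" if y: "y \<in> D" for y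
    proof (cases "f y = 0")
      case True
      then show ?thesis by (simp add: r_def w_def)
    next
      case False
      then have f0: "f y > 0" using f_nonneg[OF y] by simp
      have "(\<lambda>k. (f y / (f y + e k)) powr (1 - q)) \<longlonglongrightarrow> (f y / (f y + 0)) powr (1 - q)"
        by (intro tendsto_powr tendsto_divide tendsto_add tendsto_const e0) (use f0 in auto)
      then have "(\<lambda>k. rho k y * w y) \<longlonglongrightarrow> 1 * w y"
        using f0 by (intro tendsto_mult tendsto_const) (simp add: rho_def)
      then show ?thesis by (simp add: r_def)
    qed
  qed
  have "integral D w \<le> integral D (\<lambda>y. f y powr q * lap g p y * vol g y)"
    by (rule LIMSEQ_le[OF lim_r lim_l]) (use le in blast)
  then show ?thesis by (simp add: w_def[abs_def])
qed

end

end

section \<open>Skew-symmetric matrices\<close>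

lemma bounded_bilinear_matrix_mult: "bounded_bilinear ((**) :: real^'r::finite^'r \<Rightarrow> real^'r^'r \<Rightarrow> real^'r^'r)"
  unfolding bilinear_conv_bounded_bilinear[symmetric] bilinear_def
  by (auto intro!: linearI simp: vec_eq_iff matrix_matrix_mult_def distrib_left distrib_right sum.distrib sum_distrib_left ac_simps)

lemmas matrix_algebra = bounded_bilinear.add_left[OF bounded_bilinear_matrix_mult] bounded_bilinear.add_right[OF bounded_bilinear_matrix_mult]
  bounded_bilinear.diff_left[OF bounded_bilinear_matrix_mult] bounded_bilinear.diff_right[OF bounded_bilinear_matrix_mult]
  bounded_bilinear.minus_left[OF bounded_bilinear_matrix_mult] bounded_bilinear.minus_right[OF bounded_bilinear_matrix_mult]
  bounded_bilinear.scaleR_left[OF bounded_bilinear_matrix_mult] bounded_bilinear.scaleR_right[OF bounded_bilinear_matrix_mult]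
  bounded_bilinear.zero_left[OF bounded_bilinear_matrix_mult] bounded_bilinear.zero_right[OF bounded_bilinear_matrix_mult]
  matrix_mul_lid matrix_mul_rid

lemma bounded_linear_transpose: "bounded_linear (transpose :: real^'r::finite^'r \<Rightarrow> real^'r^'r)"
  unfolding linear_conv_bounded_linear[symmetric] by (auto intro!: linearI simp: vec_eq_iff transpose_def)

lemmas linear_transpose = bounded_linear.linear[OF bounded_linear_transpose]

lemmas transpose_simps = linear_add[OF linear_transpose] linear_diff[OF linear_transpose]
  linear_neg[OF linear_transpose] linear_scale[OF linear_transpose] linear_0[OF linear_transpose]
  matrix_transpose_mul transpose_transpose

lemma bounded_bilinear_comm: "bounded_bilinear (comm :: real^'r::finite^'r \<Rightarrow> real^'r^'r \<Rightarrow> real^'r^'r)"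
  unfolding bilinear_conv_bounded_bilinear[symmetric] bilinear_def
  by (auto intro!: linearI simp: comm_def matrix_algebra algebra_simps)

lemma comm_anti: "comm a b = - comm b (a :: real^'r::finite^'r)"
  by (simp add: comm_def)

lemma comm_jacobi: "comm a (comm b c) = comm (comm a b) c + comm b (comm a (c :: real^'r::finite^'r))"
  by (simp add: comm_def matrix_algebra matrix_mul_assoc algebra_simps)

lemma so_iff: "a \<in> so \<longleftrightarrow> transpose a = - a"
  by (simp add: so_def)

lemma subspace_so: "subspace (so :: (real^'r::finite^'r) set)"
  by (auto simp: subspace_def so_iff transpose_simps)

lemma comm_so: "a \<in> so \<Longrightarrow> b \<in> so \<Longrightarrow> comm a b \<in> so"
  by (simp add: so_iff comm_def transpose_simps matrix_algebra)

lemma conj_so: "a \<in> so \<Longrightarrow> q ** a ** transpose q \<in> so" for a q :: "real^'r::finite^'r"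
  by (simp add: so_iff transpose_simps matrix_algebra matrix_mul_assoc)

lemma dd_so:
  fixes f :: "'a::real_normed_vector \<Rightarrow> real^'r::finite^'r"
  assumes "open D" "y \<in> D" "f differentiable (at y)" "\<And>z. z \<in> D \<Longrightarrow> f z \<in> so"
  shows "dd f y v \<in> so"
proof -
  have "transpose (dd f y v) = dd (\<lambda>z. transpose (f z)) y v"
    by (rule dd_bounded_linear[OF bounded_linear_transpose assms(3), symmetric])
  also have "\<dots> = dd (\<lambda>z. - f z) y v" by (rule dd_cong_open[OF assms(1,2)]) (use assms(4) so_iff in blast)
  also have "\<dots> = - dd f y v" by (rule dd_minus[OF assms(3)])
  finally show ?thesis by (simp add: so_iff)
qed

text \<open>
  For skew \<open>b\<close> and \<open>q = 1 + t b\<close> the Cayley transform \<open>(q\<^sup>T)\<^sup>-\<^sup>1 q\<close> is orthogonal. Invariance under it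
  is an identity between polynomials in \<open>t\<close>, whose linear part is the claim.
\<close>

lemma Cayley_invariance:
  fixes \<kappa> :: "real^'r::finite^'r \<Rightarrow> real^'r^'r \<Rightarrow> real"
  assumes k: "Ad_invariant_metric \<kappa>" and a: "a \<in> so" and b: "b \<in> so" and c: "c \<in> so" and q: "q = mat 1 + t *\<^sub>R b"
  shows "\<kappa> (q ** a ** transpose q) (q ** c ** transpose q) = \<kappa> (transpose q ** a ** q) (transpose q ** c ** q)"
proof -
  let ?p = "transpose q"
  have pt: "?p = mat 1 - t *\<^sub>R b" using b by (simp add: q so_iff transpose_simps transpose_mat)
  have com: "?p ** q = q ** ?p" unfolding pt unfolding q by (simp add: matrix_algebra algebra_simps)
  \<comment> \<open>Invertibility: for skew \<open>b\<close> the vector \<open>b *v x\<close> is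
    orthogonal to \<open>x\<close>, so \<open>x = t *\<^sub>R (b *v x)\<close> forces
    \<open>x = 0\<close>.\<close>
  have "x = 0" if "?p *v x = 0" for x
  proof -
    have "x \<bullet> (b *v x) = (transpose b *v x) \<bullet> x" by (simp add: dot_lmul_matrix[symmetric] transpose_matrix_vector)
    also have "\<dots> = - (x \<bullet> (b *v x))"
    proof -
      have "(- b) *v x = - (b *v x)" by (simp add: matrix_vector_mult_def vec_eq_iff sum_negf)
      then show ?thesis using b by (simp add: so_iff inner_commute)
    qed
    finally have "x \<bullet> (b *v x) = 0" by simp
    moreover have "?p *v x = x - t *\<^sub>R (b *v x)"
      unfolding pt by (simp add: matrix_vector_mult_diff_rdistrib scaleR_matrix_vector_assoc)
    ultimately have "x \<bullet> x = 0" using that by (metis add.right_neutral diff_add_cancel inner_scaleR_right inner_zero_right mult_zero_right diff_zero inner_diff_right)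
    then show ?thesis by simp
  qed
  then obtain N where N: "N ** ?p = mat 1" using matrix_left_invertible_ker[of ?p] by blast
  then have N': "?p ** N = mat 1" using matrix_left_right_inverse by blast
  have Nt: "q ** transpose N = mat 1" "transpose N ** q = mat 1"
    using arg_cong[OF N, of transpose] arg_cong[OF N', of transpose] by (simp_all add: matrix_transpose_mul transpose_mat)
  \<comment> \<open>The Cayley transform: it is orthogonal, and conjugation by it carries
    \<open>transpose q ** x ** q\<close> to \<open>q ** x ** transpose q\<close>.\<close>
  define r where "r = N ** q"
  have Nc: "N ** q = q ** N"
  proof -
    have "N ** q = N ** q ** (?p ** N)" by (simp add: N' matrix_algebra)
    also have "\<dots> = N ** (q ** ?p) ** N" by (simp add: matrix_mul_assoc)
    also have "\<dots> = (N ** ?p) ** q ** N" unfolding com[symmetric] by (simp add: matrix_mul_assoc)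
    finally show ?thesis by (simp add: N matrix_algebra)
  qed
  have rt: "transpose r = ?p ** transpose N" by (simp add: r_def matrix_transpose_mul)
  have "r ** transpose r = N ** (q ** ?p) ** transpose N" unfolding rt by (simp add: r_def matrix_mul_assoc)
  also have "\<dots> = (N ** ?p) ** (q ** transpose N)" unfolding com[symmetric] by (simp add: matrix_mul_assoc)
  also have "\<dots> = mat 1" by (simp add: N Nt matrix_algebra)
  finally have "orthogonal_matrix r" unfolding orthogonal_matrix_def using matrix_left_right_inverse by blast
  moreover have "r ** (?p ** x ** q) ** transpose r = q ** x ** ?p" for x
  proof -
    have "r ** (?p ** x ** q) ** transpose r = (q ** (N ** ?p)) ** x ** (q ** ?p) ** transpose N"
      unfolding rt by (simp add: r_def Nc matrix_mul_assoc)
    also have "\<dots> = q ** x ** ?p ** (q ** transpose N)" unfolding com[symmetric] by (simp add: N matrix_algebra matrix_mul_assoc)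
    finally show ?thesis by (simp add: Nt matrix_algebra)
  qed
  moreover have "?p ** x ** q \<in> so" if "x \<in> so" for x using conj_so[OF that, of ?p] by simp
  ultimately show ?thesis using k a c unfolding Ad_invariant_metric_def by metis
qed

text \<open>The two sides of the Cayley identity differ by the sign of the odd powers of
  \<open>t\<close>, so equality says \<open>t * p = t * t * t * r\<close> for the linear coefficient
  \<open>p\<close> and the cubic coefficient \<open>r\<close>.\<close>

lemma Ad_invariant_comm:
  fixes \<kappa> :: "real^'r::finite^'r \<Rightarrow> real^'r^'r \<Rightarrow> real"
  assumes k: "Ad_invariant_metric \<kappa>" and so: "a \<in> so" "b \<in> so" "c \<in> so"
  shows "\<kappa> (comm b a) c + \<kappa> a (comm b c) = 0"
proof -
  have bl: "bilinear \<kappa>" using k by (simp add: Ad_invariant_metric_def)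
  note l = bilinearD[OF bl]
  note ks = linear_add[OF l(1)] linear_add[OF l(2)] linear_diff[OF l(1)] linear_diff[OF l(2)] linear_scale[OF l(1)] linear_scale[OF l(2)]
  define z where "z x = b ** x ** b" for x
  have E: "(mat 1 + t *\<^sub>R b) ** x ** transpose (mat 1 + t *\<^sub>R b) = x + t *\<^sub>R comm b x - (t * t) *\<^sub>R z x"
    "transpose (mat 1 + t *\<^sub>R b) ** x ** (mat 1 + t *\<^sub>R b) = x - t *\<^sub>R comm b x - (t * t) *\<^sub>R z x" for t x
  proof -
    have "transpose (mat 1 + t *\<^sub>R b) = mat 1 - t *\<^sub>R b" using so(2) by (simp add: so_iff transpose_simps transpose_mat)
    note tr = this
    show "(mat 1 + t *\<^sub>R b) ** x ** transpose (mat 1 + t *\<^sub>R b) = x + t *\<^sub>R comm b x - (t * t) *\<^sub>R z x"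
      "transpose (mat 1 + t *\<^sub>R b) ** x ** (mat 1 + t *\<^sub>R b) = x - t *\<^sub>R comm b x - (t * t) *\<^sub>R z x"
      unfolding tr by (simp_all add: comm_def z_def matrix_algebra matrix_mul_assoc algebra_simps)
  qed
  define p where "p = \<kappa> (comm b a) c + \<kappa> a (comm b c)"
  define r where "r = \<kappa> (comm b a) (z c) + \<kappa> (z a) (comm b c)"
  have id: "t * p = t * t * t * r" for t
    using Cayley_invariance[OF k so(1,2,3) refl, of t] unfolding E p_def r_def by (simp add: ks algebra_simps)
  \<comment> \<open>\<open>p = r\<close> together with \<open>2 * p = 8 * r\<close> leaves
    \<open>p = 0\<close>.\<close>
  from id[of 1] id[of 2] show ?thesis by (simp add: p_def)
qed

definition skew :: "real^'r^'r \<Rightarrow> real^'r^'r"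
  where "skew a = (1/2) *\<^sub>R (a - transpose a)"

lemma skew_so: "skew a \<in> so"
  by (simp add: skew_def so_iff transpose_simps algebra_simps)

lemma skew_id: "a \<in> so \<Longrightarrow> skew a = a"
  by (simp add: skew_def so_iff scaleR_2[symmetric])

lemma bounded_linear_skew: "bounded_linear (skew :: real^'r::finite^'r \<Rightarrow> real^'r^'r)"
  unfolding skew_def by (intro bounded_linear_const_scaleR bounded_linear_sub bounded_linear_ident bounded_linear_transpose)

lemma skew_comm: "a \<in> so \<Longrightarrow> skew (comm a b) = comm a (skew b)"
  by (simp add: skew_def so_iff comm_def transpose_simps matrix_algebra algebra_simps)

text \<open>\<open>\<kappa>\<close> is symmetric, positive and invariant on \<open>so\<close> only,
  whereas \<open>bundle_field\<close> asks for a form on a whole vector space. The projection onto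
  skew matrices commutes with brackets by skew matrices; composing with it gives an invariant
  semidefinite form that agrees with \<open>\<kappa>\<close> on \<open>so\<close>.\<close>

definition kskew :: "(real^'r^'r \<Rightarrow> real^'r^'r \<Rightarrow> real) \<Rightarrow> real^'r^'r \<Rightarrow> real^'r^'r \<Rightarrow> real"
  where "kskew \<kappa> a b = \<kappa> (skew a) (skew b)"

lemma kskew_so: "a \<in> so \<Longrightarrow> b \<in> so \<Longrightarrow> kskew \<kappa> a b = \<kappa> a b"
  by (simp add: kskew_def skew_id)

lemma bounded_bilinear_kskew:
  fixes \<kappa> :: "real^'r::finite^'r \<Rightarrow> real^'r^'r \<Rightarrow> real"
  assumes "Ad_invariant_metric \<kappa>" shows "bounded_bilinear (kskew \<kappa>)"
  unfolding kskew_def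
  by (rule bounded_bilinear.comp[OF _ bounded_linear_skew bounded_linear_skew])
    (use assms in \<open>simp add: Ad_invariant_metric_def bilinear_conv_bounded_bilinear\<close>)

lemma kskew_sym: "Ad_invariant_metric \<kappa> \<Longrightarrow> kskew \<kappa> a b = kskew \<kappa> b a"
  using skew_so unfolding kskew_def Ad_invariant_metric_def by blast

lemma kskew_nonneg:
  fixes \<kappa> :: "real^'r::finite^'r \<Rightarrow> real^'r^'r \<Rightarrow> real"
  assumes k: "Ad_invariant_metric \<kappa>" shows "kskew \<kappa> a a \<ge> 0"
proof (cases "skew a = 0")
  case True
  have "bilinear \<kappa>" using k by (simp add: Ad_invariant_metric_def)
  then show ?thesis using True by (simp add: kskew_def bilinear_lzero)
next
  case False
  then show ?thesis using k skew_so[of a] unfolding kskew_def Ad_invariant_metric_def by (meson less_imp_le)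
qed

lemma kskew_comm:
  fixes \<kappa> :: "real^'r::finite^'r \<Rightarrow> real^'r^'r \<Rightarrow> real"
  shows "Ad_invariant_metric \<kappa> \<Longrightarrow> a \<in> so \<Longrightarrow> kskew \<kappa> (comm a b) c + kskew \<kappa> b (comm a c) = 0"
  using Ad_invariant_comm[of \<kappa> "skew b" a "skew c"] by (simp add: kskew_def skew_comm skew_so)

lemma Ad_invariant_definite:
  assumes "Ad_invariant_metric \<kappa>" "a \<in> so" "\<And>b. b \<in> so \<Longrightarrow> \<kappa> a b = 0" shows "a = 0"
  using assms unfolding Ad_invariant_metric_def by (metis less_irrefl)

section \<open>From weak to pointwise equations\<close>

lemma Ck_on_Un:
  assumes "open S" "open T" "Ck_on k f S" "Ck_on k f T" shows "Ck_on k f (S \<union> T)"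
  using assms(3,4) by (induction k arbitrary: f) (auto intro: continuous_on_open_Un assms(1,2))

text \<open>The coefficient is smooth on \<open>D\<close> only; the product extends by zero because
  \<open>D\<close> and the complement of a compact set carrying \<open>p\<close> cover the
  space.\<close>

lemma test_function_scaleR:
  fixes h :: "'a::euclidean_space \<Rightarrow> 'b::real_normed_vector"
  assumes D: "open D" and p: "test_function D p" and h: "smooth_on h D"
  shows "test_function D (\<lambda>y. if y \<in> D then p y *\<^sub>R h y else 0)" (is "test_function D ?f")
proof -
  obtain C where C: "compact C" "C \<subseteq> D" "\<And>y. y \<notin> C \<Longrightarrow> p y = 0" and sp: "smooth_on p UNIV"
    using p unfolding test_function_def vanishes_off_compact_def by blast
  have oC: "open (- C)" using C compact_imp_closed by blast
  have "smooth_on (\<lambda>y. p y *\<^sub>R h y) D" by (intro smooth_on_scaleR D smooth_on_subset[OF sp] h) simp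
  then have 1: "Ck_on k ?f D" for k by (intro Ck_on_cong[OF D smooth_onD]) auto
  have 2: "Ck_on k ?f (- C)" for k by (rule Ck_on_cong[OF oC Ck_on_const[of k 0]]) (use C in auto)
  have "D \<union> - C = UNIV" using C by auto
  then have "smooth_on ?f UNIV" unfolding smooth_on_def using Ck_on_Un[OF D oC 1 2] by simp
  moreover have "\<forall>y. y \<notin> C \<longrightarrow> ?f y = 0" using C by simp
  ultimately show ?thesis unfolding test_function_def vanishes_off_compact_def using C by blast
qed

context gram_field
begin

lemma mtrace_gframe_product:
  "gframe G S \<Longrightarrow> linear f \<Longrightarrow> linear h \<Longrightarrow> mtrace G (\<lambda>X Y. f X * h Y) = (\<Sum>e\<in>S. f e * h e)" for f h :: "real^'n \<Rightarrow> real"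
  by (rule mtrace_gframe) (auto simp: bilinear_def linear_add linear_scale algebra_simps intro!: linearI)

lemma continuous_on_mtrace:
  fixes b :: "real^'n \<Rightarrow> real^'n \<Rightarrow> real^'n \<Rightarrow> real"
  assumes "\<And>X Y. continuous_on D (\<lambda>y. b y X Y)" shows "continuous_on D (\<lambda>y. mtrace (g y) (b y))"
  unfolding mtrace_def
  by (intro continuous_on_sum continuous_on_scaleR assms smooth_on_continuous[OF smooth_inv])

text \<open>The divergence theorem for \<open>p *\<^sub>R sharp \<theta>\<close> gives the same
  integral identity with \<open>divg g (sharp \<theta>)\<close> in place of \<open>s\<close>. The
  difference is orthogonal to all test functions, so the fundamental lemma identifies the
  two.\<close>

lemma weak_divergence:
  assumes l: "\<And>y. y \<in> D \<Longrightarrow> linear (\<theta> y)" and C1: "\<And>X. Ck_on 1 (\<lambda>y. \<theta> y X) D" and s: "continuous_on D s"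
    and weak: "\<And>p :: real^'n \<Rightarrow> real. test_function D p \<Longrightarrow> integral D (\<lambda>y. (mtrace (g y) (\<lambda>X Y. dd p y X * \<theta> y Y) + p y * s y) * vol g y) = 0"
    and y: "y \<in> D" and S: "gframe (g y) S"
  shows "s y = (\<Sum>e\<in>S. dd (\<lambda>z. \<theta> z e) y e - \<theta> y (chris g y e e))"
proof -
  have dS: "sharp \<theta> differentiable (at z)" if "z \<in> D" for z using Ck_on_sharp[OF C1] that by simp
  have cth: "continuous_on D (\<lambda>y. \<theta> y X)" for X using Ck_on_mono[OF C1[of X], of 0] by simp
  \<comment> \<open>The fundamental lemma needs continuity, which is visible from a trace with the
    inverse metric but not from sums over frames chosen point by point.\<close>
  have cS: "continuous_on D (divg g (sharp \<theta>))"
  proof -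
    have c: "continuous_on D (\<lambda>y. mtrace (g y) (\<lambda>v w. dd (\<lambda>z. \<theta> z w) y v - (\<Sum>i\<in>UNIV. chris g y v w $ i * \<theta> y (axis i 1))))"
      by (intro continuous_on_mtrace continuous_on_diff continuous_on_sum continuous_on_mult cth
          bounded_linear.continuous_on[OF bounded_linear_vec_nth] smooth_on_continuous[OF smooth_chris])
        (use C1 in simp)
    show ?thesis
    proof (rule continuous_on_eq[OF c])
      fix z assume z: "z \<in> D"
      obtain S where S: "gframe (g z) S" using gram_frame gram[OF z] by blast
      have dt: "(\<lambda>z. \<theta> z X) differentiable (at z)" for X using C1[of X] z by simp
      have "(\<Sum>i\<in>UNIV. v $ i * \<theta> z (axis i 1)) = \<theta> z v" for v using linear_axis_expand[OF l[OF z], of v] by simp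
      then have "mtrace (g z) (\<lambda>v w. dd (\<lambda>z. \<theta> z w) z v - (\<Sum>i\<in>UNIV. chris g z v w $ i * \<theta> z (axis i 1))) =
        mtrace (g z) (\<lambda>v w. dd (\<lambda>z. \<theta> z w) z v - \<theta> z (chris g z v w))" by simp
      also have "\<dots> = (\<Sum>e\<in>S. dd (\<lambda>z. \<theta> z e) z e - \<theta> z (chris g z e e))"
      proof (rule mtrace_gframe[OF S])
        note b = bilinearD[OF bilinear_dd_form[OF open_D z l dt]] and c = bilinearD[OF bilinear_chris[OF z]] and lt = l[OF z]
        show "bilinear (\<lambda>v w. dd (\<lambda>z. \<theta> z w) z v - \<theta> z (chris g z v w))"
          by (rule bilinearI'; rule linearI)
            (simp_all add: linear_add[OF b(1)] linear_add[OF b(2)] linear_scale[OF b(1)] linear_scale[OF b(2)]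
              linear_add[OF c(1)] linear_add[OF c(2)] linear_scale[OF c(1)] linear_scale[OF c(2)] linear_add[OF lt] linear_scale[OF lt] algebra_simps)
      qed
      also have "\<dots> = divg g (sharp \<theta>) z" by (rule divg_sharp_gframe[OF z S l C1, symmetric])
      finally show "mtrace (g z) (\<lambda>v w. dd (\<lambda>z. \<theta> z w) z v - (\<Sum>i\<in>UNIV. chris g z v w $ i * \<theta> z (axis i 1))) = divg g (sharp \<theta>) z" .
    qed
  qed
  have "(s y - divg g (sharp \<theta>) y) * vol g y = 0"
  proof (rule fundamental_lemma_of_variations[OF open_D _ _ y])
    show "continuous_on D (\<lambda>y. (s y - divg g (sharp \<theta>) y) * vol g y)"
      by (intro continuous_on_mult continuous_on_diff s cS smooth_on_continuous[OF smooth_vol])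
    fix p :: "real^'n \<Rightarrow> real" assume p: "test_function D p"
    obtain C where C: "compact C" "C \<subseteq> D" "\<And>y. y \<notin> C \<Longrightarrow> p y = 0" and sp: "smooth_on p UNIV"
      using p unfolding test_function_def vanishes_off_compact_def by blast
    have oC: "open (D - C)" using open_D C compact_imp_closed by blast
    have dp: "p differentiable (at z)" for z using smooth_on_differentiable[OF sp] by simp
    define U where "U z = p z *\<^sub>R sharp \<theta> z" for z
    have U0: "U z = 0" if "z \<in> D - C" for z using that C by (simp add: U_def)
    have dp0: "dd p z v = 0" if "z \<in> D - C" for z v by (rule dd_eq_0_open[OF oC that]) (use C in auto)
    have CU: "Ck_on 1 U D" unfolding U_def
      by (rule Ck_on_bilinear[OF open_D bounded_bilinear_scaleR Ck_on_subset[OF smooth_onD[OF sp]] Ck_on_sharp[OF C1]]) simp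
    have i1: "integral D (\<lambda>y. divg g U y * vol g y) = 0" by (rule integral_divg_eq_0[OF CU C(1,2) U0])
    have m: "mtrace (g z) (\<lambda>X Y. dd p z X * \<theta> z Y) = dd p z (sharp \<theta> z)" if z: "z \<in> D" for z
    proof -
      obtain S where S: "gframe (g z) S" using gram_frame gram[OF z] by blast
      show ?thesis unfolding sharp_def sharp_gframe[OF S l[OF z]] mtrace_gframe_product[OF S linear_dd[OF dp] l[OF z]]
        by (simp add: linear_sum[OF linear_dd[OF dp]] linear_scale[OF linear_dd[OF dp]] mult.commute)
    qed
    have dU: "divg g U z = p z * divg g (sharp \<theta>) z + mtrace (g z) (\<lambda>X Y. dd p z X * \<theta> z Y)" if "z \<in> D" for z
      unfolding U_def m[OF that] by (rule divg_scaleR[OF that dp dS[OF that]])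
    have cp: "continuous_on D p" "continuous_on D (\<lambda>y. dd p y v)" for v
      using smooth_on_continuous[OF smooth_on_subset[OF sp]] smooth_on_continuous[OF smooth_on_subset[OF smooth_on_dd[OF sp]]] by auto
    have cm: "continuous_on D (\<lambda>y. mtrace (g y) (\<lambda>X Y. dd p y X * \<theta> y Y))"
      by (intro continuous_on_mtrace continuous_on_mult cp cth)
    have m0: "mtrace (g z) (\<lambda>X Y. dd p z X * \<theta> z Y) = 0" if "z \<in> D - C" for z using dp0[OF that] by (simp add: mtrace_def)
    have a1: "(\<lambda>y. (mtrace (g y) (\<lambda>X Y. dd p y X * \<theta> y Y) + p y * s y) * vol g y) integrable_on D"
      by (rule set_lebesgue_integral_eq_integral(1)[OF absolutely_integrable_compact_support[OF open_D C(1,2)]])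
        (use C m0 in \<open>auto intro!: continuous_on_mult continuous_on_add cm cp s smooth_on_continuous[OF smooth_vol]\<close>)
    have a2: "(\<lambda>y. (p y * divg g (sharp \<theta>) y + mtrace (g y) (\<lambda>X Y. dd p y X * \<theta> y Y)) * vol g y) integrable_on D"
      by (rule set_lebesgue_integral_eq_integral(1)[OF absolutely_integrable_compact_support[OF open_D C(1,2)]])
        (use C m0 in \<open>auto intro!: continuous_on_mult continuous_on_add cm cp cS smooth_on_continuous[OF smooth_vol]\<close>)
    have i2: "integral D (\<lambda>y. (p y * divg g (sharp \<theta>) y + mtrace (g y) (\<lambda>X Y. dd p y X * \<theta> y Y)) * vol g y) = 0"
      using i1 integral_cong[of D "\<lambda>y. divg g U y * vol g y"] dU by simp
    have "integral D (\<lambda>y. p y * ((s y - divg g (sharp \<theta>) y) * vol g y)) =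
       integral D (\<lambda>y. (mtrace (g y) (\<lambda>X Y. dd p y X * \<theta> y Y) + p y * s y) * vol g y
         - (p y * divg g (sharp \<theta>) y + mtrace (g y) (\<lambda>X Y. dd p y X * \<theta> y Y)) * vol g y)"
      by (rule integral_cong) (simp add: algebra_simps)
    also have "\<dots> = 0" using integral_diff[OF a1 a2] weak[OF p] i2 by simp
    finally show "integral D (\<lambda>y. p y * ((s y - divg g (sharp \<theta>) y) * vol g y)) = 0" .
  qed
  then show ?thesis using vol_pos[OF y] divg_sharp_gframe[OF y S l C1] by simp
qed

end

section \<open>Connections over a coordinate domain\<close>

lemma Basis_cart_iff: "(b :: real^'n) \<in> Basis \<longleftrightarrow> (\<exists>i. b = axis i 1)"
  by (auto simp: Basis_vec_def)

lemma sum_Basis_cart: "(\<Sum>b\<in>(Basis :: (real^'n) set). f b) = (\<Sum>i\<in>UNIV. f (axis i 1))"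
proof -
  have b: "(Basis :: (real^'n) set) = range (\<lambda>i. axis i 1)" using Basis_cart_iff by blast
  have "inj (\<lambda>i. axis i 1 :: real^'n)" by (auto simp: inj_def axis_eq_axis)
  from sum.reindex[OF this, of f] show ?thesis unfolding b by (simp add: o_def)
qed

context gram_field
begin

text \<open>The inverse metric on coordinate covectors, for which the elements of
  \<open>Basis\<close> stand; it serves as the \<open>\<gamma>\<close> of
  \<open>bundle_field\<close>.\<close>

definition cometric :: "real^'n \<Rightarrow> real^'n \<Rightarrow> real^'n \<Rightarrow> real"
  where "cometric y u v = u \<bullet> (matrix_inv (g y) *v v)"

lemma cometric_axis: "cometric y (axis i 1) (axis j 1) = matrix_inv (g y) $ i $ j"
  by (simp add: cometric_def inner_axis' matrix_vector_mult_basis column_def)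

lemma smooth_cometric: "smooth_on (\<lambda>y. cometric y u v) D"
proof -
  have "cometric y u v = (\<Sum>i\<in>UNIV. u $ i * (\<Sum>j\<in>UNIV. matrix_inv (g y) $ i $ j * v $ j))" for y
    by (simp add: cometric_def inner_vec_def matrix_vector_mult_def)
  then show ?thesis by (simp only:) (intro smooth_on_sum smooth_on_mult smooth_on_const open_D smooth_inv)
qed

lemma cometric_parallel:
  assumes y: "y \<in> D" and "i \<in> Basis" "j \<in> Basis"
  shows "dd (\<lambda>z. cometric z i j) y Z = - (\<Sum>k\<in>Basis. cometric y k j * (chris g y Z k \<bullet> i) + cometric y i k * (chris g y Z k \<bullet> j))"
proof -
  obtain a b where ij: "i = axis a 1" "j = axis b 1" using assms Basis_cart_iff by metis
  obtain S where S: "gframe (g y) S" using gram_frame gram[OF y] by blast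
  have l: "linear (chris g y Z)" using bilinear_chris[OF y] by (simp add: bilinear_def)
  have e: "(\<Sum>k\<in>UNIV. (e $ k) * chris g y Z (axis k 1) $ c) = chris g y Z e $ c" for e c
    using arg_cong[OF linear_axis_expand[OF l, of e], of "\<lambda>v. v $ c"] by simp
  have 1: "(\<Sum>k\<in>UNIV. matrix_inv (g y) $ k $ d * chris g y Z (axis k 1) $ c) = (\<Sum>e\<in>S. chris g y Z e $ c * e $ d)" for c d
  proof -
    have "(\<Sum>k\<in>UNIV. matrix_inv (g y) $ k $ d * chris g y Z (axis k 1) $ c) = (\<Sum>k\<in>UNIV. \<Sum>e\<in>S. e $ d * (e $ k * chris g y Z (axis k 1) $ c))"
      by (simp add: matrix_inv_gframe[OF S] sum_distrib_left sum_distrib_right ac_simps)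
    also have "\<dots> = (\<Sum>e\<in>S. e $ d * (\<Sum>k\<in>UNIV. e $ k * chris g y Z (axis k 1) $ c))"
      by (subst sum.swap) (simp add: sum_distrib_left)
    finally show ?thesis by (simp add: e mult.commute)
  qed
  show ?thesis
    unfolding ij cometric_axis dd_inv[OF y S] sum_Basis_cart
    using 1[of b a] 1[of a b] matrix_inv_sym[OF gram[OF y], of a]
    by (simp add: inner_axis sum.distrib mult.commute[of "_ $ a" "chris g y Z _ $ b"])
qed

end

locale gauge_field = gram_field D g for D :: "(real^'n::finite) set" and g +
  fixes \<kappa> :: "real^'r::finite^'r \<Rightarrow> real^'r^'r \<Rightarrow> real" and A :: "real^'n \<Rightarrow> real^'n \<Rightarrow> real^'r^'r"
  assumes Ad: "Ad_invariant_metric \<kappa>" and linear_conn: "\<And>y. y \<in> D \<Longrightarrow> linear (A y)"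
    and conn_so: "\<And>y X. y \<in> D \<Longrightarrow> A y X \<in> so" and smooth_conn: "\<And>X. smooth_on (\<lambda>y. A y X) D"
begin

sublocale B: bundle_field D cometric "chris g" comm "kskew \<kappa>" A
proof (rule bundle_field.intro)
  show "bounded_bilinear (kskew \<kappa>)" by (rule bounded_bilinear_kskew[OF Ad])
  show "\<And>a b. kskew \<kappa> a b = kskew \<kappa> b a" by (rule kskew_sym[OF Ad])
  show "\<And>a. 0 \<le> kskew \<kappa> a a" by (rule kskew_nonneg[OF Ad])
  show "\<And>y X b c. y \<in> D \<Longrightarrow> kskew \<kappa> (comm (A y X) b) c + kskew \<kappa> b (comm (A y X) c) = 0"
    by (rule kskew_comm[OF Ad conn_so])
  show "\<And>i j. i \<in> Basis \<Longrightarrow> j \<in> Basis \<Longrightarrow> smooth_on (\<lambda>y. cometric y i j) D" by (rule smooth_cometric)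
qed (fact open_D bilinear_chris chris_sym smooth_chris cometric_parallel bounded_bilinear_comm
    comm_anti comm_jacobi linear_conn smooth_conn)+

abbreviation FA :: "real^'n \<Rightarrow> real^'n \<Rightarrow> real^'n \<Rightarrow> real^'r^'r" where "FA \<equiv> curvature A"

lemma F_eq: "B.F = curvature A"
  by (simp add: fun_eq_iff B.F_def curvature_def)

lemma R_eq: "B.R = curv_op g"
  by (simp add: fun_eq_iff B.R_def curv_op_def)

lemma tr_eq: "B.tr y b = mtrace (g y) b"
  by (simp add: B.tr_def mtrace_def sum_Basis_cart cometric_axis)

lemma coframe_gframe: "gframe (g y) S \<Longrightarrow> B.coframe y S"
  using gframe_card[of "g y" S]
  by (auto simp: B.coframe_def Basis_cart_iff cometric_axis matrix_inv_gframe inner_axis orthonormal_frame_def)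

lemma ip_eq: "B.ip y \<omega> \<eta> = ip2 (g y) (kskew \<kappa>) \<omega> \<eta>"
  by (simp add: B.ip_def ip2_def tr_eq)

lemma ip2_kskew:
  "(\<And>X Y. \<omega> X Y \<in> so) \<Longrightarrow> (\<And>X Y. \<eta> X Y \<in> so) \<Longrightarrow> ip2 G (kskew \<kappa>) \<omega> \<eta> = ip2 G \<kappa> \<omega> \<eta>"
  by (simp add: ip2_def kskew_so)

lemma F_so: "y \<in> D \<Longrightarrow> curvature A y X Y \<in> so"
  unfolding curvature_def
  by (intro subspace_add[OF subspace_so] subspace_diff[OF subspace_so] comm_so conn_so
      dd_so[OF open_D _ smooth_on_differentiable[OF smooth_conn]])

lemma bilinear_FA: "y \<in> D \<Longrightarrow> bilinear (FA y)" and smooth_FA: "smooth_on (\<lambda>y. FA y X Y) D"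
  using B.tensor2D[OF B.tensor2_F] by (auto simp: F_eq)

lemma covF_so: "y \<in> D \<Longrightarrow> B.cov FA y X Y Z \<in> so"
  unfolding B.cov_def
  by (intro subspace_add[OF subspace_so] subspace_diff[OF subspace_so] comm_so conn_so F_so
      dd_so[OF open_D _ smooth_on_differentiable[OF smooth_FA]])

abbreviation ks :: "real^'r^'r \<Rightarrow> real^'r^'r \<Rightarrow> real" where "ks \<equiv> kskew \<kappa>"

lemma gframe_sum_met:
  assumes "y \<in> D" "gframe (g y) S" "linear L"
  shows "(\<Sum>c\<in>S. met (g y) c W * L c) = (L W :: real)"
  using orthonormal_frame_linear[OF assms(2,3), of W] gram_met_sym[OF gram[OF assms(1)], of _ W] by simp

lemma linear_ks: "linear f \<Longrightarrow> linear (\<lambda>x. ks (f x) a)" "linear f \<Longrightarrow> linear (\<lambda>x. ks a (f x))"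
  by (rule B.linear_\<kappa>_comp; assumption)+

text \<open>
  The test forms \<open>\<beta> X = \<phi> g(X, Z) b\<close> for a constant vector field \<open>Z\<close> reduce the weak equation to a
  weak divergence equation for the one-form \<open>\<kappa>(F(\<sqdot>, Z), b)\<close>.
\<close>

lemma ym_weak_to_pointwise:
  assumes weak: "\<And>\<beta>. so_test_form D \<beta> \<Longrightarrow>
      vint g D (\<lambda>y. ip2 (g y) \<kappa> (FA y) (dA1 A \<beta> y)) = vint g D (\<lambda>y. ip1 (g y) \<kappa> (\<eta> y) (\<beta> y))"
    and \<eta>: "\<And>y. y \<in> D \<Longrightarrow> linear (\<eta> y)" "\<And>y X. y \<in> D \<Longrightarrow> \<eta> y X \<in> so" "\<And>X. continuous_on D (\<lambda>y. \<eta> y X)"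
    and y: "y \<in> D" and S: "gframe (g y) S"
  shows "(\<Sum>e\<in>S. B.cov FA y e e Z) = - \<eta> y Z"
proof -
  \<comment> \<open>The defect of the pointwise equation. It is skew, so by definiteness it suffices
    to pair it with constant skew matrices \<open>b\<close>.\<close>
  define E where "E = (\<Sum>e\<in>S. B.cov FA y e e Z) + \<eta> y Z"
  have Eso: "E \<in> so" unfolding E_def by (intro subspace_add[OF subspace_so] subspace_sum[OF subspace_so] covF_so[OF y] \<eta>(2)[OF y])
  have k0: "ks E b = 0" if b: "b \<in> so" for b
  proof -
    define \<theta> where "\<theta> z Y = ks (FA z Y Z) b" for z Y
    \<comment> \<open>The terms without derivatives of the test function: the corrections because
      \<open>Z\<close> and \<open>b\<close> are not parallel, and the pairing with
      \<open>\<eta>\<close>.\<close>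
    define s where "s z = mtrace (g z) (\<lambda>X Y. ks (FA z X (chris g z Y Z)) b - ks (comm (A z X) (FA z Y Z)) b) - ks (\<eta> z Z) b" for z
    note lF = bilinearD[OF bilinear_FA]
    have l\<theta>: "linear (\<theta> z)" if "z \<in> D" for z unfolding \<theta>_def by (rule linear_ks(1)[OF lF(2)[OF that]])
    have s\<theta>: "smooth_on (\<lambda>z. \<theta> z X) D" for X
      unfolding \<theta>_def by (rule smooth_on_bilinear[OF open_D B.\<kappa> smooth_FA smooth_on_const])
    have bs: "bilinear (\<lambda>X Y. ks (FA z X (chris g z Y Z)) b - ks (comm (A z X) (FA z Y Z)) b)" if z: "z \<in> D" for z
    proof -
      note c = bilinearD(2)[OF bilinear_chris[OF z], of Z] and lA = linear_conn[OF z]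
      show ?thesis
        by (rule bilinearI'; rule linearI)
          (simp_all add: linear_add[OF lF(1)[OF z]] linear_add[OF lF(2)[OF z]] linear_scale[OF lF(1)[OF z]] linear_scale[OF lF(2)[OF z]]
            linear_add[OF c] linear_scale[OF c] linear_add[OF lA] linear_scale[OF lA] B.\<kappa>_lin B.br_lin algebra_simps)
    qed
    have cks: "continuous_on D (\<lambda>z. ks (f z) b)" if "continuous_on D f" for f
      by (rule bounded_bilinear.continuous_on[OF B.\<kappa> that continuous_on_const])
    have cs: "continuous_on D s"
      unfolding s_def[abs_def]
    proof (intro continuous_on_diff continuous_on_mtrace cks \<eta>(3))
      show "continuous_on D (\<lambda>z. FA z X (chris g z Y Z))" for X Y
        by (rule smooth_on_continuous[OF smooth_on_linear_moving[OF open_D lF(1) smooth_FA smooth_chris]])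
      show "continuous_on D (\<lambda>z. comm (A z X) (FA z Y Z))" for X Y
        by (rule smooth_on_continuous[OF smooth_on_bilinear[OF open_D bounded_bilinear_comm smooth_conn smooth_FA]])
    qed
    have "s y = (\<Sum>e\<in>S. dd (\<lambda>z. \<theta> z e) y e - \<theta> y (chris g y e e))"
    proof (rule weak_divergence[OF l\<theta> smooth_onD[OF s\<theta>] cs _ y S])
      fix p :: "real^'n \<Rightarrow> real" assume p: "test_function D p"
      obtain C where C: "compact C" "C \<subseteq> D" "\<And>y. y \<notin> C \<Longrightarrow> p y = 0" and sp: "smooth_on p UNIV"
        using p unfolding test_function_def vanishes_off_compact_def by blast
      have oC: "open (D - C)" using open_D C compact_imp_closed by blast
      have dp: "p differentiable (at z)" for z using smooth_on_differentiable[OF sp] by simp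
      define \<beta> where "\<beta> z X = (if z \<in> D then p z *\<^sub>R (met (g z) X Z *\<^sub>R b) else 0)" for z X
      have bt: "so_test_form D \<beta>"
        unfolding so_test_form_def
      proof (intro conjI allI)
        show "linear (\<beta> z)" for z
          by (rule linearI) (simp_all add: \<beta>_def linear_add[OF linear_met1] linear_scale[OF linear_met1] algebra_simps)
        show "\<beta> z X \<in> so" for z X
          unfolding \<beta>_def using subspace_scale[OF subspace_so b] subspace_scale[OF subspace_so] subspace_0[OF subspace_so] by auto
        show "test_function D (\<lambda>y. \<beta> y X)" for X
          unfolding \<beta>_def by (rule test_function_scaleR[OF open_D p smooth_on_scaleR[OF open_D smooth_met smooth_on_const]])
      qed
      have db: "dd (\<lambda>w. \<beta> w Y) z X = (dd p z X * met (g z) Y Z + p z * (met (g z) (chris g z X Y) Z + met (g z) Y (chris g z X Z))) *\<^sub>R b"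
        if z: "z \<in> D" for z X Y
      proof -
        have "dd (\<lambda>w. \<beta> w Y) z X = dd (\<lambda>w. (p w * met (g w) Y Z) *\<^sub>R b) z X"
          by (rule dd_cong_open[OF open_D z]) (simp add: \<beta>_def)
        also have "\<dots> = dd (\<lambda>w. p w * met (g w) Y Z) z X *\<^sub>R b"
          by (rule dd_bounded_linear[OF bounded_linear_scaleR_left differentiable_bilinear[OF bounded_bilinear_mult dp diff_met[OF z]]])
        finally show ?thesis by (simp only: dd_mult[OF dp diff_met[OF z]] dd_met[OF z])
      qed
      define P where "P z = mtrace (g z) (\<lambda>X Y. dd p z X * \<theta> z Y) + p z * (s z + ks (\<eta> z Z) b)" for z
      define Q where "Q z = p z * ks (\<eta> z Z) b" for z
      have PQ: "ip2 (g z) \<kappa> (FA z) (dA1 A \<beta> z) = P z \<and> ip1 (g z) \<kappa> (\<eta> z) (\<beta> z) = Q z" if z: "z \<in> D" for z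
      proof
        obtain T where T: "gframe (g z) T" using gram_frame gram[OF z] by blast
        \<comment> \<open>\<open>dA1 A \<beta>\<close> is the antisymmetrisation of
          \<open>M\<close>; the term with \<open>chris g z X Y\<close> is symmetric in
          \<open>X\<close> and \<open>Y\<close> and drops out.\<close>
        define M where "M X Y = (dd p z X * met (g z) Y Z + p z * met (g z) Y (chris g z X Z)) *\<^sub>R b + (p z * met (g z) Y Z) *\<^sub>R comm (A z X) b" for X Y
        have bz: "\<beta> z X = (p z * met (g z) X Z) *\<^sub>R b" for X using z by (simp add: \<beta>_def)
        have dM: "dA1 A \<beta> z X Y = M X Y - M Y X" for X Y
          unfolding dA1_def db[OF z] bracket11_def bz M_def
          by (simp add: chris_sym[OF z, of Y X] B.br_lin algebra_simps)
        have lM: "linear (\<lambda>X. M X Y)" "linear (M X)" for X Y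
        proof -
          note c = bilinearD(2)[OF bilinear_chris[OF z], of Z] and lA = linear_conn[OF z] and ld = linear_dd[OF dp, of z]
          note lm = bilinearD(1)[OF bilinear_met[of "g z"]]
          show "linear (\<lambda>X. M X Y)" unfolding M_def
            by (rule linearI) (simp_all add: linear_add[OF c] linear_scale[OF c] linear_add[OF lA] linear_scale[OF lA]
              linear_add[OF ld] linear_scale[OF ld] linear_add[OF lm] linear_scale[OF lm] B.br_lin algebra_simps)
          show "linear (M X)" unfolding M_def
            by (rule linearI) (simp_all add: linear_add[OF linear_met1] linear_scale[OF linear_met1] algebra_simps)
        qed
        have bd: "bilinear (dA1 A \<beta> z)"
          by (rule bilinearI'; rule linearI) (simp_all add: dM linear_add[OF lM(1)] linear_add[OF lM(2)] linear_scale[OF lM(1)] linear_scale[OF lM(2)] algebra_simps)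
        have Mso: "M X Y \<in> so" for X Y
          unfolding M_def by (intro subspace_add[OF subspace_so] subspace_scale[OF subspace_so] b comm_so conn_so[OF z])
        have "ip2 (g z) \<kappa> (FA z) (dA1 A \<beta> z) = B.ip z (FA z) (dA1 A \<beta> z)"
          unfolding ip_eq by (rule ip2_kskew[symmetric]) (use F_so[OF z] in \<open>auto simp: dM intro: subspace_diff[OF subspace_so] Mso\<close>)
        also have "\<dots> = 1/2 * (\<Sum>a\<in>T. \<Sum>c\<in>T. ks (FA z a c) (M a c) - ks (FA z a c) (M c a))"
          unfolding B.ip_coframe[OF coframe_gframe[OF T] bilinear_FA[OF z] bd] dM by (simp add: B.\<kappa>_lin)
        also have "\<dots> = 1/2 * ((\<Sum>a\<in>T. \<Sum>c\<in>T. ks (FA z a c) (M a c)) - (\<Sum>a\<in>T. \<Sum>c\<in>T. ks (FA z a c) (M c a)))"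
          by (simp add: sum_subtractf)
        \<comment> \<open>By antisymmetry of the curvature both halves of the antisymmetrisation
          contribute equally, which cancels the factor \<open>1/2\<close>.\<close>
        also have "(\<Sum>a\<in>T. \<Sum>c\<in>T. ks (FA z a c) (M c a)) = - (\<Sum>a\<in>T. \<Sum>c\<in>T. ks (FA z a c) (M a c))"
        proof -
          have "(\<Sum>a\<in>T. \<Sum>c\<in>T. ks (FA z a c) (M c a)) = (\<Sum>c\<in>T. \<Sum>a\<in>T. ks (FA z a c) (M c a))" by (rule sum.swap)
          also have "\<dots> = (\<Sum>c\<in>T. \<Sum>a\<in>T. - ks (FA z c a) (M c a))"
          proof (intro sum.cong refl)
            fix a c
            have "FA z a c = - FA z c a" using B.F_anti[of z a c] by (simp add: F_eq)
            then show "ks (FA z a c) (M c a) = - ks (FA z c a) (M c a)" by (simp only: B.\<kappa>_lin)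
          qed
          finally show ?thesis by (simp add: sum_negf)
        qed
        also have "1/2 * ((\<Sum>a\<in>T. \<Sum>c\<in>T. ks (FA z a c) (M a c)) - - (\<Sum>a\<in>T. \<Sum>c\<in>T. ks (FA z a c) (M a c))) = (\<Sum>a\<in>T. \<Sum>c\<in>T. ks (FA z a c) (M a c))"
          by simp
        \<comment> \<open>Summing over \<open>c\<close> against the metric inserts \<open>Z\<close>,
          or its derivative, into the second slot of the curvature; invariance of
          \<open>\<kappa>\<close> moves the bracket off \<open>b\<close>.\<close>
        also have "\<dots> = (\<Sum>a\<in>T. dd p z a * \<theta> z a + p z * (ks (FA z a (chris g z a Z)) b - ks (comm (A z a) (FA z a Z)) b))"
        proof (rule sum.cong[OF refl])
          fix a
          have l1: "linear (\<lambda>c. ks (FA z a c) x)" for x by (rule linear_ks(1)[OF lF(1)[OF z]])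
          note g1 = gframe_sum_met[OF z T l1]
          have "(\<Sum>c\<in>T. ks (FA z a c) (M a c)) =
             (\<Sum>c\<in>T. dd p z a * (met (g z) c Z * ks (FA z a c) b) + p z * (met (g z) c (chris g z a Z) * ks (FA z a c) b)
               + p z * (met (g z) c Z * ks (FA z a c) (comm (A z a) b)))"
            by (rule sum.cong) (simp_all add: M_def B.\<kappa>_lin algebra_simps)
          also have "\<dots> = dd p z a * ks (FA z a Z) b + p z * ks (FA z a (chris g z a Z)) b + p z * ks (FA z a Z) (comm (A z a) b)"
            by (simp only: sum.distrib sum_distrib_left[symmetric] g1)
          also have "ks (FA z a Z) (comm (A z a) b) = - ks (comm (A z a) (FA z a Z)) b"
            using B.\<kappa>_inv[OF z, of a "FA z a Z" b] by simp
          finally show "(\<Sum>c\<in>T. ks (FA z a c) (M a c)) = dd p z a * \<theta> z a + p z * (ks (FA z a (chris g z a Z)) b - ks (comm (A z a) (FA z a Z)) b)"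
            by (simp add: \<theta>_def algebra_simps)
        qed
        also have "\<dots> = P z"
          unfolding P_def s_def mtrace_gframe[OF T bs[OF z]] mtrace_gframe_product[OF T linear_dd[OF dp] l\<theta>[OF z]]
          by (simp add: sum.distrib sum_distrib_left)
        finally show "ip2 (g z) \<kappa> (FA z) (dA1 A \<beta> z) = P z" .
        have bso: "\<beta> z X \<in> so" for X unfolding bz by (rule subspace_scale[OF subspace_so b])
        have "ip1 (g z) \<kappa> (\<eta> z) (\<beta> z) = mtrace (g z) (\<lambda>X Y. (p z * ks (\<eta> z X) b) * met (g z) Y Z)"
        proof -
          have "\<kappa> (\<eta> z X) (\<beta> z Y) = (p z * ks (\<eta> z X) b) * met (g z) Y Z" for X Y
            using kskew_so[OF \<eta>(2)[OF z] bso, of \<kappa> X Y] by (simp add: bz B.\<kappa>_lin ac_simps)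
          then show ?thesis unfolding ip1_def by simp
        qed
        also have "\<dots> = (\<Sum>e\<in>T. (p z * ks (\<eta> z e) b) * met (g z) e Z)"
        proof (rule mtrace_gframe_product[OF T _ linear_met1])
          have "linear (\<lambda>X. ks (\<eta> z X) b)" by (rule linear_ks(1)[OF \<eta>(1)[OF z]])
          then show "linear (\<lambda>X. p z * ks (\<eta> z X) b)" using linear_compose_scale_right[of "\<lambda>X. ks (\<eta> z X) b" "p z"] by simp
        qed
        also have "\<dots> = p z * (\<Sum>e\<in>T. met (g z) e Z * ks (\<eta> z e) b)" by (simp add: sum_distrib_left ac_simps)
        also have "\<dots> = Q z" unfolding Q_def gframe_sum_met[OF z T linear_ks(1)[OF \<eta>(1)[OF z]]] ..
        finally show "ip1 (g z) \<kappa> (\<eta> z) (\<beta> z) = Q z" .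
      qed
      have e: "integral D (\<lambda>y. P y * vol g y) = integral D (\<lambda>y. Q y * vol g y)"
      proof -
        have "integral D (\<lambda>y. P y * vol g y) = integral D (\<lambda>y. ip2 (g y) \<kappa> (FA y) (dA1 A \<beta> y) * vol g y)"
          by (rule integral_cong) (use PQ in simp)
        also have "\<dots> = integral D (\<lambda>y. ip1 (g y) \<kappa> (\<eta> y) (\<beta> y) * vol g y)" using weak[OF bt] by (simp add: vint_def)
        also have "\<dots> = integral D (\<lambda>y. Q y * vol g y)" by (rule integral_cong) (use PQ in simp)
        finally show ?thesis .
      qed
      have cp: "continuous_on D p" "continuous_on D (\<lambda>y. dd p y v)" for v
        using smooth_on_continuous[OF smooth_on_subset[OF sp]] smooth_on_continuous[OF smooth_on_subset[OF smooth_on_dd[OF sp]]] by auto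
      have dp0: "dd p z v = 0" if "z \<in> D - C" for z v by (rule dd_eq_0_open[OF oC that]) (use C in auto)
      have m0: "mtrace (g z) (\<lambda>X Y. dd p z X * \<theta> z Y) = 0" if "z \<in> D - C" for z using dp0[OF that] by (simp add: mtrace_def)
      have ce: "continuous_on D (\<lambda>z. ks (\<eta> z Z) b)" by (rule cks[OF \<eta>(3)])
      have cm: "continuous_on D (\<lambda>y. mtrace (g y) (\<lambda>X Y. dd p y X * \<theta> y Y))"
        by (intro continuous_on_mtrace continuous_on_mult cp smooth_on_continuous[OF s\<theta>])
      have iP: "(\<lambda>y. P y * vol g y) integrable_on D"
        unfolding P_def
        by (rule set_lebesgue_integral_eq_integral(1)[OF absolutely_integrable_compact_support[OF open_D C(1,2)]])
          (use C m0 in \<open>auto intro!: continuous_on_mult continuous_on_add cm cp cs ce smooth_on_continuous[OF smooth_vol]\<close>)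
      have iQ: "(\<lambda>y. Q y * vol g y) integrable_on D"
        unfolding Q_def
        by (rule set_lebesgue_integral_eq_integral(1)[OF absolutely_integrable_compact_support[OF open_D C(1,2)]])
          (use C in \<open>auto intro!: continuous_on_mult cp ce smooth_on_continuous[OF smooth_vol]\<close>)
      have "integral D (\<lambda>y. (mtrace (g y) (\<lambda>X Y. dd p y X * \<theta> y Y) + p y * s y) * vol g y) = integral D (\<lambda>y. P y * vol g y - Q y * vol g y)"
        by (rule integral_cong) (simp add: P_def Q_def algebra_simps)
      also have "\<dots> = 0" using integral_diff[OF iP iQ] e by simp
      finally show "integral D (\<lambda>y. (mtrace (g y) (\<lambda>X Y. dd p y X * \<theta> y Y) + p y * s y) * vol g y) = 0" .
    qed
    moreover have "s y = (\<Sum>e\<in>S. ks (FA y e (chris g y e Z)) b - ks (comm (A y e) (FA y e Z)) b) - ks (\<eta> y Z) b"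
      unfolding s_def mtrace_gframe[OF S bs[OF y]] ..
    moreover have "dd (\<lambda>z. \<theta> z e) y e = ks (dd (\<lambda>z. FA z e Z) y e) b" for e
      unfolding \<theta>_def
      by (subst dd_bilinear[OF B.\<kappa> smooth_on_differentiable[OF smooth_FA y] differentiable_const]) (simp add: B.\<kappa>_lin)
    moreover have "ks E b = (\<Sum>e\<in>S. ks (dd (\<lambda>z. FA z e Z) y e) b - ks (FA y (chris g y e e) Z) b
        - (ks (FA y e (chris g y e Z)) b - ks (comm (A y e) (FA y e Z)) b)) + ks (\<eta> y Z) b"
      by (simp add: E_def B.\<kappa>_lin linear_sum[OF B.linear_\<kappa>(2)] B.cov_def algebra_simps)
    ultimately show ?thesis by (simp add: \<theta>_def sum_subtractf)
  qed
  have "E = 0"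
  proof (rule Ad_invariant_definite[OF Ad Eso])
    show "\<kappa> E b = 0" if "b \<in> so" for b using kskew_so[OF Eso that, of \<kappa>] k0[OF that] by simp
  qed
  then show ?thesis by (simp add: E_def eq_neg_iff_add_eq_0)
qed

text \<open>The counterpart for sections: test sections \<open>p *\<^sub>R b\<close> with constant
  skew \<open>b\<close> yield a weak divergence equation for the one-form
  \<open>\<kappa>(\<alpha>, b)\<close>.\<close>

lemma higgs_weak_to_pointwise:
  assumes weak: "\<And>\<xi>. test_function D \<xi> \<Longrightarrow> (\<And>y. \<xi> y \<in> so) \<Longrightarrow>
      vint g D (\<lambda>y. ip1 (g y) \<kappa> (\<alpha> y) (dA0 A \<xi> y)) = 0"
    and \<alpha>: "\<And>y. y \<in> D \<Longrightarrow> linear (\<alpha> y)" "\<And>y X. y \<in> D \<Longrightarrow> \<alpha> y X \<in> so" "\<And>X. smooth_on (\<lambda>y. \<alpha> y X) D"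
    and y: "y \<in> D" and S: "gframe (g y) S"
  shows "(\<Sum>e\<in>S. dd (\<lambda>z. \<alpha> z e) y e + comm (A y e) (\<alpha> y e) - \<alpha> y (chris g y e e)) = 0" (is "?E = 0")
proof -
  have d\<alpha>: "(\<lambda>z. \<alpha> z X) differentiable (at y)" for X by (rule smooth_on_differentiable[OF \<alpha>(3) y])
  have Eso: "?E \<in> so"
    by (intro subspace_add[OF subspace_so] subspace_diff[OF subspace_so] subspace_sum[OF subspace_so] comm_so conn_so[OF y] \<alpha>(2)[OF y]
        dd_so[OF open_D y d\<alpha> \<alpha>(2)])
  have k0: "ks ?E b = 0" if b: "b \<in> so" for b
  proof -
    define \<theta> where "\<theta> z Y = ks (\<alpha> z Y) b" for z Y
    define s where "s z = mtrace (g z) (\<lambda>X Y. - ks (comm (A z X) (\<alpha> z Y)) b)" for z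
    have l\<theta>: "linear (\<theta> z)" if "z \<in> D" for z unfolding \<theta>_def by (rule linear_ks(1)[OF \<alpha>(1)[OF that]])
    have s\<theta>: "smooth_on (\<lambda>z. \<theta> z X) D" for X
      unfolding \<theta>_def by (rule smooth_on_bilinear[OF open_D B.\<kappa> \<alpha>(3) smooth_on_const])
    have bs: "bilinear (\<lambda>X Y. - ks (comm (A z X) (\<alpha> z Y)) b)" if z: "z \<in> D" for z
      by (rule bilinearI'; rule linearI)
        (simp_all add: linear_add[OF \<alpha>(1)[OF z]] linear_scale[OF \<alpha>(1)[OF z]] linear_add[OF linear_conn[OF z]] linear_scale[OF linear_conn[OF z]]
          B.\<kappa>_lin B.br_lin)
    have cs: "continuous_on D s"
      unfolding s_def[abs_def]
      by (intro continuous_on_mtrace continuous_on_minus bounded_bilinear.continuous_on[OF B.\<kappa>] continuous_on_const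
        smooth_on_continuous[OF smooth_on_bilinear[OF open_D bounded_bilinear_comm smooth_conn \<alpha>(3)]])
    have "s y = (\<Sum>e\<in>S. dd (\<lambda>z. \<theta> z e) y e - \<theta> y (chris g y e e))"
    proof (rule weak_divergence[OF l\<theta> smooth_onD[OF s\<theta>] cs _ y S])
      fix p :: "real^'n \<Rightarrow> real" assume p: "test_function D p"
      have sp: "smooth_on p UNIV" using p unfolding test_function_def by blast
      have dp: "p differentiable (at z)" for z using smooth_on_differentiable[OF sp] by simp
      define \<xi> where "\<xi> z = p z *\<^sub>R b" for z
      obtain C where "compact C" "C \<subseteq> D" "\<And>y. y \<notin> C \<Longrightarrow> p y = 0"
        using p unfolding test_function_def vanishes_off_compact_def by blast
      then have t: "test_function D \<xi>"
        unfolding test_function_def vanishes_off_compact_def \<xi>_def[abs_def]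
        using smooth_on_scaleR[OF open_UNIV sp smooth_on_const[of b]] by (intro conjI exI[of _ C]) auto
      have xso: "\<xi> z \<in> so" for z unfolding \<xi>_def by (rule subspace_scale[OF subspace_so b])
      have dx: "dA0 A \<xi> z X = dd p z X *\<^sub>R b + p z *\<^sub>R comm (A z X) b" for z X
        unfolding dA0_def \<xi>_def[abs_def] by (simp add: dd_bounded_linear[OF bounded_linear_scaleR_left dp] B.br_lin)
      have e: "ip1 (g z) \<kappa> (\<alpha> z) (dA0 A \<xi> z) = mtrace (g z) (\<lambda>X Y. dd p z X * \<theta> z Y) + p z * s z" if z: "z \<in> D" for z
      proof -
        obtain T where T: "gframe (g z) T" using gram_frame gram[OF z] by blast
        have dso: "dA0 A \<xi> z X \<in> so" for X
          unfolding dx by (intro subspace_add[OF subspace_so] subspace_scale[OF subspace_so] b comm_so conn_so[OF z])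
        have lx: "linear (dA0 A \<xi> z)"
          by (rule linearI) (simp_all add: dx linear_add[OF linear_dd[OF dp]] linear_scale[OF linear_dd[OF dp]]
              linear_add[OF linear_conn[OF z]] linear_scale[OF linear_conn[OF z]] B.br_lin algebra_simps)
        have "ip1 (g z) \<kappa> (\<alpha> z) (dA0 A \<xi> z) = mtrace (g z) (\<lambda>X Y. ks (\<alpha> z X) (dA0 A \<xi> z Y))"
          unfolding ip1_def by (simp add: kskew_so[OF \<alpha>(2)[OF z] dso])
        also have "\<dots> = (\<Sum>e\<in>T. ks (\<alpha> z e) (dA0 A \<xi> z e))"
          by (rule mtrace_gframe[OF T bilinearI'[OF linear_ks(1)[OF \<alpha>(1)[OF z]] linear_ks(2)[OF lx]]])
        also have "\<dots> = (\<Sum>e\<in>T. dd p z e * \<theta> z e + p z * - ks (comm (A z e) (\<alpha> z e)) b)"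
        proof (rule sum.cong[OF refl])
          fix e
          have "ks (\<alpha> z e) (comm (A z e) b) = - ks (comm (A z e) (\<alpha> z e)) b"
            using B.\<kappa>_inv[OF z, of e "\<alpha> z e" b] by simp
          then show "ks (\<alpha> z e) (dA0 A \<xi> z e) = dd p z e * \<theta> z e + p z * - ks (comm (A z e) (\<alpha> z e)) b"
            unfolding dx \<theta>_def B.\<kappa>_lin by simp
        qed
        also have "\<dots> = mtrace (g z) (\<lambda>X Y. dd p z X * \<theta> z Y) + p z * s z"
          unfolding s_def mtrace_gframe[OF T bs[OF z]] mtrace_gframe_product[OF T linear_dd[OF dp] l\<theta>[OF z]]
          by (simp add: sum.distrib sum_subtractf sum_distrib_left sum_negf)
        finally show ?thesis .
      qed
      have "integral D (\<lambda>y. (mtrace (g y) (\<lambda>X Y. dd p y X * \<theta> y Y) + p y * s y) * vol g y)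
        = integral D (\<lambda>y. ip1 (g y) \<kappa> (\<alpha> y) (dA0 A \<xi> y) * vol g y)"
        by (rule integral_cong) (simp add: e)
      then show "integral D (\<lambda>y. (mtrace (g y) (\<lambda>X Y. dd p y X * \<theta> y Y) + p y * s y) * vol g y) = 0"
        using weak[OF t xso] by (simp add: vint_def)
    qed
    moreover have "s y = (\<Sum>e\<in>S. - ks (comm (A y e) (\<alpha> y e)) b)"
      unfolding s_def mtrace_gframe[OF S bs[OF y]] ..
    moreover have "dd (\<lambda>z. \<theta> z e) y e = ks (dd (\<lambda>z. \<alpha> z e) y e) b" for e
      unfolding \<theta>_def by (subst dd_bilinear[OF B.\<kappa> d\<alpha> differentiable_const]) (simp add: B.\<kappa>_lin)
    moreover have "ks ?E b = (\<Sum>e\<in>S. ks (dd (\<lambda>z. \<alpha> z e) y e) b - ks (\<alpha> y (chris g y e e)) b - - ks (comm (A y e) (\<alpha> y e)) b)"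
      by (simp add: B.\<kappa>_lin linear_sum[OF B.linear_\<kappa>(2)] algebra_simps)
    ultimately show ?thesis by (simp add: \<theta>_def sum_subtractf sum_negf sum.distrib)
  qed
  show ?thesis
  proof (rule Ad_invariant_definite[OF Ad Eso])
    show "\<kappa> ?E b = 0" if "b \<in> so" for b using kskew_so[OF Eso that, of \<kappa>] k0[OF that] by simp
  qed
qed

end

section \<open>The curvature terms\<close>

text \<open>The normalised vector dual to \<open>f\<close> is completed to a frame; if it is zero,
  any frame will do.\<close>

lemma adapted_frame:
  fixes f :: "real^'n::finite \<Rightarrow> real"
  assumes G: "gram G" and f: "linear f"
  shows "\<exists>S e1. gframe G S \<and> e1 \<in> S \<and> (\<forall>e\<in>S. e \<noteq> e1 \<longrightarrow> f e = 0)"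
proof -
  define v where "v = matrix_inv G *v (\<chi> l. f (axis l 1))"
  have v: "met G v X = f X" for X unfolding v_def by (rule met_sharp[OF G f])
  show ?thesis
  proof (cases "v = 0")
    case True
    then have f0: "f X = 0" for X using v[of X] by (simp add: met_def)
    obtain S where S: "gframe G S" using gram_frame[OF G] by blast
    then obtain e1 where "e1 \<in> S" using gframe_card[OF S] by fastforce
    then show ?thesis using S f0 by blast
  next
    case False
    then have p: "met G v v > 0" using G by (simp add: gram_def)
    define e1 where "e1 = (1 / sqrt (met G v v)) *\<^sub>R v"
    have "met G e1 e1 = 1" using p
      by (simp add: e1_def bilinear_lmul[OF bilinear_met] bilinear_rmul[OF bilinear_met] real_sqrt_mult_self)
    then obtain S where S: "{e1} \<subseteq> S" "gframe G S" using gram_frame_extend[OF G, of "{e1}"] by auto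
    have "f e = 0" if "e \<in> S" "e \<noteq> e1" for e
    proof -
      have "met G e1 e = 0" using S that by (auto simp: orthonormal_frame_def)
      then show ?thesis using p v[of e] by (simp add: e1_def bilinear_lmul[OF bilinear_met])
    qed
    then show ?thesis using S by blast
  qed
qed

lemma linear_mult_const: "linear f \<Longrightarrow> linear (\<lambda>x. f x * c)" "linear f \<Longrightarrow> linear (\<lambda>x. c * f x)" for f :: "'a::real_vector \<Rightarrow> real"
  by (auto intro!: linearI simp: linear_add linear_scale algebra_simps)

lemma ip2_gframe:
  fixes k :: "'b::real_vector \<Rightarrow> 'b \<Rightarrow> real"
  assumes S: "gframe G S" and k: "bilinear k" and w: "bilinear \<omega>" "bilinear \<eta>"
  shows "ip2 G k \<omega> \<eta> = 1/2 * (\<Sum>a\<in>S. \<Sum>c\<in>S. k (\<omega> a c) (\<eta> a c))"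
proof -
  note lk = bilinearD[OF k]
  have kl: "linear (\<lambda>x. k (f x) a)" "linear (\<lambda>x. k a (f x))" if "linear f" for f :: "'c::real_vector \<Rightarrow> 'b" and a
    using linear_compose[OF that lk(2)] linear_compose[OF that lk(1)] by (auto simp: o_def)
  have "bilinear (\<lambda>Y Y'. k (\<omega> X Y) (\<eta> X' Y'))" for X X'
    by (rule bilinearI'[OF kl(1)[OF bilinearD(1)[OF w(1)]] kl(2)[OF bilinearD(1)[OF w(2)]]])
  then have 1: "mtrace G (\<lambda>Y Y'. k (\<omega> X Y) (\<eta> X' Y')) = (\<Sum>c\<in>S. k (\<omega> X c) (\<eta> X' c))" for X X'
    using mtrace_gframe[OF S] by blast
  have "bilinear (\<lambda>X X'. \<Sum>c\<in>S. k (\<omega> X c) (\<eta> X' c))"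
    by (rule bilinearI'[OF linear_compose_sum[OF ballI[OF kl(1)[OF bilinearD(2)[OF w(1)]]]]
          linear_compose_sum[OF ballI[OF kl(2)[OF bilinearD(2)[OF w(2)]]]]])
  from mtrace_gframe[OF S this] show ?thesis by (simp add: ip2_def 1)
qed

lemma bilinear_times_real: "bilinear ((*) :: real \<Rightarrow> real \<Rightarrow> real)"
  by (simp add: bilinear_conv_bounded_bilinear bounded_bilinear_mult)

context bundle_field
begin

lemma linear_R1: "y \<in> D \<Longrightarrow> linear (\<lambda>X. R y X Y W)"
  by (subst R_anti) (rule linear_compose_neg[OF linear_R(1)])

lemma weitz_anti:
  assumes y: "y \<in> D" shows "weitz y S X Y = - weitz y S Y X"
proof -
  have "2 *\<^sub>R br (F y X e) (F y Y e) + F y (R y X e e) Y + F y X (R y Y e e) - F y (R y X Y e) e =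
     - (2 *\<^sub>R br (F y Y e) (F y X e) + F y (R y Y e e) X + F y Y (R y X e e) - F y (R y Y X e) e)" for e
    using br_anti[of "F y X e" "F y Y e"] F_anti[of y "R y X e e" Y] F_anti[of y X "R y Y e e"] R_anti[of y X Y e]
    by (simp add: linear_neg[OF bilinearD(2)[OF bilinear_F[OF y]]])
  then show ?thesis unfolding weitz_def sum_negf[symmetric] by presburger
qed

lemma bilinear_weitz:
  assumes y: "y \<in> D" shows "bilinear (weitz y S)"
proof -
  note l = bilinearD[OF bilinear_F[OF y]] and r = linear_R(1)[OF y] linear_R1[OF y]
  note s = linear_add[OF l(1)] linear_scale[OF l(1)] linear_add[OF l(2)] linear_scale[OF l(2)]
    linear_add[OF r(1)] linear_scale[OF r(1)] linear_add[OF r(2)] linear_scale[OF r(2)]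
  show ?thesis unfolding weitz_def
    by (rule bilinearI'; rule linear_compose_sum; rule ballI; rule linearI) (simp_all add: s br_lin algebra_simps)
qed

end

context gauge_field
begin

lemma linear_curv: "y \<in> D \<Longrightarrow> linear (\<lambda>X. curv_op g y X Y W)" "y \<in> D \<Longrightarrow> linear (\<lambda>Y. curv_op g y X Y W)"
    "y \<in> D \<Longrightarrow> linear (\<lambda>W. curv_op g y X Y W)"
  using B.linear_R B.linear_R1 by (simp_all add: R_eq)

lemma Ric_gframe:
  assumes y: "y \<in> D" and S: "gframe (g y) S"
  shows "Ric g y X Y = met (g y) (\<Sum>e\<in>S. curv_op g y X e e) Y"
proof -
  have b: "bilinear (\<lambda>v w. met (g y) (curv_op g y X v w) Y)"
    by (rule bilinearI'; rule linear_compose[OF _ linear_met1, unfolded o_def]) (rule linear_curv[OF y])+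
  show ?thesis unfolding Ric_def Rm_def mtrace_gframe[OF S b] by (simp add: linear_sum[OF linear_met1])
qed

lemma Ric_end_gframe:
  assumes y: "y \<in> D" and S: "gframe (g y) S"
  shows "Ric_end g y X = (\<Sum>e\<in>S. curv_op g y X e e)"
proof (rule gram_nondegenerate[OF gram[OF y]])
  have l: "linear (Ric g y X)" unfolding Ric_gframe[OF y S, abs_def] by (rule bilinearD(1)[OF bilinear_met])
  show "met (g y) (Ric_end g y X) Y = met (g y) (\<Sum>e\<in>S. curv_op g y X e e) Y" for Y
    unfolding Ric_end_def met_sharp[OF gram[OF y] l] by (rule Ric_gframe[OF y S])
qed

lemma linear_Ric_end: "y \<in> D \<Longrightarrow> linear (Ric_end g y)"
proof -
  assume y: "y \<in> D"
  obtain S where S: "gframe (g y) S" using gram_frame gram[OF y] by blast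
  have e: "Ric_end g y = (\<lambda>X. \<Sum>e\<in>S. curv_op g y X e e)" using Ric_end_gframe[OF y S] by blast
  show ?thesis unfolding e by (rule linear_compose_sum, rule ballI, rule linear_curv(1)[OF y])
qed

text \<open>\<open>Kop\<close> with the double trace carried out in a frame. The products with
  \<open>Rm\<close> become arguments of the form, so the expression makes sense for forms with
  values in any vector space.\<close>

definition KF :: "real^'n \<Rightarrow> (real^'n) set \<Rightarrow> (real^'n \<Rightarrow> real^'n \<Rightarrow> 'b::real_vector) \<Rightarrow> real^'n \<Rightarrow> real^'n \<Rightarrow> 'b"
  where "KF y S \<omega> X Y = \<omega> (Ric_end g y X) Y + \<omega> X (Ric_end g y Y) - (\<Sum>e\<in>S. \<omega> (curv_op g y X Y e) e)"

lemma bilinear_KF: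
  assumes y: "y \<in> D" and w: "bilinear \<omega>" shows "bilinear (KF y S \<omega>)"
proof -
  note l = bilinearD[OF w] and r = linear_Ric_end[OF y] and c = linear_curv[OF y]
  have s: "linear (\<lambda>X. \<Sum>e\<in>S. \<omega> (curv_op g y X Y e) e)" "linear (\<lambda>X. \<Sum>e\<in>S. \<omega> (curv_op g y Y X e) e)" for Y
    by (rule linear_compose_sum, rule ballI, rule linear_compose[OF _ l(2), unfolded o_def], rule c)+
  show ?thesis unfolding KF_def
    by (rule bilinearI'; rule linearI)
      (simp_all add: linear_add[OF s(1)] linear_add[OF s(2)] linear_scale[OF s(1)] linear_scale[OF s(2)]
       linear_add[OF l(1)] linear_add[OF l(2)] linear_scale[OF l(1)] linear_scale[OF l(2)] linear_add[OF r] linear_scale[OF r] algebra_simps)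
qed

lemma Kop_gframe:
  assumes y: "y \<in> D" and S: "gframe (g y) S" and w: "bilinear \<omega>"
  shows "Kop g y \<omega> = KF y S \<omega>"
proof (intro ext)
  fix X Y
  note l = bilinearD[OF w] and c = linear_curv(3)[OF y]
  have lc: "linear (\<lambda>w. Rm g y X Y v w)" for v unfolding Rm_def by (rule linear_compose[OF c linear_met1, unfolded o_def])
  have lv: "linear (\<lambda>v. Rm g y X Y v w)" for w unfolding Rm_def by (rule bilinearD(1)[OF bilinear_met])
  have "bilinear (\<lambda>w w'. Rm g y X Y v w * \<omega> v' w')" for v v'
    by (rule bilinearI'[OF linear_mult_const(1)[OF lc] linear_mult_const(2)[OF l(1)]])
  then have 1: "mtrace (g y) (\<lambda>w w'. Rm g y X Y v w * \<omega> v' w') = (\<Sum>e\<in>S. Rm g y X Y v e * \<omega> v' e)" for v v'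
    using mtrace_gframe[OF S] by blast
  have "bilinear (\<lambda>v v'. \<Sum>e\<in>S. Rm g y X Y v e * \<omega> v' e)"
    by (rule bilinearI'[OF linear_compose_sum[OF ballI[OF linear_mult_const(1)[OF lv]]] linear_compose_sum[OF ballI[OF linear_mult_const(2)[OF l(2)]]]])
  then have "mtrace (g y) (\<lambda>v v'. mtrace (g y) (\<lambda>w w'. Rm g y X Y v w * \<omega> v' w')) = (\<Sum>a\<in>S. \<Sum>e\<in>S. Rm g y X Y a e * \<omega> a e)"
    unfolding 1 by (rule mtrace_gframe[OF S])
  also have "\<dots> = (\<Sum>e\<in>S. \<Sum>a\<in>S. met (g y) (curv_op g y X Y e) a *\<^sub>R \<omega> a e)" by (subst sum.swap) (simp add: Rm_def)
  also have "\<dots> = (\<Sum>e\<in>S. \<omega> (curv_op g y X Y e) e)" by (intro sum.cong refl orthonormal_frame_linear[OF S l(2)]) simp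
  finally show "Kop g y \<omega> X Y = KF y S \<omega> X Y" by (simp add: Kop_def KF_def)
qed

lemma Ftilde_gframe:
  assumes y: "y \<in> D" and S: "gframe (g y) S"
  shows "Ftilde (g y) (FA y) (FA y) X Y = (\<Sum>e\<in>S. 2 *\<^sub>R comm (FA y X e) (FA y Y e))"
proof -
  note l = bilinearD(1)[OF bilinear_FA[OF y]]
  have "bilinear (\<lambda>v w. comm (FA y X v) (FA y Y w) - comm (FA y Y v) (FA y X w))"
    by (rule bilinearI'; rule linearI) (simp_all add: linear_add[OF l] linear_scale[OF l] B.br_lin algebra_simps)
  from mtrace_gframe[OF S this] have "Ftilde (g y) (FA y) (FA y) X Y = (\<Sum>e\<in>S. comm (FA y X e) (FA y Y e) - comm (FA y Y e) (FA y X e))"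
    by (simp add: Ftilde_def)
  also have "\<dots> = (\<Sum>e\<in>S. 2 *\<^sub>R comm (FA y X e) (FA y Y e))"
    by (rule sum.cong) (simp_all add: comm_anti[of "FA y Y _" "FA y X _"] scaleR_2)
  finally show ?thesis .
qed

text \<open>Summed over the frame, the curvature terms with repeated \<open>e\<close> are values of
  the Ricci endomorphism, and the brackets make up \<open>Ftilde\<close>.\<close>

lemma weitz_eq:
  assumes y: "y \<in> D" and S: "gframe (g y) S"
  shows "B.weitz y S X Y = Ftilde (g y) (FA y) (FA y) X Y + KF y S (FA y) X Y"
proof -
  note l = bilinearD[OF bilinear_FA[OF y]]
  show ?thesis
    unfolding B.weitz_def KF_def Ftilde_gframe[OF y S] Ric_end_gframe[OF y S] F_eq R_eq
    by (simp add: linear_sum[OF l(1)] linear_sum[OF l(2)] sum.distrib sum_subtractf)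
qed

section \<open>Lower bounds for the curvature terms on forms with values in
  \<open>so\<close>\<close>

lemma so_frame: "\<exists>T. orthonormal_frame \<kappa> so T"
proof -
  have b: "bilinear \<kappa>" and s: "\<And>x y. x \<in> so \<Longrightarrow> y \<in> so \<Longrightarrow> \<kappa> x y = \<kappa> y x" and p: "\<And>x. x \<in> so \<Longrightarrow> x \<noteq> 0 \<Longrightarrow> \<kappa> x x > 0"
    using Ad unfolding Ad_invariant_metric_def by blast+
  show ?thesis using orthonormal_frame_extend[OF b subspace_so s p, of "{}"] by auto
qed

lemma ks_expand:
  assumes T: "orthonormal_frame \<kappa> so T" and w: "w \<in> so" "w' \<in> so"
  shows "ks w w' = (\<Sum>t\<in>T. ks w t * ks w' t)"
proof -
  have tso: "t \<in> so" if "t \<in> T" for t using T that by (auto simp: orthonormal_frame_def)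
  have "ks w w' = (\<Sum>t\<in>T. \<kappa> w' t *\<^sub>R ks w t)"
    using orthonormal_frame_linear[OF T B.linear_\<kappa>(1) w(2)] by simp
  also have "\<dots> = (\<Sum>t\<in>T. ks w t * ks w' t)" by (rule sum.cong) (simp_all add: kskew_so[OF w(2) tso])
  finally show ?thesis .
qed

text \<open>The Ricci bound concerns single tangent vectors. Each component of
  \<open>\<alpha>\<close> in an orthonormal frame of \<open>so\<close> is a real one-form, and the
  bound applies to its dual vector; summation over the components recovers the full norm.\<close>

lemma Ric_end_so_lower:
  assumes y: "y \<in> D" and S: "gframe (g y) S" and a: "linear \<alpha>" "\<And>X. \<alpha> X \<in> so"
    and Rc: "\<And>X. Ric g y X X \<ge> c * met (g y) X X"
  shows "(\<Sum>e\<in>S. ks (\<alpha> (Ric_end g y e)) (\<alpha> e)) \<ge> c * (\<Sum>e\<in>S. ks (\<alpha> e) (\<alpha> e))"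
proof -
  obtain T where T: "orthonormal_frame \<kappa> so T" using so_frame by blast
  have "c * (\<Sum>e\<in>S. ks (\<alpha> e) t * ks (\<alpha> e) t) \<le> (\<Sum>e\<in>S. ks (\<alpha> (Ric_end g y e)) t * ks (\<alpha> e) t)" for t
  proof -
    define f where "f X = ks (\<alpha> X) t" for X
    have f: "linear f" unfolding f_def by (rule linear_ks(1)[OF a(1)])
    define v where "v = (\<Sum>e\<in>S. f e *\<^sub>R e)"
    have v: "met (g y) v X = f X" for X
      unfolding v_def sharp_gframe[OF S f, symmetric] by (rule met_sharp[OF gram[OF y] f])
    have l: "linear (\<lambda>X. f (Ric_end g y X))" using linear_compose[OF linear_Ric_end[OF y] f] by (simp add: o_def)
    have "(\<Sum>e\<in>S. f (Ric_end g y e) * f e) = f (Ric_end g y v)"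
      unfolding v_def by (simp add: linear_sum[OF l] linear_scale[OF l] mult.commute)
    also have "\<dots> = met (g y) (Ric_end g y v) v" unfolding v[symmetric] by (rule gram_met_sym[OF gram[OF y]])
    also have "\<dots> = Ric g y v v" unfolding Ric_gframe[OF y S] Ric_end_gframe[OF y S] ..
    also have "\<dots> \<ge> c * met (g y) v v" by (rule Rc)
    also have "met (g y) v v = (\<Sum>e\<in>S. f e * f e)" unfolding v by (simp add: v_def linear_sum[OF f] linear_scale[OF f])
    finally show ?thesis by (simp add: f_def)
  qed
  then have "(\<Sum>t\<in>T. c * (\<Sum>e\<in>S. ks (\<alpha> e) t * ks (\<alpha> e) t)) \<le> (\<Sum>t\<in>T. \<Sum>e\<in>S. ks (\<alpha> (Ric_end g y e)) t * ks (\<alpha> e) t)" by (rule sum_mono)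
  also have "(\<Sum>t\<in>T. \<Sum>e\<in>S. ks (\<alpha> (Ric_end g y e)) t * ks (\<alpha> e) t) = (\<Sum>e\<in>S. ks (\<alpha> (Ric_end g y e)) (\<alpha> e))"
    by (subst sum.swap) (simp add: ks_expand[OF T a(2) a(2), symmetric])
  also have "(\<Sum>t\<in>T. c * (\<Sum>e\<in>S. ks (\<alpha> e) t * ks (\<alpha> e) t)) = c * (\<Sum>e\<in>S. ks (\<alpha> e) (\<alpha> e))"
    unfolding sum_distrib_left[symmetric] by (subst sum.swap) (simp add: ks_expand[OF T a(2) a(2), symmetric])
  finally show ?thesis .
qed

text \<open>The bound on \<open>K\<close> concerns real two-forms. \<open>KF\<close> acts on the
  components of the curvature in an orthonormal frame of \<open>so\<close> separately, so the bound
  can be applied to each and summed.\<close>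

lemma KF_lower:
  assumes y: "y \<in> D" and S: "gframe (g y) S"
    and K: "\<And>\<omega>. two_form \<omega> \<Longrightarrow> ip2 (g y) (*) (Kop g y \<omega>) \<omega> \<ge> c * ip2 (g y) (*) \<omega> \<omega>"
  shows "B.ip y (KF y S (FA y)) (FA y) \<ge> c * B.ip y (FA y) (FA y)"
proof -
  obtain T where T: "orthonormal_frame \<kappa> so T" using so_frame by blast
  note bF = bilinear_FA[OF y]
  define w where "w t X Y = ks (FA y X Y) t" for t X Y
  have bw: "bilinear (w t)" for t
    unfolding w_def by (rule bilinearI'[OF linear_ks(1)[OF bilinearD(2)[OF bF]] linear_ks(1)[OF bilinearD(1)[OF bF]]])
  have tw: "two_form (w t)" for t
  proof -
    have "FA y X X = 0" for X unfolding curvature_def by (simp add: comm_def)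
    then show ?thesis using bw by (simp add: two_form_def w_def B.\<kappa>_lin)
  qed
  have KFso: "KF y S (FA y) X Y \<in> so" for X Y
    unfolding KF_def by (intro subspace_add[OF subspace_so] subspace_diff[OF subspace_so] subspace_sum[OF subspace_so] F_so[OF y])
  have KFt: "ks (KF y S (FA y) X Y) t = KF y S (w t) X Y" for X Y t
    by (simp add: KF_def w_def B.\<kappa>_lin linear_sum[OF B.linear_\<kappa>(2)])
  have "c * (\<Sum>a\<in>S. \<Sum>e\<in>S. w t a e * w t a e) \<le> (\<Sum>a\<in>S. \<Sum>e\<in>S. KF y S (w t) a e * w t a e)" for t
    using K[OF tw[of t]]
    unfolding Kop_gframe[OF y S bw] ip2_gframe[OF S bilinear_times_real bw bw] ip2_gframe[OF S bilinear_times_real bilinear_KF[OF y bw] bw] by simp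
  then have "(\<Sum>t\<in>T. c * (\<Sum>a\<in>S. \<Sum>e\<in>S. w t a e * w t a e)) \<le> (\<Sum>t\<in>T. \<Sum>a\<in>S. \<Sum>e\<in>S. KF y S (w t) a e * w t a e)" by (rule sum_mono)
  moreover have "(\<Sum>t\<in>T. \<Sum>a\<in>S. \<Sum>e\<in>S. h t a e) = (\<Sum>a\<in>S. \<Sum>e\<in>S. \<Sum>t\<in>T. h t a e)" for h :: "_ \<Rightarrow> _ \<Rightarrow> _ \<Rightarrow> real"
    by (subst sum.swap) (intro sum.cong refl sum.swap)
  ultimately have "c * (\<Sum>a\<in>S. \<Sum>e\<in>S. \<Sum>t\<in>T. w t a e * w t a e) \<le> (\<Sum>a\<in>S. \<Sum>e\<in>S. \<Sum>t\<in>T. KF y S (w t) a e * w t a e)"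
    by (simp only: sum_distrib_left[symmetric])
  moreover have "(\<Sum>t\<in>T. w t a e * w t a e) = ks (FA y a e) (FA y a e)" for a e
    unfolding w_def by (rule ks_expand[OF T F_so[OF y] F_so[OF y], symmetric])
  moreover have "(\<Sum>t\<in>T. KF y S (w t) a e * w t a e) = ks (KF y S (FA y) a e) (FA y a e)" for a e
    unfolding KFt[symmetric] unfolding w_def by (rule ks_expand[OF T KFso F_so[OF y], symmetric])
  ultimately show ?thesis
    unfolding B.ip_coframe[OF coframe_gframe[OF S] bF bF] B.ip_coframe[OF coframe_gframe[OF S] bilinear_KF[OF y bF] bF] by simp
qed

lemma weitz_lower:
  assumes y: "y \<in> D" and S: "gframe (g y) S"
    and K: "\<And>\<omega>. two_form \<omega> \<Longrightarrow> ip2 (g y) (*) (Kop g y \<omega>) \<omega> \<ge> c * ip2 (g y) (*) \<omega> \<omega>"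
    and Ft: "\<bar>ip2 (g y) \<kappa> (Ftilde (g y) (FA y) (FA y)) (FA y)\<bar> \<le> b * sqrt (ip2 (g y) \<kappa> (FA y) (FA y)) ^ 3"
  shows "B.ip y (B.weitz y S) (FA y) \<ge> c * B.ip y (FA y) (FA y) - b * sqrt (B.ip y (FA y) (FA y)) ^ 3"
proof -
  note bF = bilinear_FA[OF y] and cS = coframe_gframe[OF S]
  define Ft' where "Ft' = Ftilde (g y) (FA y) (FA y)"
  have Ftso: "Ft' X Y \<in> so" for X Y
    unfolding Ft'_def Ftilde_gframe[OF y S] by (intro subspace_sum[OF subspace_so] subspace_scale[OF subspace_so] comm_so F_so[OF y])
  have bFt: "bilinear Ft'"
  proof -
    note l = bilinearD(2)[OF bF]
    show ?thesis unfolding Ft'_def Ftilde_gframe[OF y S, abs_def]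
      by (rule bilinearI'; rule linear_compose_sum; rule ballI; rule linearI) (simp_all add: linear_add[OF l] linear_scale[OF l] B.br_lin algebra_simps)
  qed
  have i1: "ip2 (g y) \<kappa> (FA y) (FA y) = B.ip y (FA y) (FA y)" unfolding ip_eq by (rule ip2_kskew[symmetric]) (rule F_so[OF y])+
  have i2: "ip2 (g y) \<kappa> Ft' (FA y) = B.ip y Ft' (FA y)" unfolding ip_eq by (rule ip2_kskew[symmetric]) (rule F_so[OF y] Ftso)+
  have "B.ip y (B.weitz y S) (FA y) = B.ip y Ft' (FA y) + B.ip y (KF y S (FA y)) (FA y)"
    unfolding B.ip_coframe[OF cS B.bilinear_weitz[OF y] bF] B.ip_coframe[OF cS bFt bF] B.ip_coframe[OF cS bilinear_KF[OF y bF] bF]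
    by (simp add: weitz_eq[OF y S] Ft'_def B.\<kappa>_lin sum.distrib distrib_left)
  then show ?thesis using KF_lower[OF y S K] Ft unfolding Ft'_def[symmetric] i1 i2 by linarith
qed

lemma ym_local_inequality:
  assumes coclosed: "\<And>y Z S. y \<in> D \<Longrightarrow> gframe (g y) S \<Longrightarrow> (\<Sum>e\<in>S. B.cov FA y e e Z) = 0"
    and dim: "CARD('n) \<ge> 4" and y: "y \<in> D"
    and K: "\<And>\<omega>. two_form \<omega> \<Longrightarrow> ip2 (g y) (*) (Kop g y \<omega>) \<omega> \<ge> c * ip2 (g y) (*) \<omega> \<omega>"
    and Ft: "\<bar>ip2 (g y) \<kappa> (Ftilde (g y) (FA y) (FA y)) (FA y)\<bar> \<le> b * sqrt (ip2 (g y) \<kappa> (FA y) (FA y)) ^ 3"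
    and f: "\<And>z. z \<in> D \<Longrightarrow> f z = ip2 (g z) \<kappa> (FA z) (FA z)"
  shows "f y * lap g f y - (real CARD('n) - 1) / (2 * (real CARD('n) - 2)) * dd f y (grad g f y) \<ge> 2 * f y * (c * f y - b * sqrt (f y) ^ 3)"
proof -
  have f': "f z = B.ip z (B.F z) (B.F z)" if "z \<in> D" for z
    unfolding f[OF that] ip_eq F_eq by (rule ip2_kskew[symmetric]) (rule F_so[OF that])+
  have sf: "smooth_on f D" by (rule smooth_on_cong[OF open_D B.smooth_ip[OF B.tensor2_F B.tensor2_F]]) (simp add: f')
  have df: "f differentiable (at y)" by (rule smooth_on_differentiable[OF sf y])
  obtain S e1 where S: "gframe (g y) S" "e1 \<in> S" "\<And>e. e \<in> S \<Longrightarrow> e \<noteq> e1 \<Longrightarrow> dd f y e = 0"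
    using adapted_frame[OF gram[OF y] linear_dd[OF df]] by blast
  have cc: "B.tr z (\<lambda>X Y. B.cov B.F z X Y Z) = 0" if z: "z \<in> D" for z Z
  proof -
    obtain T where T: "gframe (g z) T" using gram_frame gram[OF z] by blast
    show ?thesis unfolding B.tr_coframe[OF coframe_gframe[OF T] B.bilinear_covF_trace[OF z]] unfolding F_eq by (rule coclosed[OF z T])
  qed
  have "2 * f y * B.ip y (B.weitz y S) (B.F y) \<le> f y * (\<Sum>e\<in>S. dd (\<lambda>z. dd f z e) y e - dd f y (chris g y e e))
      - (real DIM(real^'n) - 1) / (2 * (real DIM(real^'n) - 2)) * (\<Sum>e\<in>S. (dd f y e)\<^sup>2)"
    by (rule B.bochner_kato[OF cc y coframe_gframe[OF S(1)] S(2) _ f' S(3)]) (use dim in auto)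
  then have "2 * f y * B.ip y (B.weitz y S) (FA y) \<le> f y * lap g f y - (real CARD('n) - 1) / (2 * (real CARD('n) - 2)) * dd f y (grad g f y)"
    by (simp only: lap_gframe[OF y S(1) smooth_onD[OF sf]] dd_grad_gframe[OF y S(1) df] F_eq) simp
  moreover have "2 * f y * (c * f y - b * sqrt (f y) ^ 3) \<le> 2 * f y * B.ip y (B.weitz y S) (FA y)"
  proof (rule mult_left_mono)
    show "c * f y - b * sqrt (f y) ^ 3 \<le> B.ip y (B.weitz y S) (FA y)"
      using weitz_lower[OF y S(1) K Ft] f'[OF y] by (simp add: F_eq)
    show "0 \<le> 2 * f y" using B.ip_nonneg[OF coframe_gframe[OF S(1)] bilinear_FA[OF y]] f'[OF y] by (simp add: F_eq)
  qed
  ultimately show ?thesis by linarith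
qed

end

section \<open>The product with a line\<close>

lemma dd_fst:
  assumes "f differentiable (at (fst z))"
  shows "(\<lambda>z. f (fst z)) differentiable (at z)" "dd (\<lambda>z. f (fst z)) z v = dd f (fst z) (fst v)"
proof -
  have "((\<lambda>z. f (fst z)) has_derivative (\<lambda>v. dd f (fst z) (fst v))) (at z)"
    by (rule has_derivative_compose[OF bounded_linear_imp_has_derivative[OF bounded_linear_fst] has_derivative_dd[OF assms]])
  then show "(\<lambda>z. f (fst z)) differentiable (at z)" "dd (\<lambda>z. f (fst z)) z v = dd f (fst z) (fst v)"
    using differentiableI dd_eqI by blast+
qed

lemma Ck_on_fst:
  assumes "open D" "Ck_on k f D"
  shows "Ck_on k (\<lambda>z. f (fst z)) (D \<times> (UNIV :: 'c::real_normed_vector set))"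
  using assms(2)
proof (induction k arbitrary: f)
  case 0
  then show ?case by (auto intro!: continuous_on_compose2[of D f _ fst] continuous_intros)
next
  case (Suc k)
  have o: "open (D \<times> (UNIV :: 'c set))" using assms(1) by (simp add: open_Times)
  have "Ck_on k (\<lambda>z. dd (\<lambda>z. f (fst z)) z v) (D \<times> (UNIV :: 'c set))" for v
  proof (rule Ck_on_cong[OF o])
    show "Ck_on k (\<lambda>z. dd f (fst z) (fst v)) (D \<times> (UNIV :: 'c set))" using Suc.IH[of "\<lambda>y. dd f y (fst v)"] Suc.prems by simp
    show "dd f (fst z) (fst v) = dd (\<lambda>z. f (fst z)) z v" if "z \<in> D \<times> (UNIV :: 'c set)" for z
      by (rule dd_fst(2)[symmetric]) (use Suc.prems that in auto)
  qed
  then show ?case using Suc.prems by (auto intro: dd_fst(1))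
qed

lemma smooth_on_fst: "open D \<Longrightarrow> smooth_on f D \<Longrightarrow> smooth_on (\<lambda>z. f (fst z)) (D \<times> UNIV)"
  by (simp add: smooth_on_def Ck_on_fst)

lemma sum_Basis_prod:
  "sum f (Basis :: ('a::euclidean_space \<times> 'b::euclidean_space) set) = (\<Sum>i\<in>Basis. f (i, 0)) + (\<Sum>i\<in>Basis. f (0, i))"
  by (subst Basis_prod_def, subst sum.union_disjoint) (auto simp: sum.reindex inj_on_def)

lemma bounded_linear_Pair0: "bounded_linear (\<lambda>x. (x, 0))"
  by (intro bounded_linear_Pair bounded_linear_ident bounded_linear_zero)

text \<open>
  With \<open>A' = A + \<Phi> dt\<close> on the product with a line, the curvature of \<open>A'\<close> is \<open>F + d\<^sub>A\<Phi> \<and> dt\<close>, and the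
  Yang--Mills--Higgs equations for \<open>(A, \<Phi>)\<close> are the Yang--Mills equation for \<open>A'\<close>.
\<close>

locale higgs_field = gauge_field D g \<kappa> A for D :: "(real^'n::finite) set" and g
    and \<kappa> :: "real^'r::finite^'r \<Rightarrow> real^'r^'r \<Rightarrow> real" and A +
  fixes \<Phi> :: "real^'n \<Rightarrow> real^'r^'r"
  assumes smooth_higgs: "smooth_on \<Phi> D" and higgs_so: "\<And>y. y \<in> D \<Longrightarrow> \<Phi> y \<in> so"
begin

definition cometricP :: "(real^'n) \<times> real \<Rightarrow> (real^'n) \<times> real \<Rightarrow> (real^'n) \<times> real \<Rightarrow> real"
  where "cometricP z i j = cometric (fst z) (fst i) (fst j) + snd i * snd j"

text \<open>In a product with a flat line no Christoffel symbol involves the line direction.\<close>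

definition chrisP :: "(real^'n) \<times> real \<Rightarrow> (real^'n) \<times> real \<Rightarrow> (real^'n) \<times> real \<Rightarrow> (real^'n) \<times> real"
  where "chrisP z X Y = (chris g (fst z) (fst X) (fst Y), 0)"

definition AP :: "(real^'n) \<times> real \<Rightarrow> (real^'n) \<times> real \<Rightarrow> real^'r^'r"
  where "AP z X = A (fst z) (fst X) + snd X *\<^sub>R \<Phi> (fst z)"

abbreviation DP :: "((real^'n) \<times> real) set" where "DP \<equiv> D \<times> UNIV"

lemma open_DP: "open DP" using open_D by (simp add: open_Times)

lemma cometricP_parallel:
  assumes z: "z \<in> DP" and ij: "i \<in> Basis" "j \<in> Basis"
  shows "dd (\<lambda>z. cometricP z i j) z Z = - (\<Sum>k\<in>Basis. cometricP z k j * (chrisP z Z k \<bullet> i) + cometricP z i k * (chrisP z Z k \<bullet> j))"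
proof -
  have y: "fst z \<in> D" using z by auto
  have dc: "cometric y 0 v = 0" "cometric y u 0 = 0" for y u v by (simp_all add: cometric_def)
  have c0: "chris g (fst z) v 0 = 0" for v by (rule linear_0[OF bilinearD(1)[OF bilinear_chris[OF y]]])
  have "(\<lambda>y. cometric y u v) differentiable (at (fst z))" for u v by (rule smooth_on_differentiable[OF smooth_cometric y])
  note d = dd_fst[OF this]
  have l: "dd (\<lambda>z. cometricP z i j) z Z = dd (\<lambda>y. cometric y (fst i) (fst j)) (fst z) (fst Z)"
    unfolding cometricP_def by (simp add: dd_add[OF d(1) differentiable_const] d(2))
  have r: "(\<Sum>k\<in>Basis. cometricP z k j * (chrisP z Z k \<bullet> i) + cometricP z i k * (chrisP z Z k \<bullet> j))
    = (\<Sum>k\<in>Basis. cometric (fst z) k (fst j) * (chris g (fst z) (fst Z) k \<bullet> fst i) + cometric (fst z) (fst i) k * (chris g (fst z) (fst Z) k \<bullet> fst j))"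
    by (subst sum_Basis_prod) (simp add: cometricP_def chrisP_def inner_prod_def c0)
  show ?thesis
  proof (cases "fst i = 0 \<or> fst j = 0")
    case True
    then show ?thesis unfolding l r by (auto simp: dc)
  next
    case False
    then have "fst i \<in> Basis" "fst j \<in> Basis" using ij by (auto simp: Basis_prod_def)
    then show ?thesis unfolding l r by (rule cometric_parallel[OF y])
  qed
qed

lemma smooth_AP: "smooth_on (\<lambda>z. AP z X) DP"
  unfolding AP_def
  by (intro smooth_on_add[OF open_DP] smooth_on_scaleR[OF open_DP] smooth_on_const smooth_on_fst[OF open_D] smooth_conn smooth_higgs)

lemma AP_so: "z \<in> DP \<Longrightarrow> AP z X \<in> so"
  unfolding AP_def by (intro subspace_add[OF subspace_so] subspace_scale[OF subspace_so] conn_so higgs_so) auto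

sublocale P: bundle_field DP cometricP chrisP comm ks AP
proof (rule bundle_field.intro)
  show "\<And>i j. i \<in> Basis \<Longrightarrow> j \<in> Basis \<Longrightarrow> smooth_on (\<lambda>z. cometricP z i j) DP"
    unfolding cometricP_def by (intro smooth_on_add[OF open_DP] smooth_on_const smooth_on_fst[OF open_D smooth_cometric])
  show "bilinear (chrisP z)" if "z \<in> DP" for z
  proof -
    have "fst z \<in> D" using that by auto
    note l = bilinearD[OF bilinear_chris[OF this]]
    show ?thesis
      by (rule bilinearI'; rule linearI) (simp_all add: chrisP_def linear_add[OF l(1)] linear_add[OF l(2)] linear_scale[OF l(1)] linear_scale[OF l(2)])
  qed
  show "chrisP z X Y = chrisP z Y X" if "z \<in> DP" for z X Y
    using that chris_sym[of "fst z" "fst X" "fst Y"] by (auto simp: chrisP_def)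
  show "smooth_on (\<lambda>z. chrisP z X Y) DP" for X Y
    unfolding chrisP_def by (rule smooth_on_bounded_linear[OF open_DP bounded_linear_Pair0 smooth_on_fst[OF open_D smooth_chris]])
  show "linear (AP z)" if "z \<in> DP" for z
  proof -
    have "fst z \<in> D" using that by auto
    note l = linear_conn[OF this]
    show ?thesis by (rule linearI) (simp_all add: AP_def linear_add[OF l] linear_scale[OF l] algebra_simps)
  qed
  show "kskew \<kappa> (comm (AP y X) b) c + kskew \<kappa> b (comm (AP y X) c) = 0" if "y \<in> DP" for y X b c
    by (rule kskew_comm[OF Ad AP_so[OF that]])
qed (fact open_DP cometricP_parallel smooth_AP B.br B.br_anti B.jacobi B.\<kappa> B.\<kappa>_sym B.\<kappa>_nonneg)+

definition al :: "real^'n \<Rightarrow> real^'n \<Rightarrow> real^'r^'r" where "al y X = dA0 A \<Phi> y X"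

lemma diff_higgs: "y \<in> D \<Longrightarrow> \<Phi> differentiable (at y)"
  by (rule smooth_on_differentiable[OF smooth_higgs])

lemma linear_al: "y \<in> D \<Longrightarrow> linear (al y)"
  by (rule linearI) (simp_all add: al_def dA0_def linear_add[OF linear_dd[OF diff_higgs]] linear_scale[OF linear_dd[OF diff_higgs]]
      linear_add[OF linear_conn] linear_scale[OF linear_conn] B.br_lin algebra_simps)

lemma al_so: "y \<in> D \<Longrightarrow> al y X \<in> so"
  unfolding al_def dA0_def by (intro subspace_add[OF subspace_so] comm_so conn_so higgs_so dd_so[OF open_D _ diff_higgs])

lemma smooth_al: "smooth_on (\<lambda>y. al y X) D"
  unfolding al_def dA0_def
  by (intro smooth_on_add[OF open_D] smooth_on_dd smooth_higgs smooth_on_bilinear[OF open_D bounded_bilinear_comm] smooth_conn)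

lemma diff_al: "y \<in> D \<Longrightarrow> (\<lambda>y. al y X) differentiable (at y)"
  by (rule smooth_on_differentiable[OF smooth_al])

lemma FP_eq:
  assumes z: "z \<in> DP"
  shows "P.F z X Y = FA (fst z) (fst X) (fst Y) + snd Y *\<^sub>R al (fst z) (fst X) - snd X *\<^sub>R al (fst z) (fst Y)"
proof -
  have y: "fst z \<in> D" using z by auto
  note dA = dd_fst[OF B.diff_A[OF y]] and dP = dd_fst[OF diff_higgs[OF y]]
  have dPs: "(\<lambda>z. c *\<^sub>R \<Phi> (fst z)) differentiable (at z)" for c by (rule differentiable_bounded_linear[OF bounded_linear_scaleR_right dP(1)])
  have "dd (\<lambda>z. AP z Y) z X = dd (\<lambda>y. A y (fst Y)) (fst z) (fst X) + snd Y *\<^sub>R dd \<Phi> (fst z) (fst X)" for X Y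
    unfolding AP_def by (simp add: dd_add[OF dA(1) dPs] dd_bounded_linear[OF bounded_linear_scaleR_right dP(1)] dA(2) dP(2))
  moreover have "comm (\<Phi> (fst z)) (A (fst z) V) = - comm (A (fst z) V) (\<Phi> (fst z))" for V by (rule comm_anti)
  moreover have "comm (\<Phi> (fst z)) (\<Phi> (fst z)) = 0" by (simp add: comm_def)
  ultimately show ?thesis
    unfolding P.F_def curvature_def al_def dA0_def by (simp add: AP_def B.br_lin algebra_simps)
qed

lemma RP_eq:
  assumes z: "z \<in> DP"
  shows "P.R z X Y W = (curv_op g (fst z) (fst X) (fst Y) (fst W), 0)"
proof -
  have y: "fst z \<in> D" using z by auto
  note d = dd_fst[OF B.diff_\<Gamma>[OF y]]
  have "dd (\<lambda>z. chrisP z Y W) z X = (dd (\<lambda>y. chris g y (fst Y) (fst W)) (fst z) (fst X), 0)" for X Y W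
    unfolding chrisP_def by (simp add: dd_bounded_linear[OF bounded_linear_Pair0 d(1)] d(2))
  then show ?thesis unfolding P.R_def curv_op_def by (simp add: chrisP_def)
qed

definition frameP :: "(real^'n) set \<Rightarrow> ((real^'n) \<times> real) set"
  where "frameP S = insert (0, 1) ((\<lambda>e. (e, 0)) ` S)"

lemma sum_frameP:
  assumes "finite S" shows "(\<Sum>e\<in>frameP S. h e) = (\<Sum>e\<in>S. h (e, 0)) + (h (0, 1) :: 'b::comm_monoid_add)"
proof -
  have "(0, 1) \<notin> (\<lambda>e. (e, 0 :: real)) ` S" by auto
  moreover have "inj_on (\<lambda>e. (e, 0 :: real)) S" by (auto simp: inj_on_def)
  ultimately show ?thesis using assms by (simp add: frameP_def sum.reindex add.commute)
qed

lemma finite_gframe: "gframe G S \<Longrightarrow> finite S" for G :: "real^'n^'n"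
  by (simp add: orthonormal_frame_def)

lemma coframe_frameP:
  assumes S: "gframe (g (fst z)) S" shows "P.coframe z (frameP S)"
proof -
  note fS = finite_gframe[OF S]
  have c: "cometric (fst z) u v = (\<Sum>e\<in>S. (e \<bullet> u) * (e \<bullet> v))" for u v
  proof -
    have "cometric (fst z) u v = (\<Sum>i\<in>UNIV. \<Sum>j\<in>UNIV. \<Sum>e\<in>S. (e $ i * u $ i) * (e $ j * v $ j))"
      by (simp add: cometric_def inner_vec_def matrix_vector_mult_def matrix_inv_gframe[OF S] sum_distrib_left sum_distrib_right ac_simps)
    also have "\<dots> = (\<Sum>i\<in>UNIV. \<Sum>e\<in>S. \<Sum>j\<in>UNIV. (e $ i * u $ i) * (e $ j * v $ j))" by (intro sum.cong refl sum.swap)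
    also have "\<dots> = (\<Sum>e\<in>S. (\<Sum>i\<in>UNIV. e $ i * u $ i) * (\<Sum>j\<in>UNIV. e $ j * v $ j))"
      by (subst sum.swap) (simp add: sum_product)
    finally show ?thesis by (simp add: inner_vec_def)
  qed
  have "card (frameP S) = Suc (card S)"
    using fS by (subst frameP_def, subst card_insert_disjoint) (auto simp: card_image inj_on_def)
  then show ?thesis
    unfolding P.coframe_def sum_frameP[OF fS] using fS gframe_card[OF S]
    by (auto simp: frameP_def cometricP_def c inner_prod_def)
qed

lemma al_0: "y \<in> D \<Longrightarrow> al y 0 = 0" by (rule linear_0[OF linear_al])

lemma FA_0: "y \<in> D \<Longrightarrow> FA y 0 X = 0" "y \<in> D \<Longrightarrow> FA y X 0 = 0"
  using linear_0[OF bilinearD(1)[OF bilinear_FA]] linear_0[OF bilinearD(2)[OF bilinear_FA]] by auto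

lemma curv_0: "y \<in> D \<Longrightarrow> curv_op g y 0 X Y = 0" "y \<in> D \<Longrightarrow> curv_op g y X 0 Y = 0" "y \<in> D \<Longrightarrow> curv_op g y X Y 0 = 0"
  using linear_0[OF linear_curv(1)] linear_0[OF linear_curv(2)] linear_0[OF linear_curv(3)] by auto

lemma chris_0: "y \<in> D \<Longrightarrow> chris g y 0 X = 0" "y \<in> D \<Longrightarrow> chris g y X 0 = 0"
  using linear_0[OF bilinearD(1)[OF bilinear_chris]] linear_0[OF bilinearD(2)[OF bilinear_chris]] by auto

lemma ddFP:
  assumes z: "z \<in> DP"
  shows "dd (\<lambda>z. P.F z Y W) z X = dd (\<lambda>y. FA y (fst Y) (fst W)) (fst z) (fst X)
     + snd W *\<^sub>R dd (\<lambda>y. al y (fst Y)) (fst z) (fst X) - snd Y *\<^sub>R dd (\<lambda>y. al y (fst W)) (fst z) (fst X)"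
proof -
  have y: "fst z \<in> D" using z by auto
  note dF = dd_fst[OF smooth_on_differentiable[OF smooth_FA y]] and da = dd_fst[OF diff_al[OF y]]
  have das: "(\<lambda>z. c *\<^sub>R al (fst z) V) differentiable (at z)" for c V
    by (rule differentiable_bounded_linear[OF bounded_linear_scaleR_right da(1)])
  have "dd (\<lambda>z. P.F z Y W) z X = dd (\<lambda>z. FA (fst z) (fst Y) (fst W) + snd W *\<^sub>R al (fst z) (fst Y) - snd Y *\<^sub>R al (fst z) (fst W)) z X"
    by (rule dd_cong_open[OF open_DP z]) (rule FP_eq)
  then show ?thesis
    by (simp add: dd_diff[OF differentiable_add[OF dF(1) das] das] dd_add[OF dF(1) das] dd_bounded_linear[OF bounded_linear_scaleR_right da(1)] dF(2) da(2))
qed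

text \<open>The horizontal part of the trace is the divergence of the curvature plus
  \<open>r\<close> times the equation for \<open>\<Phi>\<close>. Nothing depends on the line
  coordinate, so the line direction contributes only a bracket with \<open>\<Phi>\<close>, and this
  balances the right-hand side of the equation for the curvature.\<close>

lemma coclosedP:
  assumes ym: "\<And>y Z S. y \<in> D \<Longrightarrow> gframe (g y) S \<Longrightarrow> (\<Sum>e\<in>S. B.cov FA y e e Z) = - comm (al y Z) (\<Phi> y)"
    and higgs: "\<And>y S. y \<in> D \<Longrightarrow> gframe (g y) S \<Longrightarrow> (\<Sum>e\<in>S. dd (\<lambda>z. al z e) y e + comm (A y e) (al y e) - al y (chris g y e e)) = 0"
    and z: "z \<in> DP"
  shows "P.tr z (\<lambda>X Y. P.cov P.F z X Y Z) = 0"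
proof -
  have y: "fst z \<in> D" using z by auto
  obtain S where S: "gframe (g (fst z)) S" using gram_frame gram[OF y] by blast
  obtain W r where Z: "Z = (W, r)" by fastforce
  have d0: "dd f (fst z) 0 = 0" if "f differentiable (at (fst z))" for f :: "real^'n \<Rightarrow> real^'r^'r" by (rule linear_0[OF linear_dd[OF that]])
  note dF = smooth_on_differentiable[OF smooth_FA y]
  have 1: "P.cov P.F z (e, 0) (e, 0) (W, r) = B.cov FA (fst z) e e W
      + r *\<^sub>R (dd (\<lambda>z. al z e) (fst z) e + comm (A (fst z) e) (al (fst z) e) - al (fst z) (chris g (fst z) e e))" for e
    unfolding P.cov_def B.cov_def by (simp add: ddFP[OF z] FP_eq[OF z] AP_def chrisP_def B.br_lin algebra_simps)
  have 2: "P.cov P.F z (0, 1) (0, 1) (W, r) = comm (al (fst z) W) (\<Phi> (fst z))"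
    unfolding P.cov_def using comm_anti[of "\<Phi> (fst z)" "al (fst z) W"] linear_0[OF linear_conn[OF y]]
    by (simp add: ddFP[OF z] FP_eq[OF z] AP_def chrisP_def B.br_lin d0[OF dF] d0[OF diff_al[OF y]] chris_0[OF y] al_0[OF y] FA_0[OF y])
  show ?thesis
    unfolding P.tr_coframe[OF coframe_frameP[OF S] P.bilinear_covF_trace[OF z]] sum_frameP[OF finite_gframe[OF S]] Z 1 2
      sum.distrib scaleR_sum_right[symmetric] higgs[OF y S] ym[OF y S] by simp
qed

text \<open>Pairs of a horizontal vector and the line direction occur in both orders, which cancels
  the factor \<open>1/2\<close> for them.\<close>

lemma ip_frameP:
  assumes S: "gframe (g (fst z)) S" and w: "bilinear \<omega>" "bilinear \<eta>" and a: "\<And>X Y. \<omega> X Y = - \<omega> Y X" "\<And>X Y. \<eta> X Y = - \<eta> Y X"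
  shows "P.ip z \<omega> \<eta> = 1/2 * (\<Sum>a\<in>S. \<Sum>c\<in>S. ks (\<omega> (a, 0) (c, 0)) (\<eta> (a, 0) (c, 0))) + (\<Sum>a\<in>S. ks (\<omega> (a, 0) (0, 1)) (\<eta> (a, 0) (0, 1)))"
proof -
  have 1: "ks (\<omega> (0, 1) c) (\<eta> (0, 1) c) = ks (\<omega> c (0, 1)) (\<eta> c (0, 1))" for c
    using a(1)[of "(0, 1)" c] a(2)[of "(0, 1)" c] by (simp add: B.\<kappa>_lin)
  have "\<omega> (0, 1) (0, 1) + \<omega> (0, 1) (0, 1) = 0" using a(1)[of "(0, 1)" "(0, 1)"] by (metis add.right_inverse)
  then have "\<omega> (0, 1) (0, 1) = 0" by (simp add: scaleR_2[symmetric])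
  then show ?thesis
    unfolding P.ip_coframe[OF coframe_frameP[OF S] w] sum_frameP[OF finite_gframe[OF S]]
    by (simp add: sum.distrib 1 B.\<kappa>_lin)
qed

text \<open>The line direction adds one summand to \<open>weitz\<close>. The curvature of the
  product vanishes on it, so the summand is the bracket of the mixed components of
  \<open>P.F\<close>.\<close>

lemma weitzP_horizontal:
  assumes z: "z \<in> DP" and S: "gframe (g (fst z)) S"
  shows "P.weitz z (frameP S) (a, 0) (c, 0) = B.weitz (fst z) S a c + 2 *\<^sub>R comm (al (fst z) a) (al (fst z) c)"
proof -
  have y: "fst z \<in> D" using z by auto
  show ?thesis
    unfolding P.weitz_def sum_frameP[OF finite_gframe[OF S]] B.weitz_def F_eq R_eq
    by (simp add: FP_eq[OF z] RP_eq[OF z] curv_0[OF y] FA_0[OF y] al_0[OF y] B.br_lin)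
qed

text \<open>With one argument along the line, of the curvature terms only the Ricci term in the
  other argument survives, beside the brackets of horizontal with mixed components.\<close>

lemma weitzP_vertical:
  assumes z: "z \<in> DP" and S: "gframe (g (fst z)) S"
  shows "P.weitz z (frameP S) (a, 0) (0, 1) = al (fst z) (Ric_end g (fst z) a) - (\<Sum>e\<in>S. 2 *\<^sub>R comm (FA (fst z) a e) (al (fst z) e))"
proof -
  have y: "fst z \<in> D" using z by auto
  show ?thesis
    unfolding P.weitz_def sum_frameP[OF finite_gframe[OF S]] Ric_end_gframe[OF y S] linear_sum[OF linear_al[OF y]] sum_subtractf[symmetric]
    by (simp add: FP_eq[OF z] RP_eq[OF z] curv_0[OF y] FA_0[OF y] al_0[OF y] B.br_lin add.commute)
qed

text \<open>\<open>bochner_kato\<close> on the product, whose dimension is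
  \<open>CARD('n) + 1\<close>; this shift accounts for the coefficient of the gradient term. The
  mixed brackets are controlled by \<open>Br\<close>, the Ricci term by \<open>Rc\<close>.\<close>

lemma higgs_local_inequality:
  assumes ym: "\<And>y Z S. y \<in> D \<Longrightarrow> gframe (g y) S \<Longrightarrow> (\<Sum>e\<in>S. B.cov FA y e e Z) = - comm (al y Z) (\<Phi> y)"
    and higgs: "\<And>y S. y \<in> D \<Longrightarrow> gframe (g y) S \<Longrightarrow> (\<Sum>e\<in>S. dd (\<lambda>z. al z e) y e + comm (A y e) (al y e) - al y (chris g y e e)) = 0"
    and dim: "CARD('n) \<ge> 3" and y: "y \<in> D"
    and K: "\<And>\<omega>. two_form \<omega> \<Longrightarrow> ip2 (g y) (*) (Kop g y \<omega>) \<omega> \<ge> c1 * ip2 (g y) (*) \<omega> \<omega>"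
    and Rc: "\<And>X. Ric g y X X \<ge> c2 * met (g y) X X"
    and Ft: "\<bar>ip2 (g y) \<kappa> (Ftilde (g y) (FA y) (FA y)) (FA y)\<bar> \<le> b1 * sqrt (ip2 (g y) \<kappa> (FA y) (FA y)) ^ 3"
    and Br: "sqrt (ip2 (g y) \<kappa> (bracket11 (al y) (al y)) (bracket11 (al y) (al y))) \<le> b2 * ip1 (g y) \<kappa> (al y) (al y)"
    and f: "\<And>z. z \<in> D \<Longrightarrow> f z = ip2 (g z) \<kappa> (FA z) (FA z) + ip1 (g z) \<kappa> (al z) (al z)"
  shows "f y * lap g f y - real CARD('n) / (2 * (real CARD('n) - 1)) * dd f y (grad g f y)
     \<ge> 2 * f y * ((min c1 c2 - max b1 (3 * b2) * sqrt (ip2 (g y) \<kappa> (FA y) (FA y))) * f y)"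
proof -
  have ip1S: "ip1 (g z) \<kappa> (al z) (al z) = (\<Sum>a\<in>S. ks (al z a) (al z a))" if z: "z \<in> D" and S: "gframe (g z) S" for z S
  proof -
    have "ip1 (g z) \<kappa> (al z) (al z) = mtrace (g z) (\<lambda>X Y. ks (al z X) (al z Y))"
      unfolding ip1_def by (simp add: kskew_so[OF al_so[OF z] al_so[OF z]])
    also have "\<dots> = (\<Sum>a\<in>S. ks (al z a) (al z a))"
      by (rule mtrace_gframe[OF S bilinearI'[OF linear_ks(1)[OF linear_al[OF z]] linear_ks(2)[OF linear_al[OF z]]]])
    finally show ?thesis .
  qed
  have ip2F: "ip2 (g z) \<kappa> (FA z) (FA z) = B.ip z (FA z) (FA z)" if "z \<in> D" for z
    unfolding ip_eq by (rule ip2_kskew[symmetric]) (rule F_so[OF that])+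
  have fP: "f (fst z) = P.ip z (P.F z) (P.F z)" if z: "z \<in> DP" for z
  proof -
    have y: "fst z \<in> D" using z by auto
    obtain S where S: "gframe (g (fst z)) S" using gram_frame gram[OF y] by blast
    show ?thesis
      unfolding f[OF y] ip2F[OF y] ip1S[OF y S] ip_frameP[OF S P.bilinear_F[OF z] P.bilinear_F[OF z] P.F_anti P.F_anti]
        B.ip_coframe[OF coframe_gframe[OF S] bilinear_FA[OF y] bilinear_FA[OF y]]
      by (simp add: FP_eq[OF z] al_0[OF y] FA_0[OF y])
  qed
  have sf: "smooth_on f D"
  proof -
    have m: "smooth_on (\<lambda>y. mtrace (g y) (\<lambda>X Y. ks (al y X) (al y Y))) D"
      unfolding tr_eq[symmetric]
      by (rule B.smooth_tr) (rule smooth_on_bilinear[OF open_D B.\<kappa> smooth_al smooth_al])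
    have "smooth_on (\<lambda>y. B.ip y (B.F y) (B.F y) + mtrace (g y) (\<lambda>X Y. ks (al y X) (al y Y))) D"
      by (rule smooth_on_add[OF open_D B.smooth_ip[OF B.tensor2_F B.tensor2_F] m])
    then show ?thesis
      by (rule smooth_on_cong[OF open_D]) (simp add: f ip2F F_eq ip1_def kskew_so[OF al_so al_so])
  qed
  have df: "f differentiable (at y)" by (rule smooth_on_differentiable[OF sf y])
  obtain S e1 where S: "gframe (g y) S" and e1: "e1 \<in> S" "\<And>e. e \<in> S \<Longrightarrow> e \<noteq> e1 \<Longrightarrow> dd f y e = 0"
    using adapted_frame[OF gram[OF y] linear_dd[OF df]] by blast
  \<comment> \<open>All data are constant along the line, so any point above \<open>y\<close>
    serves.\<close>
  define z where "z = (y, 0 :: real)"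
  have z: "z \<in> DP" "fst z = y" using y by (auto simp: z_def)
  have S': "gframe (g (fst z)) S" using S z by simp
  have fS: "finite S" by (rule finite_gframe[OF S])
  have dfP: "dd (\<lambda>z. f (fst z)) w v = dd f (fst w) (fst v)" if "w \<in> DP" for w v
    by (rule dd_fst(2)[OF smooth_on_differentiable[OF sf]]) (use that in auto)
  have ddfP: "dd (\<lambda>w. dd (\<lambda>z. f (fst z)) w e) z e = dd (\<lambda>y. dd f y (fst e)) y (fst e)" for e
  proof -
    have "dd (\<lambda>w. dd (\<lambda>z. f (fst z)) w e) z e = dd (\<lambda>w. dd f (fst w) (fst e)) z e"
      by (rule dd_cong_open[OF open_DP z(1)]) (rule dfP)
    also have "\<dots> = dd (\<lambda>y. dd f y (fst e)) (fst z) (fst e)"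
      by (rule dd_fst(2)[OF smooth_on_differentiable[OF smooth_on_dd[OF sf]]]) (use z y in auto)
    finally show ?thesis using z by simp
  qed
  have df0: "dd f y 0 = 0" "dd (\<lambda>y. dd f y v) y 0 = 0" for v
    using linear_0[OF linear_dd[OF df]] linear_0[OF linear_dd[OF smooth_on_differentiable[OF smooth_on_dd[OF sf] y]]] by auto
  have main: "2 * f (fst z) * P.ip z (P.weitz z (frameP S)) (P.F z) \<le>
      f (fst z) * (\<Sum>e\<in>frameP S. dd (\<lambda>w. dd (\<lambda>z. f (fst z)) w e) z e - dd (\<lambda>z. f (fst z)) z (chrisP z e e))
      - (real DIM((real^'n) \<times> real) - 1) / (2 * (real DIM((real^'n) \<times> real) - 2)) * (\<Sum>e\<in>frameP S. (dd (\<lambda>z. f (fst z)) z e)\<^sup>2)"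
  proof (rule P.bochner_kato[OF coclosedP[OF ym higgs] z(1) coframe_frameP[OF S'] _ _ fP])
    show "(e1, 0) \<in> frameP S" using e1 by (simp add: frameP_def)
    show "4 \<le> DIM((real^'n) \<times> real)" using dim by simp
    show "dd (\<lambda>z. f (fst z)) z e = 0" if "e \<in> frameP S" "e \<noteq> (e1, 0)" for e
    proof (cases "e = (0, 1)")
      case True
      then show ?thesis unfolding dfP[OF z(1)] using df0 z(2) by simp
    next
      case False
      then obtain a where "a \<in> S" "e = (a, 0)" using \<open>e \<in> frameP S\<close> by (auto simp: frameP_def)
      then show ?thesis unfolding dfP[OF z(1)] using e1(2)[of a] \<open>e \<noteq> (e1, 0)\<close> z(2) by simp
    qed
  qed
  have 1: "(\<Sum>e\<in>frameP S. dd (\<lambda>w. dd (\<lambda>z. f (fst z)) w e) z e - dd (\<lambda>z. f (fst z)) z (chrisP z e e)) = lap g f y"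
    unfolding ddfP dfP[OF z(1)] lap_gframe[OF y S smooth_onD[OF sf]] sum_frameP[OF fS]
    using df0 chris_0[OF y] by (simp add: chrisP_def z(2))
  have 2: "(\<Sum>e\<in>frameP S. (dd (\<lambda>z. f (fst z)) z e)\<^sup>2) = dd f y (grad g f y)"
    unfolding dfP[OF z(1)] dd_grad_gframe[OF y S df] sum_frameP[OF fS] using df0 by (simp add: z(2))
  have 3: "(real DIM((real^'n) \<times> real) - 1) / (2 * (real DIM((real^'n) \<times> real) - 2)) = real CARD('n) / (2 * (real CARD('n) - 1))"
    by simp
  define N where "N = B.ip y (FA y) (FA y)"
  define M where "M = (\<Sum>a\<in>S. ks (al y a) (al y a))"
  define Q where "Q = (\<Sum>a\<in>S. \<Sum>c\<in>S. ks (comm (al y a) (al y c)) (FA y a c))"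
  have NM: "f y = N + M" unfolding N_def M_def f[OF y] ip2F[OF y] ip1S[OF y S] ..
  have N0: "N \<ge> 0" unfolding N_def by (rule B.ip_nonneg[OF coframe_gframe[OF S] bilinear_FA[OF y]])
  have M0: "M \<ge> 0" unfolding M_def by (intro sum_nonneg B.\<kappa>_nonneg)
  \<comment> \<open>The bracket sum \<open>Q\<close> occurs once in the horizontal part and, after
    invariance of \<open>\<kappa>\<close> has rearranged it, twice in the vertical part: the origin
    of the factor 3.\<close>
  have ipw: "P.ip z (P.weitz z (frameP S)) (P.F z) = B.ip y (B.weitz y S) (FA y) + 3 * Q + (\<Sum>a\<in>S. ks (al y (Ric_end g y a)) (al y a))"
  proof -
    have v: "ks (\<Sum>e\<in>S. 2 *\<^sub>R comm (FA y a e) (al y e)) (al y a) = - (2 * (\<Sum>e\<in>S. ks (comm (al y a) (al y e)) (FA y a e)))" for a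
    proof -
      have "ks (comm (FA y a e) (al y e)) (al y a) = - ks (comm (al y a) (al y e)) (FA y a e)" for e
      proof -
        have "ks (comm (FA y a e) (al y e)) (al y a) = ks (FA y a e) (comm (al y e) (al y a))"
          using kskew_comm[OF Ad al_so[OF y, of e], of "FA y a e" "al y a"] comm_anti[of "FA y a e" "al y e"] by (simp add: B.\<kappa>_lin)
        then show ?thesis
          using comm_anti[of "al y e" "al y a"] B.\<kappa>_sym[of "FA y a e"] by (simp add: B.\<kappa>_lin)
      qed
      then show ?thesis by (simp add: linear_sum[OF B.linear_\<kappa>(2)] B.\<kappa>_lin sum_negf sum_distrib_left)
    qed
    show ?thesis
      unfolding ip_frameP[OF S' P.bilinear_weitz[OF z(1)] P.bilinear_F[OF z(1)] P.weitz_anti[OF z(1)] P.F_anti]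
        weitzP_horizontal[OF z(1) S'] weitzP_vertical[OF z(1) S'] FP_eq[OF z(1)] z(2)
        B.ip_coframe[OF coframe_gframe[OF S] B.bilinear_weitz[OF y] bilinear_FA[OF y]]
      by (simp add: B.\<kappa>_lin FA_0[OF y] al_0[OF y] v sum.distrib sum_subtractf sum_negf sum_distrib_left[symmetric] Q_def)
  qed
  \<comment> \<open>\<open>bracket11 (al y) (al y)\<close> is twice the commutator, which offsets
    the factor \<open>1/2\<close> of the inner product; hence \<open>Q\<close> is its pairing with
    the curvature, and Cauchy-Schwarz applies.\<close>
  have q1: "\<bar>Q\<bar> \<le> b2 * M * sqrt N"
  proof -
    define E where "E = bracket11 (al y) (al y)"
    have E: "E X Y = 2 *\<^sub>R comm (al y X) (al y Y)" for X Y
      unfolding E_def bracket11_def using comm_anti[of "al y Y" "al y X"] by (simp add: scaleR_2)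
    note la = linear_al[OF y]
    have bE: "bilinear E"
      by (rule bilinearI'; rule linearI) (simp_all add: E linear_add[OF la] linear_scale[OF la] B.br_lin algebra_simps)
    have Eso: "E X Y \<in> so" for X Y unfolding E by (intro subspace_scale[OF subspace_so] comm_so al_so[OF y])
    have "Q = B.ip y E (FA y)"
      unfolding B.ip_coframe[OF coframe_gframe[OF S] bE bilinear_FA[OF y]] by (simp add: Q_def E B.\<kappa>_lin sum_distrib_left)
    then have "Q\<^sup>2 \<le> B.ip y E E * N"
      using B.ip_Cauchy_Schwarz[OF coframe_gframe[OF S] bE bilinear_FA[OF y]] by (simp add: N_def)
    then have "\<bar>Q\<bar> \<le> sqrt (B.ip y E E * N)" by (metis real_sqrt_abs real_sqrt_le_iff)
    also have "\<dots> = sqrt (B.ip y E E) * sqrt N" by (rule real_sqrt_mult)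
    also have "\<dots> \<le> b2 * M * sqrt N"
    proof (rule mult_right_mono)
      have "ip2 (g y) \<kappa> E E = B.ip y E E" unfolding ip_eq by (rule ip2_kskew[symmetric]) (rule Eso)+
      then show "sqrt (B.ip y E E) \<le> b2 * M" using Br unfolding E_def[symmetric] ip1S[OF y S] M_def by simp
    qed (use N0 in simp)
    finally show ?thesis .
  qed
  have w1: "c1 * N - b1 * sqrt N ^ 3 \<le> B.ip y (B.weitz y S) (FA y)"
    unfolding N_def by (rule weitz_lower[OF y S K Ft])
  have r1: "c2 * M \<le> (\<Sum>a\<in>S. ks (al y (Ric_end g y a)) (al y a))"
    unfolding M_def by (rule Ric_end_so_lower[OF y S linear_al[OF y] al_so[OF y] Rc])
  \<comment> \<open>The error is \<open>sqrt N * N\<close> from the curvature and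
    \<open>sqrt N * M\<close> from the bracket; a common constant combines them to a multiple of
    \<open>sqrt N * (N + M)\<close>.\<close>
  have low: "(min c1 c2 - max b1 (3 * b2) * sqrt N) * f y \<le> P.ip z (P.weitz z (frameP S)) (P.F z)"
  proof -
    have s3: "sqrt N ^ 3 = sqrt N * N" using N0 by (simp add: power3_eq_cube)
    have "min c1 c2 * N \<le> c1 * N" "min c1 c2 * M \<le> c2 * M" using N0 M0 by (auto intro: mult_right_mono)
    moreover have "b1 * (sqrt N * N) \<le> max b1 (3 * b2) * (sqrt N * N)" "(3 * b2) * (sqrt N * M) \<le> max b1 (3 * b2) * (sqrt N * M)"
      using N0 M0 by (auto intro: mult_right_mono)
    moreover have "3 * Q \<ge> - ((3 * b2) * (sqrt N * M))" using q1 by (simp add: ac_simps abs_le_iff)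
    ultimately have "min c1 c2 * N + min c1 c2 * M - max b1 (3 * b2) * (sqrt N * N) - max b1 (3 * b2) * (sqrt N * M)
       \<le> P.ip z (P.weitz z (frameP S)) (P.F z)"
      unfolding ipw using w1[unfolded s3] r1 by linarith
    then show ?thesis unfolding NM by (simp add: algebra_simps)
  qed
  have "2 * f y * ((min c1 c2 - max b1 (3 * b2) * sqrt N) * f y) \<le> 2 * f y * P.ip z (P.weitz z (frameP S)) (P.F z)"
    by (rule mult_left_mono[OF low]) (use NM N0 M0 in simp)
  then show ?thesis using main unfolding 1 2 3 z(2) ip2F[OF y] N_def[symmetric] by linarith
qed

end

section \<open>Invariance under changes of charts and frames\<close>

lemma gframe_image:
  fixes L :: "real^'n::finite \<Rightarrow> real^'n"
  assumes G: "gram G" and L: "linear L" and iso: "\<And>X Y. met G X Y = met G' (L X) (L Y)" and S: "gframe G S"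
  shows "gframe G' (L ` S)" "inj_on L S"
proof -
  have i: "inj L"
  proof (rule injI)
    fix X Y assume e: "L X = L Y"
    show "X = Y" by (rule gram_nondegenerate[OF G]) (simp add: iso e)
  qed
  then show iS: "inj_on L S" by (rule inj_on_subset) simp
  have su: "surj L" using linear_injective_imp_surjective[OF L i] by simp
  have "(\<Sum>e\<in>L ` S. met G' x e *\<^sub>R e) = x" for x
  proof -
    obtain u where u: "x = L u" using su by (metis surjD)
    have "(\<Sum>e\<in>L ` S. met G' x e *\<^sub>R e) = (\<Sum>e\<in>S. met G u e *\<^sub>R L e)" by (simp add: sum.reindex[OF iS] u iso)
    also have "\<dots> = L u" by (rule orthonormal_frame_linear[OF S L]) simp
    finally show ?thesis using u by simp
  qed
  moreover have "met G' (L a) (L b) = (if L a = L b then 1 else 0)" if "a \<in> S" "b \<in> S" for a b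
    using S that inj_eq[OF i, of a b] by (auto simp: orthonormal_frame_def iso[symmetric])
  ultimately show "gframe G' (L ` S)" using S by (auto simp: orthonormal_frame_def)
qed

lemma ip2_pullback:
  fixes L :: "real^'n::finite \<Rightarrow> real^'n" and k :: "'b::real_vector \<Rightarrow> 'b \<Rightarrow> real"
  assumes G: "gram G" and L: "linear L" and iso: "\<And>X Y. met G X Y = met G' (L X) (L Y)"
    and k: "bilinear k" and w: "bilinear \<omega>" "bilinear \<omega>'" and e: "\<And>X Y. \<omega> X Y = \<omega>' (L X) (L Y)"
  shows "ip2 G k \<omega> \<omega> = ip2 G' k \<omega>' \<omega>'"
proof -
  obtain S where S: "gframe G S" using gram_frame[OF G] by blast
  note S' = gframe_image[OF G L iso S]
  show ?thesis
    unfolding ip2_gframe[OF S k w(1) w(1)] ip2_gframe[OF S'(1) k w(2) w(2)] sum.reindex[OF S'(2)] by (simp add: e)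
qed

lemma ip1_pullback:
  fixes L :: "real^'n::finite \<Rightarrow> real^'n" and k :: "'b::real_vector \<Rightarrow> 'b \<Rightarrow> real"
  assumes G: "gram G" and L: "linear L" and iso: "\<And>X Y. met G X Y = met G' (L X) (L Y)"
    and k: "bilinear k" and w: "linear \<omega>" "linear \<omega>'" and e: "\<And>X. \<omega> X = \<omega>' (L X)"
  shows "ip1 G k \<omega> \<omega> = ip1 G' k \<omega>' \<omega>'"
proof -
  obtain S where S: "gframe G S" using gram_frame[OF G] by blast
  note S' = gframe_image[OF G L iso S]
  have b: "bilinear (\<lambda>v v'. k (w v) (w v'))" if "linear w" for w :: "real^'n \<Rightarrow> 'b"
    using linear_compose[OF that bilinearD(2)[OF k]] linear_compose[OF that bilinearD(1)[OF k]] by (simp add: bilinear_def o_def)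
  show ?thesis
    unfolding ip1_def mtrace_gframe[OF S b[OF w(1)]] mtrace_gframe[OF S'(1) b[OF w(2)]] sum.reindex[OF S'(2)] by (simp add: e)
qed

text \<open>Differentiating \<open>A' (\<phi> z) (dd \<phi> z Y)\<close> produces second derivatives
  of \<open>\<phi>\<close>; they are symmetric and cancel in the curvature.\<close>

lemma curvature_pullback:
  fixes A A' :: "real^'n::finite \<Rightarrow> real^'n \<Rightarrow> real^'r::finite^'r"
  assumes W: "open W" "y \<in> W" and phi: "smooth_on \<phi> W"
    and l: "\<And>z. z \<in> W \<Longrightarrow> linear (A' (\<phi> z))" and d: "\<And>X. (\<lambda>w. A' w X) differentiable (at (\<phi> y))"
    and A: "\<And>z X. z \<in> W \<Longrightarrow> A z X = A' (\<phi> z) (dd \<phi> z X)"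
  shows "curvature A y X Y = curvature A' (\<phi> y) (dd \<phi> y X) (dd \<phi> y Y)"
proof -
  have dphi: "\<phi> differentiable (at y)" "(\<lambda>z. dd \<phi> z Y) differentiable (at y)" for Y
    using smooth_on_differentiable[OF phi W(2)] smooth_on_differentiable[OF smooth_on_dd[OF phi] W(2)] by auto
  have dc: "(\<lambda>z. A' (\<phi> z) u) differentiable (at y)" "dd (\<lambda>z. A' (\<phi> z) u) y X = dd (\<lambda>w. A' w u) (\<phi> y) (dd \<phi> y X)" for u X
    using differentiableI[OF has_derivative_compose[OF has_derivative_dd[OF dphi(1)] has_derivative_dd[OF d]]]
      dd_compose[OF dphi(1) d] by auto
  have e: "dd (\<lambda>z. A z Y) y X = dd (\<lambda>w. A' w (dd \<phi> y Y)) (\<phi> y) (dd \<phi> y X) + A' (\<phi> y) (dd (\<lambda>z. dd \<phi> z Y) y X)" for X Y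
  proof -
    have "dd (\<lambda>z. A z Y) y X = dd (\<lambda>z. A' (\<phi> z) (dd \<phi> z Y)) y X" by (rule dd_cong_open[OF W]) (rule A)
    also have "\<dots> = dd (\<lambda>z. A' (\<phi> z) (dd \<phi> y Y)) y X + A' (\<phi> y) (dd (\<lambda>z. dd \<phi> z Y) y X)"
      by (rule dd_linear_moving(2)[OF W l dc(1) dphi(2)])
    finally show ?thesis by (simp add: dc(2))
  qed
  have c: "dd (\<lambda>z. dd \<phi> z Y) y X = dd (\<lambda>z. dd \<phi> z X) y Y" by (rule dd_commute[OF W smooth_onD[OF phi]])
  show ?thesis unfolding curvature_def e c by (simp add: A[OF W(2)])
qed

lemma differentiable_matrix_mult:
  fixes f h :: "'a::real_normed_vector \<Rightarrow> real^'r::finite^'r"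
  assumes "f differentiable (at y)" "h differentiable (at y)"
  shows "(\<lambda>z. f z ** h z) differentiable (at y)" "dd (\<lambda>z. f z ** h z) y v = dd f y v ** h y + f y ** dd h y v"
  by (rule differentiable_bilinear[OF bounded_bilinear_matrix_mult assms], rule dd_bilinear[OF bounded_bilinear_matrix_mult assms])

text \<open>Differentiate \<open>transpose (T z) ** T z = mat 1\<close> and multiply by
  \<open>transpose (T y)\<close> from the right.\<close>

lemma dd_orthogonal_transpose:
  fixes T :: "'a::real_normed_vector \<Rightarrow> real^'r::finite^'r"
  assumes W: "open W" "y \<in> W" and T: "T differentiable (at y)" and o: "\<And>z. z \<in> W \<Longrightarrow> orthogonal_matrix (T z)"
  shows "dd (\<lambda>z. transpose (T z)) y X = - (transpose (T y) ** (dd T y X ** transpose (T y)))"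
proof -
  have dt: "(\<lambda>z. transpose (T z)) differentiable (at y)" by (rule differentiable_bounded_linear[OF bounded_linear_transpose T])
  have o': "T y ** transpose (T y) = mat 1" using o[OF W(2)] by (simp add: orthogonal_matrix_def)
  have "dd (\<lambda>z. transpose (T z) ** T z) y X = dd (\<lambda>z. mat 1 :: real^'r^'r) y X"
    by (rule dd_cong_open[OF W]) (use o in \<open>simp add: orthogonal_matrix_def\<close>)
  then have "dd (\<lambda>z. transpose (T z)) y X ** T y = - (transpose (T y) ** dd T y X)"
    by (simp add: differentiable_matrix_mult[OF dt T] eq_neg_iff_add_eq_0)
  then have "dd (\<lambda>z. transpose (T z)) y X ** T y ** transpose (T y) = - (transpose (T y) ** dd T y X) ** transpose (T y)" by simp
  then show ?thesis by (simp add: matrix_mul_assoc[symmetric] o' matrix_algebra)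
qed

text \<open>The inhomogeneous part of the change of connection contributes second derivatives of
  \<open>T\<close>, which cancel by symmetry, and terms with first derivatives of \<open>T\<close>,
  which cancel against those of the bracket.\<close>

lemma curvature_gauge:
  fixes A A' :: "real^'n::finite \<Rightarrow> real^'n \<Rightarrow> real^'r::finite^'r"
  assumes W: "open W" "y \<in> W" and T: "smooth_on T W" and o: "\<And>z. z \<in> W \<Longrightarrow> orthogonal_matrix (T z)"
    and d: "\<And>X. (\<lambda>w. A' w X) differentiable (at y)"
    and A: "\<And>z X. z \<in> W \<Longrightarrow> A z X = T z ** A' z X ** transpose (T z) - dd T z X ** transpose (T z)"
  shows "curvature A y X Y = T y ** curvature A' y X Y ** transpose (T y)"
proof -
  define s where "s = transpose (T y)"
  have dT: "T differentiable (at y)" "(\<lambda>z. dd T z Y) differentiable (at y)" for Y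
    using smooth_on_differentiable[OF T W(2)] smooth_on_differentiable[OF smooth_on_dd[OF T] W(2)] by auto
  have dt: "(\<lambda>z. transpose (T z)) differentiable (at y)" by (rule differentiable_bounded_linear[OF bounded_linear_transpose dT(1)])
  note ds = dd_orthogonal_transpose[OF W dT(1) o, folded s_def]
  \<comment> \<open>With all products associated to the right, this one rule removes every adjacent
    pair of \<open>transpose T\<close> and \<open>T\<close>.\<close>
  have sT: "s ** (T y ** x) = x" for x using o[OF W(2)] by (simp add: matrix_mul_assoc s_def orthogonal_matrix_def)
  have e: "dd (\<lambda>z. A z Y) y X = (dd T y X ** A' y Y + T y ** dd (\<lambda>z. A' z Y) y X) ** s - T y ** A' y Y ** (s ** (dd T y X ** s))
      - (dd (\<lambda>z. dd T z Y) y X ** s - dd T y Y ** (s ** (dd T y X ** s)))" for X Y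
  proof -
    note m1 = differentiable_matrix_mult[OF dT(1) d] and m2 = differentiable_matrix_mult[OF differentiable_matrix_mult(1)[OF dT(1) d] dt]
      and m3 = differentiable_matrix_mult[OF dT(2) dt]
    have "dd (\<lambda>z. A z Y) y X = dd (\<lambda>z. T z ** A' z Y ** transpose (T z) - dd T z Y ** transpose (T z)) y X"
      by (rule dd_cong_open[OF W]) (rule A)
    then show ?thesis
      by (simp add: dd_diff[OF m2(1) m3(1)] m1(2) m2(2) m3(2) ds s_def[symmetric] matrix_algebra)
  qed
  have c: "dd (\<lambda>z. dd T z Y) y X = dd (\<lambda>z. dd T z X) y Y" by (rule dd_commute[OF W smooth_onD[OF T]])
  show ?thesis
    unfolding curvature_def e c comm_def A[OF W(2)] s_def[symmetric]
    by (simp add: matrix_algebra matrix_mul_assoc[symmetric] sT algebra_simps)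
qed

lemma dA0_gauge:
  fixes A A' :: "real^'n::finite \<Rightarrow> real^'n \<Rightarrow> real^'r::finite^'r"
  assumes W: "open W" "y \<in> W" and T: "smooth_on T W" and o: "\<And>z. z \<in> W \<Longrightarrow> orthogonal_matrix (T z)"
    and d: "\<phi>' differentiable (at y)"
    and A: "\<And>z X. z \<in> W \<Longrightarrow> A z X = T z ** A' z X ** transpose (T z) - dd T z X ** transpose (T z)"
    and phi: "\<And>z. z \<in> W \<Longrightarrow> \<phi> z = T z ** \<phi>' z ** transpose (T z)"
  shows "dA0 A \<phi> y X = T y ** dA0 A' \<phi>' y X ** transpose (T y)"
proof -
  define s where "s = transpose (T y)"
  have dT: "T differentiable (at y)" by (rule smooth_on_differentiable[OF T W(2)])
  have dt: "(\<lambda>z. transpose (T z)) differentiable (at y)" by (rule differentiable_bounded_linear[OF bounded_linear_transpose dT])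
  note ds = dd_orthogonal_transpose[OF W dT o, folded s_def]
  have sT: "s ** (T y ** x) = x" for x using o[OF W(2)] by (simp add: matrix_mul_assoc s_def orthogonal_matrix_def)
  note m1 = differentiable_matrix_mult[OF dT d] and m2 = differentiable_matrix_mult[OF differentiable_matrix_mult(1)[OF dT d] dt]
  have "dd \<phi> y X = dd (\<lambda>z. T z ** \<phi>' z ** transpose (T z)) y X" by (rule dd_cong_open[OF W]) (rule phi)
  then have e: "dd \<phi> y X = (dd T y X ** \<phi>' y + T y ** dd \<phi>' y X) ** s - T y ** \<phi>' y ** (s ** (dd T y X ** s))"
    by (simp add: m1(2) m2(2) ds s_def[symmetric] matrix_algebra)
  show ?thesis
    unfolding dA0_def e comm_def A[OF W(2)] phi[OF W(2)] s_def[symmetric]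
    by (simp add: matrix_algebra matrix_mul_assoc[symmetric] sT algebra_simps)
qed

text \<open>Norms are computed in a frame of the bundle, which may cover only a part of a chart
  domain; this glues the regularity over the parts.\<close>

lemma Ck_on_locally:
  assumes "\<And>y. y \<in> D \<Longrightarrow> \<exists>U. open U \<and> y \<in> U \<and> Ck_on k f U"
  shows "Ck_on k f D"
  using assms
proof (induction k arbitrary: f)
  case 0
  then show ?case
    by simp (meson continuous_at_imp_continuous_on continuous_on_eq_continuous_at)
next
  case (Suc k)
  have "Ck_on k (\<lambda>y. dd f y v) D" for v by (rule Suc.IH) (use Suc.prems in fastforce)
  moreover have "f differentiable (at y)" if "y \<in> D" for y using Suc.prems[OF that] by auto
  ultimately show ?case by simp
qed

section \<open>Charts\<close>

context
  fixes \<A> :: "('m::{t2_space,second_countable_topology}, 'n::finite) chart set"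
    and g :: "('m, 'n) chart \<Rightarrow> real^'n \<Rightarrow> real^'n^'n"
  assumes M: "riemannian_manifold \<A> g"
begin

lemma
  assumes c: "c \<in> \<A>"
  shows open_chart: "open (fst c)" and open_cdom: "open (cdom c)"
    and chart_continuous: "continuous_on (fst c) (snd c)" and pt_continuous: "continuous_on (cdom c) (pt c)"
    and pt_chart: "x \<in> fst c \<Longrightarrow> pt c (snd c x) = x" and chart_pt: "y \<in> cdom c \<Longrightarrow> snd c (pt c y) = y"
    and pt_in: "y \<in> cdom c \<Longrightarrow> pt c y \<in> fst c" and chart_in: "x \<in> fst c \<Longrightarrow> snd c x \<in> cdom c"
proof -
  have h: "open (fst c)" "open (cdom c)" "homeomorphism (fst c) (cdom c) (snd c) (pt c)"
    using M c unfolding riemannian_manifold_def smooth_atlas_def by blast+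
  show "open (fst c)" "open (cdom c)" by (fact h)+
  show "continuous_on (fst c) (snd c)" "continuous_on (cdom c) (pt c)"
    "x \<in> fst c \<Longrightarrow> pt c (snd c x) = x" "y \<in> cdom c \<Longrightarrow> snd c (pt c y) = y"
    "y \<in> cdom c \<Longrightarrow> pt c y \<in> fst c" "x \<in> fst c \<Longrightarrow> snd c x \<in> cdom c"
    using h(3) unfolding homeomorphism_def by blast+
qed

lemma loc_iff: "c \<in> \<A> \<Longrightarrow> y \<in> loc c W \<longleftrightarrow> y \<in> cdom c \<and> pt c y \<in> W"
proof -
  assume c: "c \<in> \<A>"
  have "y \<in> cdom c \<longleftrightarrow> (\<exists>x\<in>fst c. y = snd c x)" by (auto simp: loc_def)
  moreover have "y \<in> loc c W \<longleftrightarrow> (\<exists>x\<in>fst c. y = snd c x \<and> x \<in> W)" by (auto simp: loc_def)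
  ultimately show ?thesis using pt_chart[OF c] by auto
qed

lemma open_loc:
  assumes c: "c \<in> \<A>" and W: "open W" shows "open (loc c W)"
proof -
  have "open (cdom c \<inter> pt c -` W)" by (rule continuous_open_preimage[OF pt_continuous[OF c] open_cdom[OF c] W])
  moreover have "cdom c \<inter> pt c -` W = loc c W" using loc_iff[OF c] by auto
  ultimately show ?thesis by simp
qed

lemma loc_subset: "c \<in> \<A> \<Longrightarrow> loc c W \<subseteq> cdom c"
  using loc_iff by blast

lemma gram_field_chart: "c \<in> \<A> \<Longrightarrow> gram_field (cdom c) (g c)"
  by unfold_locales (use M open_cdom in \<open>auto simp: riemannian_manifold_def riemannian_metric_def gram_def\<close>)

lemma gram_field_loc: "c \<in> \<A> \<Longrightarrow> open W \<Longrightarrow> gram_field (loc c W) (g c)"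
  by (rule gram_field.gram_field_subset[OF gram_field_chart open_loc loc_subset])

lemma transition_facts:
  assumes c: "c \<in> \<A>" "c' \<in> \<A>" and y: "y \<in> loc c (fst c')"
  shows "smooth_on (transition c c') (loc c (fst c'))" "transition c c' y \<in> cdom c'" "pt c' (transition c c' y) = pt c y"
    "met (g c y) X Y = met (g c' (transition c c' y)) (dd (transition c c') y X) (dd (transition c c') y Y)"
proof -
  show "smooth_on (transition c c') (loc c (fst c'))"
    using M c unfolding riemannian_manifold_def smooth_atlas_def by blast
  show "met (g c y) X Y = met (g c' (transition c c' y)) (dd (transition c c') y X) (dd (transition c c') y Y)"
    using M c y unfolding riemannian_manifold_def riemannian_metric_def by blast
  have "pt c y \<in> fst c'" using y loc_iff c by blast
  then show "transition c c' y \<in> cdom c'" "pt c' (transition c c' y) = pt c y"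
    using c pt_chart chart_in by (auto simp: transition_def)
qed

text \<open>Where \<open>f\<close> is positive, the power is twice continuously differentiable and
  the chart inequality applies. A zero near which the power happens to be of this class is a minimum
  of it, so the Laplacian is nonnegative while the right-hand side is 0.\<close>

lemma lap_ge_powr:
  fixes f H :: "'m \<Rightarrow> real" and q :: real
  assumes f: "\<And>c. c \<in> \<A> \<Longrightarrow> Ck_on 2 (f \<circ> pt c) (cdom c)" and f0: "\<And>x. f x \<ge> 0" and q: "0 < q" "q < 1"
    and ineq: "\<And>c y. c \<in> \<A> \<Longrightarrow> y \<in> cdom c \<Longrightarrow>
      f (pt c y) * lap (g c) (f \<circ> pt c) y - (1 - q) * dd (f \<circ> pt c) y (grad (g c) (f \<circ> pt c) y) \<ge> H (pt c y) * (f (pt c y))\<^sup>2 / q"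
  shows "lap_ge \<A> g (\<lambda>x. f x powr q) (\<lambda>x. H x * f x powr q)"
proof -
  define W where "W = {x. f x > 0}"
  have oW: "open W"
  proof -
    \<comment> \<open>Openness is checked chart by chart, as continuity of \<open>f\<close> is known
      in coordinates only.\<close>
    have "open (fst c \<inter> W)" if c: "c \<in> \<A>" for c
    proof -
      have "continuous_on (cdom c) (f \<circ> pt c)" using Ck_on_mono[OF f[OF c], of 0] by simp
      then have "open (cdom c \<inter> (f \<circ> pt c) -` {0<..})" by (rule continuous_open_preimage[OF _ open_cdom[OF c] open_greaterThan])
      then have "open (fst c \<inter> snd c -` (cdom c \<inter> (f \<circ> pt c) -` {0<..}))"
        by (rule continuous_open_preimage[OF chart_continuous[OF c] open_chart[OF c]])
      moreover have "fst c \<inter> snd c -` (cdom c \<inter> (f \<circ> pt c) -` {0<..}) = fst c \<inter> W"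
        using pt_chart[OF c] chart_in[OF c] by (auto simp: W_def)
      ultimately show ?thesis by simp
    qed
    then have "open (\<Union>c\<in>\<A>. fst c \<inter> W)" by blast
    moreover have "(\<Union>c\<in>\<A>. fst c \<inter> W) = W"
      using M unfolding riemannian_manifold_def smooth_atlas_def by blast
    ultimately show ?thesis by simp
  qed
  have e: "(\<lambda>x. f x powr q) \<circ> pt c = (\<lambda>z. (f \<circ> pt c) z powr q)" for c by auto
  have f0': "(f \<circ> pt c) y \<ge> 0" for c y using f0 by (simp only: comp_apply)
  have ineq': "(f \<circ> pt c) y * lap (g c) (f \<circ> pt c) y - (1 - q) * dd (f \<circ> pt c) y (grad (g c) (f \<circ> pt c) y) \<ge> (H \<circ> pt c) y * ((f \<circ> pt c) y)\<^sup>2 / q"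
    if "c \<in> \<A>" "y \<in> cdom c" for c y
    using ineq[OF that] by (simp only: comp_apply)
  have near: "C2_near \<A> (\<lambda>x. f x powr q) x" if "f x powr q \<noteq> 0" for x
    unfolding C2_near_def
  proof (intro exI[of _ W] conjI oW ballI)
    show "x \<in> W" using that f0[of x] by (auto simp: W_def less_le)
    fix c assume c: "c \<in> \<A>"
    show "Ck_on 2 ((\<lambda>x. f x powr q) \<circ> pt c) (loc c W)"
      unfolding e
      by (rule Ck_on_powr[OF open_loc[OF c oW] Ck_on_subset[OF f[OF c] loc_subset[OF c]]])
        (use iffD1[OF loc_iff[OF c, of _ W]] in \<open>fastforce simp: W_def\<close>)
  qed
  have pw: "lap (g c) ((\<lambda>x. f x powr q) \<circ> pt c) (snd c x) \<ge> H x * f x powr q"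
    if n: "C2_near \<A> (\<lambda>x. f x powr q) x" and c: "c \<in> \<A>" and x: "x \<in> fst c" for x c
  proof -
    interpret G: gram_field "cdom c" "g c" by (rule gram_field_chart[OF c])
    note y = chart_in[OF c x] and px = pt_chart[OF c x]
    show ?thesis
    proof (cases "f x = 0")
      case False
      then have p: "(f \<circ> pt c) (snd c x) > 0" using f0[of x] px by (simp add: less_le)
      have "lap (g c) (\<lambda>z. (f \<circ> pt c) z powr q) (snd c x) \<ge> (H \<circ> pt c) (snd c x) * (f \<circ> pt c) (snd c x) powr q"
        by (rule G.lap_powr_ge[OF f[OF c] f0' q ineq'[OF c] y p])
      then show ?thesis unfolding e using px by simp
    next
      case True
      \<comment> \<open>The minimum argument is run on the part of the chart in \<open>U\<close>,
        where the power itself has two continuous derivatives.\<close>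
      obtain U where U: "open U" "x \<in> U" "Ck_on 2 ((\<lambda>x. f x powr q) \<circ> pt c) (loc c U)" using n c unfolding C2_near_def by blast
      interpret U: gram_field "loc c U" "g c" by (rule gram_field_loc[OF c U(1)])
      have "snd c x \<in> loc c U" using y px U(2) by (intro iffD2[OF loc_iff[OF c]]) simp
      from U.lap_nonneg_at_min[OF this U(3)] show ?thesis using True px by simp
    qed
  qed
  have "lap_ge_pointwise \<A> g (\<lambda>x. f x powr q) (\<lambda>x. H x * f x powr q)"
    unfolding lap_ge_pointwise_def using near pw by blast
  moreover have "lap_ge_distr \<A> g (\<lambda>x. f x powr q) (\<lambda>x. H x * f x powr q)"
    unfolding lap_ge_distr_def
  proof (intro conjI ballI allI impI)
    fix c assume c: "c \<in> \<A>"
    show "continuous_on (cdom c) ((\<lambda>x. f x powr q) \<circ> pt c)"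
      unfolding e by (rule continuous_on_powr') (use Ck_on_mono[OF f[OF c], of 0] f0 q in auto)
    interpret G: gram_field "cdom c" "g c" by (rule gram_field_chart[OF c])
    fix p assume "test_function (cdom c) p \<and> (\<forall>y. p y \<ge> 0) \<and>
       (\<lambda>y. H (pt c y) * f (pt c y) powr q * p y * vol (g c) y) absolutely_integrable_on cdom c"
    then have p: "test_function (cdom c) p" "\<And>y. p y \<ge> 0"
      "(\<lambda>y. (H \<circ> pt c) y * (f \<circ> pt c) y powr q * p y * vol (g c) y) absolutely_integrable_on cdom c" by auto
    have "integral (cdom c) (\<lambda>y. (H \<circ> pt c) y * (f \<circ> pt c) y powr q * p y * vol (g c) y)
        \<le> integral (cdom c) (\<lambda>y. (f \<circ> pt c) y powr q * lap (g c) p y * vol (g c) y)"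
      by (rule G.powr_lap_ge_distr[OF f[OF c] f0' q ineq'[OF c] p])
    then show "vint (g c) (cdom c) (\<lambda>y. f (pt c y) powr q * lap (g c) p y) \<ge>
       vint (g c) (cdom c) (\<lambda>y. H (pt c y) * f (pt c y) powr q * p y)"
      by (simp add: vint_def)
  qed
  ultimately show ?thesis unfolding lap_ge_def by blast
qed

end

text \<open>\<open>at_point\<close> evaluates in an arbitrarily selected chart and frame; agreement
  of all choices transfers the value to the given one.\<close>

lemma at_point_eq:
  assumes "\<And>c i c' i'. c \<in> \<A> \<Longrightarrow> i \<in> J \<Longrightarrow> x \<in> fst c \<inter> V i \<Longrightarrow> c' \<in> \<A> \<Longrightarrow> i' \<in> J \<Longrightarrow> x \<in> fst c' \<inter> V i' \<Longrightarrow>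
      q c i (snd c x) = q c' i' (snd c' x)"
    and c: "c \<in> \<A>" "i \<in> J" "x \<in> fst c \<inter> V i"
  shows "at_point \<A> J V q x = q c i (snd c x)"
proof -
  define p where "p = (SOME (c, i). c \<in> \<A> \<and> i \<in> J \<and> x \<in> fst c \<inter> V i)"
  have "case p of (c, i) \<Rightarrow> c \<in> \<A> \<and> i \<in> J \<and> x \<in> fst c \<inter> V i"
    unfolding p_def by (rule someI[of _ "(c, i)"]) (use c in simp)
  then obtain c' i' where p: "p = (c', i')" "c' \<in> \<A>" "i' \<in> J" "x \<in> fst c' \<inter> V i'" by (cases p) auto
  then show ?thesis unfolding at_point_def p_def[symmetric] using assms(1)[OF p(2-4) c] by simp
qed

context
  fixes \<A> :: "('m::{t2_space,second_countable_topology}, 'n::finite) chart set"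
    and g :: "('m, 'n) chart \<Rightarrow> real^'n \<Rightarrow> real^'n^'n"
    and J :: "'i set" and V :: "'i \<Rightarrow> 'm set" and t :: "'i \<Rightarrow> 'i \<Rightarrow> 'm \<Rightarrow> real^'r::finite^'r"
    and \<kappa> :: "real^'r^'r \<Rightarrow> real^'r^'r \<Rightarrow> real"
    and A :: "('m, 'n) chart \<Rightarrow> 'i \<Rightarrow> real^'n \<Rightarrow> real^'n \<Rightarrow> real^'r^'r"
  assumes M: "riemannian_manifold \<A> g" and E: "riemannian_bundle \<A> J V t" and Ad: "Ad_invariant_metric \<kappa>"
    and C: "metric_connection \<A> J V t A"
begin

lemma open_V: "i \<in> J \<Longrightarrow> open (V i)"
  using E by (simp add: riemannian_bundle_def)

lemma gauge_field_loc:
  assumes "c \<in> \<A>" "i \<in> J" shows "gauge_field (loc c (V i)) (g c) \<kappa> (A c i)"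
proof -
  interpret gram_field "loc c (V i)" "g c" by (rule gram_field_loc[OF M assms(1) open_V[OF assms(2)]])
  have 1: "\<And>y. y \<in> loc c (V i) \<Longrightarrow> linear (A c i y)" "\<And>y X. y \<in> loc c (V i) \<Longrightarrow> A c i y X \<in> so"
    "\<And>X. smooth_on (\<lambda>y. A c i y X) (loc c (V i))"
    using C assms unfolding metric_connection_def by blast+
  show ?thesis by (rule gauge_field.intro[OF gram_field_axioms gauge_field_axioms.intro[OF Ad 1]])
qed

lemma exists_frame: "\<exists>i\<in>J. x \<in> V i"
  using E unfolding riemannian_bundle_def by blast

lemma loc_Int: "c \<in> \<A> \<Longrightarrow> y \<in> loc c (W \<inter> W') \<longleftrightarrow> y \<in> loc c W \<and> y \<in> loc c W'"
  using loc_iff[OF M, of c y W] loc_iff[OF M, of c y W'] loc_iff[OF M, of c y "W \<inter> W'"] by blast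

lemma transition_loc:
  assumes "c \<in> \<A>" "c' \<in> \<A>" "y \<in> loc c (fst c' \<inter> V i)"
  shows "y \<in> loc c (fst c')" "y \<in> loc c (V i)" "transition c c' y \<in> loc c' (V i)"
proof -
  show y: "y \<in> loc c (fst c')" "y \<in> loc c (V i)" using assms loc_Int by blast+
  show "transition c c' y \<in> loc c' (V i)"
    using transition_facts[OF M assms(1,2) y(1)] loc_iff[OF M assms(1), of y "V i"] loc_iff[OF M assms(2), of "transition c c' y" "V i"] y(2) by simp
qed

lemma curv_chart:
  assumes c: "c \<in> \<A>" "c' \<in> \<A>" and i: "i \<in> J" and y: "y \<in> loc c (fst c' \<inter> V i)"
  shows "curv A c i y X Y = curv A c' i (transition c c' y) (dd (transition c c') y X) (dd (transition c c') y Y)"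
proof (rule curvature_pullback)
  interpret G: gauge_field "loc c' (V i)" "g c'" \<kappa> "A c' i" by (rule gauge_field_loc[OF c(2) i])
  show "open (loc c (fst c' \<inter> V i))" by (rule open_loc[OF M c(1)]) (use open_chart[OF M c(2)] open_V[OF i] in auto)
  show "smooth_on (transition c c') (loc c (fst c' \<inter> V i))"
    by (rule smooth_on_subset[OF transition_facts(1)[OF M c transition_loc(1)[OF c y]]]) (use transition_loc(1)[OF c] in blast)
  show "linear (A c' i (transition c c' z))" if "z \<in> loc c (fst c' \<inter> V i)" for z
    by (rule G.linear_conn[OF transition_loc(3)[OF c that]])
  show "(\<lambda>w. A c' i w X) differentiable (at (transition c c' y))" for X
    by (rule G.B.diff_A[OF transition_loc(3)[OF c y]])
  show "A c i z X = A c' i (transition c c' z) (dd (transition c c') z X)" if "z \<in> loc c (fst c' \<inter> V i)" for z X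
    using C c i that unfolding metric_connection_def by blast
qed (rule y)

lemma frame_change:
  assumes c: "c \<in> \<A>" and ij: "i \<in> J" "j \<in> J"
  shows "open (loc c (V i \<inter> V j))" "smooth_on (t i j \<circ> pt c) (loc c (V i \<inter> V j))"
    "\<And>z. z \<in> loc c (V i \<inter> V j) \<Longrightarrow> orthogonal_matrix ((t i j \<circ> pt c) z)"
    "\<And>z X. z \<in> loc c (V i \<inter> V j) \<Longrightarrow> A c i z X = (t i j \<circ> pt c) z ** A c j z X ** transpose ((t i j \<circ> pt c) z)
         - dd (t i j \<circ> pt c) z X ** transpose ((t i j \<circ> pt c) z)"
proof -
  show "open (loc c (V i \<inter> V j))" by (rule open_loc[OF M c]) (use open_V ij in auto)
  show "smooth_on (t i j \<circ> pt c) (loc c (V i \<inter> V j))" using E c ij unfolding riemannian_bundle_def by blast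
  show "orthogonal_matrix ((t i j \<circ> pt c) z)" if "z \<in> loc c (V i \<inter> V j)" for z
    using E ij iffD1[OF loc_iff[OF M c, of z "V i \<inter> V j"] that] unfolding riemannian_bundle_def by simp
  show "A c i z X = (t i j \<circ> pt c) z ** A c j z X ** transpose ((t i j \<circ> pt c) z)
         - dd (t i j \<circ> pt c) z X ** transpose ((t i j \<circ> pt c) z)" if "z \<in> loc c (V i \<inter> V j)" for z X
    using C c ij that unfolding metric_connection_def comp_apply by blast
qed

lemma curv_frame:
  assumes c: "c \<in> \<A>" and ij: "i \<in> J" "j \<in> J" and y: "y \<in> loc c (V i \<inter> V j)"
  shows "curv A c i y X Y = (t i j \<circ> pt c) y ** curv A c j y X Y ** transpose ((t i j \<circ> pt c) y)"
proof (rule curvature_gauge[OF frame_change(1)[OF c ij] y frame_change(2)[OF c ij] frame_change(3)[OF c ij] _ frame_change(4)[OF c ij]])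
  interpret G: gauge_field "loc c (V j)" "g c" \<kappa> "A c j" by (rule gauge_field_loc[OF c ij(2)])
  show "(\<lambda>w. A c j w X) differentiable (at y)" for X by (rule G.B.diff_A) (use y loc_Int[OF c] in blast)
qed

lemma Ad_conj:
  "orthogonal_matrix q \<Longrightarrow> a \<in> so \<Longrightarrow> b \<in> so \<Longrightarrow> \<kappa> (q ** a ** transpose q) (q ** b ** transpose q) = \<kappa> a b"
  using Ad unfolding Ad_invariant_metric_def by blast

lemma bilinear_Ad: "bilinear \<kappa>" using Ad unfolding Ad_invariant_metric_def by blast

text \<open>Any two pairs of a chart and a frame are related through the chart of one and the frame of the other.\<close>

lemma chart_frame_independent:
  assumes chart: "\<And>c c' i y. c \<in> \<A> \<Longrightarrow> c' \<in> \<A> \<Longrightarrow> i \<in> J \<Longrightarrow> y \<in> loc c (fst c' \<inter> V i) \<Longrightarrow> Q c i y = Q c' i (transition c c' y)"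
    and frame: "\<And>c i j y. c \<in> \<A> \<Longrightarrow> i \<in> J \<Longrightarrow> j \<in> J \<Longrightarrow> y \<in> loc c (V i \<inter> V j) \<Longrightarrow> Q c i y = Q c j y"
    and c: "c \<in> \<A>" and i: "i \<in> J" and y: "y \<in> loc c (V i)"
  shows "at_point \<A> J V Q (pt c y) = Q c i y"
proof -
  have y': "y \<in> cdom c" "pt c y \<in> V i" using loc_iff[OF M c, of y "V i"] y by auto
  have "at_point \<A> J V Q (pt c y) = Q c i (snd c (pt c y))"
  proof (rule at_point_eq[OF _ c i])
    show "pt c y \<in> fst c \<inter> V i" using y' pt_in[OF M c] by simp
    fix c1 i1 c2 i2 assume a: "c1 \<in> \<A>" "i1 \<in> J" "pt c y \<in> fst c1 \<inter> V i1" "c2 \<in> \<A>" "i2 \<in> J" "pt c y \<in> fst c2 \<inter> V i2"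
    have p: "pt c1 (snd c1 (pt c y)) = pt c y" using pt_chart[OF M a(1)] a(3) by simp
    have "snd c1 (pt c y) \<in> loc c1 (fst c2 \<inter> V i1)" using a by (auto simp: loc_def)
    from chart[OF a(1,4,2) this] have "Q c1 i1 (snd c1 (pt c y)) = Q c2 i1 (snd c2 (pt c y))" by (simp add: transition_def p)
    also have "\<dots> = Q c2 i2 (snd c2 (pt c y))" by (rule frame[OF a(4,2,5)]) (use a in \<open>auto simp: loc_def\<close>)
    finally show "Q c1 i1 (snd c1 (pt c y)) = Q c2 i2 (snd c2 (pt c y))" .
  qed
  then show ?thesis using chart_pt[OF M c y'(1)] by simp
qed

text \<open>Under a change of chart the derivative of the transition map is an isometry along which
  the curvature is pulled back. Under a change of frame the curvature is conjugated by an orthogonal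
  matrix, which \<open>\<kappa>\<close> does not notice.\<close>

lemma normF_chart:
  assumes c: "c \<in> \<A>" and i: "i \<in> J" and y: "y \<in> loc c (V i)"
  shows "normF \<A> g J V \<kappa> A (pt c y) = sqrt (ip2 (g c y) \<kappa> (curv A c i y) (curv A c i y))"
  unfolding normF_def
proof (rule chart_frame_independent[OF _ _ c i y])
  fix c c' :: "('m, 'n) chart" and i y assume c: "c \<in> \<A>" "c' \<in> \<A>" and i: "i \<in> J" and y: "y \<in> loc c (fst c' \<inter> V i)"
  interpret G: gauge_field "loc c (V i)" "g c" \<kappa> "A c i" by (rule gauge_field_loc[OF c(1) i])
  interpret G': gauge_field "loc c' (V i)" "g c'" \<kappa> "A c' i" by (rule gauge_field_loc[OF c(2) i])
  note tl = transition_loc[OF c y] and tf = transition_facts[OF M c transition_loc(1)[OF c y]]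
  show "sqrt (ip2 (g c y) \<kappa> (curv A c i y) (curv A c i y)) =
      sqrt (ip2 (g c' (transition c c' y)) \<kappa> (curv A c' i (transition c c' y)) (curv A c' i (transition c c' y)))"
    by (rule arg_cong[where f = sqrt], rule ip2_pullback[OF G.gram[OF tl(2)] linear_dd[OF smooth_on_differentiable[OF tf(1) tl(1)]] tf(4)
          bilinear_Ad G.bilinear_FA[OF tl(2)] G'.bilinear_FA[OF tl(3)] curv_chart[OF c i y]])
next
  fix c :: "('m, 'n) chart" and i j y assume c: "c \<in> \<A>" and ij: "i \<in> J" "j \<in> J" and y: "y \<in> loc c (V i \<inter> V j)"
  interpret G: gauge_field "loc c (V j)" "g c" \<kappa> "A c j" by (rule gauge_field_loc[OF c ij(2)])
  have "y \<in> loc c (V j)" using y loc_Int[OF c] by blast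
  then show "sqrt (ip2 (g c y) \<kappa> (curv A c i y) (curv A c i y)) = sqrt (ip2 (g c y) \<kappa> (curv A c j y) (curv A c j y))"
    unfolding ip2_def curv_frame[OF c ij y] by (simp only: Ad_conj[OF frame_change(3)[OF c ij y] G.F_so G.F_so])
qed

lemma higgs_field_loc:
  assumes S: "so_section \<A> J V t \<Phi>" and c: "c \<in> \<A>" and i: "i \<in> J"
  shows "higgs_field (loc c (V i)) (g c) \<kappa> (A c i) (\<Phi> i \<circ> pt c)"
proof -
  interpret G: gauge_field "loc c (V i)" "g c" \<kappa> "A c i" by (rule gauge_field_loc[OF c i])
  have 1: "smooth_on (\<Phi> i \<circ> pt c) (loc c (V i))" using S c i unfolding so_section_def by blast
  have 2: "(\<Phi> i \<circ> pt c) y \<in> so" if "y \<in> loc c (V i)" for y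
    using S i iffD1[OF loc_iff[OF M c] that] unfolding so_section_def comp_apply by blast
  show ?thesis by unfold_locales (fact 1 2)+
qed

lemma normdPhi_chart:
  assumes S: "so_section \<A> J V t \<Phi>" and c: "c \<in> \<A>" and i: "i \<in> J" and y: "y \<in> loc c (V i)"
  shows "normdPhi \<A> g J V \<kappa> A \<Phi> (pt c y) = sqrt (ip1 (g c y) \<kappa> (dAPhi A \<Phi> c i y) (dAPhi A \<Phi> c i y))"
  unfolding normdPhi_def
proof (rule chart_frame_independent[OF _ _ c i y])
  note H = higgs_field_loc[OF S]
  {
    fix c c' :: "('m, 'n) chart" and i y assume c: "c \<in> \<A>" "c' \<in> \<A>" and i: "i \<in> J" and y: "y \<in> loc c (fst c' \<inter> V i)"
    interpret G: higgs_field "loc c (V i)" "g c" \<kappa> "A c i" "\<Phi> i \<circ> pt c" by (rule H[OF c(1) i])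
    interpret G': higgs_field "loc c' (V i)" "g c'" \<kappa> "A c' i" "\<Phi> i \<circ> pt c'" by (rule H[OF c(2) i])
    note tl = transition_loc[OF c y] and tf = transition_facts[OF M c transition_loc(1)[OF c y]]
    have o: "open (loc c (fst c'))" by (rule open_loc[OF M c(1) open_chart[OF M c(2)]])
    have dt: "transition c c' differentiable (at y)" by (rule smooth_on_differentiable[OF tf(1) tl(1)])
    have "dd (\<Phi> i \<circ> pt c) y X = dd (\<lambda>z. (\<Phi> i \<circ> pt c') (transition c c' z)) y X" for X
      by (rule dd_cong_open[OF o tl(1)]) (use transition_facts(3)[OF M c] in simp)
    also have "\<dots> X = dd (\<Phi> i \<circ> pt c') (transition c c' y) (dd (transition c c') y X)" for X
      by (rule dd_compose[OF dt G'.diff_higgs[OF tl(3)]])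
    finally have dP: "dd (\<Phi> i \<circ> pt c) y X = dd (\<Phi> i \<circ> pt c') (transition c c' y) (dd (transition c c') y X)" for X .
    have "A c i y X = A c' i (transition c c' y) (dd (transition c c') y X)" for X
      using C c i y unfolding metric_connection_def by blast
    then have e: "dAPhi A \<Phi> c i y X = dAPhi A \<Phi> c' i (transition c c' y) (dd (transition c c') y X)" for X
      unfolding dA0_def dP using tf(3) by simp
    show "sqrt (ip1 (g c y) \<kappa> (dAPhi A \<Phi> c i y) (dAPhi A \<Phi> c i y)) =
      sqrt (ip1 (g c' (transition c c' y)) \<kappa> (dAPhi A \<Phi> c' i (transition c c' y)) (dAPhi A \<Phi> c' i (transition c c' y)))"
      by (rule arg_cong[where f = sqrt], rule ip1_pullback[OF G.gram[OF tl(2)] linear_dd[OF dt] tf(4) bilinear_Ad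
            G.linear_al[OF tl(2), unfolded G.al_def[abs_def]] G'.linear_al[OF tl(3), unfolded G'.al_def[abs_def]] e])
  next
    fix c :: "('m, 'n) chart" and i j y assume c: "c \<in> \<A>" and ij: "i \<in> J" "j \<in> J" and y: "y \<in> loc c (V i \<inter> V j)"
    interpret G: higgs_field "loc c (V j)" "g c" \<kappa> "A c j" "\<Phi> j \<circ> pt c" by (rule H[OF c ij(2)])
    have yj: "y \<in> loc c (V j)" using y loc_Int[OF c] by blast
    have P: "(\<Phi> i \<circ> pt c) z = (t i j \<circ> pt c) z ** (\<Phi> j \<circ> pt c) z ** transpose ((t i j \<circ> pt c) z)" if "z \<in> loc c (V i \<inter> V j)" for z
      using S ij iffD1[OF loc_iff[OF M c] that] unfolding so_section_def comp_apply by blast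
    have e: "dAPhi A \<Phi> c i y X = (t i j \<circ> pt c) y ** dAPhi A \<Phi> c j y X ** transpose ((t i j \<circ> pt c) y)" for X
      by (rule dA0_gauge[OF frame_change(1)[OF c ij] y frame_change(2)[OF c ij] frame_change(3)[OF c ij] G.diff_higgs[OF yj] frame_change(4)[OF c ij] P])
    show "sqrt (ip1 (g c y) \<kappa> (dAPhi A \<Phi> c i y) (dAPhi A \<Phi> c i y)) = sqrt (ip1 (g c y) \<kappa> (dAPhi A \<Phi> c j y) (dAPhi A \<Phi> c j y))"
      unfolding ip1_def e
      by (simp only: Ad_conj[OF frame_change(3)[OF c ij y] G.al_so[OF yj, unfolded G.al_def] G.al_so[OF yj, unfolded G.al_def]])
  }
qed

lemma ip_nonneg_loc:
  assumes c: "c \<in> \<A>" and i: "i \<in> J" and y: "y \<in> loc c (V i)"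
  shows "ip2 (g c y) \<kappa> (curv A c i y) (curv A c i y) \<ge> 0"
proof -
  interpret G: gauge_field "loc c (V i)" "g c" \<kappa> "A c i" by (rule gauge_field_loc[OF c i])
  obtain S where S: "gframe (g c y) S" using gram_frame G.gram[OF y] by blast
  have "ip2 (g c y) \<kappa> (curv A c i y) (curv A c i y) = G.B.ip y (curv A c i y) (curv A c i y)"
    unfolding G.ip_eq by (rule G.ip2_kskew[symmetric]) (rule G.F_so[OF y])+
  then show ?thesis using G.B.ip_nonneg[OF G.coframe_gframe[OF S] G.bilinear_FA[OF y]] by simp
qed

lemma ip1_nonneg_loc:
  assumes S: "so_section \<A> J V t \<Phi>" and c: "c \<in> \<A>" and i: "i \<in> J" and y: "y \<in> loc c (V i)"
  shows "ip1 (g c y) \<kappa> (dAPhi A \<Phi> c i y) (dAPhi A \<Phi> c i y) \<ge> 0"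
proof -
  interpret G: higgs_field "loc c (V i)" "g c" \<kappa> "A c i" "\<Phi> i \<circ> pt c" by (rule higgs_field_loc[OF S c i])
  obtain T where T: "gframe (g c y) T" using gram_frame G.gram[OF y] by blast
  note l = G.linear_al[OF y] and s = G.al_so[OF y]
  have "ip1 (g c y) \<kappa> (G.al y) (G.al y) = mtrace (g c y) (\<lambda>X Y. G.ks (G.al y X) (G.al y Y))"
    unfolding ip1_def by (simp add: kskew_so[OF s s])
  also have "\<dots> = (\<Sum>a\<in>T. G.ks (G.al y a) (G.al y a))"
    by (rule mtrace_gframe[OF T bilinearI'[OF G.linear_ks(1)[OF l] G.linear_ks(2)[OF l]]])
  also have "\<dots> \<ge> 0" by (intro sum_nonneg G.B.\<kappa>_nonneg)
  finally show ?thesis by (simp add: G.al_def[abs_def])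
qed

section \<open>Regularity of the squared norms and the inequalities in charts\<close>

lemma smooth_ip2_curv:
  assumes c: "c \<in> \<A>" and i: "i \<in> J"
  shows "smooth_on (\<lambda>y. ip2 (g c y) \<kappa> (curv A c i y) (curv A c i y)) (loc c (V i))"
proof -
  interpret G: gauge_field "loc c (V i)" "g c" \<kappa> "A c i" by (rule gauge_field_loc[OF c i])
  show ?thesis
    by (rule smooth_on_cong[OF G.open_D G.B.smooth_ip[OF G.B.tensor2_F G.B.tensor2_F]])
      (unfold G.ip_eq G.F_eq, rule G.ip2_kskew, (rule G.F_so, assumption)+)
qed

lemma smooth_ip1_dAPhi:
  assumes S: "so_section \<A> J V t \<Phi>" and c: "c \<in> \<A>" and i: "i \<in> J"
  shows "smooth_on (\<lambda>y. ip1 (g c y) \<kappa> (dAPhi A \<Phi> c i y) (dAPhi A \<Phi> c i y)) (loc c (V i))"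
proof -
  interpret G: higgs_field "loc c (V i)" "g c" \<kappa> "A c i" "\<Phi> i \<circ> pt c" by (rule higgs_field_loc[OF S c i])
  have "smooth_on (\<lambda>y. mtrace (g c y) (\<lambda>X Y. G.ks (G.al y X) (G.al y Y))) (loc c (V i))"
    unfolding G.tr_eq[symmetric]
    by (rule G.B.smooth_tr) (rule smooth_on_bilinear[OF G.open_D G.B.\<kappa> G.smooth_al G.smooth_al])
  then show ?thesis
    by (rule smooth_on_cong[OF G.open_D]) (simp add: ip1_def kskew_so[OF G.al_so G.al_so], simp add: G.al_def)
qed

lemma ym_chart_inequality:
  assumes ym: "yang_mills \<A> g J V t \<kappa> A" and Ft: "Ftilde_bound \<A> g J V \<kappa> A B1" and K: "K_ge \<A> g a1" and dim: "CARD('n) \<ge> 4"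
    and f: "f = (\<lambda>x. (normF \<A> g J V \<kappa> A x)\<^sup>2)" and c: "c \<in> \<A>" and y: "y \<in> cdom c"
  shows "f (pt c y) * lap (g c) (f \<circ> pt c) y
      - (real CARD('n) - 1) / (2 * (real CARD('n) - 2)) * dd (f \<circ> pt c) y (grad (g c) (f \<circ> pt c) y)
    \<ge> 2 * f (pt c y) * (a1 (pt c y) * f (pt c y) - B1 * normF \<A> g J V \<kappa> A (pt c y) ^ 3)"
proof -
  \<comment> \<open>The inequality is local, so one frame around the point suffices; over its domain
    the norm has an explicit formula.\<close>
  obtain i where i: "i \<in> J" "pt c y \<in> V i" using exists_frame by blast
  have yi: "y \<in> loc c (V i)" using loc_iff[OF M c, of y "V i"] y i by simp
  interpret G: gauge_field "loc c (V i)" "g c" \<kappa> "A c i" by (rule gauge_field_loc[OF c i(1)])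
  have fz: "(f \<circ> pt c) z = ip2 (g c z) \<kappa> (curv A c i z) (curv A c i z)" if "z \<in> loc c (V i)" for z
    using normF_chart[OF c i(1) that] ip_nonneg_loc[OF c i(1) that] by (simp add: f)
  have cc: "(\<Sum>e\<in>S. G.B.cov (curv A c i) z e e Z) = 0" if "z \<in> loc c (V i)" "gframe (g c z) S" for z Z S
  proof -
    have "(\<Sum>e\<in>S. G.B.cov (curv A c i) z e e Z) = - (\<lambda>z X. 0) z Z"
    proof (rule G.ym_weak_to_pointwise[OF _ _ _ _ that])
      show "vint (g c) (loc c (V i)) (\<lambda>y. ip2 (g c y) \<kappa> (curv A c i y) (dA1 (A c i) \<beta> y)) = vint (g c) (loc c (V i)) (\<lambda>y. ip1 (g c y) \<kappa> (\<lambda>X. 0) (\<beta> y))"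
        if "so_test_form (loc c (V i)) \<beta>" for \<beta>
        using ym c i(1) that unfolding yang_mills_def dA_adjoint_eq_def by blast
    qed (use subspace_0[OF subspace_so] linear_zero in auto)
    then show ?thesis by simp
  qed
  have K': "ip2 (g c y) (*) (Kop (g c) y \<omega>) \<omega> \<ge> a1 (pt c y) * ip2 (g c y) (*) \<omega> \<omega>" if "two_form \<omega>" for \<omega>
    using K c y that unfolding K_ge_def by blast
  have F': "\<bar>ip2 (g c y) \<kappa> (Ftilde (g c y) (curv A c i y) (curv A c i y)) (curv A c i y)\<bar> \<le> B1 * sqrt (ip2 (g c y) \<kappa> (curv A c i y) (curv A c i y)) ^ 3"
    using Ft c i(1) yi unfolding Ftilde_bound_def Let_def by blast
  have "sqrt ((f \<circ> pt c) y) = normF \<A> g J V \<kappa> A (pt c y)" unfolding fz[OF yi] by (rule normF_chart[OF c i(1) yi, symmetric])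
  then show ?thesis using G.ym_local_inequality[where f = "f \<circ> pt c", OF cc dim yi K' F' fz] by (simp only: comp_apply)
qed

lemma ymh_chart_inequality:
  assumes ym: "yang_mills_higgs \<A> g J V t \<kappa> A \<Phi>" and Ft: "Ftilde_bound \<A> g J V \<kappa> A B1" and Br: "bracket_bound \<A> g J V \<kappa> A \<Phi> B2"
    and K: "K_ge \<A> g a1" and Rc: "Ric_ge \<A> g a2" and dim: "CARD('n) \<ge> 4"
    and f: "f = (\<lambda>x. (normF \<A> g J V \<kappa> A x)\<^sup>2 + (normdPhi \<A> g J V \<kappa> A \<Phi> x)\<^sup>2)" and c: "c \<in> \<A>" and y: "y \<in> cdom c"
  shows "f (pt c y) * lap (g c) (f \<circ> pt c) y
      - real CARD('n) / (2 * (real CARD('n) - 1)) * dd (f \<circ> pt c) y (grad (g c) (f \<circ> pt c) y)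
    \<ge> 2 * f (pt c y) * ((min (a1 (pt c y)) (a2 (pt c y)) - max B1 (3 * B2) * normF \<A> g J V \<kappa> A (pt c y)) * f (pt c y))"
proof -
  have S: "so_section \<A> J V t \<Phi>" using ym unfolding yang_mills_higgs_def by blast
  obtain i where i: "i \<in> J" "pt c y \<in> V i" using exists_frame by blast
  have yi: "y \<in> loc c (V i)" using loc_iff[OF M c, of y "V i"] y i by simp
  interpret G: higgs_field "loc c (V i)" "g c" \<kappa> "A c i" "\<Phi> i \<circ> pt c" by (rule higgs_field_loc[OF S c i(1)])
  have al: "G.al = dAPhi A \<Phi> c i" by (simp add: fun_eq_iff G.al_def)
  have fz: "(f \<circ> pt c) z = ip2 (g c z) \<kappa> (curv A c i z) (curv A c i z) + ip1 (g c z) \<kappa> (G.al z) (G.al z)" if "z \<in> loc c (V i)" for z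
    using normF_chart[OF c i(1) that] ip_nonneg_loc[OF c i(1) that] normdPhi_chart[OF S c i(1) that] ip1_nonneg_loc[OF S c i(1) that]
    by (simp add: f al)
  have cc: "(\<Sum>e\<in>T. G.B.cov (curv A c i) z e e Z) = - comm (G.al z Z) ((\<Phi> i \<circ> pt c) z)" if "z \<in> loc c (V i)" "gframe (g c z) T" for z Z T
  proof -
    have "(\<Sum>e\<in>T. G.B.cov (curv A c i) z e e Z) = - (\<lambda>z X. comm (G.al z X) ((\<Phi> i \<circ> pt c) z)) z Z"
    proof (rule G.ym_weak_to_pointwise[OF _ _ _ _ that])
      show "vint (g c) (loc c (V i)) (\<lambda>y. ip2 (g c y) \<kappa> (curv A c i y) (dA1 (A c i) \<beta> y)) =
          vint (g c) (loc c (V i)) (\<lambda>y. ip1 (g c y) \<kappa> (\<lambda>X. comm (G.al y X) ((\<Phi> i \<circ> pt c) y)) (\<beta> y))"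
        if b: "so_test_form (loc c (V i)) \<beta>" for \<beta>
      proof -
        have "vint (g c) (loc c (V i)) (\<lambda>y. ip2 (g c y) \<kappa> (curv A c i y) (dA1 (A c i) \<beta> y)) =
          vint (g c) (loc c (V i)) (\<lambda>y. ip1 (g c y) \<kappa> (\<lambda>X. comm (dAPhi A \<Phi> c i y X) (\<Phi> i (pt c y))) (\<beta> y))"
          using ym c i(1) b unfolding yang_mills_higgs_def dA_adjoint_eq_def by blast
        then show ?thesis unfolding al by (simp only: comp_apply)
      qed
      show "linear (\<lambda>X. comm (G.al y X) ((\<Phi> i \<circ> pt c) y))" if "y \<in> loc c (V i)" for y
        by (rule linearI) (simp_all add: linear_add[OF G.linear_al[OF that]] linear_scale[OF G.linear_al[OF that]] G.B.br_lin)
      show "comm (G.al y X) ((\<Phi> i \<circ> pt c) y) \<in> so" if "y \<in> loc c (V i)" for y X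
        by (rule comm_so[OF G.al_so[OF that] G.higgs_so[OF that]])
      show "continuous_on (loc c (V i)) (\<lambda>y. comm (G.al y X) ((\<Phi> i \<circ> pt c) y))" for X
        by (rule smooth_on_continuous[OF smooth_on_bilinear[OF G.open_D bounded_bilinear_comm G.smooth_al G.smooth_higgs]])
    qed
    then show ?thesis by simp
  qed
  have hh: "(\<Sum>e\<in>T. dd (\<lambda>z. G.al z e) z e + comm (A c i z e) (G.al z e) - G.al z (chris (g c) z e e)) = 0"
    if "z \<in> loc c (V i)" "gframe (g c z) T" for z T
  proof (rule G.higgs_weak_to_pointwise[OF _ G.linear_al G.al_so G.smooth_al that])
    fix \<xi> :: "real^'n \<Rightarrow> real^'r^'r" assume x: "test_function (loc c (V i)) \<xi>" "\<And>y. \<xi> y \<in> so"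
    have "vint (g c) (loc c (V i)) (\<lambda>y. ip1 (g c y) \<kappa> (dAPhi A \<Phi> c i y) (dA0 (A c i) \<xi> y)) = vint (g c) (loc c (V i)) (\<lambda>y. \<kappa> 0 (\<xi> y))"
      using ym c i(1) x unfolding yang_mills_higgs_def nablaA_adjoint_eq_def by blast
    then show "vint (g c) (loc c (V i)) (\<lambda>y. ip1 (g c y) \<kappa> (G.al y) (dA0 (A c i) \<xi> y)) = 0"
      by (simp add: al bilinear_lzero[OF bilinear_Ad] vint_def)
  qed
  have K': "ip2 (g c y) (*) (Kop (g c) y \<omega>) \<omega> \<ge> a1 (pt c y) * ip2 (g c y) (*) \<omega> \<omega>" if "two_form \<omega>" for \<omega>
    using K c y that unfolding K_ge_def by blast
  have R': "Ric (g c) y X X \<ge> a2 (pt c y) * met (g c y) X X" for X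
    using Rc c y unfolding Ric_ge_def by blast
  have F': "\<bar>ip2 (g c y) \<kappa> (Ftilde (g c y) (curv A c i y) (curv A c i y)) (curv A c i y)\<bar> \<le> B1 * sqrt (ip2 (g c y) \<kappa> (curv A c i y) (curv A c i y)) ^ 3"
    using Ft c i(1) yi unfolding Ftilde_bound_def Let_def by blast
  have B': "sqrt (ip2 (g c y) \<kappa> (bracket11 (G.al y) (G.al y)) (bracket11 (G.al y) (G.al y))) \<le> B2 * ip1 (g c y) \<kappa> (G.al y) (G.al y)"
    unfolding al using Br c i(1) yi unfolding bracket_bound_def Let_def by blast
  have d3: "CARD('n) \<ge> 3" using dim by simp
  show ?thesis
    using G.higgs_local_inequality[where f = "f \<circ> pt c", OF cc hh d3 yi K' R' F' B' fz] normF_chart[OF c i(1) yi]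
    by (simp only: comp_apply)
qed

text \<open>The square is a smooth expression in coordinates, whereas the norm itself may fail to be
  differentiable at its zeros.\<close>

lemma Ck_on_normF:
  assumes c: "c \<in> \<A>"
  shows "Ck_on k ((\<lambda>x. (normF \<A> g J V \<kappa> A x)\<^sup>2) \<circ> pt c) (cdom c)"
proof (rule Ck_on_locally)
  fix y assume y: "y \<in> cdom c"
  obtain i where i: "i \<in> J" "pt c y \<in> V i" using exists_frame by blast
  have yi: "y \<in> loc c (V i)" using loc_iff[OF M c, of y "V i"] y i by simp
  have o: "open (loc c (V i))" by (rule open_loc[OF M c open_V[OF i(1)]])
  have "Ck_on k ((\<lambda>x. (normF \<A> g J V \<kappa> A x)\<^sup>2) \<circ> pt c) (loc c (V i))"
    by (rule Ck_on_cong[OF o smooth_onD[OF smooth_ip2_curv[OF c i(1)]]])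
      (simp add: normF_chart[OF c i(1)] ip_nonneg_loc[OF c i(1)])
  then show "\<exists>U. open U \<and> y \<in> U \<and> Ck_on k ((\<lambda>x. (normF \<A> g J V \<kappa> A x)\<^sup>2) \<circ> pt c) U" using o yi by blast
qed

lemma Ck_on_normdPhi:
  assumes S: "so_section \<A> J V t \<Phi>" and c: "c \<in> \<A>"
  shows "Ck_on k ((\<lambda>x. (normdPhi \<A> g J V \<kappa> A \<Phi> x)\<^sup>2) \<circ> pt c) (cdom c)"
proof (rule Ck_on_locally)
  fix y assume y: "y \<in> cdom c"
  obtain i where i: "i \<in> J" "pt c y \<in> V i" using exists_frame by blast
  have yi: "y \<in> loc c (V i)" using loc_iff[OF M c, of y "V i"] y i by simp
  have o: "open (loc c (V i))" by (rule open_loc[OF M c open_V[OF i(1)]])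
  have "Ck_on k ((\<lambda>x. (normdPhi \<A> g J V \<kappa> A \<Phi> x)\<^sup>2) \<circ> pt c) (loc c (V i))"
    by (rule Ck_on_cong[OF o smooth_onD[OF smooth_ip1_dAPhi[OF S c i(1)]]])
      (simp add: normdPhi_chart[OF S c i(1)] ip1_nonneg_loc[OF S c i(1)])
  then show "\<exists>U. open U \<and> y \<in> U \<and> Ck_on k ((\<lambda>x. (normdPhi \<A> g J V \<kappa> A \<Phi> x)\<^sup>2) \<circ> pt c) U" using o yi by blast
qed

lemma normF_nonneg: "normF \<A> g J V \<kappa> A x \<ge> 0"
proof -
  obtain c where c: "c \<in> \<A>" "x \<in> fst c" using M unfolding riemannian_manifold_def smooth_atlas_def by blast
  obtain i where i: "i \<in> J" "x \<in> V i" using exists_frame by blast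
  have "snd c x \<in> loc c (V i)" using c i by (auto simp: loc_def)
  from normF_chart[OF c(1) i(1) this] ip_nonneg_loc[OF c(1) i(1) this] show ?thesis by (simp add: pt_chart[OF M c])
qed

section \<open>The differential inequalities on the manifold\<close>

theorem yang_mills_lap_ge:
  assumes ym: "yang_mills \<A> g J V t \<kappa> A" and Ft: "Ftilde_bound \<A> g J V \<kappa> A B1" and K: "K_ge \<A> g a1" and dim: "CARD('n) \<ge> 4"
    and n: "n = real CARD('n)"
  shows "lap_ge \<A> g (\<lambda>x. normF \<A> g J V \<kappa> A x powr ((n - 3) / (n - 2)))
    (\<lambda>x. (n - 3) / (n - 2) * (a1 x - B1 * normF \<A> g J V \<kappa> A x) * normF \<A> g J V \<kappa> A x powr ((n - 3) / (n - 2)))"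
proof -
  define N where "N = normF \<A> g J V \<kappa> A"
  define f where "f x = (N x)\<^sup>2" for x
  \<comment> \<open>Half of the exponent, since \<open>f\<close> is the squared norm. With this
    choice \<open>1 - q\<close> is the coefficient of the gradient term delivered by the Kato
    inequality.\<close>
  define q where "q = (n - 3) / (2 * (n - 2))"
  have n4: "n \<ge> 4" using dim n by simp
  have N0: "N x \<ge> 0" for x unfolding N_def by (rule normF_nonneg)
  have q: "0 < q" "q < 1" using n4 by (auto simp: q_def field_simps)
  have q1: "1 - q = (n - 1) / (2 * (n - 2))" using n4 by (simp add: q_def field_simps)
  have q2: "2 * q = (n - 3) / (n - 2)" using n4 by (simp add: q_def field_simps)
  \<comment> \<open>Powers compose for positive \<open>N x\<close>; at zeros both sides are 0
    because \<open>0 powr q\<close> is 0.\<close>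
  have fN: "f x powr q = N x powr ((n - 3) / (n - 2))" for x
  proof (cases "N x = 0")
    case False
    then have "f x = N x powr 2" using N0[of x] by (simp add: f_def powr_numeral)
    then show ?thesis by (simp add: powr_powr q2)
  qed (simp add: f_def)
  have "lap_ge \<A> g (\<lambda>x. f x powr q) (\<lambda>x. (2 * q * (a1 x - B1 * N x)) * f x powr q)"
  proof (rule lap_ge_powr[OF M _ _ q])
    show "Ck_on 2 (f \<circ> pt c) (cdom c)" if "c \<in> \<A>" for c using Ck_on_normF[OF that, of 2] by (simp add: f_def[abs_def] N_def)
    show "f x \<ge> 0" for x by (simp add: f_def)
    show "f (pt c y) * lap (g c) (f \<circ> pt c) y - (1 - q) * dd (f \<circ> pt c) y (grad (g c) (f \<circ> pt c) y)
       \<ge> 2 * q * (a1 (pt c y) - B1 * N (pt c y)) * (f (pt c y))\<^sup>2 / q" if c: "c \<in> \<A>" and y: "y \<in> cdom c" for c y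
    proof -
      have "2 * q * (a1 (pt c y) - B1 * N (pt c y)) * (f (pt c y))\<^sup>2 / q = 2 * f (pt c y) * (a1 (pt c y) * f (pt c y) - B1 * N (pt c y) ^ 3)"
        using q(1) by (simp add: f_def power2_eq_square power3_eq_cube right_diff_distrib left_diff_distrib add_divide_distrib diff_divide_distrib)
      then show ?thesis
        using ym_chart_inequality[OF ym Ft K dim _ c y, of f] by (simp add: f_def[abs_def] N_def q1 n)
    qed
  qed
  then show ?thesis unfolding fN q2 N_def .
qed

theorem yang_mills_higgs_lap_ge:
  assumes ym: "yang_mills_higgs \<A> g J V t \<kappa> A \<Phi>" and Ft: "Ftilde_bound \<A> g J V \<kappa> A B1" and Br: "bracket_bound \<A> g J V \<kappa> A \<Phi> B2"
    and K: "K_ge \<A> g a1" and Rc: "Ric_ge \<A> g a2" and dim: "CARD('n) \<ge> 4" and n: "n = real CARD('n)"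
    and f: "f = (\<lambda>x. (normF \<A> g J V \<kappa> A x)\<^sup>2 + (normdPhi \<A> g J V \<kappa> A \<Phi> x)\<^sup>2)"
  shows "lap_ge \<A> g (\<lambda>x. f x powr ((n - 2) / (2 * (n - 1))))
    (\<lambda>x. (n - 2) / (n - 1) * (min (a1 x) (a2 x) - max B1 (3 * B2) * normF \<A> g J V \<kappa> A x) * f x powr ((n - 2) / (2 * (n - 1))))"
proof -
  have S: "so_section \<A> J V t \<Phi>" using ym unfolding yang_mills_higgs_def by blast
  \<comment> \<open>The value of \<open>q\<close> from the Yang-Mills case with \<open>n + 1\<close>
    in place of \<open>n\<close>.\<close>
  define q where "q = (n - 2) / (2 * (n - 1))"
  have n4: "n \<ge> 4" using dim n by simp
  have q: "0 < q" "q < 1" using n4 by (auto simp: q_def field_simps)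
  have q1: "1 - q = n / (2 * (n - 1))" using n4 by (simp add: q_def field_simps)
  have q2: "(n - 2) / (n - 1) = 2 * q" using n4 by (simp add: q_def field_simps)
  show ?thesis
    unfolding q2 q_def[symmetric]
  proof (rule lap_ge_powr[OF M _ _ q])
    show "Ck_on 2 (f \<circ> pt c) (cdom c)" if c: "c \<in> \<A>" for c
    proof -
      have "Ck_on 2 (\<lambda>y. ((\<lambda>x. (normF \<A> g J V \<kappa> A x)\<^sup>2) \<circ> pt c) y + ((\<lambda>x. (normdPhi \<A> g J V \<kappa> A \<Phi> x)\<^sup>2) \<circ> pt c) y) (cdom c)"
        by (rule Ck_on_add[OF open_cdom[OF M c] Ck_on_normF[OF c] Ck_on_normdPhi[OF S c]])
      moreover have "(\<lambda>y. ((\<lambda>x. (normF \<A> g J V \<kappa> A x)\<^sup>2) \<circ> pt c) y + ((\<lambda>x. (normdPhi \<A> g J V \<kappa> A \<Phi> x)\<^sup>2) \<circ> pt c) y) = f \<circ> pt c"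
        by (simp add: f fun_eq_iff)
      ultimately show ?thesis by (simp only:)
    qed
    show "f x \<ge> 0" for x by (simp add: f)
    show "f (pt c y) * lap (g c) (f \<circ> pt c) y - (1 - q) * dd (f \<circ> pt c) y (grad (g c) (f \<circ> pt c) y)
       \<ge> 2 * q * (min (a1 (pt c y)) (a2 (pt c y)) - max B1 (3 * B2) * normF \<A> g J V \<kappa> A (pt c y)) * (f (pt c y))\<^sup>2 / q" if c: "c \<in> \<A>" and y: "y \<in> cdom c" for c y
    proof -
      have "2 * q * (min (a1 (pt c y)) (a2 (pt c y)) - max B1 (3 * B2) * normF \<A> g J V \<kappa> A (pt c y)) * (f (pt c y))\<^sup>2 / q
        = 2 * f (pt c y) * ((min (a1 (pt c y)) (a2 (pt c y)) - max B1 (3 * B2) * normF \<A> g J V \<kappa> A (pt c y)) * f (pt c y))"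
        using q(1) by (simp add: power2_eq_square)
      then show ?thesis
        using ymh_chart_inequality[OF ym Ft Br K Rc dim f c y] unfolding q1 n by (simp only:)
    qed
  qed
qed

end

theorem theorem8:
  fixes \<A> :: "('m::{t2_space,second_countable_topology}, 'n::finite) chart set"
    and g :: "('m, 'n) chart \<Rightarrow> real^'n \<Rightarrow> real^'n^'n"
    and J :: "'i set" and V :: "'i \<Rightarrow> 'm set"
    and t :: "'i \<Rightarrow> 'i \<Rightarrow> 'm \<Rightarrow> real^'r::finite^'r"
    and \<kappa> :: "real^'r^'r \<Rightarrow> real^'r^'r \<Rightarrow> real"
    and a1 a2 :: "'m \<Rightarrow> real" and B1 B2 n :: real
  assumes "riemannian_manifold \<A> g" and "CARD('n) \<ge> 4" and "n = real CARD('n)"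
    and "K_ge \<A> g a1" and "Ric_ge \<A> g a2"
    and "riemannian_bundle \<A> J V t" and "Ad_invariant_metric \<kappa>"
    and "B1 > 0" and "B2 > 0"
  shows
    "(\<forall>A. yang_mills \<A> g J V t \<kappa> A \<and> Ftilde_bound \<A> g J V \<kappa> A B1 \<longrightarrow>
        (let F = normF \<A> g J V \<kappa> A;
             u = (\<lambda>x. F x powr ((n - 3) / (n - 2)));
             B = (n - 3) / (n - 2) * B1;
             a = (\<lambda>x. (n - 3) / (n - 2) * a1 x)
         in lap_ge \<A> g u (\<lambda>x. - B * F x * u x + a x * u x)))
     \<and>
     (\<forall>A \<Phi>. yang_mills_higgs \<A> g J V t \<kappa> A \<Phi> \<and>
        Ftilde_bound \<A> g J V \<kappa> A B1 \<and> bracket_bound \<A> g J V \<kappa> A \<Phi> B2 \<longrightarrow>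
        (let F = normF \<A> g J V \<kappa> A;
             u = (\<lambda>x. ((F x)\<^sup>2 + (normdPhi \<A> g J V \<kappa> A \<Phi> x)\<^sup>2) powr ((n - 2) / (2 * (n - 1))));
             B = (n - 2) / (n - 1) * max B1 (3 * B2);
             a = (\<lambda>x. (n - 2) / (n - 1) * min (a1 x) (a2 x))
         in lap_ge \<A> g u (\<lambda>x. - B * F x * u x + a x * u x)))"
proof (intro conjI allI impI)
  fix A
  assume h: "yang_mills \<A> g J V t \<kappa> A \<and> Ftilde_bound \<A> g J V \<kappa> A B1"
  then have C: "metric_connection \<A> J V t A" unfolding yang_mills_def by blast
  show "let F = normF \<A> g J V \<kappa> A;
             u = (\<lambda>x. F x powr ((n - 3) / (n - 2)));
             B = (n - 3) / (n - 2) * B1;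
             a = (\<lambda>x. (n - 3) / (n - 2) * a1 x)
         in lap_ge \<A> g u (\<lambda>x. - B * F x * u x + a x * u x)"
    using yang_mills_lap_ge[OF assms(1,6,7) C conjunct1[OF h] conjunct2[OF h] assms(4,2,3)]
    unfolding Let_def by (rule back_subst[where P = "lap_ge \<A> g _"]) (simp only: fun_eq_iff, algebra)
next
  fix A \<Phi>
  assume h: "yang_mills_higgs \<A> g J V t \<kappa> A \<Phi> \<and>
        Ftilde_bound \<A> g J V \<kappa> A B1 \<and> bracket_bound \<A> g J V \<kappa> A \<Phi> B2"
  then have C: "metric_connection \<A> J V t A" unfolding yang_mills_higgs_def by blast
  show "let F = normF \<A> g J V \<kappa> A;
             u = (\<lambda>x. ((F x)\<^sup>2 + (normdPhi \<A> g J V \<kappa> A \<Phi> x)\<^sup>2) powr ((n - 2) / (2 * (n - 1))));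
             B = (n - 2) / (n - 1) * max B1 (3 * B2);
             a = (\<lambda>x. (n - 2) / (n - 1) * min (a1 x) (a2 x))
         in lap_ge \<A> g u (\<lambda>x. - B * F x * u x + a x * u x)"
    using yang_mills_higgs_lap_ge[OF assms(1,6,7) C conjunct1[OF h] conjunct1[OF conjunct2[OF h]] conjunct2[OF conjunct2[OF h]] assms(4,5,2,3) refl]
    unfolding Let_def by (rule back_subst[where P = "lap_ge \<A> g _"]) (simp only: fun_eq_iff, algebra)
qed

end
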